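(* Let $\Lambda$ be any one of the following four graphs (the four Archimedean lattices with even degrees): the square lattice, the triangular lattice, the Kagomé lattice, or the $(3,4,6,4)$ lattice. Then there is a finitary $\mathrm{Aut}(\Lambda)$-factor of $\left([0,1]^{V(\Lambda)},\mu_\Lambda\right)$ which is almost surely a Schreier decoration of $\Lambda$. Moreover, it has almost surely no infinite monochromatic paths.
   Context: **Lattices.** An Archimedean lattice is (the graph of vertices and edges of) a vertex-transitive tiling of the plane by regular polygons. The square lattice is the Cayley graph of $\mathbb{Z}^2$ with the standard generators (4-regular). The triangular lattice is the 6-regular Archimedean lattice (all faces equilateral triangles). The Kagomé lattice is the line graph of the hexagonal lattice (4-regular). The $(3,4,6,4)$ lattice is the 4-regular Archimedean lattice in which the faces around every vertex are, in cyclic order, a triangle, a square, a hexagon and a square. All are viewed as abstract graphs; $\mathrm{Aut}(\Lambda)$ is the full graph automorphism group. **Schreier decoration.** For a simple connected $2d$-regular graph $G$, a Schreier decoration of $G$ is a colouring of the edges with $d$ colours together with an orientation of the edges such that at every vertex there is exactly one incoming and exactly one outgoing edge of each colour. (So $d=2$, or $d=3$ for the triangular lattice.) A path is monochromatic if all its edges have the same colour (orientation is ignored). **Factors.** $\mu_G$ is the product measure on $[0,1]^{V(G)}$ with each coordinate Lebesgue. $\mathrm{Aut}(G)$ acts on $[0,1]^{V(G)}$ by $(\gamma.f)(v)=f(\gamma^{-1}.v)$ and acts naturally on the measurable space of edge-colourings-with-orientation of $G$. An $\mathrm{Aut}(G)$-factor of $([0,1]^{V(G)},\mu_G)$ is a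 measurable map $\Phi$ from $[0,1]^{V(G)}$ to such a space (possibly undefined on a $\mu_G$-null set) that is $\mathrm{Aut}(G)$-equivariant: $\gamma.\Phi(\omega)=\Phi(\gamma.\omega)$. It is finitary if, for each vertex $x$ and almost all $\omega\in[0,1]^{V(G)}$, there exists $R\in\mathbb{N}$ (depending on $\omega$) such that the restriction of $\Phi(\omega)$ to the edges incident to $x$ is already determined by $\omega|_{B_G(x,R)}$, i.e. changing $\omega$ outside the ball $B_G(x,R)$ does not change the decoration around $x$. *)

theory Defs
  imports "HOL-Probability.Probability"
begin

section \<open>Simple graphs\<close>

record 'v ugraph =
  verts :: "'v set"
  edges :: "'v set set"

definition adj :: "'v ugraph \<Rightarrow> ('v \<times> 'v) set" where
  "adj G = {(u, v). {u, v} \<in> edges G}"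

definition graph_ball :: "'v ugraph \<Rightarrow> 'v \<Rightarrow> nat \<Rightarrow> 'v set" where
  "graph_ball G x R = {y. \<exists>n\<le>R. (x, y) \<in> adj G ^^ n}"

text \<open>Automorphisms are HOL functions of which only the restriction to the vertex set matters;
  every action below depends only on that restriction.\<close>

definition graph_aut :: "'v ugraph \<Rightarrow> ('v \<Rightarrow> 'v) set" where
  "graph_aut G = {\<gamma>. bij_betw \<gamma> (verts G) (verts G) \<and>
     (\<forall>u\<in>verts G. \<forall>v\<in>verts G. {u, v} \<in> edges G \<longleftrightarrow> {\<gamma> u, \<gamma> v} \<in> edges G)}"

definition cayley_graph :: "'a::ab_group_add set \<Rightarrow> 'a ugraph" where
  "cayley_graph S = \<lparr>verts = UNIV, edges = {{x, x + s} | x s. s \<in> S}\<rparr>"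

definition line_graph :: "'v ugraph \<Rightarrow> 'v set ugraph" where
  "line_graph G = \<lparr>verts = edges G,
     edges = {{e, f} | e f. e \<in> edges G \<and> f \<in> edges G \<and> e \<noteq> f \<and> e \<inter> f \<noteq> {}}\<rparr>"


section \<open>The four lattices\<close>

definition square_lattice :: "(int \<times> int) ugraph" where
  "square_lattice = cayley_graph {(1, 0), (0, 1)}"

text \<open>The point \<open>(a, b)\<close> of the triangular lattice lies at \<open>a + b exp(i pi/3)\<close> in the plane, so that
  \<open>(1, 0)\<close>, \<open>(0, 1)\<close>, \<open>(-1, 1)\<close> and their negatives are the six vectors of length 1.\<close>

definition triangular_lattice :: "(int \<times> int) ugraph" where
  "triangular_lattice = cayley_graph {(1, 0), (0, 1), (-1, 1)}"

text \<open>The two vertices of the fundamental cell \<open>x\<close> are \<open>(x, False)\<close> and \<open>(x, True)\<close>; the vertex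
  \<open>(x, True)\<close> is joined to \<open>(x, False)\<close> and to the \<open>False\<close> vertices of two neighbouring cells.\<close>

definition hexagonal_lattice :: "((int \<times> int) \<times> bool) ugraph" where
  "hexagonal_lattice = \<lparr>verts = UNIV,
     edges = {{(x, True), (x + s, False)} | x s. s \<in> {(0, 0), (1, 0), (0, 1)}}\<rparr>"

definition kagome_lattice :: "((int \<times> int) \<times> bool) set ugraph" where
  "kagome_lattice = line_graph hexagonal_lattice"

text \<open>In the (3,4,6,4) tiling with edges of length 1 every vertex lies on exactly one hexagon, and the
  centres of the hexagons form a triangular lattice of spacing \<open>1 + sqrt 3\<close>. The vertex
  \<open>((a, b), k)\<close> is the corner with number \<open>k\<close> of the hexagon \<open>(a, b)\<close>; its position is
    \<open>(1 + sqrt 3) (a exp(i pi/6) + b exp(i pi/2)) + exp(i pi k/3)\<close>.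
  The hexagon \<open>x + hex_dir k\<close> is the one facing the side of the hexagon \<open>x\<close> between its corners
  \<open>k\<close> and \<open>k + 1\<close>. With corner numbers taken modulo 6, the faces are
    the hexagons \<open>(x, 0), ..., (x, 5)\<close>,
    the squares \<open>(x, k), (x, k + 1), (x + hex_dir k, k + 3), (x + hex_dir k, k + 4)\<close>, and
    the triangles \<open>(x, k), (x + hex_dir k, k + 4), (x + hex_dir (k + 1), k + 2)\<close>.
  The edges not on a hexagon are those joining \<open>(x, k)\<close> and \<open>(x + hex_dir k, k + 4)\<close>: the other
  sides of the squares and the triangles are again of this form, as
  \<open>hex_dir (k + 3) = - hex_dir k\<close> and \<open>hex_dir k + hex_dir (k + 2) = hex_dir (k + 1)\<close>.\<close>

definition hex_dir :: "nat \<Rightarrow> int \<times> int" where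
  "hex_dir k = [(1, 0), (0, 1), (-1, 1), (-1, 0), (0, -1), (1, -1)] ! (k mod 6)"

definition lattice_3464 :: "((int \<times> int) \<times> nat) ugraph" where
  "lattice_3464 = \<lparr>verts = UNIV \<times> {..<6},
     edges = {{(x, k), (x, (k + 1) mod 6)} | x k. k < 6} \<union>
             {{(x, k), (x + hex_dir k, (k + 4) mod 6)} | x k. k < 6}\<rparr>"


section \<open>Schreier decorations\<close>

text \<open>An edge-colouring with orientation maps each edge to its colour and its head (the endpoint
  towards which it is oriented). The colours are \<open>0, ..., d - 1\<close>.\<close>

type_synonym 'v decoration = "'v set \<Rightarrow> nat \<times> 'v"

definition decoration_space :: "'v ugraph \<Rightarrow> nat \<Rightarrow> 'v decoration measure" where
  "decoration_space G d = (\<Pi>\<^sub>M e\<in>edges G. count_space ({..<d} \<times> e))"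

definition schreier_decoration :: "'v ugraph \<Rightarrow> nat \<Rightarrow> 'v decoration \<Rightarrow> bool" where
  "schreier_decoration G d D \<longleftrightarrow>
     D \<in> space (decoration_space G d) \<and>
     (\<forall>v\<in>verts G. \<forall>c<d.
        (\<exists>!e. e \<in> edges G \<and> v \<in> e \<and> fst (D e) = c \<and> snd (D e) = v) \<and>
        (\<exists>!e. e \<in> edges G \<and> v \<in> e \<and> fst (D e) = c \<and> snd (D e) \<noteq> v))"

definition infinite_monochromatic_path :: "'v ugraph \<Rightarrow> 'v decoration \<Rightarrow> (nat \<Rightarrow> 'v) \<Rightarrow> bool" where
  "infinite_monochromatic_path G D p \<longleftrightarrow>
     inj p \<and> (\<forall>n. {p n, p (Suc n)} \<in> edges G) \<and> (\<exists>c. \<forall>n. fst (D {p n, p (Suc n)}) = c)"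


section \<open>Factors of i.i.d.\<close>

definition iid_measure :: "'v ugraph \<Rightarrow> ('v \<Rightarrow> real) measure" where
  "iid_measure G = (\<Pi>\<^sub>M v\<in>verts G. restrict_space lborel {0..1})"

definition act_label :: "'v ugraph \<Rightarrow> ('v \<Rightarrow> 'v) \<Rightarrow> ('v \<Rightarrow> real) \<Rightarrow> ('v \<Rightarrow> real)" where
  "act_label G \<gamma> \<omega> = (\<lambda>v\<in>verts G. \<omega> (inv_into (verts G) \<gamma> v))"

definition act_decoration :: "'v ugraph \<Rightarrow> ('v \<Rightarrow> 'v) \<Rightarrow> 'v decoration \<Rightarrow> 'v decoration" where
  "act_decoration G \<gamma> D =
     (\<lambda>e\<in>edges G. let (c, h) = D (inv_into (verts G) \<gamma> ` e) in (c, \<gamma> h))"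

text \<open>The set \<open>A\<close> is the domain of definition of the factor map \<open>\<Phi>\<close>, whose complement is a null set;
  values of \<open>\<Phi>\<close> outside \<open>A\<close> are irrelevant. Equivariance of a partial map includes the invariance
  of its domain.\<close>

definition aut_factor ::
  "'v ugraph \<Rightarrow> nat \<Rightarrow> ('v \<Rightarrow> real) set \<Rightarrow> (('v \<Rightarrow> real) \<Rightarrow> 'v decoration) \<Rightarrow> bool" where
  "aut_factor G d A \<Phi> \<longleftrightarrow>
     A \<subseteq> space (iid_measure G) \<and>
     space (iid_measure G) - A \<in> null_sets (iid_measure G) \<and>
     \<Phi> \<in> measurable (restrict_space (iid_measure G) A) (decoration_space G d) \<and>
     (\<forall>\<gamma>\<in>graph_aut G. \<forall>\<omega>\<in>A.
        act_label G \<gamma> \<omega> \<in> A \<and> act_decoration G \<gamma> (\<Phi> \<omega>) = \<Phi> (act_label G \<gamma> \<omega>))"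

definition finitary ::
  "'v ugraph \<Rightarrow> ('v \<Rightarrow> real) set \<Rightarrow> (('v \<Rightarrow> real) \<Rightarrow> 'v decoration) \<Rightarrow> bool" where
  "finitary G A \<Phi> \<longleftrightarrow>
     (\<forall>x\<in>verts G. AE \<omega> in iid_measure G. \<exists>R. \<forall>\<omega>'\<in>A.
        (\<forall>y\<in>graph_ball G x R. \<omega>' y = \<omega> y) \<longrightarrow> (\<forall>e\<in>edges G. x \<in> e \<longrightarrow> \<Phi> \<omega>' e = \<Phi> \<omega> e))"

end

theory Submission
  imports Defs
begin

text \<open>A Schreier decoration consists of a colouring in which every colour class is
  2-regular and of an orientation of the colour classes along their cycles. The lattices have
  periodic colourings of this kind all of whose monochromatic cycles are short: unit squares on
  the square lattice, triangles on the triangular and the Kagome lattice, triangles and hexagons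
  on the (3,4,6,4) lattice. Such reference colourings are called phases. Except on the last
  lattice a phase is not invariant under all automorphisms, so an equivariant rule cannot use
  one phase everywhere; it has to use different phases in different regions. Two facts make this
  possible: automorphisms permute the finite set of phases, and any two phases can be joined by
  a valid transition in a strip of bounded width around an arbitrary set of vertices
  (\<open>glue\<close>).

  The random labels are used to select regions of larger and larger scales. At scale n, vertices
  with a label below a threshold that have no rival nearby are centres; the new region consists
  of large balls around the centres, enlarged by the previous clusters that they touch. All
  clusters remain bounded (\<open>cover_bounded\<close>). When a cluster is created it receives
  colours that respect the colours of the clusters it swallows and that continue as a phase
  outside; such colours exist because around each swallowed cluster its phase can be exchanged
  for a common one (the lemma \<open>extensions_nonempty\<close>). Among the possibilities one
  is picked by means of the order of the labels alone (\<open>pick_match\<close>), so the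
  construction is equivariant. Colours are never changed later (\<open>paint_stable\<close>).

  A monochromatic path cannot leave the neighbourhood of a cluster, since outside the cluster it
  would follow a short cycle of a phase (\<open>mono_confined\<close>). Hence there are no
  infinite monochromatic paths, and each monochromatic cycle is finite, so that one of its two
  orientations can be picked by the order of the labels as well. What happens at a vertex
  depends on finitely many comparisons of labels, for which reason the map is finitary and
  measurable (\<open>decor_alike\<close>, \<open>local_measurable\<close>). Every vertex is
  reached by some scale almost surely, because the chances of different scales are bounded below
  and nearly independent (\<open>AE_reached\<close>). This proves the existence of the factor
  for every graph of quadratic growth with suitable phases (\<open>factor_exists\<close>).

  For the individual lattices it remains to exhibit the phases. That automorphisms permute them
  is derived from a characterisation in terms of the abstract graph, such as that monochromatic
  paths of length 2 close to a triangle. Gluing is shown by cutting the edges into bounded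
  pieces within which both colourings have equal colour degrees at each vertex; then either
  colouring can be used on each piece separately (\<open>glue_pieces\<close>). For the Kagome
  lattice the pieces are the hexagonal faces; for the square and the triangular lattice the
  colourings are periodic, and the pieces are verified on one period.\<close>

section \<open>Balls, neighbourhoods and automorphisms\<close>

locale graph =
  fixes G :: "'v ugraph"
  assumes edge_pair: "e \<in> edges G \<Longrightarrow> \<exists>u v. u \<in> verts G \<and> v \<in> verts G \<and> u \<noteq> v \<and> e = {u, v}"
    and finite_ball: "x \<in> verts G \<Longrightarrow> finite (graph_ball G x r)"
begin

abbreviation V where "V \<equiv> verts G"
abbreviation E where "E \<equiv> edges G"
abbreviation B where "B \<equiv> graph_ball G"

definition nb :: "nat \<Rightarrow> 'v set \<Rightarrow> 'v set" where
  "nb r K = (\<Union>x\<in>K. B x r)"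

lemma adjD: "(x, y) \<in> adj G \<Longrightarrow> x \<in> V \<and> y \<in> V \<and> x \<noteq> y"
  using edge_pair[of "{x, y}"] by (auto simp: adj_def doubleton_eq_iff)

lemma adj_sym: "(x, y) \<in> adj G \<Longrightarrow> (y, x) \<in> adj G"
  by (auto simp: adj_def insert_commute)

lemma edge_sub: "e \<in> E \<Longrightarrow> e \<subseteq> V"
  using edge_pair by blast

lemma edge_adj: "{x, y} \<in> E \<longleftrightarrow> (x, y) \<in> adj G"
  by (auto simp: adj_def)

lemma ball_self[simp]: "x \<in> B x r"
  by (auto simp: graph_ball_def intro!: exI[of _ 0])

lemma ball_mono: "r \<le> s \<Longrightarrow> B x r \<subseteq> B x s"
  by (auto simp: graph_ball_def) (meson le_trans)

lemma ball_monoD: "y \<in> B x r \<Longrightarrow> r \<le> s \<Longrightarrow> y \<in> B x s"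
  using ball_mono by blast

lemma relpow_adj_sym: "(x, y) \<in> adj G ^^ n \<Longrightarrow> (y, x) \<in> adj G ^^ n"
proof (induction n arbitrary: y)
  case (Suc n)
  then obtain z where "(x, z) \<in> adj G ^^ n" "(z, y) \<in> adj G" by auto
  then have "(y, z) \<in> adj G" "(z, x) \<in> adj G ^^ n" using Suc adj_sym by auto
  then show ?case by (metis relpow_Suc_I2)
qed auto

lemma ball_sym: "y \<in> B x r \<Longrightarrow> x \<in> B y r"
  using relpow_adj_sym by (auto simp: graph_ball_def)

lemma ball_trans: "y \<in> B x r \<Longrightarrow> z \<in> B y s \<Longrightarrow> z \<in> B x (r + s)"
proof -
  assume "y \<in> B x r" "z \<in> B y s"
  then obtain m n where "m \<le> r" "n \<le> s" "(x, y) \<in> adj G ^^ m" "(y, z) \<in> adj G ^^ n"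
    by (auto simp: graph_ball_def)
  then have "(x, z) \<in> adj G ^^ (m + n)" "m + n \<le> r + s" by (auto simp: relpow_add)
  then show ?thesis by (auto simp: graph_ball_def)
qed

lemma ball_trans_le: "y \<in> B x r \<Longrightarrow> z \<in> B y s \<Longrightarrow> r + s \<le> t \<Longrightarrow> z \<in> B x t"
  using ball_trans ball_monoD by blast

lemma ball_verts: "x \<in> V \<Longrightarrow> y \<in> B x r \<Longrightarrow> y \<in> V"
proof -
  assume "x \<in> V" "y \<in> B x r"
  then obtain n where "(x, y) \<in> adj G ^^ n" by (auto simp: graph_ball_def)
  then show ?thesis using \<open>x \<in> V\<close> by (cases n) (auto dest: adjD)
qed

lemma ball_edge: "{x, y} \<in> E \<Longrightarrow> y \<in> B x 1"
  by (auto simp: graph_ball_def adj_def intro!: exI[of _ 1])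

lemma edge_in_ball: "e \<in> E \<Longrightarrow> x \<in> e \<Longrightarrow> y \<in> e \<Longrightarrow> y \<in> B x 1"
  using edge_pair[of e] ball_edge by (metis ball_self insert_commute insert_iff singletonD)

lemma nb_mono: "K \<subseteq> K' \<Longrightarrow> r \<le> s \<Longrightarrow> nb r K \<subseteq> nb s K'"
  unfolding nb_def using ball_mono by blast

lemma nb_self: "K \<subseteq> nb r K"
  by (auto simp: nb_def intro: ball_self)

lemma nb_nb: "nb r (nb s K) \<subseteq> nb (s + r) K"
  unfolding nb_def using ball_trans by blast

lemma nb_verts: "K \<subseteq> V \<Longrightarrow> nb r K \<subseteq> V"
  unfolding nb_def using ball_verts by blast

lemma nb_edge: "e \<in> E \<Longrightarrow> x \<in> e \<Longrightarrow> x \<in> nb r K \<Longrightarrow> r < s \<Longrightarrow> e \<subseteq> nb s K"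
proof
  fix y assume *: "e \<in> E" "x \<in> e" "x \<in> nb r K" "r < s" "y \<in> e"
  then obtain z where "z \<in> K" "x \<in> B z r" by (auto simp: nb_def)
  moreover have "y \<in> B x 1" using * edge_in_ball by blast
  ultimately show "y \<in> nb s K"
    unfolding nb_def using ball_trans_le[of x z r y 1 s] * by auto
qed

lemma finite_nb: "K \<subseteq> V \<Longrightarrow> finite K \<Longrightarrow> finite (nb r K)"
  unfolding nb_def using finite_ball by blast

lemma finite_incident: "v \<in> V \<Longrightarrow> finite {e \<in> E. v \<in> e}"
proof -
  assume "v \<in> V"
  have "{e \<in> E. v \<in> e} \<subseteq> Pow (B v 1)" using edge_in_ball by blast
  then show ?thesis using finite_ball[OF \<open>v \<in> V\<close>] by (meson finite_Pow_iff finite_subset)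
qed

abbreviation Aut where "Aut \<equiv> graph_aut G"

lemma aut_bij: "\<gamma> \<in> Aut \<Longrightarrow> bij_betw \<gamma> V V"
  by (auto simp: graph_aut_def)

lemma aut_V: "\<gamma> \<in> Aut \<Longrightarrow> x \<in> V \<Longrightarrow> \<gamma> x \<in> V"
  using aut_bij bij_betwE by blast

lemma aut_inj: "\<gamma> \<in> Aut \<Longrightarrow> x \<in> V \<Longrightarrow> y \<in> V \<Longrightarrow> \<gamma> x = \<gamma> y \<longleftrightarrow> x = y"
  using aut_bij by (metis bij_betw_imp_inj_on inj_onD)

lemma aut_image_V: "\<gamma> \<in> Aut \<Longrightarrow> \<gamma> ` V = V"
  using aut_bij bij_betw_imp_surj_on by blast

lemma aut_adj: "\<gamma> \<in> Aut \<Longrightarrow> x \<in> V \<Longrightarrow> y \<in> V \<Longrightarrow> (\<gamma> x, \<gamma> y) \<in> adj G \<longleftrightarrow> (x, y) \<in> adj G"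
  by (auto simp: graph_aut_def adj_def)

lemma aut_edge: "\<gamma> \<in> Aut \<Longrightarrow> e \<in> E \<Longrightarrow> \<gamma> ` e \<in> E"
  using edge_pair[of e] by (auto simp: graph_aut_def)

abbreviation ainv :: "('v \<Rightarrow> 'v) \<Rightarrow> 'v \<Rightarrow> 'v" where "ainv \<gamma> \<equiv> inv_into V \<gamma>"

lemma ainv_V: "\<gamma> \<in> Aut \<Longrightarrow> x \<in> V \<Longrightarrow> ainv \<gamma> x \<in> V"
  using aut_image_V by (metis inv_into_into)

lemma ainv_right[simp]: "\<gamma> \<in> Aut \<Longrightarrow> x \<in> V \<Longrightarrow> \<gamma> (ainv \<gamma> x) = x"
  using aut_image_V by (metis f_inv_into_f)

lemma ainv_left[simp]: "\<gamma> \<in> Aut \<Longrightarrow> x \<in> V \<Longrightarrow> ainv \<gamma> (\<gamma> x) = x"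
  using aut_bij by (metis bij_betw_imp_inj_on inv_into_f_f)

lemma ainv_aut: "\<gamma> \<in> Aut \<Longrightarrow> ainv \<gamma> \<in> Aut"
proof -
  assume g: "\<gamma> \<in> Aut"
  have "bij_betw (ainv \<gamma>) V V" using g aut_bij bij_betw_inv_into by blast
  moreover have "{u, v} \<in> E \<longleftrightarrow> {ainv \<gamma> u, ainv \<gamma> v} \<in> E" if "u \<in> V" "v \<in> V" for u v
    using aut_adj[OF g, of "ainv \<gamma> u" "ainv \<gamma> v"] that g ainv_V by (simp add: edge_adj)
  ultimately show ?thesis by (auto simp: graph_aut_def)
qed

lemma ainv_image_left: "\<gamma> \<in> Aut \<Longrightarrow> K \<subseteq> V \<Longrightarrow> ainv \<gamma> ` (\<gamma> ` K) = K"
  using ainv_left by (force simp: image_image)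

lemma ainv_image_right: "\<gamma> \<in> Aut \<Longrightarrow> K \<subseteq> V \<Longrightarrow> \<gamma> ` (ainv \<gamma> ` K) = K"
  using ainv_right by (force simp: image_image)

lemma aut_edge_iff: "\<gamma> \<in> Aut \<Longrightarrow> e \<subseteq> V \<Longrightarrow> \<gamma> ` e \<in> E \<longleftrightarrow> e \<in> E"
  using aut_edge ainv_aut ainv_image_left by metis

lemma aut_relpow: "\<gamma> \<in> Aut \<Longrightarrow> x \<in> V \<Longrightarrow> (x, y) \<in> adj G ^^ n \<Longrightarrow> (\<gamma> x, \<gamma> y) \<in> adj G ^^ n"
proof (induction n arbitrary: y)
  case (Suc n)
  then obtain z where z: "(x, z) \<in> adj G ^^ n" "(z, y) \<in> adj G" by auto
  then have "(\<gamma> z, \<gamma> y) \<in> adj G" using aut_adj adjD Suc by blast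
  then show ?case using Suc z by auto
qed auto

lemma aut_ball: "\<gamma> \<in> Aut \<Longrightarrow> x \<in> V \<Longrightarrow> y \<in> B x r \<Longrightarrow> \<gamma> y \<in> B (\<gamma> x) r"
  using aut_relpow by (auto simp: graph_ball_def)

lemma aut_ball_iff: "\<gamma> \<in> Aut \<Longrightarrow> x \<in> V \<Longrightarrow> y \<in> V \<Longrightarrow> \<gamma> y \<in> B (\<gamma> x) r \<longleftrightarrow> y \<in> B x r"
  using aut_ball aut_ball[OF ainv_aut, of \<gamma> "\<gamma> x" "\<gamma> y" r] aut_V by (metis ainv_left)

lemma aut_ball_image: "\<gamma> \<in> Aut \<Longrightarrow> x \<in> V \<Longrightarrow> \<gamma> ` B x r = B (\<gamma> x) r"
proof
  assume g: "\<gamma> \<in> Aut" "x \<in> V"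
  show "\<gamma> ` B x r \<subseteq> B (\<gamma> x) r" using g aut_ball by blast
  show "B (\<gamma> x) r \<subseteq> \<gamma> ` B x r"
  proof
    fix y assume y: "y \<in> B (\<gamma> x) r"
    then have "y \<in> V" using g aut_V ball_verts by blast
    then have "y = \<gamma> (ainv \<gamma> y)" "ainv \<gamma> y \<in> B x r"
      using g y aut_ball_iff[of \<gamma> x "ainv \<gamma> y" r] ainv_V by auto
    then show "y \<in> \<gamma> ` B x r" by blast
  qed
qed

lemma aut_nb_image: "\<gamma> \<in> Aut \<Longrightarrow> K \<subseteq> V \<Longrightarrow> \<gamma> ` nb r K = nb r (\<gamma> ` K)"
  unfolding nb_def using aut_ball_image by (auto simp: image_UN subset_iff)

end

section \<open>Two-factor colourings and gluing\<close>

locale coloured_graph = graph G for G :: "'v ugraph" +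
  fixes d :: nat
begin

text \<open>A valid colouring splits the graph into d spanning 2-regular subgraphs. It is what
  remains of a Schreier decoration when the orientation is forgotten, and it becomes one as soon
  as each colour class is oriented along its cycles and infinite paths.\<close>

definition valid :: "('v set \<Rightarrow> nat) \<Rightarrow> bool" where
  "valid q \<longleftrightarrow> (\<forall>e\<in>E. q e < d) \<and> (\<forall>v\<in>V. \<forall>i<d. card {e \<in> E. v \<in> e \<and> q e = i} = 2)"

text \<open>Validity is a condition on the stars of single vertices. This is the tool by which
  pieces of different valid colourings are put together: it is enough that every vertex sees
  only one of them.\<close>

lemma valid_local:
  assumes "\<And>v. v \<in> V \<Longrightarrow> \<exists>\<sigma>. valid \<sigma> \<and> (\<forall>e\<in>E. v \<in> e \<longrightarrow> f e = \<sigma> e)"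
  shows "valid f"
  unfolding valid_def
proof (intro conjI ballI allI impI)
  fix e assume "e \<in> E"
  then obtain v where "v \<in> e" "v \<in> V" using edge_pair by blast
  then show "f e < d" using assms[of v] \<open>e \<in> E\<close> by (auto simp: valid_def)
next
  fix v i assume "v \<in> V" "i < d"
  then obtain \<sigma> where s: "valid \<sigma>" "\<forall>e\<in>E. v \<in> e \<longrightarrow> f e = \<sigma> e" using assms by blast
  then have "{e \<in> E. v \<in> e \<and> f e = i} = {e \<in> E. v \<in> e \<and> \<sigma> e = i}" by auto
  then show "card {e \<in> E. v \<in> e \<and> f e = i} = 2" using s \<open>v \<in> V\<close> \<open>i < d\<close> by (auto simp: valid_def)
qed

definition push :: "('v \<Rightarrow> 'v) \<Rightarrow> ('v set \<Rightarrow> nat) \<Rightarrow> 'v set \<Rightarrow> nat" where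
  "push \<gamma> q e = q (ainv \<gamma> ` e)"

lemma push_image: "\<gamma> \<in> Aut \<Longrightarrow> e \<subseteq> V \<Longrightarrow> push \<gamma> q (\<gamma> ` e) = q e"
  by (simp add: push_def ainv_image_left)

lemma valid_push:
  assumes g: "\<gamma> \<in> Aut" and v: "valid q"
  shows "valid (push \<gamma> q)"
  unfolding valid_def
proof (intro conjI ballI allI impI)
  fix e assume "e \<in> E"
  then show "push \<gamma> q e < d" using v aut_edge[OF ainv_aut[OF g]] by (auto simp: valid_def push_def)
next
  fix x i assume x: "x \<in> V" "i < d"
  let ?y = "ainv \<gamma> x"
  have eq: "{e \<in> E. x \<in> e \<and> push \<gamma> q e = i} = (\<lambda>e. \<gamma> ` e) ` {e \<in> E. ?y \<in> e \<and> q e = i}"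
  proof (intro equalityI subsetI)
    fix e assume e: "e \<in> {e \<in> E. x \<in> e \<and> push \<gamma> q e = i}"
    then have "e = \<gamma> ` (ainv \<gamma> ` e)" "ainv \<gamma> ` e \<in> E" "?y \<in> ainv \<gamma> ` e" "q (ainv \<gamma> ` e) = i"
      using ainv_image_right[OF g] edge_sub aut_edge[OF ainv_aut[OF g]] by (auto simp: push_def)
    then show "e \<in> (\<lambda>e. \<gamma> ` e) ` {e \<in> E. ?y \<in> e \<and> q e = i}" by blast
  next
    fix e' assume "e' \<in> (\<lambda>e. \<gamma> ` e) ` {e \<in> E. ?y \<in> e \<and> q e = i}"
    then obtain e where e: "e \<in> E" "?y \<in> e" "q e = i" "e' = \<gamma> ` e" by blast
    have "x \<in> e'" using e(2,4) x g by (metis ainv_right image_eqI)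
    then show "e' \<in> {e \<in> E. x \<in> e \<and> push \<gamma> q e = i}"
      using e aut_edge[OF g] push_image[OF g] edge_sub by auto
  qed
  have "inj_on ((`) \<gamma>) {e \<in> E. ?y \<in> e \<and> q e = i}"
    by (rule inj_on_inverseI[where g = "\<lambda>e. ainv \<gamma> ` e"]) (use ainv_image_left[OF g] edge_sub in auto)
  then have "card {e \<in> E. x \<in> e \<and> push \<gamma> q e = i} = card {e \<in> E. ?y \<in> e \<and> q e = i}"
    unfolding eq by (rule card_image)
  then show "card {e \<in> E. x \<in> e \<and> push \<gamma> q e = i} = 2"
    using v x ainv_V[OF g] by (auto simp: valid_def)
qed

definition mono_step :: "('v set \<Rightarrow> nat) \<Rightarrow> nat \<Rightarrow> ('v \<times> 'v) set" where
  "mono_step q i = {(u, v). {u, v} \<in> E \<and> q {u, v} = i}"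

text \<open>Inside any set of vertices one colouring can be had, and outside its neighbourhood
  of radius k the other, with a valid transition in between. The transition may depend on the
  set in any manner: only its existence and the uniform width k matter.\<close>

definition glue :: "nat \<Rightarrow> ('v set \<Rightarrow> nat) \<Rightarrow> ('v set \<Rightarrow> nat) \<Rightarrow> bool" where
  "glue k p q \<longleftrightarrow> (\<forall>K\<subseteq>V. \<exists>\<sigma>. valid \<sigma> \<and> (\<forall>e\<in>E. e \<inter> K \<noteq> {} \<longrightarrow> \<sigma> e = p e) \<and>
     (\<forall>e\<in>E. \<not> e \<subseteq> nb k K \<longrightarrow> \<sigma> e = q e))"

lemma glue_mono:
  assumes "glue k p q" "k \<le> k'" shows "glue k' p q"
  unfolding glue_def
proof (intro allI impI)
  fix K assume K: "K \<subseteq> V"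
  have "nb k K \<subseteq> nb k' K" using nb_mono assms(2) by blast
  then have *: "\<not> e \<subseteq> nb k' K \<Longrightarrow> \<not> e \<subseteq> nb k K" for e by blast
  obtain \<sigma> where "valid \<sigma>" "\<forall>e\<in>E. e \<inter> K \<noteq> {} \<longrightarrow> \<sigma> e = p e"
      "\<forall>e\<in>E. \<not> e \<subseteq> nb k K \<longrightarrow> \<sigma> e = q e"
    using assms(1)[unfolded glue_def, rule_format, OF K] by blast
  then show "\<exists>\<sigma>. valid \<sigma> \<and> (\<forall>e\<in>E. e \<inter> K \<noteq> {} \<longrightarrow> \<sigma> e = p e) \<and>
     (\<forall>e\<in>E. \<not> e \<subseteq> nb k' K \<longrightarrow> \<sigma> e = q e)"
    using * by (intro exI[of _ \<sigma>]) simp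
qed

lemma glue_refl: "valid p \<Longrightarrow> glue k p p"
  unfolding glue_def by blast

lemma glue_trans:
  assumes 1: "glue k p q" and 2: "glue l q r"
  shows "glue (k + l) p r"
  unfolding glue_def
proof (intro allI impI)
  fix K assume K: "K \<subseteq> V"
  obtain \<sigma>1 where s1: "valid \<sigma>1" "\<forall>e\<in>E. e \<inter> K \<noteq> {} \<longrightarrow> \<sigma>1 e = p e"
      "\<forall>e\<in>E. \<not> e \<subseteq> nb k K \<longrightarrow> \<sigma>1 e = q e"
    using 1[unfolded glue_def, rule_format, OF K] by blast
  have "nb k K \<subseteq> V" using K nb_verts by blast
  from 2[unfolded glue_def, rule_format, OF this]
  obtain \<sigma>2 where s2: "valid \<sigma>2" "\<forall>e\<in>E. e \<inter> nb k K \<noteq> {} \<longrightarrow> \<sigma>2 e = q e"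
      "\<forall>e\<in>E. \<not> e \<subseteq> nb l (nb k K) \<longrightarrow> \<sigma>2 e = r e"
    by blast
  define \<sigma> where "\<sigma> e = (if e \<subseteq> nb k K then \<sigma>1 e else \<sigma>2 e)" for e
  have "valid \<sigma>"
  proof (rule valid_local)
    fix v assume "v \<in> V"
    show "\<exists>\<tau>. valid \<tau> \<and> (\<forall>e\<in>E. v \<in> e \<longrightarrow> \<sigma> e = \<tau> e)"
    proof (cases "v \<in> nb k K")
      case True
      then have "\<forall>e\<in>E. v \<in> e \<longrightarrow> \<sigma> e = \<sigma>1 e" unfolding \<sigma>_def using s1 s2 by auto
      then show ?thesis using s1 by blast
    next
      case False
      then have "\<forall>e\<in>E. v \<in> e \<longrightarrow> \<sigma> e = \<sigma>2 e" unfolding \<sigma>_def by auto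
      then show ?thesis using s2 by blast
    qed
  qed
  moreover have "\<sigma> e = p e" if "e \<in> E" "e \<inter> K \<noteq> {}" for e
  proof (cases "e \<subseteq> nb k K")
    case False
    have "e \<inter> nb k K \<noteq> {}" using that nb_self[of K k] by blast
    then have "\<sigma> e = q e" using False that s2(2) by (simp add: \<sigma>_def)
    also have "\<dots> = \<sigma>1 e" using False that s1(3) by simp
    finally show ?thesis using that s1(2) by simp
  qed (use that s1(2) in \<open>simp add: \<sigma>_def\<close>)
  moreover have "\<sigma> e = r e" if "e \<in> E" "\<not> e \<subseteq> nb (k + l) K" for e
  proof -
    have "\<not> e \<subseteq> nb l (nb k K)" using that nb_nb[of l k K] by blast
    moreover have "\<not> e \<subseteq> nb k K" using that nb_mono[of K K k "k + l"] by auto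
    ultimately show ?thesis using that s2 unfolding \<sigma>_def by auto
  qed
  ultimately show "\<exists>\<sigma>. valid \<sigma> \<and> (\<forall>e\<in>E. e \<inter> K \<noteq> {} \<longrightarrow> \<sigma> e = p e) \<and>
     (\<forall>e\<in>E. \<not> e \<subseteq> nb (k + l) K \<longrightarrow> \<sigma> e = r e)" by blast
qed

text \<open>Apply the hypothesis to the complement of the k-neighbourhood of the given set; by
  symmetry of distance its own k-neighbourhood misses the set.\<close>

lemma glue_sym:
  assumes "glue k p q" shows "glue k q p"
  unfolding glue_def
proof (intro allI impI)
  fix K assume K: "K \<subseteq> V"
  let ?K' = "V - nb k K"
  obtain \<sigma> where s: "valid \<sigma>" "\<forall>e\<in>E. e \<inter> ?K' \<noteq> {} \<longrightarrow> \<sigma> e = p e"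
      "\<forall>e\<in>E. \<not> e \<subseteq> nb k ?K' \<longrightarrow> \<sigma> e = q e"
    using assms[unfolded glue_def, rule_format, OF Diff_subset] by blast
  have "K \<inter> nb k ?K' = {}" unfolding nb_def using ball_sym by blast
  then have "\<sigma> e = q e" if "e \<in> E" "e \<inter> K \<noteq> {}" for e using that s(3) by blast
  moreover have "\<sigma> e = p e" if "e \<in> E" "\<not> e \<subseteq> nb k K" for e
    using that s(2) edge_sub by blast
  ultimately show "\<exists>\<sigma>. valid \<sigma> \<and> (\<forall>e\<in>E. e \<inter> K \<noteq> {} \<longrightarrow> \<sigma> e = q e) \<and>
     (\<forall>e\<in>E. \<not> e \<subseteq> nb k K \<longrightarrow> \<sigma> e = p e)" using s(1) by blast
qed

text \<open>How gluing is established in practice. If the edges are cut into bounded pieces so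
  that at each vertex the two colourings use every colour equally often within each piece, then
  exchanging one colouring for the other on an arbitrary family of pieces keeps all colour
  degrees. The family of the pieces that meet the given set does what is required.\<close>

lemma glue_pieces:
  fixes piece :: "'v set \<Rightarrow> 'i"
  assumes valid: "valid p" "valid q"
    and balanced: "\<And>v i j. v \<in> V \<Longrightarrow> i < d \<Longrightarrow>
      card {e \<in> E. v \<in> e \<and> piece e = j \<and> p e = i} = card {e \<in> E. v \<in> e \<and> piece e = j \<and> q e = i}"
    and bounded: "\<And>e e' x. e \<in> E \<Longrightarrow> e' \<in> E \<Longrightarrow> piece e = piece e' \<Longrightarrow> x \<in> e \<Longrightarrow> e' \<subseteq> B x k"
  shows "glue k p q"
  unfolding glue_def
proof (intro allI impI)
  fix K assume K: "K \<subseteq> V"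
  define S where "S = {piece e | e. e \<in> E \<and> e \<inter> K \<noteq> {}}"
  define \<sigma> where "\<sigma> e = (if piece e \<in> S then p e else q e)" for e
  have "valid \<sigma>"
    unfolding valid_def
  proof (intro conjI ballI allI impI)
    fix e assume "e \<in> E" then show "\<sigma> e < d" using valid by (auto simp: \<sigma>_def valid_def)
  next
    fix v i assume v: "v \<in> V" "i < d"
    let ?J = "piece ` {e \<in> E. v \<in> e}"
    have fin: "finite {e \<in> E. v \<in> e}" using finite_incident v by blast
    have dec: "card {e \<in> E. v \<in> e \<and> f e = i} = (\<Sum>j\<in>?J. card {e \<in> E. v \<in> e \<and> piece e = j \<and> f e = i})" for f :: "'v set \<Rightarrow> nat"
    proof -
      have "{e \<in> E. v \<in> e \<and> f e = i} = (\<Union>j\<in>?J. {e \<in> E. v \<in> e \<and> piece e = j \<and> f e = i})" by auto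
      moreover have "finite {e \<in> E. v \<in> e \<and> piece e = j \<and> f e = i}" for j
        by (rule finite_subset[OF _ fin]) auto
      then have "card (\<Union>j\<in>?J. {e \<in> E. v \<in> e \<and> piece e = j \<and> f e = i})
          = (\<Sum>j\<in>?J. card {e \<in> E. v \<in> e \<and> piece e = j \<and> f e = i})"
        by (intro card_UN_disjoint finite_imageI fin) auto
      ultimately show ?thesis by simp
    qed
    have "card {e \<in> E. v \<in> e \<and> piece e = j \<and> \<sigma> e = i} = card {e \<in> E. v \<in> e \<and> piece e = j \<and> q e = i}" for j
    proof (cases "j \<in> S")
      case True
      then have "{e \<in> E. v \<in> e \<and> piece e = j \<and> \<sigma> e = i} = {e \<in> E. v \<in> e \<and> piece e = j \<and> p e = i}"
        by (auto simp: \<sigma>_def)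
      then show ?thesis using balanced[OF v, of j] by (simp only:)
    next
      case False
      then have "{e \<in> E. v \<in> e \<and> piece e = j \<and> \<sigma> e = i} = {e \<in> E. v \<in> e \<and> piece e = j \<and> q e = i}"
        by (auto simp: \<sigma>_def)
      then show ?thesis by (simp only:)
    qed
    then have "card {e \<in> E. v \<in> e \<and> \<sigma> e = i} = card {e \<in> E. v \<in> e \<and> q e = i}"
      by (simp only: dec[of \<sigma>] dec[of q])
    then show "card {e \<in> E. v \<in> e \<and> \<sigma> e = i} = 2" using valid v by (auto simp: valid_def)
  qed
  moreover have "\<sigma> e = p e" if "e \<in> E" "e \<inter> K \<noteq> {}" for e
    using that by (auto simp: \<sigma>_def S_def)
  moreover have "\<sigma> e = q e" if e: "e \<in> E" "\<not> e \<subseteq> nb k K" for e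
  proof -
    have "piece e \<notin> S"
    proof
      assume "piece e \<in> S"
      then obtain e' x where "e' \<in> E" "x \<in> e'" "x \<in> K" "piece e = piece e'" by (auto simp: S_def)
      then have "e \<subseteq> nb k K" using bounded[of e' e x] e(1) by (auto simp: nb_def)
      then show False using e by blast
    qed
    then show ?thesis by (simp add: \<sigma>_def)
  qed
  ultimately show "\<exists>\<sigma>. valid \<sigma> \<and> (\<forall>e\<in>E. e \<inter> K \<noteq> {} \<longrightarrow> \<sigma> e = p e) \<and>
     (\<forall>e\<in>E. \<not> e \<subseteq> nb k K \<longrightarrow> \<sigma> e = q e)" by blast
qed

end

section \<open>Growing finite regions\<close>

text \<open>What a lattice must provide. The phases are reference colourings whose monochromatic
  cycles are confined to balls of radius D. In general no phase can be singled out in an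
  automorphism-invariant way, so the whole family is required to be invariant, up to agreement
  on edges; any two of its members can be glued within distance \<open>k\<^sub>0\<close>.
  Quadratic growth is what the probability estimates rest on.\<close>

locale phases = coloured_graph G d for G :: "'v ugraph" and d +
  fixes Ph :: "('v set \<Rightarrow> nat) set" and D k\<^sub>0 :: nat
  assumes Ph_nonempty: "Ph \<noteq> {}"
    and Ph_valid: "q \<in> Ph \<Longrightarrow> valid q"
    and Ph_aut: "q \<in> Ph \<Longrightarrow> \<gamma> \<in> Aut \<Longrightarrow> \<exists>q'\<in>Ph. \<forall>e\<in>E. q' (\<gamma> ` e) = q e"
    and Ph_glue: "q \<in> Ph \<Longrightarrow> q' \<in> Ph \<Longrightarrow> glue k\<^sub>0 q q'"
    and Ph_short: "q \<in> Ph \<Longrightarrow> u \<in> V \<Longrightarrow> (u, v) \<in> (mono_step q i)\<^sup>* \<Longrightarrow> v \<in> B u D"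
    and countable_V: "countable V"
    and growth: "\<exists>c>0. \<exists>c'. \<forall>x\<in>V. \<forall>n\<ge>1. c * (real n)\<^sup>2 \<le> real (card (B x n)) \<and>
      real (card (B x n)) \<le> c' * (real n)\<^sup>2"

text \<open>A scale n of the construction has a radius r n and a density p n. The radii have to
  leave room for all that happened at smaller scales, while the construction makes sense for
  arbitrary densities; these matter for the probability that a vertex is reached.\<close>

locale phased_graph = phases G d Ph D k\<^sub>0
  for G :: "'v ugraph" and d and Ph :: "('v set \<Rightarrow> nat) set" and D k\<^sub>0 +
  fixes r :: "nat \<Rightarrow> nat" and p :: "nat \<Rightarrow> real"
  assumes r_0: "r 0 \<ge> 4 * (2 * D + k\<^sub>0 + 3)"
    and r_Suc: "r (Suc n) \<ge> 7 * r n"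
begin

text \<open>Widths around a coloured cluster: in the collar of width s its colours are fixed
  once and for all, and the strip from s to k leaves room to pass from one phase to another.
  Clusters lie more than a = 2 k apart, so their k-neighbourhoods are disjoint. A new region
  swallows the old clusters at distance up to t = k + a from its core. The diameter bound of the
  clusters of scales below n is M n.\<close>

definition s where "s = 2 * D + 2"
definition k where "k = s + k\<^sub>0 + 1"
definition a where "a = 2 * k"
definition t where "t = 3 * k"

definition M :: "nat \<Rightarrow> nat" where "M n = (case n of 0 \<Rightarrow> 0 | Suc m \<Rightarrow> 6 * r m)"

lemma M_simps[simp]: "M 0 = 0" "M (Suc n) = 6 * r n"
  by (simp_all add: M_def)

lemma r_ge: "r n \<ge> t + k"
proof (induction n)
  case 0 then show ?case using r_0 by (simp add: t_def k_def s_def)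
next
  case (Suc n) then show ?case using r_Suc[of n] by linarith
qed

lemma r_ge_M: "r n \<ge> t + k + M n"
proof (cases n)
  case (Suc m) then show ?thesis using r_ge[of m] r_Suc[of m] by simp
qed (use r_ge in simp)

text \<open>Centres of scale n are vertices with label below p n without rivals at distance 8 r
  n. Thinning a random set in this way is a finite-range, equivariant rule.\<close>

definition centres :: "nat \<Rightarrow> ('v \<Rightarrow> real) \<Rightarrow> 'v set" where
  "centres n \<omega> = {c \<in> V. \<omega> c < p n \<and> (\<forall>c'\<in>V. \<omega> c' < p n \<longrightarrow> c' \<in> B c (8 * r n) \<longrightarrow> c' = c)}"

lemma cen_unique: "c \<in> centres n \<omega> \<Longrightarrow> c' \<in> centres n \<omega> \<Longrightarrow> c' \<in> B c (8 * r n) \<Longrightarrow> c' = c"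
  by (auto simp: centres_def)

definition hop :: "nat \<Rightarrow> 'v set \<Rightarrow> ('v \<times> 'v) set" where
  "hop l U = {(u, v). u \<in> U \<and> v \<in> U \<and> v \<in> B u l}"

text \<open>Clusters: the classes of points of U that can be linked by hops of length l inside
  U.\<close>

definition conn :: "nat \<Rightarrow> 'v set \<Rightarrow> 'v \<Rightarrow> 'v set" where
  "conn l U u = {v. (u, v) \<in> (hop l U)\<^sup>*}"

lemma hop_sym: "(u, v) \<in> hop l U \<Longrightarrow> (v, u) \<in> hop l U"
  by (auto simp: hop_def intro: ball_sym)

lemma hops_sym: "(u, v) \<in> (hop l U)\<^sup>* \<Longrightarrow> (v, u) \<in> (hop l U)\<^sup>*"
  using sym_rtrancl[of "hop l U"] hop_sym by (auto simp: sym_def)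

lemma hop_mono: "l \<le> l' \<Longrightarrow> U \<subseteq> U' \<Longrightarrow> hop l U \<subseteq> hop l' U'"
  by (auto simp: hop_def intro: ball_monoD)

lemma hops_mono: "l \<le> l' \<Longrightarrow> U \<subseteq> U' \<Longrightarrow> (u, v) \<in> (hop l U)\<^sup>* \<Longrightarrow> (u, v) \<in> (hop l' U')\<^sup>*"
  using rtrancl_mono[OF hop_mono[of l l' U U']] by blast

lemma conn_self: "u \<in> conn l U u"
  by (simp add: conn_def)

lemma conn_mono: "l \<le> l' \<Longrightarrow> U \<subseteq> U' \<Longrightarrow> conn l U u \<subseteq> conn l' U' u"
  using hops_mono by (auto simp: conn_def)

lemma conn_eq: "v \<in> conn l U u \<Longrightarrow> conn l U v = conn l U u"
  unfolding conn_def using rtrancl_trans hops_sym[of u v l U] by fast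

lemma hops_in: "(u, v) \<in> (hop l U)\<^sup>* \<Longrightarrow> u \<in> U \<Longrightarrow> v \<in> U"
  by (induction rule: rtrancl_induct) (auto simp: hop_def)

lemma conn_sub: "u \<in> U \<Longrightarrow> conn l U u \<subseteq> U"
  using hops_in by (auto simp: conn_def)

lemma conn_hop: "v \<in> conn l U u \<Longrightarrow> (v, w) \<in> hop l U \<Longrightarrow> w \<in> conn l U u"
  by (auto simp: conn_def)

lemma conn_closed:
  assumes "u \<in> X" "\<And>v w. v \<in> X \<Longrightarrow> (v, w) \<in> hop l U \<Longrightarrow> w \<in> X"
  shows "conn l U u \<subseteq> X"
proof
  fix v assume "v \<in> conn l U u"
  then have "(u, v) \<in> (hop l U)\<^sup>*" by (simp add: conn_def)
  then show "v \<in> X" by (induction rule: rtrancl_induct) (use assms in blast)+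
qed

lemma conn_near_eq:
  assumes uv: "u \<in> U" "v \<in> U" and y: "y \<in> nb l (conn a U u)" "y \<in> nb l (conn a U v)" and l: "2 * l \<le> a"
  shows "conn a U u = conn a U v"
proof -
  obtain x z where x: "x \<in> conn a U u" "y \<in> B x l" and z: "z \<in> conn a U v" "y \<in> B z l"
    using y by (auto simp: nb_def)
  have "z \<in> B x a" using ball_trans_le[OF x(2) ball_sym[OF z(2)]] l by simp
  then have "(x, z) \<in> hop a U" using x z conn_sub uv by (auto simp: hop_def)
  then have "z \<in> conn a U u" using x(1) conn_hop by blast
  then show ?thesis using z(1) conn_eq by metis
qed

definition cover :: "nat \<Rightarrow> ('v \<Rightarrow> real) \<Rightarrow> 'v set" where
  "cover n \<omega> = (\<Union>j<n. \<Union>c\<in>centres j \<omega>. B c (2 * r j))"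

text \<open>Clusters stay bounded although regions of all scales overlap. Two balls of scale n
  are so far apart that a chain of hops through the old clusters, each of diameter at most M n,
  cannot lead from one to the other. A chain of hops therefore meets at most one ball of scale
  n, which it enters and leaves through one old cluster each.\<close>

lemma cover_bounded: "(u, v) \<in> (hop t (cover n \<omega>))\<^sup>* \<Longrightarrow> v \<in> B u (M n)"
proof (induction n arbitrary: u v)
  case 0
  then have "u = v" by (induction rule: rtrancl_induct) (auto simp: hop_def cover_def)
  then show ?case by simp
next
  case (Suc n)
  let ?H = "(hop t (cover n \<omega>))\<^sup>*" and ?r = "2 * r n"
  have rn: "r n \<ge> t + M n" using r_ge_M[of n] by linarith
  have cov: "y \<in> cover n \<omega> \<or> (\<exists>c\<in>centres n \<omega>. y \<in> B c ?r)" if "y \<in> cover (Suc n) \<omega>" for y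
    using that unfolding cover_def lessThan_Suc by blast
  have near: "c' = c" if "c \<in> centres n \<omega>" "c' \<in> centres n \<omega>" "x \<in> B c ?r" "y \<in> B c' ?r" "y \<in> B x (2 * t + M n)" for c c' x y
  proof -
    have "y \<in> B c (?r + (2 * t + M n))" using that ball_trans by blast
    then have "c' \<in> B c (?r + (2 * t + M n) + ?r)" using that ball_trans ball_sym by blast
    then have "c' \<in> B c (8 * r n)" by (rule ball_monoD) (use rn in simp)
    then show ?thesis using that cen_unique by blast
  qed
  \<comment> \<open>The invariant of the chain: it has not left the old clusters, or it has done
    so around one centre c. In the latter case w is the point where the chain first came to the
    ball of c, and x is the last point of that ball on the chain.\<close>
  define P where "P v \<longleftrightarrow> (u, v) \<in> ?H \<or> (\<exists>c\<in>centres n \<omega>. \<exists>w\<in>B c ?r. u \<in> B w (t + M n) \<and>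
      (\<exists>x\<in>B c ?r. v = x \<or> (\<exists>y\<in>B x t. (y, v) \<in> ?H)))" for v
  have "P v" using Suc.prems
  proof (induction rule: rtrancl_induct)
    case base then show ?case by (simp add: P_def)
  next
    case (step v v')
    then have vv: "v \<in> cover (Suc n) \<omega>" "v' \<in> cover (Suc n) \<omega>" "v' \<in> B v t" by (auto simp: hop_def)
    have hop: "(z, v') \<in> ?H" if "(z, v) \<in> ?H" "v \<in> cover n \<omega>" "v' \<in> cover n \<omega>" for z
      using that vv by (intro rtrancl_into_rtrancl[OF that(1)]) (auto simp: hop_def)
    from \<open>P v\<close> consider (1) "(u, v) \<in> ?H" |
        (2) c w x where "c \<in> centres n \<omega>" "w \<in> B c ?r" "u \<in> B w (t + M n)" "x \<in> B c ?r"
           "v = x \<or> (\<exists>y\<in>B x t. (y, v) \<in> ?H)"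
      unfolding P_def by blast
    then show ?case
    proof cases
      case 1
      show ?thesis
      proof (cases "\<exists>c\<in>centres n \<omega>. v' \<in> B c ?r")
        case True
        then obtain c where c: "c \<in> centres n \<omega>" "v' \<in> B c ?r" by blast
        have "v \<in> B u (M n)" using Suc.IH 1 by blast
        then have "u \<in> B v' (t + M n)" using vv(3) ball_sym ball_trans by (metis add.commute)
        then show ?thesis unfolding P_def using c by blast
      next
        case False
        then have v': "v' \<in> cover n \<omega>" using cov vv by blast
        show ?thesis
        proof (cases "v \<in> cover n \<omega>")
          case True then show ?thesis using hop 1 v' by (auto simp: P_def)
        next
          case False
          then obtain c where c: "c \<in> centres n \<omega>" "v \<in> B c ?r" using cov vv by blast
          have "v \<in> B u (M n)" using Suc.IH 1 by blast
          then have "u \<in> B v (t + M n)" using ball_sym ball_monoD by (meson le_add2)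
          then show ?thesis unfolding P_def using c vv(3) by blast
        qed
      qed
    next
      case 2
      have vx: "v \<in> B x (t + M n)" using 2(5)
      proof
        assume "\<exists>y\<in>B x t. (y, v) \<in> ?H"
        then show ?thesis using Suc.IH ball_trans by blast
      qed simp
      show ?thesis
      proof (cases "\<exists>c\<in>centres n \<omega>. v' \<in> B c ?r")
        case True
        then obtain c' where c': "c' \<in> centres n \<omega>" "v' \<in> B c' ?r" by blast
        have "v' \<in> B x (2 * t + M n)" using ball_trans_le[OF vx vv(3)] by simp
        then have "c' = c" using near 2 c' by blast
        then show ?thesis unfolding P_def using 2 c' by blast
      next
        case False
        then have v': "v' \<in> cover n \<omega>" using cov vv by blast
        show ?thesis
        proof (cases "v \<in> cover n \<omega>")
          case True
          then show ?thesis using hop v' 2 vv(3) unfolding P_def by blast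
        next
          case False
          then obtain c' where c': "c' \<in> centres n \<omega>" "v \<in> B c' ?r" using cov vv by blast
          have "v \<in> B x (2 * t + M n)" using vx ball_monoD by (metis add_le_mono1 le_add1 mult_2)
          then have "c' = c" using near 2 c' by blast
          then show ?thesis unfolding P_def using 2 c' vv(3) by blast
        qed
      qed
    qed
  qed
  then consider (1) "(u, v) \<in> ?H" |
        (2) c w x where "w \<in> B c ?r" "u \<in> B w (t + M n)" "x \<in> B c ?r"
           "v = x \<or> (\<exists>y\<in>B x t. (y, v) \<in> ?H)"
      unfolding P_def by blast
  then show ?case
  proof cases
    case 1
    then have "v \<in> B u (M n)" using Suc.IH by blast
    then show ?thesis by (rule ball_monoD) (use rn in simp)
  next
    case 2
    have vx: "v \<in> B x (t + M n)" using 2(4)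
    proof
      assume "\<exists>y\<in>B x t. (y, v) \<in> ?H"
      then show ?thesis using Suc.IH ball_trans by blast
    qed simp
    have "c \<in> B u (t + M n + ?r)" using 2 ball_sym ball_trans by blast
    then have "x \<in> B u (t + M n + ?r + ?r)" using 2 ball_trans by blast
    then have "v \<in> B u (t + M n + ?r + ?r + (t + M n))" using vx ball_trans by blast
    then show ?thesis by (rule ball_monoD) (use rn in simp)
  qed
qed

text \<open>The core of the new region: the balls around the centres together with every part of
  the old region U that is linked to one of them by hops of length t. Since a \<le> t, such a
  part consists of entire old clusters.\<close>

definition zone :: "nat \<Rightarrow> ('v \<Rightarrow> real) \<Rightarrow> 'v set \<Rightarrow> 'v set" where
  "zone n \<omega> U = (\<Union>c\<in>centres n \<omega>. B c (r n)) \<union>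
     {z. \<exists>c\<in>centres n \<omega>. \<exists>b\<in>B c (r n). \<exists>u\<in>U. u \<in> B b t \<and> (u, z) \<in> (hop t U)\<^sup>*}"

definition fresh :: "nat \<Rightarrow> ('v \<Rightarrow> real) \<Rightarrow> 'v set \<Rightarrow> 'v set" where
  "fresh n \<omega> U = nb k (zone n \<omega> U)"

definition grow :: "nat \<Rightarrow> ('v \<Rightarrow> real) \<Rightarrow> 'v set \<Rightarrow> 'v set" where
  "grow n \<omega> U = U \<union> fresh n \<omega> U"

lemma a_t: "a \<le> t" "k \<le> a" "k + a = t" "2 * s \<le> a" "s \<le> k" "s + k\<^sub>0 < k"
  by (simp_all add: a_def t_def k_def)

lemma zone_fresh: "zone n \<omega> U \<subseteq> fresh n \<omega> U"
  unfolding fresh_def by (rule nb_self)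

lemma zone_absorbs: "z \<in> zone n \<omega> U \<Longrightarrow> u \<in> U \<Longrightarrow> u \<in> B z t \<Longrightarrow> u \<in> zone n \<omega> U"
proof -
  assume z: "z \<in> zone n \<omega> U" and u: "u \<in> U" "u \<in> B z t"
  from z consider (1) c where "c \<in> centres n \<omega>" "z \<in> B c (r n)" |
      (2) c b v where "c \<in> centres n \<omega>" "b \<in> B c (r n)" "v \<in> U" "v \<in> B b t" "(v, z) \<in> (hop t U)\<^sup>*"
    unfolding zone_def by blast
  then show ?thesis
  proof cases
    case 1 then show ?thesis using u unfolding zone_def by blast
  next
    case 2
    then have "z \<in> U" using hops_in by blast
    then have "(z, u) \<in> hop t U" using u by (simp add: hop_def)
    then have "(v, u) \<in> (hop t U)\<^sup>*" using 2 by simp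
    then show ?thesis using 2 unfolding zone_def by blast
  qed
qed

lemma fresh_absorbs: "w \<in> fresh n \<omega> U \<Longrightarrow> u \<in> U \<Longrightarrow> u \<in> B w a \<Longrightarrow> u \<in> zone n \<omega> U"
proof -
  assume w: "w \<in> fresh n \<omega> U" and u: "u \<in> U" "u \<in> B w a"
  then obtain z where z: "z \<in> zone n \<omega> U" "w \<in> B z k" by (auto simp: fresh_def nb_def)
  have "u \<in> B z t" using ball_trans[OF z(2) u(2)] a_t by simp
  then show ?thesis using zone_absorbs z u by blast
qed

lemma conn_fresh: "w \<in> fresh n \<omega> U \<Longrightarrow> conn a (grow n \<omega> U) w \<subseteq> fresh n \<omega> U"
proof (rule conn_closed)
  fix v y assume "v \<in> fresh n \<omega> U" "(v, y) \<in> hop a (grow n \<omega> U)"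
  then show "y \<in> fresh n \<omega> U"
    using fresh_absorbs[of v n \<omega> U y] zone_fresh[of n \<omega> U] by (auto simp: hop_def grow_def)
qed

text \<open>Dichotomy for old clusters: those that the new region does not touch remain
  clusters, and by the next lemma those that it touches are swallowed together with their
  neighbourhood of radius k, which is the room needed for changing the phase around them.\<close>

lemma conn_old:
  assumes "u \<in> U" "u \<notin> fresh n \<omega> U"
  shows "conn a (grow n \<omega> U) u = conn a U u"
proof
  show "conn a U u \<subseteq> conn a (grow n \<omega> U) u" by (rule conn_mono) (auto simp: grow_def)
  have "conn a (grow n \<omega> U) u \<subseteq> conn a U u \<inter> (U - fresh n \<omega> U)"
  proof (rule conn_closed)
    show "u \<in> conn a U u \<inter> (U - fresh n \<omega> U)" using assms conn_self by blast
  next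
    fix v y assume v: "v \<in> conn a U u \<inter> (U - fresh n \<omega> U)" "(v, y) \<in> hop a (grow n \<omega> U)"
    then have "y \<notin> fresh n \<omega> U" using fresh_absorbs[of y n \<omega> U v] zone_fresh ball_sym by (auto simp: hop_def)
    then have "(v, y) \<in> hop a U" using v by (auto simp: hop_def grow_def)
    then show "y \<in> conn a U u \<inter> (U - fresh n \<omega> U)"
      using v conn_hop \<open>y \<notin> _\<close> by (auto simp: hop_def)
  qed
  then show "conn a (grow n \<omega> U) u \<subseteq> conn a U u" by blast
qed

lemma conn_absorbed:
  assumes "u \<in> U" "u \<in> fresh n \<omega> U"
  shows "nb k (conn a U u) \<subseteq> conn a (grow n \<omega> U) u"
proof
  fix y assume "y \<in> nb k (conn a U u)"
  then obtain x where x: "x \<in> conn a U u" "y \<in> B x k" by (auto simp: nb_def)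
  have "u \<in> zone n \<omega> U" using fresh_absorbs[OF assms(2,1)] by simp
  then have "conn a U u \<subseteq> zone n \<omega> U"
  proof (rule conn_closed)
    fix v w assume "v \<in> zone n \<omega> U" "(v, w) \<in> hop a U"
    then show "w \<in> zone n \<omega> U" using zone_absorbs[of v n \<omega> U w] a_t ball_monoD by (auto simp: hop_def)
  qed
  then have "x \<in> zone n \<omega> U" using x by blast
  then have "y \<in> fresh n \<omega> U" "x \<in> fresh n \<omega> U"
    using x zone_fresh[of n \<omega> U] by (auto simp: fresh_def nb_def)
  then have "(x, y) \<in> hop a (grow n \<omega> U)" using x a_t ball_monoD by (auto simp: hop_def grow_def)
  moreover have "x \<in> conn a (grow n \<omega> U) u" using x conn_mono[of a a U "grow n \<omega> U" u] by (auto simp: grow_def)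
  ultimately show "y \<in> conn a (grow n \<omega> U) u" using conn_hop by blast
qed

section \<open>Choosing equivariantly\<close>

definition rank :: "('v \<Rightarrow> real) \<Rightarrow> 'v set \<Rightarrow> 'v \<Rightarrow> nat" where
  "rank \<omega> W v = card {w \<in> W. \<omega> w < \<omega> v}"

text \<open>A description of the colouring f of W up to isomorphism: vertices are replaced by
  their ranks in the order of the labels.\<close>

definition code :: "('v \<Rightarrow> real) \<Rightarrow> 'v set \<Rightarrow> ('v set \<Rightarrow> nat) \<Rightarrow> (nat set \<times> nat) set" where
  "code \<omega> W f = {(rank \<omega> W ` e, f e) | e. e \<in> E \<and> e \<subseteq> W}"

text \<open>An equivariant choice from S. The operator SOME is applied to a set of codes, which
  does not change under isomorphisms, and only then to S itself. As the labels are distinct, two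
  members of S with the same code agree on W, so the second application does not break the
  symmetry there.\<close>

definition pick :: "('v \<Rightarrow> real) \<Rightarrow> 'v set \<Rightarrow> ('v set \<Rightarrow> nat) set \<Rightarrow> 'v set \<Rightarrow> nat" where
  "pick \<omega> W S = (SOME f. f \<in> S \<and> code \<omega> W f = (SOME X. X \<in> code \<omega> W ` S))"

lemma pick_in:
  assumes "S \<noteq> {}"
  shows "pick \<omega> W S \<in> S \<and> code \<omega> W (pick \<omega> W S) = (SOME X. X \<in> code \<omega> W ` S)"
proof -
  have "(SOME X. X \<in> code \<omega> W ` S) \<in> code \<omega> W ` S" using assms by (simp add: some_in_eq)
  then have "\<exists>f. f \<in> S \<and> code \<omega> W f = (SOME X. X \<in> code \<omega> W ` S)" by auto
  then show ?thesis unfolding pick_def by (rule someI_ex)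
qed

lemma rank_inj:
  assumes "finite W" "inj_on \<omega> W" shows "inj_on (rank \<omega> W) W"
proof -
  have less: "rank \<omega> W u < rank \<omega> W v" if "u \<in> W" "v \<in> W" "\<omega> u < \<omega> v" for u v
    unfolding rank_def by (rule psubset_card_mono) (use assms that in auto)
  show ?thesis
  proof (rule inj_onI)
    fix u v assume uv: "u \<in> W" "v \<in> W" "rank \<omega> W u = rank \<omega> W v"
    then have "\<omega> u = \<omega> v" using less[of u v] less[of v u] by linarith
    then show "u = v" using assms uv by (auto dest: inj_onD)
  qed
qed

lemma rank_match:
  assumes g: "\<gamma> \<in> Aut" and W: "W \<subseteq> V" "v \<in> W"
    and ord: "\<And>v w. v \<in> W \<Longrightarrow> w \<in> W \<Longrightarrow> \<omega> v < \<omega> w \<longleftrightarrow> \<omega>' (\<gamma> v) < \<omega>' (\<gamma> w)"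
  shows "rank \<omega>' (\<gamma> ` W) (\<gamma> v) = rank \<omega> W v"
proof -
  have "{w \<in> \<gamma> ` W. \<omega>' w < \<omega>' (\<gamma> v)} = \<gamma> ` {w \<in> W. \<omega> w < \<omega> v}" using ord W by auto
  moreover have "inj_on \<gamma> {w \<in> W. \<omega> w < \<omega> v}" using g W by (intro inj_onI) (auto simp: aut_inj subset_iff)
  ultimately show ?thesis by (simp add: rank_def card_image)
qed

lemma pick_match:
  assumes g: "\<gamma> \<in> Aut" and W: "W \<subseteq> V" "finite W" and inj: "inj_on \<omega>' (\<gamma> ` W)"
    and ord: "\<And>v w. v \<in> W \<Longrightarrow> w \<in> W \<Longrightarrow> \<omega> v < \<omega> w \<longleftrightarrow> \<omega>' (\<gamma> v) < \<omega>' (\<gamma> w)"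
    and S: "S \<noteq> {}" and fwd: "\<And>f. f \<in> S \<Longrightarrow> push \<gamma> f \<in> S'"
    and bwd: "\<And>f. f \<in> S' \<Longrightarrow> push (ainv \<gamma>) f \<in> S"
    and e: "e \<in> E" "e \<subseteq> W"
  shows "pick \<omega>' (\<gamma> ` W) S' (\<gamma> ` e) = pick \<omega> W S e"
proof -
  have rk: "rank \<omega>' (\<gamma> ` W) ` \<gamma> ` e = rank \<omega> W ` e" if "e \<subseteq> W" for e
    unfolding image_image by (rule image_cong) (use that rank_match[OF g W(1), of _ \<omega> \<omega>'] ord in auto)
  have codeq: "code \<omega>' (\<gamma> ` W) f' = code \<omega> W f" if ff: "\<And>e. e \<in> E \<Longrightarrow> e \<subseteq> W \<Longrightarrow> f' (\<gamma> ` e) = f e" for f f'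
  proof (intro equalityI subsetI)
    fix x assume "x \<in> code \<omega>' (\<gamma> ` W) f'"
    then obtain e' where e': "e' \<in> E" "e' \<subseteq> \<gamma> ` W" "x = (rank \<omega>' (\<gamma> ` W) ` e', f' e')" by (auto simp: code_def)
    define e where "e = ainv \<gamma> ` e'"
    have "e' = \<gamma> ` e" using ainv_image_right[OF g] edge_sub e' e_def by metis
    moreover have "e \<in> E" using e_def e' aut_edge ainv_aut g by blast
    moreover have "e \<subseteq> W" using e'(2) ainv_image_left[OF g W(1)] unfolding e_def by blast
    ultimately show "x \<in> code \<omega> W f" using e' ff rk unfolding code_def by auto
  next
    fix x assume "x \<in> code \<omega> W f"
    then obtain e where e: "e \<in> E" "e \<subseteq> W" "x = (rank \<omega> W ` e, f e)" by (auto simp: code_def)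
    then have "\<gamma> ` e \<in> E" "\<gamma> ` e \<subseteq> \<gamma> ` W" "x = (rank \<omega>' (\<gamma> ` W) ` \<gamma> ` e, f' (\<gamma> ` e))"
      using aut_edge g ff rk by auto
    then show "x \<in> code \<omega>' (\<gamma> ` W) f'" unfolding code_def by blast
  qed
  have codes: "code \<omega>' (\<gamma> ` W) ` S' = code \<omega> W ` S"
  proof (intro equalityI subsetI)
    fix x assume "x \<in> code \<omega>' (\<gamma> ` W) ` S'"
    then obtain f' where f': "f' \<in> S'" "x = code \<omega>' (\<gamma> ` W) f'" by blast
    have "x = code \<omega> W (push (ainv \<gamma>) f')" unfolding f'(2)
    proof (rule codeq)
      fix e assume "e \<in> E" "e \<subseteq> W"
      then have "push (ainv \<gamma>) f' (ainv \<gamma> ` \<gamma> ` e) = f' (\<gamma> ` e)"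
        using push_image[OF ainv_aut[OF g], of "\<gamma> ` e" f'] aut_edge[OF g] edge_sub by blast
      then show "f' (\<gamma> ` e) = push (ainv \<gamma>) f' e" using ainv_image_left[OF g] edge_sub \<open>e \<in> E\<close> by simp
    qed
    then show "x \<in> code \<omega> W ` S" using bwd f' by blast
  next
    fix x assume "x \<in> code \<omega> W ` S"
    then obtain f where f: "f \<in> S" "x = code \<omega> W f" by blast
    have "code \<omega>' (\<gamma> ` W) (push \<gamma> f) = x" unfolding f(2)
      by (rule codeq) (use push_image[OF g] edge_sub in auto)
    then show "x \<in> code \<omega>' (\<gamma> ` W) ` S'" using fwd f by blast
  qed
  have S': "S' \<noteq> {}" using S fwd by blast
  let ?f = "pick \<omega> W S" and ?f' = "pick \<omega>' (\<gamma> ` W) S'"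
  have "code \<omega>' (\<gamma> ` W) ?f' = code \<omega> W ?f"
    using pick_in[OF S, of \<omega> W] pick_in[OF S', of \<omega>' "\<gamma> ` W"] codes by simp
  moreover have "(rank \<omega> W ` e, ?f e) \<in> code \<omega> W ?f" using e unfolding code_def by blast
  ultimately have "(rank \<omega>' (\<gamma> ` W) ` \<gamma> ` e, ?f e) \<in> code \<omega>' (\<gamma> ` W) ?f'" using rk e by simp
  then obtain e' where e': "e' \<in> E" "e' \<subseteq> \<gamma> ` W" "rank \<omega>' (\<gamma> ` W) ` \<gamma> ` e = rank \<omega>' (\<gamma> ` W) ` e'"
      "?f e = ?f' e'" by (auto simp: code_def)
  have "inj_on (rank \<omega>' (\<gamma> ` W)) (\<gamma> ` W)" using rank_inj W inj by blast
  then have "\<gamma> ` e = e'" using e' e(2) by (simp add: inj_on_image_eq_iff image_mono)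
  then show ?thesis using e' by simp
qed

section \<open>Painting the regions\<close>

text \<open>Admissible colourings of a new cluster K: they come from a valid colouring that is a
  phase outside K and that keeps the old colours in the collars of the old clusters inside K.
  Only the values on the collar of width s of K are constrained; elsewhere f is arbitrary.\<close>

definition extensions :: "'v set \<Rightarrow> ('v set \<Rightarrow> nat) \<Rightarrow> 'v set \<Rightarrow> ('v set \<Rightarrow> nat) set" where
  "extensions U \<tau> K = {f. \<exists>q\<in>Ph. \<exists>\<sigma>. valid \<sigma> \<and> (\<forall>e\<in>E. e \<subseteq> nb s K \<longrightarrow> f e = \<sigma> e) \<and>
     (\<forall>e\<in>E. \<not> e \<subseteq> K \<longrightarrow> \<sigma> e = q e) \<and>
     (\<forall>u\<in>U \<inter> K. \<forall>e\<in>E. e \<subseteq> nb s (conn a U u) \<longrightarrow> \<sigma> e = \<tau> e)}"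

text \<open>The invariant of the construction: seen from each cluster alone, the colouring
  continues to a valid colouring of the whole graph that is a phase outside the cluster.
  Different clusters may use different phases.\<close>

definition good :: "'v set \<Rightarrow> ('v set \<Rightarrow> nat) \<Rightarrow> bool" where
  "good U \<tau> \<longleftrightarrow> (\<forall>u\<in>U. \<tau> \<in> extensions {} \<tau> (conn a U u))"

text \<open>The new cluster that is responsible for the edge e, if there is one; at most one
  cluster can be responsible, so the union is over at most one set.\<close>

definition home :: "nat \<Rightarrow> ('v \<Rightarrow> real) \<Rightarrow> 'v set \<Rightarrow> 'v set \<Rightarrow> 'v set" where
  "home n \<omega> U e = \<Union>{conn a (grow n \<omega> U) w | w. w \<in> fresh n \<omega> U \<and> e \<subseteq> nb s (conn a (grow n \<omega> U) w)}"

definition paint :: "nat \<Rightarrow> ('v \<Rightarrow> real) \<Rightarrow> 'v set \<Rightarrow> ('v set \<Rightarrow> nat) \<Rightarrow> 'v set \<Rightarrow> nat" where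
  "paint n \<omega> U \<tau> e = (let K = home n \<omega> U e in
     if K = {} then \<tau> e else pick \<omega> (nb s K) (extensions U \<tau> K) e)"

lemma edge_nonempty: "e \<in> E \<Longrightarrow> \<exists>y. y \<in> e"
  using edge_pair by blast

lemma fresh_in_grow: "w \<in> fresh n \<omega> U \<Longrightarrow> w \<in> grow n \<omega> U"
  by (simp add: grow_def)

lemma home_fresh:
  assumes w: "w \<in> fresh n \<omega> U" and e: "e \<in> E" "e \<subseteq> nb s (conn a (grow n \<omega> U) w)"
  shows "home n \<omega> U e = conn a (grow n \<omega> U) w"
proof -
  obtain y where y: "y \<in> e" using edge_nonempty e by blast
  have "conn a (grow n \<omega> U) w' = conn a (grow n \<omega> U) w"
    if "w' \<in> fresh n \<omega> U" "e \<subseteq> nb s (conn a (grow n \<omega> U) w')" for w'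
    by (rule conn_near_eq[where l = s and y = y]) (use that w e y a_t fresh_in_grow in auto)
  then show ?thesis unfolding home_def using w e by blast
qed

lemma home_old:
  assumes u: "u \<in> U" "u \<notin> fresh n \<omega> U" and e: "e \<in> E" "e \<subseteq> nb s (conn a U u)"
  shows "home n \<omega> U e = {}"
proof -
  obtain y where y: "y \<in> e" using edge_nonempty e by blast
  have "\<not> e \<subseteq> nb s (conn a (grow n \<omega> U) w)" if w: "w \<in> fresh n \<omega> U" for w
  proof
    assume sub: "e \<subseteq> nb s (conn a (grow n \<omega> U) w)"
    have "conn a (grow n \<omega> U) w = conn a (grow n \<omega> U) u"
      by (rule conn_near_eq[where l = s and y = y])
        (use sub u e y a_t fresh_in_grow w conn_old[OF u] in \<open>auto simp: grow_def\<close>)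
    then show False using conn_fresh[OF w] conn_self u by blast
  qed
  then show ?thesis unfolding home_def by blast
qed

text \<open>Fix one phase q. Each old cluster X inside K comes with its own phase, which can be
  exchanged for q in the strip between the collar of X and its k-neighbourhood. These
  neighbourhoods are disjoint and contained in K, so the exchanges do not interfere, and filling
  the rest with q gives an admissible colouring.\<close>

lemma extensions_nonempty:
  assumes U: "U \<subseteq> V" and good: "good U \<tau>" and w: "w \<in> fresh n \<omega> U"
  shows "extensions U \<tau> (conn a (grow n \<omega> U) w) \<noteq> {}"
proof -
  let ?K = "conn a (grow n \<omega> U) w"
  let ?XX = "conn a U ` (U \<inter> ?K)"
  obtain q where q: "q \<in> Ph" using Ph_nonempty by blast
  have inK: "nb k X \<subseteq> ?K" if X: "X \<in> ?XX" for X
  proof -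
    obtain u where u: "u \<in> U" "u \<in> ?K" "X = conn a U u" using X by blast
    then have "u \<in> fresh n \<omega> U" using conn_fresh w by blast
    then show ?thesis using conn_absorbed[OF u(1)] u conn_eq[OF u(2)] by metis
  qed
  have ex: "\<exists>\<rho>. valid \<rho> \<and> (\<forall>e\<in>E. e \<subseteq> nb s X \<longrightarrow> \<rho> e = \<tau> e) \<and> (\<forall>e\<in>E. \<not> e \<subseteq> nb (s + k\<^sub>0) X \<longrightarrow> \<rho> e = q e)"
    if X: "X \<in> ?XX" for X
  proof -
    obtain u where u: "u \<in> U" "X = conn a U u" using X by blast
    then have XV: "X \<subseteq> V" using conn_sub U by blast
    obtain q1 \<sigma> where q1: "q1 \<in> Ph" "valid \<sigma>" "\<forall>e\<in>E. e \<subseteq> nb s X \<longrightarrow> \<tau> e = \<sigma> e" "\<forall>e\<in>E. \<not> e \<subseteq> X \<longrightarrow> \<sigma> e = q1 e"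
      using good u unfolding good_def extensions_def by blast
    obtain g where g: "valid g" "\<forall>e\<in>E. e \<inter> nb s X \<noteq> {} \<longrightarrow> g e = q1 e" "\<forall>e\<in>E. \<not> e \<subseteq> nb k\<^sub>0 (nb s X) \<longrightarrow> g e = q e"
      using Ph_glue[OF q1(1) q, unfolded glue_def, rule_format, OF nb_verts[OF XV]] by blast
    \<comment> \<open>Old colours inside X, the transition from the phase of X to q around the
      collar of X.\<close>
    define \<rho> where "\<rho> e = (if e \<subseteq> X then \<sigma> e else g e)" for e
    have sX: "X \<subseteq> nb s X" by (rule nb_self)
    have at: "\<rho> e = \<sigma> e" if "e \<in> E" "v \<in> e" "v \<in> nb s X" for e v
      using that q1 g by (auto simp: \<rho>_def)
    have "valid \<rho>"
    proof (rule valid_local)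
      fix v assume "v \<in> V"
      show "\<exists>\<sigma>. valid \<sigma> \<and> (\<forall>e\<in>E. v \<in> e \<longrightarrow> \<rho> e = \<sigma> e)"
      proof (cases "v \<in> nb s X")
        case True then show ?thesis using at q1 by blast
      next
        case False
        then have "\<forall>e\<in>E. v \<in> e \<longrightarrow> \<rho> e = g e" using sX by (auto simp: \<rho>_def)
        then show ?thesis using g by blast
      qed
    qed
    moreover have "\<rho> e = \<tau> e" if "e \<in> E" "e \<subseteq> nb s X" for e
      using at[OF that(1)] edge_nonempty[OF that(1)] q1(3) that by (metis subsetD)
    moreover have "\<rho> e = q e" if "e \<in> E" "\<not> e \<subseteq> nb (s + k\<^sub>0) X" for e
    proof -
      have "\<not> e \<subseteq> X" using that nb_self[of X "s + k\<^sub>0"] by blast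
      moreover have "\<not> e \<subseteq> nb k\<^sub>0 (nb s X)" using that nb_nb[of k\<^sub>0 s X] by blast
      ultimately show ?thesis using that g by (simp add: \<rho>_def)
    qed
    ultimately show ?thesis by blast
  qed
  obtain R where R: "\<And>X. X \<in> ?XX \<Longrightarrow> valid (R X)"
      "\<And>X e. X \<in> ?XX \<Longrightarrow> e \<in> E \<Longrightarrow> e \<subseteq> nb s X \<Longrightarrow> R X e = \<tau> e"
      "\<And>X e. X \<in> ?XX \<Longrightarrow> e \<in> E \<Longrightarrow> \<not> e \<subseteq> nb (s + k\<^sub>0) X \<Longrightarrow> R X e = q e"
  proof -
    from ex have "\<forall>X\<in>?XX. \<exists>\<rho>. valid \<rho> \<and> (\<forall>e\<in>E. e \<subseteq> nb s X \<longrightarrow> \<rho> e = \<tau> e) \<and>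
      (\<forall>e\<in>E. \<not> e \<subseteq> nb (s + k\<^sub>0) X \<longrightarrow> \<rho> e = q e)" by simp
    from bchoice[OF this] obtain R where "\<forall>X\<in>?XX. valid (R X) \<and> (\<forall>e\<in>E. e \<subseteq> nb s X \<longrightarrow> R X e = \<tau> e) \<and>
      (\<forall>e\<in>E. \<not> e \<subseteq> nb (s + k\<^sub>0) X \<longrightarrow> R X e = q e)" ..
    then show ?thesis by (intro that[of R]) blast+
  qed
  \<comment> \<open>The k-neighbourhoods of the old clusters are disjoint, so each edge is
    governed by at most one of them.\<close>
  define X_of where "X_of e = (SOME X. X \<in> ?XX \<and> e \<subseteq> nb k X)" for e
  have X_of: "X_of e = X" if X: "X \<in> ?XX" "e \<subseteq> nb k X" and e: "e \<in> E" for e X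
  proof -
    obtain y where y: "y \<in> e" using edge_nonempty e by blast
    have "X_of e \<in> ?XX \<and> e \<subseteq> nb k (X_of e)"
      unfolding X_of_def by (rule someI[of "\<lambda>X. X \<in> ?XX \<and> e \<subseteq> nb k X" X]) (intro conjI X)
    then have 1: "X_of e \<in> ?XX" "y \<in> nb k (X_of e)" and 2: "y \<in> nb k X" using X y by auto
    obtain u where u: "u \<in> U" "X_of e = conn a U u" using 1 by auto
    obtain u' where u': "u' \<in> U" "X = conn a U u'" using X by auto
    show ?thesis using conn_near_eq[of u U u' y k] u u' 1 2 by (simp add: a_def)
  qed
  define \<sigma> where "\<sigma> e = (if \<exists>X\<in>?XX. e \<subseteq> nb k X then R (X_of e) e else q e)" for e
  have \<sigma>_R: "\<sigma> e = R X e" if "X \<in> ?XX" "e \<subseteq> nb k X" "e \<in> E" for e X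
  proof -
    have "\<exists>X\<in>?XX. e \<subseteq> nb k X" using that by blast
    then show ?thesis using X_of[OF that] by (simp only: \<sigma>_def if_True)
  qed
  have "valid \<sigma>"
  proof (rule valid_local)
    fix v assume "v \<in> V"
    show "\<exists>\<sigma>'. valid \<sigma>' \<and> (\<forall>e\<in>E. v \<in> e \<longrightarrow> \<sigma> e = \<sigma>' e)"
    proof (cases "\<exists>X\<in>?XX. v \<in> nb (s + k\<^sub>0) X")
      case True
      then obtain X where X: "X \<in> ?XX" "v \<in> nb (s + k\<^sub>0) X" by blast
      then have "\<sigma> e = R X e" if "e \<in> E" "v \<in> e" for e
        using \<sigma>_R[OF X(1) _ that(1)] nb_edge[OF that X(2) a_t(6)] by blast
      then show ?thesis using R(1) X by blast
    next
      case False
      have "\<sigma> e = q e" if e: "e \<in> E" "v \<in> e" for e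
      proof (cases "\<exists>X\<in>?XX. e \<subseteq> nb k X")
        case True
        then obtain X where X: "X \<in> ?XX" "e \<subseteq> nb k X" by blast
        then have "\<not> e \<subseteq> nb (s + k\<^sub>0) X" using False e by blast
        then show ?thesis using \<sigma>_R X e R(3) by metis
      qed (simp add: \<sigma>_def)
      then show ?thesis using Ph_valid q by blast
    qed
  qed
  moreover have "\<sigma> e = q e" if "e \<in> E" "\<not> e \<subseteq> ?K" for e
  proof -
    have "\<not> (\<exists>X\<in>?XX. e \<subseteq> nb k X)" using that inK by blast
    then show ?thesis by (simp add: \<sigma>_def)
  qed
  moreover have "\<sigma> e = \<tau> e" if "u \<in> U \<inter> ?K" "e \<in> E" "e \<subseteq> nb s (conn a U u)" for e u
  proof -
    have "conn a U u \<in> ?XX" using that by blast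
    moreover have "e \<subseteq> nb k (conn a U u)" using that nb_mono[of "conn a U u" _ s k] a_t by blast
    ultimately show ?thesis using \<sigma>_R R(2) that by metis
  qed
  ultimately have "\<sigma> \<in> extensions U \<tau> ?K" using q unfolding extensions_def by blast
  then show ?thesis by blast
qed

lemma paint_fresh:
  assumes U: "U \<subseteq> V" and good: "good U \<tau>" and w: "w \<in> fresh n \<omega> U"
  defines "K \<equiv> conn a (grow n \<omega> U) w"
  shows "\<exists>f\<in>extensions U \<tau> K. \<forall>e\<in>E. e \<subseteq> nb s K \<longrightarrow> paint n \<omega> U \<tau> e = f e"
proof (intro bexI ballI impI)
  show "pick \<omega> (nb s K) (extensions U \<tau> K) \<in> extensions U \<tau> K"
    using pick_in extensions_nonempty[OF U good w] unfolding K_def by blast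
  fix e assume "e \<in> E" "e \<subseteq> nb s K"
  then have "home n \<omega> U e = K" using home_fresh w unfolding K_def by blast
  moreover have "K \<noteq> {}" unfolding K_def using conn_self by blast
  ultimately show "paint n \<omega> U \<tau> e = pick \<omega> (nb s K) (extensions U \<tau> K) e" by (simp add: paint_def)
qed

lemma paint_old:
  assumes "u \<in> U" "u \<notin> fresh n \<omega> U" "e \<in> E" "e \<subseteq> nb s (conn a U u)"
  shows "paint n \<omega> U \<tau> e = \<tau> e"
  using home_old[OF assms] by (simp add: paint_def)

lemma good_paint:
  assumes U: "U \<subseteq> V" and good: "good U \<tau>"
  shows "good (grow n \<omega> U) (paint n \<omega> U \<tau>)"
  unfolding good_def
proof
  fix u assume u: "u \<in> grow n \<omega> U"
  show "paint n \<omega> U \<tau> \<in> extensions {} (paint n \<omega> U \<tau>) (conn a (grow n \<omega> U) u)"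
  proof (cases "u \<in> fresh n \<omega> U")
    case True
    from paint_fresh[OF U good True] obtain f where f: "f \<in> extensions U \<tau> (conn a (grow n \<omega> U) u)"
      "\<forall>e\<in>E. e \<subseteq> nb s (conn a (grow n \<omega> U) u) \<longrightarrow> paint n \<omega> U \<tau> e = f e" by blast
    from f(1) obtain q \<sigma> where "q \<in> Ph" "valid \<sigma>"
       "\<forall>e\<in>E. e \<subseteq> nb s (conn a (grow n \<omega> U) u) \<longrightarrow> f e = \<sigma> e"
       "\<forall>e\<in>E. \<not> e \<subseteq> conn a (grow n \<omega> U) u \<longrightarrow> \<sigma> e = q e"
      unfolding extensions_def by blast
    then show ?thesis using f(2) unfolding extensions_def by auto
  next
    case False
    then have uU: "u \<in> U" using u by (simp add: grow_def)
    obtain q \<sigma> where "q \<in> Ph" "valid \<sigma>"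
       "\<forall>e\<in>E. e \<subseteq> nb s (conn a U u) \<longrightarrow> \<tau> e = \<sigma> e"
       "\<forall>e\<in>E. \<not> e \<subseteq> conn a U u \<longrightarrow> \<sigma> e = q e"
      using good uU unfolding good_def extensions_def by blast
    then show ?thesis using paint_old[OF uU False] unfolding conn_old[OF uU False] extensions_def by auto
  qed
qed

text \<open>Colours in the collar of a cluster never change again. This is why the colouring has
  a limit at every vertex that is reached, and why the limit near a vertex is known at a finite
  stage.\<close>

lemma paint_stable:
  assumes U: "U \<subseteq> V" and good: "good U \<tau>" and u: "u \<in> U" and e: "e \<in> E" "e \<subseteq> nb s (conn a U u)"
  shows "paint n \<omega> U \<tau> e = \<tau> e"
proof (cases "u \<in> fresh n \<omega> U")
  case False then show ?thesis using paint_old u e by blast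
next
  case True
  let ?K = "conn a (grow n \<omega> U) u"
  from paint_fresh[OF U good True] obtain f where f: "f \<in> extensions U \<tau> ?K"
    "\<forall>e\<in>E. e \<subseteq> nb s ?K \<longrightarrow> paint n \<omega> U \<tau> e = f e" by blast
  have "conn a U u \<subseteq> ?K" by (rule conn_mono) (auto simp: grow_def)
  then have eK: "e \<subseteq> nb s ?K" using e nb_mono by blast
  have "u \<in> U \<inter> ?K" using u conn_self by blast
  with f(1) e eK have "f e = \<tau> e" unfolding extensions_def by fastforce
  then show ?thesis using f(2) eK e by simp
qed

lemma zone_verts: "U \<subseteq> V \<Longrightarrow> zone n \<omega> U \<subseteq> V"
proof
  fix z assume U: "U \<subseteq> V" and "z \<in> zone n \<omega> U"
  then show "z \<in> V" unfolding zone_def centres_def using ball_verts hops_in by blast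
qed

lemma grow_verts: "U \<subseteq> V \<Longrightarrow> grow n \<omega> U \<subseteq> V"
  using zone_verts nb_verts by (simp add: grow_def fresh_def)

lemma grow_cover:
  assumes "U \<subseteq> cover n \<omega>" shows "grow n \<omega> U \<subseteq> cover (Suc n) \<omega>"
proof
  fix y assume y: "y \<in> grow n \<omega> U"
  show "y \<in> cover (Suc n) \<omega>"
  proof (cases "y \<in> U")
    case True then show ?thesis using assms unfolding cover_def lessThan_Suc by blast
  next
    case False
    then obtain z where z: "z \<in> zone n \<omega> U" "y \<in> B z k" using y by (auto simp: grow_def fresh_def nb_def)
    have rn: "r n \<ge> t + k + M n" by (rule r_ge_M)
    have "\<exists>c\<in>centres n \<omega>. z \<in> B c (r n + t + M n)"
    proof -
      from z consider (1) c where "c \<in> centres n \<omega>" "z \<in> B c (r n)" |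
         (2) c b v where "c \<in> centres n \<omega>" "b \<in> B c (r n)" "v \<in> U" "v \<in> B b t" "(v, z) \<in> (hop t U)\<^sup>*"
        unfolding zone_def by blast
      then show ?thesis
      proof cases
        case 1
        then have "z \<in> B c (r n + t + M n)" by (rule_tac ball_monoD) auto
        then show ?thesis using 1 by blast
      next
        case 2
        have "z \<in> B v (M n)" using hops_mono[OF order_refl assms 2(5)] cover_bounded by blast
        then have "z \<in> B c (r n + t + M n)" using 2 ball_trans by blast
        then show ?thesis using 2 by blast
      qed
    qed
    then obtain c where c: "c \<in> centres n \<omega>" "z \<in> B c (r n + t + M n)" by blast
    have "y \<in> B c (2 * r n)" by (rule ball_trans_le[OF c(2) z(2)]) (use rn in simp)
    then show ?thesis using c unfolding cover_def by blast
  qed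
qed

fun region :: "nat \<Rightarrow> ('v \<Rightarrow> real) \<Rightarrow> 'v set" where
  "region 0 \<omega> = {}"
| "region (Suc n) \<omega> = grow n \<omega> (region n \<omega>)"

fun col :: "nat \<Rightarrow> ('v \<Rightarrow> real) \<Rightarrow> 'v set \<Rightarrow> nat" where
  "col 0 \<omega> = (\<lambda>_. 0)"
| "col (Suc n) \<omega> = paint n \<omega> (region n \<omega>) (col n \<omega>)"

lemma reg_verts: "region n \<omega> \<subseteq> V"
  by (induction n) (auto dest: grow_verts)

lemma reg_cover: "region n \<omega> \<subseteq> cover n \<omega>"
proof (induction n)
  case (Suc n) then show ?case using grow_cover by simp
qed simp

lemma reg_mono: "n \<le> m \<Longrightarrow> region n \<omega> \<subseteq> region m \<omega>"
  by (induction m rule: dec_induct) (auto simp: grow_def)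

lemma reg_bounded: "(u, v) \<in> (hop t (region n \<omega>))\<^sup>* \<Longrightarrow> v \<in> B u (M n)"
  using hops_mono[OF order_refl reg_cover] cover_bounded by blast

lemma conn_reg_ball: "conn a (region n \<omega>) u \<subseteq> B u (M n)"
  using conn_mono[OF a_t(1) order_refl] reg_bounded unfolding conn_def by blast

lemma finite_conn_reg: "u \<in> V \<Longrightarrow> finite (conn a (region n \<omega>) u)"
  using finite_subset[OF conn_reg_ball finite_ball] by blast

lemma good_reg: "good (region n \<omega>) (col n \<omega>)"
proof (induction n)
  case (Suc n) then show ?case using good_paint reg_verts by simp
qed (simp add: good_def)

lemma col_stable:
  assumes "u \<in> region n \<omega>" "e \<in> E" "e \<subseteq> nb s (conn a (region n \<omega>) u)" "n \<le> m"
  shows "col m \<omega> e = col n \<omega> e"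
  using assms(4)
proof (induction m rule: dec_induct)
  case (step m)
  have "conn a (region n \<omega>) u \<subseteq> conn a (region m \<omega>) u" using conn_mono reg_mono step by blast
  then have "e \<subseteq> nb s (conn a (region m \<omega>) u)" using assms nb_mono by blast
  moreover have "u \<in> region m \<omega>" using assms reg_mono step by blast
  ultimately show ?case using paint_stable good_reg reg_verts assms step by simp
qed simp

section \<open>Locality and equivariance\<close>

text \<open>The only information on the labels that the first n stages read off in S: their
  order and their position relative to the thresholds. With an automorphism \<gamma> this notion
  expresses equivariance, with \<gamma> = id locality; a single induction over the stages serves
  both.\<close>

definition alike :: "('v \<Rightarrow> 'v) \<Rightarrow> 'v set \<Rightarrow> nat \<Rightarrow> ('v \<Rightarrow> real) \<Rightarrow> ('v \<Rightarrow> real) \<Rightarrow> bool" where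
  "alike \<gamma> S n \<omega> \<omega>' \<longleftrightarrow> (\<forall>v\<in>S. \<forall>w\<in>S. \<omega> v < \<omega> w \<longleftrightarrow> \<omega>' (\<gamma> v) < \<omega>' (\<gamma> w)) \<and>
     (\<forall>m\<le>n. \<forall>v\<in>S. \<omega> v < p m \<longleftrightarrow> \<omega>' (\<gamma> v) < p m)"

lemma alike_inv: "\<gamma> \<in> Aut \<Longrightarrow> S \<subseteq> V \<Longrightarrow> alike \<gamma> S n \<omega> \<omega>' \<Longrightarrow> alike (ainv \<gamma>) (\<gamma> ` S) n \<omega>' \<omega>"
  by (auto simp: alike_def subset_iff)

lemma alike_mono: "alike \<gamma> S n \<omega> \<omega>' \<Longrightarrow> T \<subseteq> S \<Longrightarrow> m \<le> n \<Longrightarrow> alike \<gamma> T m \<omega> \<omega>'"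
  unfolding alike_def using subsetD by fastforce

lemma cen_alike:
  assumes g: "\<gamma> \<in> Aut" and al: "alike \<gamma> S n \<omega> \<omega>'" and c: "c \<in> centres n \<omega>" "B c (8 * r n) \<subseteq> S"
  shows "\<gamma> c \<in> centres n \<omega>'"
proof -
  have cV: "c \<in> V" "\<omega> c < p n" using c by (auto simp: centres_def)
  have "c \<in> S" using c ball_self by blast
  then have "\<omega>' (\<gamma> c) < p n" using al cV by (auto simp: alike_def)
  moreover have "c' = \<gamma> c" if c': "c' \<in> V" "\<omega>' c' < p n" "c' \<in> B (\<gamma> c) (8 * r n)" for c'
  proof -
    let ?b = "ainv \<gamma> c'"
    have b: "?b \<in> V" "\<gamma> ?b = c'" using g c' ainv_V by auto
    then have "?b \<in> B c (8 * r n)" using c' aut_ball_iff[OF g cV(1), of ?b] by simp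
    then have "\<omega> ?b < p n" using al c b c' unfolding alike_def by (metis order_refl subsetD)
    then have "?b = c" using c \<open>?b \<in> B c (8 * r n)\<close> b by (auto simp: centres_def)
    then show ?thesis using b by simp
  qed
  ultimately show ?thesis using cV aut_V[OF g] by (auto simp: centres_def)
qed

lemma hops_image:
  assumes g: "\<gamma> \<in> Aut" and S: "S \<subseteq> V" and U: "\<And>v. v \<in> S \<Longrightarrow> v \<in> U \<Longrightarrow> \<gamma> v \<in> U'"
    and c: "conn l U u \<subseteq> S" and h: "(u, z) \<in> (hop l U)\<^sup>*"
  shows "(\<gamma> u, \<gamma> z) \<in> (hop l U')\<^sup>*"
  using h
proof (induction rule: rtrancl_induct)
  case (step y z)
  then have "(u, z) \<in> (hop l U)\<^sup>*" by simp
  with step have yz: "y \<in> S" "z \<in> S" "y \<in> U" "z \<in> U" "z \<in> B y l"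
    using c by (auto simp: conn_def hop_def)
  then have "(\<gamma> y, \<gamma> z) \<in> hop l U'" using U aut_ball[OF g] S by (auto simp: hop_def)
  then show ?case using step by simp
qed simp

lemma conn_image:
  assumes g: "\<gamma> \<in> Aut" and S: "S \<subseteq> V" and U: "\<And>v. v \<in> S \<Longrightarrow> v \<in> U \<longleftrightarrow> \<gamma> v \<in> U'"
    and w: "w \<in> V" and bd: "conn l U w \<subseteq> B w m" "conn l U' (\<gamma> w) \<subseteq> B (\<gamma> w) m" "B w m \<subseteq> S"
  shows "conn l U' (\<gamma> w) = \<gamma> ` conn l U w"
proof
  show "\<gamma> ` conn l U w \<subseteq> conn l U' (\<gamma> w)"
    using hops_image[OF g S, of U U' l w] U bd by (auto simp: conn_def)
  show "conn l U' (\<gamma> w) \<subseteq> \<gamma> ` conn l U w"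
  proof
    fix z assume z: "z \<in> conn l U' (\<gamma> w)"
    have sub: "conn l U' (\<gamma> w) \<subseteq> \<gamma> ` S" using bd aut_ball_image[OF g w] by blast
    have "(ainv \<gamma> (\<gamma> w), ainv \<gamma> z) \<in> (hop l U)\<^sup>*"
    proof (rule hops_image[OF ainv_aut[OF g] _ _ sub])
      show "\<gamma> ` S \<subseteq> V" using aut_image_V[OF g] S by blast
      fix v assume "v \<in> \<gamma> ` S" "v \<in> U'"
      then show "ainv \<gamma> v \<in> U" using U S g by auto
    qed (use z in \<open>simp add: conn_def\<close>)
    then have "ainv \<gamma> z \<in> conn l U w" using g w by (simp add: conn_def)
    moreover have "z = \<gamma> (ainv \<gamma> z)" using z sub S aut_V[OF g] g by (metis ainv_right imageE subsetD)
    ultimately show "z \<in> \<gamma> ` conn l U w" by blast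
  qed
qed

lemma zone_alike:
  assumes g: "\<gamma> \<in> Aut" and S: "S \<subseteq> V" and al: "alike \<gamma> S n \<omega> \<omega>'"
    and U: "\<And>v. v \<in> S \<Longrightarrow> v \<in> U \<Longrightarrow> \<gamma> v \<in> U'"
    and bd: "\<And>u v. (u, v) \<in> (hop t U)\<^sup>* \<Longrightarrow> v \<in> B u (M n)"
    and z: "z \<in> zone n \<omega> U" "B z (12 * r n) \<subseteq> S"
  shows "\<gamma> z \<in> zone n \<omega>' U'"
proof -
  have rn: "r n \<ge> t + k + M n" by (rule r_ge_M)
  from z consider (1) c where "c \<in> centres n \<omega>" "z \<in> B c (r n)" |
     (2) c b v where "c \<in> centres n \<omega>" "b \<in> B c (r n)" "v \<in> U" "v \<in> B b t" "(v, z) \<in> (hop t U)\<^sup>*"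
    unfolding zone_def by blast
  then show ?thesis
  proof cases
    case 1
    have "B c (8 * r n) \<subseteq> S"
    proof
      fix y assume "y \<in> B c (8 * r n)"
      then have "y \<in> B z (12 * r n)" using ball_trans_le[OF ball_sym[OF 1(2)], of y "8 * r n" "12 * r n"] by simp
      then show "y \<in> S" using z by blast
    qed
    then have "\<gamma> c \<in> centres n \<omega>'" using cen_alike[OF g al 1(1)] by blast
    moreover have "\<gamma> z \<in> B (\<gamma> c) (r n)" using aut_ball[OF g _ 1(2)] 1(1) by (auto simp: centres_def)
    ultimately show ?thesis unfolding zone_def by blast
  next
    case 2
    have vz: "v \<in> B z (M n)" using bd[OF 2(5)] ball_sym by blast
    have bz: "b \<in> B z (M n + t)" using ball_trans[OF vz ball_sym[OF 2(4)]] .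
    have cz: "c \<in> B z (M n + t + r n)" using ball_trans[OF bz ball_sym[OF 2(2)]] .
    have "B c (8 * r n) \<subseteq> S"
    proof
      fix y assume "y \<in> B c (8 * r n)"
      then have "y \<in> B z (12 * r n)" by (rule ball_trans_le[OF cz]) (use rn in simp)
      then show "y \<in> S" using z by blast
    qed
    then have c': "\<gamma> c \<in> centres n \<omega>'" using cen_alike[OF g al 2(1)] by blast
    have cV: "c \<in> V" using 2(1) by (simp add: centres_def)
    then have bV: "b \<in> V" using 2 ball_verts by blast
    have b': "\<gamma> b \<in> B (\<gamma> c) (r n)" using aut_ball[OF g cV 2(2)] .
    have v': "\<gamma> v \<in> B (\<gamma> b) t" using aut_ball[OF g bV 2(4)] .
    have "conn t U v \<subseteq> S"
    proof
      fix y assume "y \<in> conn t U v"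
      then have "y \<in> B v (M n)" using bd by (simp add: conn_def)
      then have "y \<in> B z (12 * r n)" by (rule ball_trans_le[OF vz]) (use rn in simp)
      then show "y \<in> S" using z by blast
    qed
    then have h: "(\<gamma> v, \<gamma> z) \<in> (hop t U')\<^sup>*" using hops_image[OF g S U] 2(5) by blast
    have "v \<in> B z (12 * r n)" by (rule ball_monoD[OF vz]) (use rn in simp)
    then have "\<gamma> v \<in> U'" using U 2(3) z by blast
    then show ?thesis using c' b' v' h unfolding zone_def by blast
  qed
qed

lemma fresh_alike:
  assumes g: "\<gamma> \<in> Aut" and S: "S \<subseteq> V" and al: "alike \<gamma> S n \<omega> \<omega>'"
    and U: "\<And>v. v \<in> S \<Longrightarrow> v \<in> U \<Longrightarrow> \<gamma> v \<in> U'" and UV: "U \<subseteq> V"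
    and bd: "\<And>u v. (u, v) \<in> (hop t U)\<^sup>* \<Longrightarrow> v \<in> B u (M n)"
    and w: "w \<in> fresh n \<omega> U" "B w (13 * r n) \<subseteq> S"
  shows "\<gamma> w \<in> fresh n \<omega>' U'"
proof -
  obtain z where z: "z \<in> zone n \<omega> U" "w \<in> B z k" using w by (auto simp: fresh_def nb_def)
  have "B z (12 * r n) \<subseteq> S"
  proof
    fix y assume "y \<in> B z (12 * r n)"
    then have "y \<in> B w (13 * r n)"
      by (rule ball_trans_le[OF ball_sym[OF z(2)]]) (use r_ge[of n] in simp)
    then show "y \<in> S" using w by blast
  qed
  then have "\<gamma> z \<in> zone n \<omega>' U'"
    by (intro zone_alike[OF g S al _ _ z(1)]) (use U bd in auto)
  moreover have "\<gamma> w \<in> B (\<gamma> z) k" using aut_ball[OF g _ z(2)] zone_verts UV z by blast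
  ultimately show ?thesis by (auto simp: fresh_def nb_def)
qed

lemma extensions_push:
  assumes g: "\<gamma> \<in> Aut" and K: "K \<subseteq> V"
    and U': "U' \<subseteq> V" and U: "\<And>u. u \<in> K \<Longrightarrow> u \<in> U \<longleftrightarrow> \<gamma> u \<in> U'"
    and cn: "\<And>u. u \<in> K \<Longrightarrow> u \<in> U \<Longrightarrow> conn a U' (\<gamma> u) = \<gamma> ` conn a U u"
    and cV: "\<And>u. u \<in> K \<Longrightarrow> u \<in> U \<Longrightarrow> conn a U u \<subseteq> V"
    and \<tau>: "\<And>u e. u \<in> K \<Longrightarrow> u \<in> U \<Longrightarrow> e \<in> E \<Longrightarrow> e \<subseteq> nb s (conn a U u) \<Longrightarrow> \<tau>' (\<gamma> ` e) = \<tau> e"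
    and f: "f \<in> extensions U \<tau> K"
  shows "push \<gamma> f \<in> extensions U' \<tau>' (\<gamma> ` K)"
proof -
  let ?i = "ainv \<gamma>"
  obtain q \<sigma> where q: "q \<in> Ph" "valid \<sigma>" and "\<forall>e\<in>E. e \<subseteq> nb s K \<longrightarrow> f e = \<sigma> e"
      "\<forall>e\<in>E. \<not> e \<subseteq> K \<longrightarrow> \<sigma> e = q e"
      "\<forall>u\<in>U \<inter> K. \<forall>e\<in>E. e \<subseteq> nb s (conn a U u) \<longrightarrow> \<sigma> e = \<tau> e"
    using f unfolding extensions_def by blast
  then have q: "q \<in> Ph" "valid \<sigma>" "\<And>e. e \<in> E \<Longrightarrow> e \<subseteq> nb s K \<Longrightarrow> f e = \<sigma> e"
      "\<And>e. e \<in> E \<Longrightarrow> \<not> e \<subseteq> K \<Longrightarrow> \<sigma> e = q e"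
      "\<And>u e. u \<in> U \<Longrightarrow> u \<in> K \<Longrightarrow> e \<in> E \<Longrightarrow> e \<subseteq> nb s (conn a U u) \<Longrightarrow> \<sigma> e = \<tau> e"
    by (simp_all add: q)
  obtain q' where q': "q' \<in> Ph" "\<And>e. e \<in> E \<Longrightarrow> q' (\<gamma> ` e) = q e" using Ph_aut[OF q(1) g] by blast
  have bck: "?i ` e \<in> E" "\<gamma> ` (?i ` e) = e" if "e \<in> E" for e
    using that aut_edge[OF ainv_aut[OF g]] ainv_image_right[OF g] edge_sub by auto
  have sub: "?i ` e \<subseteq> X" if "e \<in> E" "e \<subseteq> \<gamma> ` X" "X \<subseteq> V" for e X
    using that ainv_image_left[OF g that(3)] by (metis image_mono)
  have "push \<gamma> f e = push \<gamma> \<sigma> e" if e: "e \<in> E" "e \<subseteq> nb s (\<gamma> ` K)" for e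
  proof -
    have "?i ` e \<subseteq> nb s K" using sub e aut_nb_image[OF g K] nb_verts[OF K] by metis
    then show ?thesis using q(3) bck e by (simp add: push_def)
  qed
  moreover have "push \<gamma> \<sigma> e = q' e" if e: "e \<in> E" "\<not> e \<subseteq> \<gamma> ` K" for e
  proof -
    have "\<not> ?i ` e \<subseteq> K" using e bck by (metis image_mono)
    then show ?thesis using q(4) q'(2)[of "?i ` e"] bck e by (simp add: push_def)
  qed
  moreover have "push \<gamma> \<sigma> e = \<tau>' e"
    if u': "u' \<in> U' \<inter> \<gamma> ` K" and e: "e \<in> E" "e \<subseteq> nb s (conn a U' u')" for u' e
  proof -
    obtain u where u: "u \<in> K" "u' = \<gamma> u" using u' by blast
    then have uU: "u \<in> U" using U u' by blast
    have "e \<subseteq> \<gamma> ` nb s (conn a U u)" using e cn u uU aut_nb_image[OF g cV] by simp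
    then have "?i ` e \<subseteq> nb s (conn a U u)" using sub e nb_verts cV u uU by blast
    then show ?thesis using q(5)[OF uU u(1)] \<tau>[OF u(1) uU, of "?i ` e"] bck e by (simp add: push_def)
  qed
  ultimately show ?thesis using q'(1) valid_push[OF g q(2)] unfolding extensions_def by blast
qed

text \<open>Everything that stage n does near T is determined within distance 40 r n of T: the
  centres within 8 r n, the old clusters of diameter M n \<le> r n, the new clusters of diameter
  6 r n, and the choice of colours, which depends only on order.\<close>

lemma step_alike:
  assumes g: "\<gamma> \<in> Aut" and S: "S \<subseteq> V" and al: "alike \<gamma> S n \<omega> \<omega>'"
    and inj: "inj_on \<omega>' V"
    and U: "\<And>v. v \<in> S \<Longrightarrow> v \<in> region n \<omega> \<longleftrightarrow> \<gamma> v \<in> region n \<omega>'"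
    and \<tau>: "\<And>e. e \<in> E \<Longrightarrow> e \<subseteq> S \<Longrightarrow> col n \<omega>' (\<gamma> ` e) = col n \<omega> e"
    and T: "T \<subseteq> V" "nb (40 * r n) T \<subseteq> S"
  shows "v \<in> T \<Longrightarrow> v \<in> region (Suc n) \<omega> \<longleftrightarrow> \<gamma> v \<in> region (Suc n) \<omega>'"
    and "e \<in> E \<Longrightarrow> e \<subseteq> T \<Longrightarrow> col (Suc n) \<omega>' (\<gamma> ` e) = col (Suc n) \<omega> e"
proof -
  let ?i = "ainv \<gamma>"
  let ?U = "region n \<omega>" and ?U' = "region n \<omega>'"
  let ?G = "region (Suc n) \<omega>" and ?G' = "region (Suc n) \<omega>'"
  let ?F = "fresh n \<omega> ?U" and ?F' = "fresh n \<omega>' ?U'"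
  let ?M = "M (Suc n)"
  have ri: "?i \<in> Aut" by (rule ainv_aut[OF g])
  have gS: "\<gamma> ` S \<subseteq> V" using aut_image_V[OF g] S by blast
  have al': "alike ?i (\<gamma> ` S) n \<omega>' \<omega>" by (rule alike_inv[OF g S al])
  have U': "?i v \<in> ?U" if "v \<in> \<gamma> ` S" "v \<in> ?U'" for v using that U S g by auto
  have F: "w \<in> ?F \<longleftrightarrow> \<gamma> w \<in> ?F'" if w: "w \<in> V" "B w (13 * r n) \<subseteq> S" for w
  proof
    assume wF: "w \<in> ?F"
    show "\<gamma> w \<in> ?F'"
      by (rule fresh_alike[OF g S al _ reg_verts reg_bounded wF w(2)]) (use U in auto)
  next
    assume wF: "\<gamma> w \<in> ?F'"
    have "B (\<gamma> w) (13 * r n) \<subseteq> \<gamma> ` S" using w aut_ball_image[OF g w(1), of "13 * r n"] by blast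
    then have "?i (\<gamma> w) \<in> ?F"
      by (intro fresh_alike[OF ri gS al' _ reg_verts reg_bounded wF]) (use U' in auto)
    then show "w \<in> ?F" using g w by simp
  qed
  define S1 where "S1 = {y \<in> V. B y (13 * r n) \<subseteq> S}"
  have S1: "S1 \<subseteq> V" "S1 \<subseteq> S" unfolding S1_def using ball_self by blast+
  have G: "w \<in> ?G \<longleftrightarrow> \<gamma> w \<in> ?G'" if w: "w \<in> S1" for w
    using F[of w] U[of w] w S1 by (auto simp: grow_def S1_def)
  have T1: "y \<in> S1" if "x \<in> T" "y \<in> B x (27 * r n)" for x y
  proof -
    have "B y (13 * r n) \<subseteq> nb (40 * r n) T"
      unfolding nb_def using that ball_trans_le[OF that(2), of _ "13 * r n" "40 * r n"] by auto
    then show ?thesis using T that ball_verts unfolding S1_def by blast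
  qed
  show "v \<in> T \<Longrightarrow> v \<in> ?G \<longleftrightarrow> \<gamma> v \<in> ?G'" using G T1 ball_self by blast
  assume e: "e \<in> E" "e \<subseteq> T"
  obtain y where y: "y \<in> e" using edge_nonempty e by blast
  have yT: "y \<in> T" "y \<in> V" using y e T by auto
  have ee: "\<gamma> ` e \<in> E" using aut_edge g e by blast
  have sr: "s \<le> r n" "M n \<le> r n" using r_ge_M[of n] a_t by auto
  have inS1: "B w ?M \<subseteq> S1" if "w \<in> B y (?M + s)" for w
  proof
    fix z assume "z \<in> B w ?M"
    then have "z \<in> B y (27 * r n)" using ball_trans_le[OF that, of z ?M "27 * r n"] sr by simp
    then show "z \<in> S1" using T1 yT by blast
  qed
  have conn: "conn a ?G' (\<gamma> w) = \<gamma> ` conn a ?G w" if w: "w \<in> V" "w \<in> B y (?M + s)" for w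
    by (rule conn_image[OF g S1(1) G w(1) conn_reg_ball conn_reg_ball inS1[OF w(2)]])
  have near: "w \<in> B y (?M + s)" if "y \<in> nb s (conn a ?G w)" for w
  proof -
    obtain x where x: "x \<in> conn a ?G w" "y \<in> B x s" using \<open>y \<in> nb s _\<close> by (auto simp: nb_def)
    then have "y \<in> B w (?M + s)" using conn_reg_ball[of "Suc n" \<omega> w] ball_trans by blast
    then show ?thesis by (rule ball_sym)
  qed
  have near': "w \<in> B (\<gamma> y) (?M + s)" if "\<gamma> y \<in> nb s (conn a ?G' w)" for w
  proof -
    obtain x where x: "x \<in> conn a ?G' w" "\<gamma> y \<in> B x s" using \<open>\<gamma> y \<in> nb s _\<close> by (auto simp: nb_def)
    then have "\<gamma> y \<in> B w (?M + s)" using conn_reg_ball[of "Suc n" \<omega>' w] ball_trans by blast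
    then show ?thesis by (rule ball_sym)
  qed
  have nbconn: "nb s (conn a ?G' (\<gamma> w)) = \<gamma> ` nb s (conn a ?G w)" if w: "w \<in> V" "w \<in> B y (?M + s)" for w
  proof -
    have "conn a ?G w \<subseteq> V" using conn_reg_ball[of "Suc n" \<omega> w] ball_verts[OF w(1)] by blast
    then show ?thesis using conn[OF w] aut_nb_image[OF g] by (simp del: region.simps)
  qed
  have FV: "?F \<subseteq> V" "?F' \<subseteq> V" using reg_verts[of "Suc n"] by (auto simp: grow_def)
  show "col (Suc n) \<omega>' (\<gamma> ` e) = col (Suc n) \<omega> e"
  proof (cases "\<exists>w\<in>?F. e \<subseteq> nb s (conn a ?G w)")
    case False
    have "\<not> (\<exists>w'\<in>?F'. \<gamma> ` e \<subseteq> nb s (conn a ?G' w'))"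
    proof
      assume "\<exists>w'\<in>?F'. \<gamma> ` e \<subseteq> nb s (conn a ?G' w')"
      then obtain w' where w': "w' \<in> ?F'" "\<gamma> ` e \<subseteq> nb s (conn a ?G' w')" by blast
      define w where "w = ?i w'"
      have wV: "w \<in> V" "w' = \<gamma> w" using w' FV g ainv_V by (auto simp: w_def)
      have "w' \<in> B (\<gamma> y) (?M + s)" using near' w' y by blast
      then have wy: "w \<in> B y (?M + s)" using aut_ball_iff[OF g yT(2) wV(1)] wV by simp
      have "w \<in> ?F" using F[OF wV(1)] inS1[OF wy] ball_self w'(1) wV unfolding S1_def by blast
      moreover have "e \<subseteq> nb s (conn a ?G w)"
      proof -
        have "\<gamma> ` e \<subseteq> \<gamma> ` nb s (conn a ?G w)" using w' wV nbconn[OF wV(1) wy] by simp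
        then have "?i ` \<gamma> ` e \<subseteq> ?i ` \<gamma> ` nb s (conn a ?G w)" by (rule image_mono)
        moreover have "nb s (conn a ?G w) \<subseteq> V"
          by (rule nb_verts) (use conn_reg_ball[of "Suc n" \<omega> w] ball_verts[OF wV(1)] in blast)
        ultimately show ?thesis using ainv_image_left[OF g] edge_sub[OF e(1)] by simp
      qed
      ultimately show False using False by blast
    qed
    then have "home n \<omega> ?U e = {}" "home n \<omega>' ?U' (\<gamma> ` e) = {}"
      using False unfolding home_def by auto
    moreover have "e \<subseteq> S" using e T nb_self by blast
    ultimately show ?thesis using \<tau> e by (simp add: paint_def)
  next
    case True
    then obtain w where w: "w \<in> ?F" "e \<subseteq> nb s (conn a ?G w)" by blast
    have wV: "w \<in> V" using w FV by blast
    have wy: "w \<in> B y (?M + s)" using near w y by blast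
    have wF': "\<gamma> w \<in> ?F'" using F[OF wV] inS1[OF wy] ball_self w(1) unfolding S1_def by blast
    let ?K = "conn a ?G w"
    have KB: "?K \<subseteq> B w ?M" by (rule conn_reg_ball)
    then have KV: "?K \<subseteq> V" using ball_verts wV by blast
    have K': "conn a ?G' (\<gamma> w) = \<gamma> ` ?K" "nb s (conn a ?G' (\<gamma> w)) = \<gamma> ` nb s ?K"
      using conn[OF wV wy] nbconn[OF wV wy] by auto
    have h: "home n \<omega> ?U e = ?K" using home_fresh[OF w(1) e(1)] w(2) by simp
    have h': "home n \<omega>' ?U' (\<gamma> ` e) = \<gamma> ` ?K"
      using home_fresh[OF wF' ee] K' w(2) by (simp add: image_mono)
    have KS1: "?K \<subseteq> S1" using KB inS1[OF wy] by blast
    have nbK: "nb s ?K \<subseteq> S"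
    proof
      fix z assume "z \<in> nb s ?K"
      then obtain x where "x \<in> ?K" "z \<in> B x s" by (auto simp: nb_def)
      then show "z \<in> S" using KS1 ball_monoD[of z x s "13 * r n"] sr unfolding S1_def by auto
    qed
    have oldconn: "conn a ?U' (\<gamma> u) = \<gamma> ` conn a ?U u" if u: "u \<in> ?K" for u
    proof (rule conn_image[OF g S U _ conn_reg_ball conn_reg_ball])
      show "u \<in> V" using u KV by blast
      show "B u (M n) \<subseteq> S"
      proof
        fix z assume "z \<in> B u (M n)"
        then have "z \<in> B u (13 * r n)" by (rule ball_monoD) (use sr in simp)
        then show "z \<in> S" using KS1 u unfolding S1_def by blast
      qed
    qed
    have sub: "conn a ?U u \<subseteq> ?K" if u: "u \<in> ?K" "u \<in> ?U" for u
      using conn_mono[of a a ?U ?G u] conn_eq[OF u(1)] by (auto simp: grow_def)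
    have fwd: "push \<gamma> f \<in> extensions ?U' (col n \<omega>') (\<gamma> ` ?K)" if "f \<in> extensions ?U (col n \<omega>) ?K" for f
    proof (rule extensions_push[OF g KV reg_verts _ _ _ _ that])
      show "u \<in> ?U \<longleftrightarrow> \<gamma> u \<in> ?U'" if "u \<in> ?K" for u using U KS1 S1 that by blast
      show "conn a ?U' (\<gamma> u) = \<gamma> ` conn a ?U u" if "u \<in> ?K" for u by (rule oldconn[OF that])
      show "conn a ?U u \<subseteq> V" if "u \<in> ?K" "u \<in> ?U" for u using sub[OF that] KV by blast
      show "col n \<omega>' (\<gamma> ` e) = col n \<omega> e"
        if "u \<in> ?K" "u \<in> ?U" "e \<in> E" "e \<subseteq> nb s (conn a ?U u)" for u e
        using \<tau>[OF that(3)] that sub nb_mono[OF sub[OF that(1,2)], of s s] nbK by blast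
    qed
    have gK: "\<gamma> ` ?K \<subseteq> V" using aut_image_V[OF g] KV by blast
    have iK: "?i ` \<gamma> ` ?K = ?K" by (rule ainv_image_left[OF g KV])
    have bwd: "push ?i f \<in> extensions ?U (col n \<omega>) ?K" if "f \<in> extensions ?U' (col n \<omega>') (\<gamma> ` ?K)" for f
    proof -
      have "push ?i f \<in> extensions ?U (col n \<omega>) (?i ` \<gamma> ` ?K)"
      proof (rule extensions_push[OF ri gK reg_verts _ _ _ _ that])
        fix u' assume "u' \<in> \<gamma> ` ?K"
        then obtain u where u: "u \<in> ?K" "u' = \<gamma> u" by blast
        then have uV: "u \<in> V" and iu: "?i u' = u" using KV g by auto
        have "u \<in> S" using KS1 S1 u by blast
        then show uU: "u' \<in> ?U' \<longleftrightarrow> ?i u' \<in> ?U" using U[of u] u iu by simp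
        assume "u' \<in> ?U'"
        then have uU: "u \<in> ?U" using uU iu by simp
        have cV: "conn a ?U u \<subseteq> V" using sub[OF u(1) uU] KV by blast
        show "conn a ?U (?i u') = ?i ` conn a ?U' u'"
          using oldconn[OF u(1)] u iu ainv_image_left[OF g cV] by simp
        show "conn a ?U' u' \<subseteq> V" using conn_sub[OF \<open>u' \<in> ?U'\<close>] reg_verts by blast
        fix e' assume e': "e' \<in> E" "e' \<subseteq> nb s (conn a ?U' u')"
        have nV: "nb s (conn a ?U u) \<subseteq> V" by (rule nb_verts[OF cV])
        have "e' \<subseteq> \<gamma> ` nb s (conn a ?U u)" using e'(2) oldconn[OF u(1)] u aut_nb_image[OF g cV] by simp
        then have sub1: "?i ` e' \<subseteq> nb s (conn a ?U u)" using ainv_image_left[OF g nV] by (metis image_mono)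
        have "?i ` e' \<in> E" "\<gamma> ` (?i ` e') = e'"
          using aut_edge[OF ri e'(1)] ainv_image_right[OF g edge_sub[OF e'(1)]] by auto
        moreover have "?i ` e' \<subseteq> S" using sub1 nb_mono[OF sub[OF u(1) uU], of s s] nbK by blast
        ultimately show "col n \<omega> (?i ` e') = col n \<omega>' e'" using \<tau>[of "?i ` e'"] by simp
      qed
      then show ?thesis using iK by simp
    qed
    have nV: "nb s ?K \<subseteq> V" by (rule nb_verts[OF KV])
    have "pick \<omega>' (\<gamma> ` nb s ?K) (extensions ?U' (col n \<omega>') (\<gamma> ` ?K)) (\<gamma> ` e) = pick \<omega> (nb s ?K) (extensions ?U (col n \<omega>) ?K) e"
    proof (rule pick_match[OF g nV _ _ _ _ fwd bwd e(1) w(2)])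
      show "finite (nb s ?K)" using finite_nb[OF KV finite_conn_reg[OF wV]] .
      have "\<gamma> ` nb s ?K \<subseteq> V" using aut_image_V[OF g] nV by blast
      then show "inj_on \<omega>' (\<gamma> ` nb s ?K)" by (rule inj_on_subset[OF inj])
      show "\<omega> v < \<omega> w \<longleftrightarrow> \<omega>' (\<gamma> v) < \<omega>' (\<gamma> w)" if "v \<in> nb s ?K" "w \<in> nb s ?K" for v w
        using al that nbK unfolding alike_def by blast
      show "extensions ?U (col n \<omega>) ?K \<noteq> {}" using extensions_nonempty[OF reg_verts good_reg w(1)] by simp
    qed
    moreover have "nb s (\<gamma> ` ?K) = \<gamma> ` nb s ?K" using aut_nb_image[OF g KV] by simp
    moreover have "?K \<noteq> {}" using conn_self by blast
    ultimately show ?thesis using h h' by (simp add: paint_def Let_def)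
  qed
qed

definition reach :: "nat \<Rightarrow> nat" where "reach n = (\<Sum>j<n. 40 * r j)"

lemma reg_col_alike:
  assumes g: "\<gamma> \<in> Aut" and inj: "inj_on \<omega>' V"
  shows "T \<subseteq> V \<Longrightarrow> alike \<gamma> (nb (reach n) T) n \<omega> \<omega>' \<Longrightarrow>
    (\<forall>v\<in>T. v \<in> region n \<omega> \<longleftrightarrow> \<gamma> v \<in> region n \<omega>') \<and>
    (\<forall>e\<in>E. e \<subseteq> T \<longrightarrow> col n \<omega>' (\<gamma> ` e) = col n \<omega> e)"
proof (induction n arbitrary: T)
  case (Suc n)
  let ?S = "nb (40 * r n) T"
  have S: "?S \<subseteq> V" using Suc.prems nb_verts by blast
  have "nb (reach n) ?S \<subseteq> nb (reach (Suc n)) T" using nb_nb[of "reach n" "40 * r n" T] by (simp add: reach_def add.commute)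
  then have "alike \<gamma> (nb (reach n) ?S) n \<omega> \<omega>'" by (rule alike_mono[OF Suc.prems(2)]) simp
  from Suc.IH[OF S this] have IH: "\<And>v. v \<in> ?S \<Longrightarrow> v \<in> region n \<omega> \<longleftrightarrow> \<gamma> v \<in> region n \<omega>'"
    "\<And>e. e \<in> E \<Longrightarrow> e \<subseteq> ?S \<Longrightarrow> col n \<omega>' (\<gamma> ` e) = col n \<omega> e" by auto
  have "?S \<subseteq> nb (reach (Suc n)) T" by (rule nb_mono) (auto simp: reach_def)
  then have "alike \<gamma> ?S n \<omega> \<omega>'" by (rule alike_mono[OF Suc.prems(2)]) simp
  from step_alike[OF g S this inj IH Suc.prems(1) order_refl] show ?case by blast
qed simp

end

section \<open>Balanced orientations of a two-factor\<close>

text \<open>The composition \<pi> of the two involutions moves along their alternating cycles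
  and infinite paths, and \<theta> reverses the direction. A \<pi>-orbit never contains both x
  and \<theta> x: otherwise some power of \<pi> would equal \<theta> at a point, and halving the
  exponent yields a fixed point of \<theta> or of \<iota>. So orbits come in pairs exchanged by
  \<theta>, and one orbit is selected from each pair. Since \<iota> = \<pi> \<theta>, the
  selection is alternating for \<iota> as well.\<close>

lemma common_transversal:
  fixes X :: "'a set" and \<theta> \<iota> :: "'a \<Rightarrow> 'a"
  assumes \<theta>: "\<And>x. x \<in> X \<Longrightarrow> \<theta> x \<in> X \<and> \<theta> (\<theta> x) = x \<and> \<theta> x \<noteq> x"
    and \<iota>: "\<And>x. x \<in> X \<Longrightarrow> \<iota> x \<in> X \<and> \<iota> (\<iota> x) = x \<and> \<iota> x \<noteq> x"
  shows "\<exists>P. \<forall>x\<in>X. (\<theta> x \<in> P \<longleftrightarrow> x \<notin> P) \<and> (\<iota> x \<in> P \<longleftrightarrow> x \<notin> P)"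
proof -
  define \<pi> where "\<pi> x = \<iota> (\<theta> x)" for x
  have \<pi>X: "\<pi> x \<in> X" if "x \<in> X" for x using that \<theta> \<iota> by (simp add: \<pi>_def)
  have pX: "(\<pi> ^^ n) x \<in> X" if "x \<in> X" for x n by (induction n) (use that \<pi>X in auto)
  have \<pi>inj: "x = y" if "x \<in> X" "y \<in> X" "\<pi> x = \<pi> y" for x y
    using that \<theta> \<iota> unfolding \<pi>_def by metis
  have pinj: "x = y" if "x \<in> X" "y \<in> X" "(\<pi> ^^ n) x = (\<pi> ^^ n) y" for x y n
    using that(3) by (induction n) (use that \<pi>inj pX in auto)
  have flip1: "\<pi> (\<theta> (\<pi> x)) = \<theta> x" if "x \<in> X" for x using that \<theta> \<iota> by (simp add: \<pi>_def)
  have flip: "(\<pi> ^^ n) (\<theta> ((\<pi> ^^ n) x)) = \<theta> x" if "x \<in> X" for x n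
  proof (induction n)
    case (Suc n)
    have "(\<pi> ^^ Suc n) (\<theta> ((\<pi> ^^ Suc n) x)) = (\<pi> ^^ n) (\<pi> (\<theta> (\<pi> ((\<pi> ^^ n) x))))"
      by (simp add: funpow_swap1)
    then show ?case using flip1[OF pX[OF that]] Suc by simp
  qed simp
  define eqv where "eqv x y \<longleftrightarrow> (\<exists>m n. (\<pi> ^^ m) x = (\<pi> ^^ n) y)" for x y
  have padd: "(\<pi> ^^ m) ((\<pi> ^^ n) x) = (\<pi> ^^ (m + n)) x" for m n x by (simp add: funpow_add)
  have sym: "eqv x y \<Longrightarrow> eqv y x" for x y unfolding eqv_def by metis
  have trans: "eqv x z" if xy: "eqv x y" and yz: "eqv y z" for x y z
  proof -
    obtain m n where "(\<pi> ^^ m) x = (\<pi> ^^ n) y" using xy unfolding eqv_def by auto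
    moreover obtain m' n' where "(\<pi> ^^ m') y = (\<pi> ^^ n') z" using yz unfolding eqv_def by auto
    ultimately
    have "(\<pi> ^^ (m' + m)) x = (\<pi> ^^ m') ((\<pi> ^^ n) y)"
      "(\<pi> ^^ (n + n')) z = (\<pi> ^^ n) ((\<pi> ^^ m') y)" by (simp_all flip: padd)
    then have "(\<pi> ^^ (m' + m)) x = (\<pi> ^^ (n + n')) z"
      by (simp only: padd add.commute[of m' n])
    then show ?thesis unfolding eqv_def by blast
  qed
  have refl: "eqv x x" for x unfolding eqv_def by blast
  have step: "eqv x (\<pi> x)" for x unfolding eqv_def by (rule exI[of _ 1], rule exI[of _ 0]) simp
  have \<theta>eqv: "eqv (\<theta> x) (\<theta> y)" if xy: "eqv x y" and that: "x \<in> X" "y \<in> X" for x y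
  proof -
    obtain m n where mn: "(\<pi> ^^ m) x = (\<pi> ^^ n) y" using xy unfolding eqv_def by auto
    have "(\<pi> ^^ n) (\<theta> x) = (\<pi> ^^ n) ((\<pi> ^^ m) (\<theta> ((\<pi> ^^ m) x)))" using flip that by simp
    also have "\<dots> = (\<pi> ^^ m) ((\<pi> ^^ n) (\<theta> ((\<pi> ^^ n) y)))"
      by (simp only: mn padd add.commute[of n m])
    also have "\<dots> = (\<pi> ^^ m) (\<theta> y)" using flip that by simp
    finally show ?thesis unfolding eqv_def by blast
  qed
  have noflip: "\<not> eqv x (\<theta> x)" if x: "x \<in> X" for x
  proof
    assume "eqv x (\<theta> x)"
    then obtain m n where mn: "(\<pi> ^^ m) x = (\<pi> ^^ n) (\<theta> x)" unfolding eqv_def by blast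
    define z where "z = (\<pi> ^^ m) x"
    have z: "z \<in> X" "\<theta> z \<in> X" using x pX \<theta> by (auto simp: z_def)
    have "(\<pi> ^^ (n + m)) (\<theta> z) = (\<pi> ^^ n) (\<theta> x)" using flip[OF x, of m] by (simp add: z_def flip: padd)
    then have zz: "(\<pi> ^^ (n + m)) (\<theta> z) = z" using mn by (simp add: z_def)
    show False
    proof (cases "even (n + m)")
      case True
      then obtain j where j: "n + m = j + j" by (metis evenE mult_2)
      define w where "w = (\<pi> ^^ j) (\<theta> z)"
      have w: "w \<in> X" using z pX by (simp add: w_def)
      have "(\<pi> ^^ j) (\<theta> w) = z" using flip[OF z(2), of j] \<theta> z by (simp add: w_def)
      moreover have "(\<pi> ^^ j) w = z" using zz j by (simp add: w_def padd)
      ultimately show False using pinj[of "\<theta> w" w j] w \<theta> by auto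
    next
      case False
      then obtain j where j: "n + m = Suc (j + j)" by (metis oddE mult_2 Suc_eq_plus1)
      define w where "w = (\<pi> ^^ j) (\<theta> z)"
      have w: "w \<in> X" "\<theta> w \<in> X" using z pX \<theta> by (auto simp: w_def)
      have "(\<pi> ^^ j) (\<theta> w) = z" using flip[OF z(2), of j] \<theta> z by (simp add: w_def)
      moreover have "(\<pi> ^^ j) (\<pi> w) = (\<pi> ^^ Suc j) w" by (simp add: funpow_swap1)
      then have "(\<pi> ^^ j) (\<pi> w) = z" using zz j by (simp add: w_def padd)
      ultimately have "\<theta> w = \<pi> w" using pinj[of "\<theta> w" "\<pi> w" j] w \<pi>X by auto
      then show False using \<iota>[OF w(2)] by (simp add: \<pi>_def)
    qed
  qed
  define cl where "cl x = {y \<in> X. eqv x y}" for x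
  have cl: "cl x = cl y \<longleftrightarrow> eqv x y" if "x \<in> X" "y \<in> X" for x y
    using that refl sym trans unfolding cl_def by blast
  define P where "P = {x \<in> X. cl x = (SOME C. C \<in> {cl x, cl (\<theta> x)})}"
  have P\<theta>: "\<theta> x \<in> P \<longleftrightarrow> x \<notin> P" if x: "x \<in> X" for x
  proof -
    define C0 where "C0 = (SOME C. C \<in> {cl x, cl (\<theta> x)})"
    have "C0 \<in> {cl x, cl (\<theta> x)}" unfolding C0_def by (rule someI[of _ "cl x"]) simp
    moreover have "cl x \<noteq> cl (\<theta> x)" using cl noflip \<theta> x by blast
    moreover have "x \<in> P \<longleftrightarrow> cl x = C0" using x by (simp add: P_def C0_def)
    moreover have "{cl (\<theta> x), cl (\<theta> (\<theta> x))} = {cl x, cl (\<theta> x)}" using \<theta>[OF x] by auto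
    then have "\<theta> x \<in> P \<longleftrightarrow> cl (\<theta> x) = C0" using \<theta>[OF x] unfolding P_def C0_def mem_Collect_eq by simp
    ultimately show ?thesis by blast
  qed
  have Peqv: "y \<in> P" if "x \<in> P" "y \<in> X" "eqv x y" for x y
  proof -
    have x: "x \<in> X" using that by (simp add: P_def)
    have "cl x = cl y" "cl (\<theta> x) = cl (\<theta> y)" using that x cl \<theta>eqv \<theta> by auto
    then show ?thesis using that by (simp add: P_def)
  qed
  have "\<iota> x \<in> P \<longleftrightarrow> \<theta> x \<in> P" if x: "x \<in> X" for x
  proof -
    have "\<iota> x = \<pi> (\<theta> x)" using \<theta>[OF x] by (simp add: \<pi>_def)
    then have "eqv (\<theta> x) (\<iota> x)" using step by simp
    then show ?thesis using Peqv sym \<theta>[OF x] \<iota>[OF x] by blast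
  qed
  then show ?thesis using P\<theta> by blast
qed

context coloured_graph
begin

text \<open>Every 2-regular colour class can be oriented consistently. A flag is a vertex with
  an incident edge of colour i; one involution moves a flag to the other end of its edge, the
  other one to the other edge at its vertex. A set of flags that alternates under both says at
  which flags the edge points to the vertex.\<close>

lemma balanced_orientation:
  assumes c: "valid c" and i: "i < d"
  shows "\<exists>h. (\<forall>e\<in>E. c e = i \<longrightarrow> h e \<in> e) \<and>
    (\<forall>v\<in>V. (\<exists>!e. e \<in> E \<and> v \<in> e \<and> c e = i \<and> h e = v) \<and> (\<exists>!e. e \<in> E \<and> v \<in> e \<and> c e = i \<and> h e \<noteq> v))"
proof -
  define other where "other v e = (THE x. x \<in> e \<and> x \<noteq> v)" for v and e :: "'v set"
  define turn where "turn v e = (THE e'. e' \<in> E \<and> v \<in> e' \<and> c e' = i \<and> e' \<noteq> e)" for v e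
  have other: "other v e \<in> e \<and> other v e \<noteq> v \<and> other (other v e) e = v \<and> e = {v, other v e}"
    if e: "e \<in> E" "v \<in> e" for v e
  proof -
    obtain x where x: "e = {v, x}" "v \<noteq> x" using edge_pair[OF e(1)] e(2) by auto
    have 1: "other v e = x" unfolding other_def using x by (intro the_equality) auto
    have 2: "other x e = v" unfolding other_def using x by (intro the_equality) auto
    show ?thesis using 1 2 x by auto
  qed
  have turn: "turn v e \<in> E \<and> v \<in> turn v e \<and> c (turn v e) = i \<and> turn v e \<noteq> e \<and> turn v (turn v e) = e \<and>
      {e \<in> E. v \<in> e \<and> c e = i} = {e, turn v e}"
    if e: "e \<in> E" "v \<in> e" "c e = i" for v e
  proof -
    have "v \<in> V" using e edge_sub by blast
    then have "card {e \<in> E. v \<in> e \<and> c e = i} = 2" using c i by (simp add: valid_def)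
    then obtain x y where "{e \<in> E. v \<in> e \<and> c e = i} = {x, y}" "x \<noteq> y" by (meson card_2_iff)
    then have mem': "z \<in> E \<and> v \<in> z \<and> c z = i \<longleftrightarrow> z = x \<or> z = y" for z by blast
    have "e = x \<or> e = y" using mem' e by blast
    then obtain e' where mem: "\<And>z. z \<in> E \<and> v \<in> z \<and> c z = i \<longleftrightarrow> z = e \<or> z = e'" and e': "e' \<noteq> e"
      using mem' \<open>x \<noteq> y\<close> that by metis
    have 1: "turn v e = e'" unfolding turn_def using mem e' by (intro the_equality) auto
    have 2: "turn v e' = e" unfolding turn_def using mem e' by (intro the_equality) auto
    have "{e \<in> E. v \<in> e \<and> c e = i} = {e, e'}" using mem by blast
    then show ?thesis using 1 2 e' mem[of e'] by simp
  qed
  let ?X = "{(v, e). e \<in> E \<and> v \<in> e \<and> c e = i}"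
  obtain P where P: "\<forall>x\<in>?X. ((case x of (v, e) \<Rightarrow> (other v e, e)) \<in> P \<longleftrightarrow> x \<notin> P) \<and>
      ((case x of (v, e) \<Rightarrow> (v, turn v e)) \<in> P \<longleftrightarrow> x \<notin> P)"
    using common_transversal[of ?X "\<lambda>(v, e). (other v e, e)" "\<lambda>(v, e). (v, turn v e)"] other turn by auto
  then have P1: "(other v e, e) \<in> P \<longleftrightarrow> (v, e) \<notin> P" "(v, turn v e) \<in> P \<longleftrightarrow> (v, e) \<notin> P"
    if "e \<in> E" "v \<in> e" "c e = i" for v e using that by auto
  define h where "h e = (THE x. x \<in> e \<and> (x, e) \<in> P)" for e
  have h: "h e = v \<longleftrightarrow> (v, e) \<in> P" "h e \<in> e" if e: "e \<in> E" "v \<in> e" "c e = i" for v e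
  proof -
    note o = other[OF e(1,2)]
    have iff: "(other v e, e) \<in> P \<longleftrightarrow> (v, e) \<notin> P" using P1 e by blast
    have mem: "x \<in> e \<longleftrightarrow> x = v \<or> x = other v e" for x using o by blast
    have "\<exists>!x. x \<in> e \<and> (x, e) \<in> P" using mem iff o by metis
    then have "h e \<in> e \<and> (h e, e) \<in> P" unfolding h_def by (rule theI')
    then show "h e \<in> e" "h e = v \<longleftrightarrow> (v, e) \<in> P" using iff mem by metis+
  qed
  have "(\<exists>!e. e \<in> E \<and> v \<in> e \<and> c e = i \<and> h e = v) \<and> (\<exists>!e. e \<in> E \<and> v \<in> e \<and> c e = i \<and> h e \<noteq> v)" if v: "v \<in> V" for v
  proof -
    have "card {e \<in> E. v \<in> e \<and> c e = i} = 2" using c i v by (simp add: valid_def)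
    then obtain x where x: "x \<in> E" "v \<in> x" "c x = i" by (metis (mono_tags, lifting) card.empty empty_Collect_eq zero_neq_numeral)
    let ?y = "turn v x"
    note tx = turn[OF x]
    have mem: "z \<in> E \<and> v \<in> z \<and> c z = i \<longleftrightarrow> z = x \<or> z = ?y" for z using tx by blast
    have "(v, ?y) \<in> P \<longleftrightarrow> (v, x) \<notin> P" using P1 x by blast
    then have hy: "h ?y = v \<longleftrightarrow> h x \<noteq> v" using h(1)[OF x] h(1)[of ?y v] tx by blast
    have xy: "?y \<noteq> x" using tx by blast
    have "(e \<in> E \<and> v \<in> e \<and> c e = i \<and> Q (h e)) = ((e = x \<or> e = ?y) \<and> Q (h e))" for e and Q :: "'v \<Rightarrow> bool"
      using mem[of e] by blast
    note eqs = this[of _ "\<lambda>u. u = v"] this[of _ "\<lambda>u. u \<noteq> v"]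
    show ?thesis unfolding eqs using hy xy by (cases "h x = v") auto
  qed
  moreover have "h e \<in> e" if "e \<in> E" "c e = i" for e
    using h(2)[OF that(1) _ that(2)] edge_pair[OF that(1)] by auto
  ultimately show ?thesis by (intro exI[of _ h]) simp
qed

end

context phased_graph
begin

section \<open>The limit colouring\<close>

text \<open>The event of probability one on which the construction succeeds. It is invariant
  under automorphisms and so serves as the domain of the factor.\<close>

definition settled :: "('v \<Rightarrow> real) \<Rightarrow> bool" where
  "settled \<omega> \<longleftrightarrow> inj_on \<omega> V \<and> (\<forall>v\<in>V. \<exists>n. v \<in> region n \<omega>)"

text \<open>The colour that e receives at the first stage at which it is touched; if e is never
  touched, the value of LEAST is arbitrary, but this does not happen for settled labels.\<close>

definition final :: "('v \<Rightarrow> real) \<Rightarrow> 'v set \<Rightarrow> nat" where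
  "final \<omega> e = col (LEAST n. e \<inter> region n \<omega> \<noteq> {}) \<omega> e"

lemma edge_nb_conn: "u \<in> e \<Longrightarrow> e \<in> E \<Longrightarrow> e \<subseteq> nb s (conn l U u)"
  using nb_edge[of e u 0 "conn l U u" s] nb_self[of "conn l U u" 0] conn_self by (auto simp: s_def)

lemma final_eq:
  assumes "settled \<omega>" and u: "u \<in> region n \<omega>" and e: "e \<in> E" "e \<subseteq> nb s (conn a (region n \<omega>) u)"
  shows "final \<omega> e = col n \<omega> e"
proof -
  obtain y where y: "y \<in> e" "y \<in> V" using edge_nonempty e edge_sub by blast
  then obtain m0 where "y \<in> region m0 \<omega>" using assms(1) by (auto simp: settled_def)
  then have ex: "e \<inter> region m0 \<omega> \<noteq> {}" using y by blast
  define m where "m = (LEAST n. e \<inter> region n \<omega> \<noteq> {})"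
  have "e \<inter> region m \<omega> \<noteq> {}" unfolding m_def using ex by (rule LeastI)
  then obtain x where x: "x \<in> e" "x \<in> region m \<omega>" by blast
  have "col m \<omega> e = col n \<omega> e"
  proof (cases "n \<le> m")
    case True then show ?thesis using col_stable[OF u e] by blast
  next
    case False
    then show ?thesis using col_stable[OF x(2) e(1) edge_nb_conn[OF x(1) e(1)], of n] by simp
  qed
  then show ?thesis by (simp add: final_def m_def)
qed

lemma final_at: "settled \<omega> \<Longrightarrow> u \<in> region n \<omega> \<Longrightarrow> e \<in> E \<Longrightarrow> u \<in> e \<Longrightarrow> final \<omega> e = col n \<omega> e"
  using final_eq edge_nb_conn by blast

text \<open>By stability, the invariant of a stage passes to the limit: near each cluster the
  limit is a valid colouring that is a phase outside the cluster. Validity and the finiteness of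
  the monochromatic paths both follow from this.\<close>

lemma final_patch:
  assumes A: "settled \<omega>" and u: "u \<in> region n \<omega>"
  defines "K \<equiv> conn a (region n \<omega>) u"
  obtains q \<sigma> where "q \<in> Ph" "valid \<sigma>" "\<And>e. e \<in> E \<Longrightarrow> e \<subseteq> nb s K \<Longrightarrow> final \<omega> e = \<sigma> e"
    "\<And>e. e \<in> E \<Longrightarrow> \<not> e \<subseteq> K \<Longrightarrow> \<sigma> e = q e"
proof -
  obtain q \<sigma> where q: "q \<in> Ph" "valid \<sigma>" "\<forall>e\<in>E. e \<subseteq> nb s K \<longrightarrow> col n \<omega> e = \<sigma> e"
     "\<forall>e\<in>E. \<not> e \<subseteq> K \<longrightarrow> \<sigma> e = q e"
    using good_reg[of n \<omega>] u unfolding good_def extensions_def K_def by blast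
  show ?thesis
    by (rule that[of q \<sigma>]) (use q final_eq[OF A u] in \<open>simp_all add: K_def\<close>)
qed

lemma final_valid: assumes A: "settled \<omega>" shows "valid (final \<omega>)"
proof (rule valid_local)
  fix v assume "v \<in> V"
  then obtain n where n: "v \<in> region n \<omega>" using A by (auto simp: settled_def)
  obtain q \<sigma> where "valid \<sigma>" "\<And>e. e \<in> E \<Longrightarrow> e \<subseteq> nb s (conn a (region n \<omega>) v) \<Longrightarrow> final \<omega> e = \<sigma> e"
    using final_patch[OF A n] by metis
  then show "\<exists>\<sigma>. valid \<sigma> \<and> (\<forall>e\<in>E. v \<in> e \<longrightarrow> final \<omega> e = \<sigma> e)" using edge_nb_conn by blast
qed

text \<open>A monochromatic path that starts in a cluster cannot escape from its collar. Once it
  is at distance D + 1 from the cluster it follows a monochromatic path of a single phase, which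
  stays within distance D of its starting point. So from there on it neither returns to the
  cluster nor leaves the collar, whose width is 2 D + 2.\<close>

lemma mono_confined:
  assumes A: "settled \<omega>" and u: "v \<in> region n \<omega>" and vy: "(v, y) \<in> (mono_step (final \<omega>) i)\<^sup>*"
  shows "y \<in> nb s (conn a (region n \<omega>) v)"
proof -
  let ?K = "conn a (region n \<omega>) v"
  obtain q \<sigma> where q: "q \<in> Ph" and f: "\<And>e. e \<in> E \<Longrightarrow> e \<subseteq> nb s ?K \<Longrightarrow> final \<omega> e = \<sigma> e"
    and \<sigma>: "\<And>e. e \<in> E \<Longrightarrow> \<not> e \<subseteq> ?K \<Longrightarrow> \<sigma> e = q e"
    using final_patch[OF A u] by metis
  have KV: "?K \<subseteq> V" using conn_sub[OF u] reg_verts by blast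
  have qcol: "q {x, z} = i" if "(x, z) \<in> mono_step (final \<omega>) i" "x \<notin> ?K" "x \<in> nb (2 * D + 1) ?K" for x z
  proof -
    have e: "{x, z} \<in> E" "final \<omega> {x, z} = i" using that by (auto simp: mono_step_def)
    have "{x, z} \<subseteq> nb s ?K" using nb_edge[OF e(1) _ that(3), of s] by (simp add: s_def)
    then show ?thesis using f[OF e(1)] \<sigma>[OF e(1)] that e by auto
  qed
  have "y \<in> nb (D + 1) ?K \<or> (\<exists>w\<in>nb (D + 1) ?K - nb D ?K. (w, y) \<in> (mono_step q i)\<^sup>*)"
    using vy
  proof (induction rule: rtrancl_induct)
    case base
    then show ?case using conn_self nb_self by blast
  next
    case (step x z)
    have xz: "{x, z} \<in> E" using step by (simp add: mono_step_def)
    have x1: "w = x \<or> x \<in> B w D" if "w \<in> nb (D + 1) ?K" "(w, x) \<in> (mono_step q i)\<^sup>*" for w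
      using Ph_short[OF q _ that(2)] that nb_verts[OF KV] by blast
    show ?case
    proof (cases "x \<in> nb D ?K")
      case True
      then show ?thesis using nb_edge[OF xz _ True, of "D + 1"] by simp
    next
      case False
      have xK: "x \<notin> ?K" using False nb_self by blast
      from step.IH show ?thesis
      proof
        assume x: "x \<in> nb (D + 1) ?K"
        have "q {x, z} = i" using qcol[OF step(2) xK] x nb_mono[of ?K ?K "D + 1" "2 * D + 1"] by auto
        then have "(x, z) \<in> (mono_step q i)\<^sup>*" using xz by (auto simp: mono_step_def)
        then show ?thesis using x False by blast
      next
        assume "\<exists>w\<in>nb (D + 1) ?K - nb D ?K. (w, x) \<in> (mono_step q i)\<^sup>*"
        then obtain w where w: "w \<in> nb (D + 1) ?K" "w \<notin> nb D ?K" "(w, x) \<in> (mono_step q i)\<^sup>*" by blast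
        have "x \<in> B w D" using x1[OF w(1,3)] by auto
        then have "x \<in> nb D (nb (D + 1) ?K)" using w unfolding nb_def by blast
        then have "x \<in> nb (2 * D + 1) ?K" using nb_nb[of D "D + 1" ?K] by (auto simp: mult_2)
        then have "q {x, z} = i" using qcol[OF step(2) xK] by simp
        then have "(w, z) \<in> (mono_step q i)\<^sup>*" using xz w(3) by (auto simp: mono_step_def intro: rtrancl_into_rtrancl)
        then show ?thesis using w by blast
      qed
    qed
  qed
  then show ?thesis
  proof
    assume "y \<in> nb (D + 1) ?K" then show ?thesis using nb_mono[of ?K ?K "D + 1" s] by (auto simp: s_def)
  next
    assume "\<exists>w\<in>nb (D + 1) ?K - nb D ?K. (w, y) \<in> (mono_step q i)\<^sup>*"
    then obtain w where w: "w \<in> nb (D + 1) ?K" "(w, y) \<in> (mono_step q i)\<^sup>*" by blast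
    then have "y \<in> B w D" using Ph_short[OF q] nb_verts[OF KV] by blast
    then have "y \<in> nb D (nb (D + 1) ?K)" using w unfolding nb_def by blast
    then have "y \<in> nb (2 * D + 1) ?K" using nb_nb[of D "D + 1" ?K] by (auto simp: mult_2)
    then show ?thesis using nb_mono[of ?K ?K "2 * D + 1" s] by (auto simp: s_def)
  qed
qed

section \<open>Orienting the monochromatic cycles\<close>

definition cycle_of :: "('v set \<Rightarrow> nat) \<Rightarrow> 'v set \<Rightarrow> 'v set" where
  "cycle_of c e = {y. \<exists>x\<in>e. (x, y) \<in> (mono_step c (c e))\<^sup>*}"

text \<open>A function f on edges encodes an orientation: f e = 0 means that e points to its end
  with the smaller label. Encoded in this way, orientations are chosen by the same device as
  colourings.\<close>

definition head_of :: "('v \<Rightarrow> real) \<Rightarrow> ('v set \<Rightarrow> nat) \<Rightarrow> 'v set \<Rightarrow> 'v" where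
  "head_of \<omega> f e = (THE x. x \<in> e \<and> (\<forall>y\<in>e. y \<noteq> x \<longrightarrow> (if f e = 0 then \<omega> x < \<omega> y else \<omega> y < \<omega> x)))"

definition orients :: "('v \<Rightarrow> real) \<Rightarrow> ('v set \<Rightarrow> nat) \<Rightarrow> nat \<Rightarrow> 'v set \<Rightarrow> ('v set \<Rightarrow> nat) set" where
  "orients \<omega> c i W = {f. \<forall>v\<in>W. (\<exists>!e. e \<in> E \<and> v \<in> e \<and> c e = i \<and> head_of \<omega> f e = v) \<and>
     (\<exists>!e. e \<in> E \<and> v \<in> e \<and> c e = i \<and> head_of \<omega> f e \<noteq> v)}"

text \<open>The edges of one monochromatic cycle are oriented together: all of them pick from
  the same set of consistent orientations of the cycle.\<close>

definition decor :: "('v \<Rightarrow> real) \<Rightarrow> 'v decoration" where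
  "decor \<omega> = (\<lambda>e\<in>E. let c = final \<omega>; W = cycle_of c e in (c e, head_of \<omega> (pick \<omega> W (orients \<omega> c (c e) W)) e))"

lemma hd_eq:
  assumes "e = {u, v}" "\<omega> u < \<omega> v"
  shows "head_of \<omega> f e = (if f e = 0 then u else v)"
  unfolding head_of_def using assms by (intro the_equality) (auto split: if_splits)

lemma edge_ordered:
  fixes \<omega> :: "'v \<Rightarrow> real"
  assumes "inj_on \<omega> V" "e \<in> E"
  obtains u v where "e = {u, v}" "\<omega> u < \<omega> v" "u \<in> V" "v \<in> V"
proof -
  obtain x y where xy: "x \<in> V" "y \<in> V" "x \<noteq> y" "e = {x, y}" using edge_pair assms by blast
  then have "\<omega> x \<noteq> \<omega> y" using assms by (auto dest: inj_onD)
  then consider "\<omega> x < \<omega> y" | "\<omega> y < \<omega> x" using less_linear[of "\<omega> x" "\<omega> y"] by blast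
  then show ?thesis
  proof cases
    case 1 show ?thesis by (rule that[OF xy(4) 1 xy(1,2)])
  next
    case 2
    have "e = {y, x}" using xy(4) by blast
    then show ?thesis by (rule that[OF _ 2 xy(2,1)])
  qed
qed

lemma hd_in:
  assumes "inj_on \<omega> V" "e \<in> E" shows "head_of \<omega> f e \<in> e"
proof -
  obtain u v where uv: "e = {u, v}" "\<omega> u < \<omega> v" using edge_ordered[OF assms] by blast
  show ?thesis using hd_eq[OF uv, of f] uv by simp
qed

lemma orients_nonempty:
  assumes inj: "inj_on \<omega> V" and c: "valid c" and i: "i < d" and W: "W \<subseteq> V"
  shows "orients \<omega> c i W \<noteq> {}"
proof -
  obtain h where h: "\<forall>e\<in>E. c e = i \<longrightarrow> h e \<in> e"
    "\<forall>v\<in>V. (\<exists>!e. e \<in> E \<and> v \<in> e \<and> c e = i \<and> h e = v) \<and> (\<exists>!e. e \<in> E \<and> v \<in> e \<and> c e = i \<and> h e \<noteq> v)"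
    using balanced_orientation[OF c i] by blast
  define f where "f e = (if \<forall>y\<in>e. \<omega> (h e) \<le> \<omega> y then 0 else 1 :: nat)" for e
  have eq: "head_of \<omega> f e = h e" if e: "e \<in> E" "c e = i" for e
  proof -
    obtain u v where uv: "e = {u, v}" "\<omega> u < \<omega> v" using edge_ordered[OF inj e(1)] by blast
    have "h e = u \<or> h e = v" using h(1) e uv by auto
    then show ?thesis using hd_eq[OF uv, of f] uv by (auto simp: f_def)
  qed
  have "f \<in> orients \<omega> c i W"
    unfolding orients_def
  proof (intro CollectI ballI conjI)
    fix v assume v: "v \<in> W"
    have 1: "(e \<in> E \<and> v \<in> e \<and> c e = i \<and> head_of \<omega> f e = v) = (e \<in> E \<and> v \<in> e \<and> c e = i \<and> h e = v)"
      "(e \<in> E \<and> v \<in> e \<and> c e = i \<and> head_of \<omega> f e \<noteq> v) = (e \<in> E \<and> v \<in> e \<and> c e = i \<and> h e \<noteq> v)" for e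
      using eq by metis+
    have "v \<in> V" using v W by blast
    then show "\<exists>!e. e \<in> E \<and> v \<in> e \<and> c e = i \<and> head_of \<omega> f e = v" "\<exists>!e. e \<in> E \<and> v \<in> e \<and> c e = i \<and> head_of \<omega> f e \<noteq> v"
      unfolding 1 using h(2) by simp_all
  qed
  then show ?thesis by blast
qed

lemma edge_mono_step: "e \<in> E \<Longrightarrow> x \<in> e \<Longrightarrow> y \<in> e \<Longrightarrow> (x, y) \<in> (mono_step c (c e))\<^sup>*"
proof (cases "x = y")
  case False
  assume e: "e \<in> E" "x \<in> e" "y \<in> e"
  then have "e = {x, y}" using edge_pair[of e] False by auto
  then have "(x, y) \<in> mono_step c (c e)" using e by (simp add: mono_step_def)
  then show ?thesis by blast
qed simp

lemma cyc_eq: "e \<in> E \<Longrightarrow> x \<in> e \<Longrightarrow> cycle_of c e = {y. (x, y) \<in> (mono_step c (c e))\<^sup>*}"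
  unfolding cycle_of_def using edge_mono_step rtrancl_trans by fast

lemma mono_steps_verts: "(x, y) \<in> (mono_step c i)\<^sup>* \<Longrightarrow> x \<in> V \<Longrightarrow> y \<in> V"
  by (induction rule: rtrancl_induct) (use edge_sub in \<open>auto simp: mono_step_def\<close>)

lemma decor_simp: "e \<in> E \<Longrightarrow> decor \<omega> e = (final \<omega> e,
    head_of \<omega> (pick \<omega> (cycle_of (final \<omega>) e) (orients \<omega> (final \<omega>) (final \<omega> e) (cycle_of (final \<omega>) e))) e)"
  by (simp add: decor_def Let_def)

lemma decor_schreier:
  assumes A: "settled \<omega>" shows "schreier_decoration G d (decor \<omega>)"
  unfolding schreier_decoration_def
proof (intro conjI)
  have inj: "inj_on \<omega> V" using A by (simp add: settled_def)
  have val: "valid (final \<omega>)" by (rule final_valid[OF A])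
  show "decor \<omega> \<in> space (decoration_space G d)"
    unfolding decoration_space_def space_PiM
  proof (rule PiE_I)
    fix e assume e: "e \<in> E"
    have "final \<omega> e < d" using val e by (simp add: valid_def)
    then show "decor \<omega> e \<in> space (count_space ({..<d} \<times> e))"
      using hd_in[OF inj e] e by (simp add: decor_simp)
  qed (simp add: decor_def)
  show "\<forall>v\<in>V. \<forall>i<d. (\<exists>!e. e \<in> E \<and> v \<in> e \<and> fst (decor \<omega> e) = i \<and> snd (decor \<omega> e) = v) \<and>
        (\<exists>!e. e \<in> E \<and> v \<in> e \<and> fst (decor \<omega> e) = i \<and> snd (decor \<omega> e) \<noteq> v)"
  proof (intro ballI allI impI)
    fix v i assume v: "v \<in> V" and i: "i < d"
    define W where "W = {y. (v, y) \<in> (mono_step (final \<omega>) i)\<^sup>*}"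
    define f where "f = pick \<omega> W (orients \<omega> (final \<omega>) i W)"
    have WV: "W \<subseteq> V" using mono_steps_verts v by (auto simp: W_def)
    have "f \<in> orients \<omega> (final \<omega>) i W"
      unfolding f_def using pick_in orients_nonempty[OF inj val i WV] by blast
    then have f: "(\<exists>!e. e \<in> E \<and> v \<in> e \<and> final \<omega> e = i \<and> head_of \<omega> f e = v)"
      "(\<exists>!e. e \<in> E \<and> v \<in> e \<and> final \<omega> e = i \<and> head_of \<omega> f e \<noteq> v)" by (auto simp: orients_def W_def)
    have eq: "fst (decor \<omega> e) = final \<omega> e" if "e \<in> E" for e using that by (simp add: decor_simp)
    have eq2: "snd (decor \<omega> e) = head_of \<omega> f e" if "e \<in> E" "v \<in> e" "final \<omega> e = i" for e
      using that cyc_eq[OF that(1,2), of "final \<omega>"] by (simp add: decor_simp f_def W_def)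
    have 1: "(e \<in> E \<and> v \<in> e \<and> fst (decor \<omega> e) = i \<and> snd (decor \<omega> e) = v) = (e \<in> E \<and> v \<in> e \<and> final \<omega> e = i \<and> head_of \<omega> f e = v)"
      "(e \<in> E \<and> v \<in> e \<and> fst (decor \<omega> e) = i \<and> snd (decor \<omega> e) \<noteq> v) = (e \<in> E \<and> v \<in> e \<and> final \<omega> e = i \<and> head_of \<omega> f e \<noteq> v)" for e
      using eq eq2 by metis+
    show "(\<exists>!e. e \<in> E \<and> v \<in> e \<and> fst (decor \<omega> e) = i \<and> snd (decor \<omega> e) = v) \<and>
        (\<exists>!e. e \<in> E \<and> v \<in> e \<and> fst (decor \<omega> e) = i \<and> snd (decor \<omega> e) \<noteq> v)" unfolding 1 using f by simp
  qed
qed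

lemma decor_no_path:
  assumes A: "settled \<omega>" shows "\<not> infinite_monochromatic_path G (decor \<omega>) x"
proof
  assume "infinite_monochromatic_path G (decor \<omega>) x"
  then obtain i where x: "inj x" "\<And>n. {x n, x (Suc n)} \<in> E" "\<And>n. fst (decor \<omega> {x n, x (Suc n)}) = i"
    by (auto simp: infinite_monochromatic_path_def)
  have x0: "x 0 \<in> V" using x(2)[of 0] edge_sub by blast
  then obtain n where n: "x 0 \<in> region n \<omega>" using A by (auto simp: settled_def)
  have "(x 0, x m) \<in> (mono_step (final \<omega>) i)\<^sup>*" for m
  proof (induction m)
    case (Suc m)
    have "(x m, x (Suc m)) \<in> mono_step (final \<omega>) i"
      using x(2,3)[of m] by (simp add: mono_step_def decor_simp)
    then show ?case using Suc by (rule_tac rtrancl_into_rtrancl)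
  qed simp
  then have "range x \<subseteq> nb s (conn a (region n \<omega>) (x 0))" using mono_confined[OF A n] by blast
  moreover have "finite (nb s (conn a (region n \<omega>) (x 0)))"
    by (rule finite_nb[OF subset_trans[OF conn_sub[OF n] reg_verts] finite_conn_reg[OF x0]])
  ultimately show False using x(1) by (meson finite_subset range_inj_infinite)
qed

lemma hd_alike:
  assumes e: "e \<in> E" and inj: "inj_on \<omega> V"
    and ord: "\<And>v w. v \<in> e \<Longrightarrow> w \<in> e \<Longrightarrow> \<omega> v < \<omega> w \<longleftrightarrow> \<omega>' (\<gamma> v) < \<omega>' (\<gamma> w)"
    and f: "f' (\<gamma> ` e) = f e"
  shows "head_of \<omega>' f' (\<gamma> ` e) = \<gamma> (head_of \<omega> f e)"
proof -
  obtain u v where uv: "e = {u, v}" "\<omega> u < \<omega> v" using edge_ordered[OF inj e] by blast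
  then have "\<omega>' (\<gamma> u) < \<omega>' (\<gamma> v)" using ord by auto
  moreover have "\<gamma> ` e = {\<gamma> u, \<gamma> v}" using uv by auto
  ultimately show ?thesis using hd_eq[OF uv, of f] hd_eq[of "\<gamma> ` e" "\<gamma> u" "\<gamma> v" \<omega>' f'] f by auto
qed

lemma orients_push:
  assumes g: "\<gamma> \<in> Aut" and inj: "inj_on \<omega> V" and WN: "W \<subseteq> V"
    and ord: "\<And>v w. v \<in> W \<Longrightarrow> w \<in> W \<Longrightarrow> \<omega> v < \<omega> w \<longleftrightarrow> \<omega>' (\<gamma> v) < \<omega>' (\<gamma> w)"
    and closed: "\<And>e. e \<in> E \<Longrightarrow> e \<inter> W \<noteq> {} \<Longrightarrow> c e = i \<Longrightarrow> e \<subseteq> W"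
    and c: "\<And>e. e \<in> E \<Longrightarrow> e \<inter> W \<noteq> {} \<Longrightarrow> c' (\<gamma> ` e) = c e"
    and f: "f \<in> orients \<omega> c i W"
  shows "push \<gamma> f \<in> orients \<omega>' c' i (\<gamma> ` W)"
  unfolding orients_def
proof (intro CollectI ballI)
  fix v' assume "v' \<in> \<gamma> ` W"
  then obtain v where v: "v \<in> W" "v' = \<gamma> v" by blast
  have vV: "v \<in> V" using v WN by blast
  have hdeq: "head_of \<omega>' (push \<gamma> f) (\<gamma> ` e) = \<gamma> (head_of \<omega> f e)" if e: "e \<in> E" "v \<in> e" "c e = i" for e
  proof (rule hd_alike[OF e(1) inj])
    have eW: "e \<subseteq> W" using closed[OF e(1) _ e(3)] e v by blast
    show "\<omega> x < \<omega> y \<longleftrightarrow> \<omega>' (\<gamma> x) < \<omega>' (\<gamma> y)" if "x \<in> e" "y \<in> e" for x y using ord eW that by blast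
    show "push \<gamma> f (\<gamma> ` e) = f e" using push_image[OF g] edge_sub e by blast
  qed
  have inE: "v' \<in> \<gamma> ` e \<longleftrightarrow> v \<in> e" if "e \<in> E" for e
    using aut_inj[OF g] edge_sub[OF that] vV v by (auto simp: image_iff)
  have transfer: "\<exists>!e'. e' \<in> E \<and> v' \<in> e' \<and> c' e' = i \<and> Q e'"
    if ex: "\<exists>!e. e \<in> E \<and> v \<in> e \<and> c e = i \<and> Q (\<gamma> ` e)" for Q
  proof -
    obtain e where e: "e \<in> E" "v \<in> e" "c e = i" "Q (\<gamma> ` e)"
      and un: "\<And>z. z \<in> E \<Longrightarrow> v \<in> z \<Longrightarrow> c z = i \<Longrightarrow> Q (\<gamma> ` z) \<Longrightarrow> z = e" using ex by blast
    show ?thesis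
    proof (rule ex1I[of _ "\<gamma> ` e"])
      show "\<gamma> ` e \<in> E \<and> v' \<in> \<gamma> ` e \<and> c' (\<gamma> ` e) = i \<and> Q (\<gamma> ` e)"
        using aut_edge[OF g] e inE c[OF e(1)] v by auto
    next
      fix z' assume z': "z' \<in> E \<and> v' \<in> z' \<and> c' z' = i \<and> Q z'"
      define z where "z = ainv \<gamma> ` z'"
      have z: "z \<in> E" "\<gamma> ` z = z'" unfolding z_def
        using z' aut_edge[OF ainv_aut[OF g]] ainv_image_right[OF g edge_sub] by auto
      then have "v \<in> z" using inE z' by blast
      moreover have "z \<inter> W \<noteq> {}" using v \<open>v \<in> z\<close> by blast
      then have "c z = c' z'" using c[of z] z by simp
      ultimately have "z = e" using un[of z] z z' by simp
      then show "z' = \<gamma> ` e" using z by simp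
    qed
  qed
  have hdV: "head_of \<omega> f e \<in> V" if "e \<in> E" for e using hd_in[OF inj that] edge_sub[OF that] by blast
  have iff: "head_of \<omega>' (push \<gamma> f) (\<gamma> ` e) = v' \<longleftrightarrow> head_of \<omega> f e = v" if e: "e \<in> E" "v \<in> e" "c e = i" for e
    using hdeq[OF e] v aut_inj[OF g hdV[OF e(1)] vV] by simp
  have ff: "(\<exists>!e. e \<in> E \<and> v \<in> e \<and> c e = i \<and> head_of \<omega> f e = v)" "(\<exists>!e. e \<in> E \<and> v \<in> e \<and> c e = i \<and> head_of \<omega> f e \<noteq> v)"
    using f v by (auto simp: orients_def)
  have "(e \<in> E \<and> v \<in> e \<and> c e = i \<and> head_of \<omega> f e = v) = (e \<in> E \<and> v \<in> e \<and> c e = i \<and> head_of \<omega>' (push \<gamma> f) (\<gamma> ` e) = v')"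
    "(e \<in> E \<and> v \<in> e \<and> c e = i \<and> head_of \<omega> f e \<noteq> v) = (e \<in> E \<and> v \<in> e \<and> c e = i \<and> head_of \<omega>' (push \<gamma> f) (\<gamma> ` e) \<noteq> v')" for e
    using iff by auto
  with ff show "(\<exists>!e. e \<in> E \<and> v' \<in> e \<and> c' e = i \<and> head_of \<omega>' (push \<gamma> f) e = v') \<and>
     (\<exists>!e. e \<in> E \<and> v' \<in> e \<and> c' e = i \<and> head_of \<omega>' (push \<gamma> f) e \<noteq> v')"
    using transfer[of "\<lambda>e. head_of \<omega>' (push \<gamma> f) e = v'"] transfer[of "\<lambda>e. head_of \<omega>' (push \<gamma> f) e \<noteq> v'"] by simp
qed

lemma finite_sub_reg:
  assumes "settled \<omega>" shows "finite T \<Longrightarrow> T \<subseteq> V \<Longrightarrow> \<exists>m. T \<subseteq> region m \<omega>"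
proof (induction T rule: finite_induct)
  case (insert x T)
  then obtain m where m: "T \<subseteq> region m \<omega>" by auto
  obtain n where n: "x \<in> region n \<omega>" using insert assms by (auto simp: settled_def)
  have "region m \<omega> \<subseteq> region (max m n) \<omega>" "region n \<omega> \<subseteq> region (max m n) \<omega>" by (auto intro!: reg_mono)
  then show ?case using m n by blast
qed simp

text \<open>The radius R depends on \<omega> and x only, neither on the automorphism nor on
  \<omega>'. The cycles through x lie in the collar N of a cluster; by stability the colours in
  a neighbourhood T of N are final at a finite stage m, and a finite ball determines the outcome
  of that stage on T, together with the orders needed for choosing orientations.\<close>

lemma decor_alike:
  assumes A: "settled \<omega>" and x: "x \<in> V"
  shows "\<exists>R. \<forall>\<gamma>\<in>Aut. \<forall>\<omega>'. settled \<omega>' \<longrightarrow> alike \<gamma> (B x R) R \<omega> \<omega>' \<longrightarrow>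
    (\<forall>e\<in>E. x \<in> e \<longrightarrow> decor \<omega>' (\<gamma> ` e) = (fst (decor \<omega> e), \<gamma> (snd (decor \<omega> e))))"
proof -
  obtain n where n: "x \<in> region n \<omega>" using A x by (auto simp: settled_def)
  define N where "N = nb s (conn a (region n \<omega>) x)"
  define T where "T = nb 1 N"
  have KV: "conn a (region n \<omega>) x \<subseteq> V" using conn_sub[OF n] reg_verts by blast
  have NV: "N \<subseteq> V" "finite N" unfolding N_def
    using nb_verts[OF KV] finite_nb[OF KV finite_conn_reg[OF x]] by auto
  have TV: "T \<subseteq> V" "finite T" unfolding T_def using nb_verts[OF NV(1)] finite_nb[OF NV] by auto
  have NT: "N \<subseteq> T" unfolding T_def by (rule nb_self)
  obtain m where m: "T \<subseteq> region m \<omega>" using finite_sub_reg[OF A TV(2,1)] by blast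
  define R where "R = M n + s + 1 + reach m + m"
  have "T \<subseteq> B x (M n + s + 1)"
  proof -
    have "N \<subseteq> nb s (B x (M n))" unfolding N_def using nb_mono[OF conn_reg_ball] by blast
    then have "T \<subseteq> nb 1 (nb s (B x (M n)))" unfolding T_def using nb_mono by blast
    then show ?thesis unfolding nb_def using ball_trans by blast
  qed
  then have TR: "nb (reach m) T \<subseteq> B x R"
    unfolding nb_def R_def using ball_trans_le[of _ x "M n + s + 1" _ "reach m"] by fastforce
  show ?thesis
  proof (intro exI[of _ R] ballI allI impI)
    fix \<gamma> \<omega>' e
    assume g: "\<gamma> \<in> Aut" and A': "settled \<omega>'" and al: "alike \<gamma> (B x R) R \<omega> \<omega>'" and e: "e \<in> E" "x \<in> e"
    have inj: "inj_on \<omega> V" "inj_on \<omega>' V" using A A' by (auto simp: settled_def)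
    have "alike \<gamma> (nb (reach m) T) m \<omega> \<omega>'" by (rule alike_mono[OF al TR]) (simp add: R_def)
    from reg_col_alike[OF g inj(2) TV(1) this]
    have rc: "\<And>v. v \<in> T \<Longrightarrow> v \<in> region m \<omega> \<longleftrightarrow> \<gamma> v \<in> region m \<omega>'"
      "\<And>e. e \<in> E \<Longrightarrow> e \<subseteq> T \<Longrightarrow> col m \<omega>' (\<gamma> ` e) = col m \<omega> e" by auto
    have fin: "final \<omega>' (\<gamma> ` e) = final \<omega> e" if e: "e \<in> E" "e \<subseteq> T" for e
    proof -
      obtain y where y: "y \<in> e" using edge_nonempty e by blast
      then have "y \<in> region m \<omega>" "\<gamma> y \<in> region m \<omega>'" using m rc(1) e by auto
      then show ?thesis
        using final_at[OF A _ e(1) y] final_at[OF A' _ aut_edge[OF g e(1)], of "\<gamma> y"] rc(2)[OF e] y by auto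
    qed
    define i where "i = final \<omega> e"
    define W where "W = cycle_of (final \<omega>) e"
    have W: "W = {y. (x, y) \<in> (mono_step (final \<omega>) i)\<^sup>*}" unfolding W_def i_def by (rule cyc_eq[OF e])
    have WN: "W \<subseteq> N" unfolding W N_def using mono_confined[OF A n] by blast
    have touch: "e \<subseteq> T" if e1: "e \<in> E" and e2: "e \<inter> N \<noteq> {}" for e
    proof -
      obtain y where "y \<in> e" "y \<in> nb 0 N" using e2 nb_self[of N 0] by blast
      then show ?thesis unfolding T_def using nb_edge[OF e1, of y 0 N 1] by simp
    qed
    have xN: "x \<in> N" using WN W by blast
    have ci: "final \<omega>' (\<gamma> ` e) = i" using fin[OF e(1) touch] e xN by (auto simp: i_def)
    have W': "cycle_of (final \<omega>') (\<gamma> ` e) = \<gamma> ` W"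
    proof -
      have "cycle_of (final \<omega>') (\<gamma> ` e) = {y. (\<gamma> x, y) \<in> (mono_step (final \<omega>') i)\<^sup>*}"
        using cyc_eq[OF aut_edge[OF g e(1)], of "\<gamma> x" "final \<omega>'"] e ci by auto
      also have "\<dots> = \<gamma> ` W"
      proof (intro equalityI subsetI)
        fix y assume "y \<in> {y. (\<gamma> x, y) \<in> (mono_step (final \<omega>') i)\<^sup>*}"
        then have "(\<gamma> x, y) \<in> (mono_step (final \<omega>') i)\<^sup>*" by simp
        then show "y \<in> \<gamma> ` W"
        proof (induction rule: rtrancl_induct)
          case base then show ?case unfolding W by blast
        next
          case (step y z)
          then obtain y0 where y0: "y0 \<in> W" "y = \<gamma> y0" by blast
          have yz: "{y, z} \<in> E" "final \<omega>' {y, z} = i" using step(2) by (auto simp: mono_step_def)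
          define z0 where "z0 = ainv \<gamma> z"
          have zV: "z \<in> V" using edge_sub[OF yz(1)] by simp
          have z0: "z0 \<in> V" "\<gamma> z0 = z" unfolding z0_def using zV g ainv_V by auto
          have img: "\<gamma> ` {y0, z0} = {y, z}" using y0 z0 by simp
          have "{y0, z0} \<in> E" using aut_edge_iff[OF g, of "{y0, z0}"] img yz y0 z0 WN NV by auto
          moreover have "final \<omega> {y0, z0} = i" using fin[OF calculation touch[OF calculation]] img yz y0 WN by auto
          ultimately have "(y0, z0) \<in> mono_step (final \<omega>) i" by (simp add: mono_step_def)
          then have "z0 \<in> W" using y0 unfolding W by auto
          then show ?case using z0 by blast
        qed
      next
        fix y' assume "y' \<in> \<gamma> ` W"
        then obtain y where y: "y' = \<gamma> y" "(x, y) \<in> (mono_step (final \<omega>) i)\<^sup>*" unfolding W by blast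
        from y(2) have "(\<gamma> x, \<gamma> y) \<in> (mono_step (final \<omega>') i)\<^sup>*"
        proof (induction rule: rtrancl_induct)
          case (step y z)
          have yz: "{y, z} \<in> E" "final \<omega> {y, z} = i" using step(2) by (auto simp: mono_step_def)
          have "y \<in> N" using step(1) WN unfolding W by blast
          then have "final \<omega>' (\<gamma> ` {y, z}) = i" using fin[OF yz(1) touch[OF yz(1)]] yz by auto
          then have "(\<gamma> y, \<gamma> z) \<in> mono_step (final \<omega>') i" using aut_edge[OF g yz(1)] by (simp add: mono_step_def)
          then show ?case using step(3) by (rule_tac rtrancl_into_rtrancl)
        qed simp
        then show "y' \<in> {y. (\<gamma> x, y) \<in> (mono_step (final \<omega>') i)\<^sup>*}" using y by simp
      qed
      finally show ?thesis .
    qed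
    have WV: "W \<subseteq> V" "finite W" using WN NV finite_subset by auto
    have gW: "\<gamma> ` W \<subseteq> V" using aut_image_V[OF g] WV by blast
    have NR: "N \<subseteq> B x R"
      using TR nb_self[of T "reach m"] NT by blast
    have ord: "\<omega> v < \<omega> w \<longleftrightarrow> \<omega>' (\<gamma> v) < \<omega>' (\<gamma> w)" if "v \<in> W" "w \<in> W" for v w
      using al that WN NR unfolding alike_def by blast
    have closed: "e \<subseteq> W" if e1: "e \<in> E" "e \<inter> W \<noteq> {}" "final \<omega> e = i" for e
    proof
      fix z assume "z \<in> e"
      obtain y where y: "y \<in> e" "y \<in> W" using e1 by blast
      have "(y, z) \<in> (mono_step (final \<omega>) i)\<^sup>*" using edge_mono_step[OF e1(1) y(1) \<open>z \<in> e\<close>] e1(3) by auto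
      then show "z \<in> W" using y(2) unfolding W by (auto intro: rtrancl_trans)
    qed
    have cc: "final \<omega>' (\<gamma> ` e) = final \<omega> e" if "e \<in> E" "e \<inter> W \<noteq> {}" for e
      using fin[OF that(1) touch[OF that(1)]] that WN by blast
    let ?S = "orients \<omega> (final \<omega>) i W" and ?S' = "orients \<omega>' (final \<omega>') i (\<gamma> ` W)"
    have id: "i < d" using final_valid[OF A] e by (simp add: valid_def i_def)
    have iW: "ainv \<gamma> ` \<gamma> ` W = W" by (rule ainv_image_left[OF g WV(1)])
    have back1: "ainv \<gamma> ` e' \<in> E \<and> \<gamma> ` (ainv \<gamma> ` e') = e'" if "e' \<in> E" for e'
      using that aut_edge[OF ainv_aut[OF g]] ainv_image_right[OF g edge_sub] by auto
    have meet: "ainv \<gamma> ` e' \<inter> W \<noteq> {}" if "e' \<inter> \<gamma> ` W \<noteq> {}" for e'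
      using that iW by (metis image_Int_subset image_is_empty le_inf_iff subset_empty inf_mono image_mono Int_lower1 Int_lower2 le_infI)
    have cl': "e' \<subseteq> \<gamma> ` W" if "e' \<in> E" "e' \<inter> \<gamma> ` W \<noteq> {}" "final \<omega>' e' = i" for e'
    proof -
      have b: "ainv \<gamma> ` e' \<in> E" "\<gamma> ` (ainv \<gamma> ` e') = e'" using back1[OF that(1)] by auto
      have "final \<omega> (ainv \<gamma> ` e') = i" using cc[OF b(1) meet[OF that(2)]] b that by simp
      then have "ainv \<gamma> ` e' \<subseteq> W" using closed[OF b(1) meet[OF that(2)]] by blast
      then show ?thesis using b(2) by (metis image_mono)
    qed
    have cc': "final \<omega> (ainv \<gamma> ` e') = final \<omega>' e'" if "e' \<in> E" "e' \<inter> \<gamma> ` W \<noteq> {}" for e'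
      using cc[OF _ meet[OF that(2)]] back1[OF that(1)] by simp
    have bwd: "push (ainv \<gamma>) f \<in> ?S" if "f \<in> ?S'" for f
    proof -
      have "push (ainv \<gamma>) f \<in> orients \<omega> (final \<omega>) i (ainv \<gamma> ` \<gamma> ` W)"
      proof (rule orients_push[OF ainv_aut[OF g] inj(2) gW _ cl' cc' that])
        show "\<omega>' v < \<omega>' w \<longleftrightarrow> \<omega> (ainv \<gamma> v) < \<omega> (ainv \<gamma> w)" if vw: "v \<in> \<gamma> ` W" "w \<in> \<gamma> ` W" for v w
        proof -
          obtain v0 w0 where "v = \<gamma> v0" "w = \<gamma> w0" "v0 \<in> W" "w0 \<in> W" using vw by blast
          then show ?thesis using ord WV g by (auto simp: subset_iff)
        qed
      qed
      then show ?thesis using iW by simp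
    qed
    have "pick \<omega>' (\<gamma> ` W) ?S' (\<gamma> ` e) = pick \<omega> W ?S e"
    proof (rule pick_match[OF g WV _ _ _ _ bwd e(1)])
      show "\<omega> v < \<omega> w \<longleftrightarrow> \<omega>' (\<gamma> v) < \<omega>' (\<gamma> w)" if "v \<in> W" "w \<in> W" for v w by (rule ord[OF that])
      show "inj_on \<omega>' (\<gamma> ` W)" by (rule inj_on_subset[OF inj(2) gW])
      show "?S \<noteq> {}" by (rule orients_nonempty[OF inj(1) final_valid[OF A] id WV(1)])
      show "push \<gamma> f \<in> ?S'" if "f \<in> ?S" for f
        by (rule orients_push[where \<omega> = \<omega> and \<omega>' = \<omega>' and c = "final \<omega>" and c' = "final \<omega>'", OF g inj(1) WV(1) ord closed cc that])
      show "e \<subseteq> W" using closed[OF e(1)] e W i_def by blast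
    qed
    then have "head_of \<omega>' (pick \<omega>' (\<gamma> ` W) ?S') (\<gamma> ` e) = \<gamma> (head_of \<omega> (pick \<omega> W ?S) e)"
    proof (intro hd_alike[OF e(1) inj(1)])
      show "\<omega> v < \<omega> w \<longleftrightarrow> \<omega>' (\<gamma> v) < \<omega>' (\<gamma> w)" if "v \<in> e" "w \<in> e" for v w
        using ord closed[OF e(1)] e W i_def that by blast
    qed
    then show "decor \<omega>' (\<gamma> ` e) = (fst (decor \<omega> e), \<gamma> (snd (decor \<omega> e)))"
      using e aut_edge[OF g e(1)] W' ci by (simp add: decor_simp W_def i_def)
  qed
qed

lemma settled_aut:
  assumes g: "\<gamma> \<in> Aut" and A: "settled \<omega>"
  shows "settled (act_label G \<gamma> \<omega>)"
proof -
  let ?\<omega>' = "act_label G \<gamma> \<omega>"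
  have val: "?\<omega>' (\<gamma> v) = \<omega> v" if "v \<in> V" for v using that g aut_V by (simp add: act_label_def)
  have inj: "inj_on \<omega> V" using A by (simp add: settled_def)
  have inj': "inj_on ?\<omega>' V"
  proof (rule inj_onI)
    fix u v assume "u \<in> V" "v \<in> V" "?\<omega>' u = ?\<omega>' v"
    then have "ainv \<gamma> u = ainv \<gamma> v" using inj_onD[OF inj] ainv_V[OF g] by (simp add: act_label_def)
    then show "u = v" using ainv_right[OF g] \<open>u \<in> V\<close> \<open>v \<in> V\<close> by metis
  qed
  have "\<exists>n. v \<in> region n ?\<omega>'" if v: "v \<in> V" for v
  proof -
    let ?u = "ainv \<gamma> v"
    have u: "?u \<in> V" "\<gamma> ?u = v" using ainv_V[OF g v] g v by auto
    obtain n where n: "?u \<in> region n \<omega>" using A u by (auto simp: settled_def)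
    have "alike \<gamma> (nb (reach n) {?u}) n \<omega> ?\<omega>'"
      using nb_verts[of "{?u}"] u val unfolding alike_def by (simp add: subset_iff)
    from reg_col_alike[OF g inj' _ this] show ?thesis using u n by auto
  qed
  then show ?thesis using inj' by (simp add: settled_def)
qed

lemma decor_aut:
  assumes g: "\<gamma> \<in> Aut" and A: "settled \<omega>"
  shows "act_decoration G \<gamma> (decor \<omega>) = decor (act_label G \<gamma> \<omega>)"
proof
  fix e'
  let ?\<omega>' = "act_label G \<gamma> \<omega>"
  show "act_decoration G \<gamma> (decor \<omega>) e' = decor ?\<omega>' e'"
  proof (cases "e' \<in> E")
    case True
    define e where "e = ainv \<gamma> ` e'"
    have e: "e \<in> E" "\<gamma> ` e = e'"
      unfolding e_def using True aut_edge[OF ainv_aut[OF g]] ainv_image_right[OF g edge_sub] by auto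
    obtain x where x: "x \<in> e" "x \<in> V" using edge_nonempty e edge_sub by blast
    obtain R where R: "\<forall>\<gamma>\<in>Aut. \<forall>\<omega>'. settled \<omega>' \<longrightarrow> alike \<gamma> (B x R) R \<omega> \<omega>' \<longrightarrow>
      (\<forall>e\<in>E. x \<in> e \<longrightarrow> decor \<omega>' (\<gamma> ` e) = (fst (decor \<omega> e), \<gamma> (snd (decor \<omega> e))))"
      using decor_alike[OF A x(2)] by blast
    have val: "?\<omega>' (\<gamma> v) = \<omega> v" if "v \<in> V" for v using that g aut_V by (simp add: act_label_def)
    have "alike \<gamma> (B x R) R \<omega> ?\<omega>'"
      using ball_verts[OF x(2)] val unfolding alike_def by simp
    then have "decor ?\<omega>' (\<gamma> ` e) = (fst (decor \<omega> e), \<gamma> (snd (decor \<omega> e)))"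
      using R g settled_aut[OF g A] e x by blast
    then show ?thesis using True e by (simp add: act_decoration_def e_def split: prod.split)
  qed (simp add: act_decoration_def decor_def)
qed

lemma id_aut: "(\<lambda>x. x) \<in> Aut"
  by (auto simp: graph_aut_def bij_betw_def)

lemma decor_local:
  assumes A: "settled \<omega>" and x: "x \<in> V"
  shows "\<exists>R. \<forall>\<omega>'. settled \<omega>' \<longrightarrow> alike (\<lambda>x. x) (B x R) R \<omega> \<omega>' \<longrightarrow> (\<forall>e\<in>E. x \<in> e \<longrightarrow> decor \<omega>' e = decor \<omega> e)"
proof -
  obtain R where "\<forall>\<gamma>\<in>Aut. \<forall>\<omega>'. settled \<omega>' \<longrightarrow> alike \<gamma> (B x R) R \<omega> \<omega>' \<longrightarrow>
      (\<forall>e\<in>E. x \<in> e \<longrightarrow> decor \<omega>' (\<gamma> ` e) = (fst (decor \<omega> e), \<gamma> (snd (decor \<omega> e))))"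
    using decor_alike[OF A x] by blast
  from bspec[OF this id_aut] show ?thesis by auto
qed

end

section \<open>Independent labels\<close>

lemma sets_countable_ball:
  assumes "countable X" "\<And>x. x \<in> X \<Longrightarrow> {\<omega> \<in> space M. P x \<omega>} \<in> sets M"
  shows "{\<omega> \<in> space M. \<forall>x\<in>X. P x \<omega>} \<in> sets M"
proof (cases "X = {}")
  case False
  then have "{\<omega> \<in> space M. \<forall>x\<in>X. P x \<omega>} = (\<Inter>x\<in>X. {\<omega> \<in> space M. P x \<omega>})" by auto
  then show ?thesis using assms False sets.countable_INT'[of X "\<lambda>x. {\<omega> \<in> space M. P x \<omega>}" M] by auto
qed simp

lemma sets_countable_bex:
  assumes "countable X" "\<And>x. x \<in> X \<Longrightarrow> {\<omega> \<in> space M. P x \<omega>} \<in> sets M"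
  shows "{\<omega> \<in> space M. \<exists>x\<in>X. P x \<omega>} \<in> sets M"
proof -
  have "{\<omega> \<in> space M. \<exists>x\<in>X. P x \<omega>} = (\<Union>x\<in>X. {\<omega> \<in> space M. P x \<omega>})" by auto
  then show ?thesis using assms sets.countable_UN'[of X "\<lambda>x. {\<omega> \<in> space M. P x \<omega>}" M] by auto
qed

abbreviation unit_measure :: "real measure" where
  "unit_measure \<equiv> restrict_space lborel {0..1}"

lemma prob_unit: "prob_space unit_measure"
  by (rule prob_spaceI) (simp add: emeasure_restrict_space space_restrict_space)

lemma unit_below: "0 \<le> q \<Longrightarrow> q \<le> 1 \<Longrightarrow> emeasure unit_measure {x \<in> {0..1}. x < q} = ennreal q"
proof -
  assume q: "0 \<le> q" "q \<le> 1"
  then have *: "{x \<in> {0..1}. x < q} = {0..<q}" by auto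
  show ?thesis unfolding * using q by (subst emeasure_restrict_space) auto
qed

lemma unit_above: "0 \<le> q \<Longrightarrow> q \<le> 1 \<Longrightarrow> emeasure unit_measure {x \<in> {0..1}. \<not> x < q} = ennreal (1 - q)"
proof -
  assume q: "0 \<le> q" "q \<le> 1"
  then have *: "{x \<in> {0..1}. \<not> x < q} = {q..1}" by auto
  show ?thesis unfolding * using q by (subst emeasure_restrict_space) auto
qed

lemma unit_sets: "{x \<in> {0..1}. P x} \<in> sets unit_measure" if "{x. P x} \<in> sets borel"
proof -
  have "{x \<in> {0..1}. P x} = {0..1} \<inter> {x. P x}" by auto
  then show ?thesis using that by (simp add: sets_restrict_space)
qed

context
  fixes G :: "'v ugraph"
begin

interpretation product_prob_space "\<lambda>_::'v. unit_measure" "verts G"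
  by (intro product_prob_spaceI prob_unit)

lemma iid_prob: "prob_space (iid_measure G)"
  unfolding iid_measure_def by (rule prob_space_axioms)

lemma iid_space: "space (iid_measure G) = verts G \<rightarrow>\<^sub>E {0..1}"
  by (simp add: iid_measure_def space_PiM space_restrict_space)

lemma iid_coord: "v \<in> verts G \<Longrightarrow> (\<lambda>\<omega>. \<omega> v) \<in> borel_measurable (iid_measure G)"
proof -
  assume v: "v \<in> verts G"
  have "(\<lambda>\<omega>. \<omega> v) \<in> measurable (iid_measure G) unit_measure"
    unfolding iid_measure_def using v by (rule measurable_component_singleton)
  moreover have "(\<lambda>x. x) \<in> measurable unit_measure borel" by (intro measurable_restrict_space1) simp
  ultimately have "(\<lambda>x. x) \<circ> (\<lambda>\<omega>. \<omega> v) \<in> borel_measurable (iid_measure G)" by (rule measurable_comp)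
  then show ?thesis by (simp add: comp_def)
qed

lemma iid_box:
  assumes "J \<subseteq> verts G" "finite J" "\<And>i. i \<in> J \<Longrightarrow> X i \<in> sets unit_measure"
  shows "measure (iid_measure G) {\<omega> \<in> space (iid_measure G). \<forall>i\<in>J. \<omega> i \<in> X i} = (\<Prod>i\<in>J. measure unit_measure (X i))"
proof -
  have "emeasure (iid_measure G) {\<omega> \<in> space (iid_measure G). \<forall>i\<in>J. \<omega> i \<in> X i} = (\<Prod>i\<in>J. emeasure unit_measure (X i))"
    unfolding iid_measure_def by (rule emeasure_PiM_Collect[OF assms])
  also have "\<dots> = ennreal (\<Prod>i\<in>J. measure unit_measure (X i))"
    using M.emeasure_eq_measure by (simp add: prod_ennreal)
  finally show ?thesis by (simp add: measure_def prod_nonneg)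
qed

lemma iid_indep: 
  assumes "verts G \<noteq> {}"
  shows "prob_space.indep_vars (iid_measure G) (\<lambda>_. unit_measure) (\<lambda>v \<omega>. \<omega> v) (verts G)"
proof -
  interpret I: prob_space "iid_measure G" by (rule iid_prob)
  have rv: "(\<lambda>\<omega>. \<omega> v) \<in> measurable (iid_measure G) unit_measure" if "v \<in> verts G" for v
    unfolding iid_measure_def using that by (rule measurable_component_singleton)
  have "distr (iid_measure G) (\<Pi>\<^sub>M i\<in>verts G. unit_measure) (\<lambda>x. \<lambda>i\<in>verts G. x i) = distr (iid_measure G) (iid_measure G) (\<lambda>x. x)"
    by (rule distr_cong) (auto simp: iid_measure_def space_PiM)
  also have "\<dots> = iid_measure G" by (rule distr_id)
  also have "\<dots> = (\<Pi>\<^sub>M i\<in>verts G. distr (iid_measure G) unit_measure (\<lambda>x. x i))"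
    unfolding iid_measure_def by (rule PiM_cong) (auto simp: PiM_component)
  finally show ?thesis using I.indep_vars_iff_distr_eq_PiM'[OF assms rv] by simp
qed

text \<open>Two given labels that coincide lie in a common interval of a partition of the unit
  interval into pieces of length 1/m, which has a probability of order 1/m.\<close>

lemma iid_inj:
  assumes "countable (verts G)"
  shows "AE \<omega> in iid_measure G. inj_on \<omega> (verts G)"
    and "{\<omega> \<in> space (iid_measure G). inj_on \<omega> (verts G)} \<in> sets (iid_measure G)"
proof -
  interpret I: prob_space "iid_measure G" by (rule iid_prob)
  have meas: "{\<omega> \<in> space (iid_measure G). \<omega> v = \<omega> w} \<in> sets (iid_measure G)" if "v \<in> verts G" "w \<in> verts G" for v w
    by (rule borel_measurable_eq[OF iid_coord[OF that(1)] iid_coord[OF that(2)]])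
  have null: "AE \<omega> in iid_measure G. \<omega> v \<noteq> \<omega> w" if vw: "v \<in> verts G" "w \<in> verts G" "v \<noteq> w" for v w
  proof -
    let ?E = "{\<omega> \<in> space (iid_measure G). \<omega> v = \<omega> w}"
    have le: "I.prob ?E \<le> 2 / real (Suc N)" for N
    proof -
      let ?n = "real (Suc N)"
      define C where "C j = {x \<in> {0..1::real}. real j / ?n \<le> x \<and> x \<le> real (Suc j) / ?n}" for j :: nat
      have Cs: "C j \<in> sets unit_measure" for j unfolding C_def by (rule unit_sets) simp
      have Cm: "measure unit_measure (C j) \<le> 1 / ?n" for j
      proof -
        have "measure unit_measure (C j) = measure lborel (C j)"
          by (rule measure_restrict_space) (auto simp: C_def)
        also have "\<dots> \<le> measure lborel {real j / ?n .. real (Suc j) / ?n}"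
          by (rule measure_mono_fmeasurable) (auto simp: C_def fmeasurable_def emeasure_lborel_Icc_eq)
        also have "\<dots> = 1 / ?n" by (simp add: diff_divide_distrib[symmetric] divide_right_mono)
        finally show ?thesis .
      qed
      define F where "F j = {\<omega> \<in> space (iid_measure G). \<forall>i\<in>{v, w}. \<omega> i \<in> C j}" for j
      have Fs: "F j \<in> sets (iid_measure G)" for j
      proof -
        have "(\<lambda>\<omega>. \<omega> i) -` C j \<inter> space (iid_measure G) \<in> sets (iid_measure G)" if "i \<in> {v, w}" for i
          by (rule measurable_sets[of _ _ unit_measure, OF _ Cs])
            (use that vw in \<open>auto simp: iid_measure_def intro!: measurable_component_singleton\<close>)
        then have "(\<Inter>i\<in>{v, w}. (\<lambda>\<omega>. \<omega> i) -` C j \<inter> space (iid_measure G)) \<in> sets (iid_measure G)"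
          by (intro sets.finite_INT) auto
        moreover have "F j = (\<Inter>i\<in>{v, w}. (\<lambda>\<omega>. \<omega> i) -` C j \<inter> space (iid_measure G))" by (auto simp: F_def)
        ultimately show ?thesis by simp
      qed
      have Fm: "I.prob (F j) \<le> 1 / ?n * (1 / ?n)" for j
      proof -
        have "I.prob (F j) = measure unit_measure (C j) * measure unit_measure (C j)"
          unfolding F_def using iid_box[of "{v, w}" "\<lambda>_. C j"] Cs vw by simp
        also have "\<dots> \<le> 1 / ?n * (1 / ?n)" by (rule mult_mono[OF Cm Cm]) auto
        finally show ?thesis .
      qed
      have "?E \<subseteq> (\<Union>j\<le>Suc N. F j)"
      proof
        fix \<omega> assume w: "\<omega> \<in> ?E"
        then have x: "\<omega> v \<in> {0..1}" "\<omega> w = \<omega> v" using vw by (auto simp: iid_space)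
        let ?j = "nat \<lfloor>\<omega> v * ?n\<rfloor>"
        have "\<omega> v * ?n \<le> ?n" using x by (simp add: mult_left_le_one_le)
        then have "?j \<le> Suc N" by linarith
        moreover have "real ?j \<le> \<omega> v * ?n" "\<omega> v * ?n \<le> real (Suc ?j)" using x by (auto, linarith)
        then have "\<omega> v \<in> C ?j" using x by (auto simp: C_def field_simps)
        ultimately show "\<omega> \<in> (\<Union>j\<le>Suc N. F j)" using w x unfolding F_def by auto
      qed
      then have "I.prob ?E \<le> I.prob (\<Union>j\<le>Suc N. F j)" by (rule I.finite_measure_mono) (use Fs in auto)
      also have "\<dots> \<le> (\<Sum>j\<le>Suc N. I.prob (F j))" by (rule I.finite_measure_subadditive_finite) (use Fs in auto)
      also have "\<dots> \<le> (\<Sum>j\<le>Suc N. 1 / ?n * (1 / ?n))" by (rule sum_mono) (rule Fm)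
      also have "\<dots> = (?n + 1) / (?n * ?n)" by (simp add: field_simps)
      also have "\<dots> \<le> (2 * ?n) / (?n * ?n)" by (rule divide_right_mono) auto
      also have "\<dots> = 2 / ?n" by (rule mult_divide_mult_cancel_right) simp
      finally show ?thesis .
    qed
    have "(\<lambda>N. 2 / real (Suc N)) \<longlonglongrightarrow> 0" by (rule LIMSEQ_Suc[OF lim_const_over_n])
    then have "I.prob ?E \<le> 0" by (rule LIMSEQ_le_const) (use le in auto)
    then have "I.prob ?E = 0" using measure_nonneg[of "iid_measure G" ?E] by linarith
    then have "AE \<omega> in iid_measure G. \<omega> \<notin> ?E"
      using meas[OF vw(1,2)] I.emeasure_eq_measure[of ?E] by (intro AE_not_in) (auto simp: null_sets_def)
    then show ?thesis using AE_space by eventually_elim auto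
  qed
  have "AE \<omega> in iid_measure G. v \<noteq> w \<longrightarrow> \<omega> v \<noteq> \<omega> w" if "v \<in> verts G" "w \<in> verts G" for v w
    using null[OF that] by (cases "v = w") auto
  then have "AE \<omega> in iid_measure G. \<forall>v\<in>verts G. \<forall>w\<in>verts G. v \<noteq> w \<longrightarrow> \<omega> v \<noteq> \<omega> w"
    by (simp add: AE_ball_countable[OF assms])
  then show "AE \<omega> in iid_measure G. inj_on \<omega> (verts G)"
    by eventually_elim (auto simp: inj_on_def)
  have "{\<omega> \<in> space (iid_measure G). inj_on \<omega> (verts G)} =
      {\<omega> \<in> space (iid_measure G). \<forall>v\<in>verts G. \<forall>w\<in>verts G. v \<noteq> w \<longrightarrow> \<not> \<omega> v = \<omega> w}" by (auto simp: inj_on_def)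
  also have "\<dots> \<in> sets (iid_measure G)"
    by (intro sets_countable_ball assms sets.sets_Collect_imp sets.sets_Collect_neg meas) auto
  finally show "{\<omega> \<in> space (iid_measure G). inj_on \<omega> (verts G)} \<in> sets (iid_measure G)" .
qed

lemma iid_below_sets: "v \<in> verts G \<Longrightarrow> {\<omega> \<in> space (iid_measure G). \<omega> v < (q::real)} \<in> sets (iid_measure G)"
  by (rule borel_measurable_less[OF iid_coord]) simp_all

lemma iid_less_sets: "v \<in> verts G \<Longrightarrow> w \<in> verts G \<Longrightarrow> {\<omega> \<in> space (iid_measure G). \<omega> v < \<omega> w} \<in> sets (iid_measure G)"
  using iid_coord[of v] iid_coord[of w] by (rule borel_measurable_less)

definition lone :: "'v set \<Rightarrow> 'v set \<Rightarrow> real \<Rightarrow> ('v \<Rightarrow> real) \<Rightarrow> bool" where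
  "lone b J q \<omega> \<longleftrightarrow> (\<exists>c\<in>b. \<omega> c < q \<and> (\<forall>y\<in>J - {c}. \<not> \<omega> y < q))"

lemma lone_sets:
  assumes "J \<subseteq> verts G" "finite J" "b \<subseteq> J"
  shows "{\<omega> \<in> space (iid_measure G). lone b J q \<omega>} \<in> sets (iid_measure G)"
proof -
  have "{\<omega> \<in> space (iid_measure G). \<omega> c < q \<and> (\<forall>y\<in>J - {c}. \<not> \<omega> y < q)} \<in> sets (iid_measure G)" if "c \<in> b" for c
  proof (rule sets.sets_Collect_conj)
    show "{\<omega> \<in> space (iid_measure G). \<omega> c < q} \<in> sets (iid_measure G)"
      using that assms by (intro iid_below_sets) auto
    have "{\<omega> \<in> space (iid_measure G). \<not> \<omega> y < q} \<in> sets (iid_measure G)" if "y \<in> J" for y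
      using that assms by (intro sets.sets_Collect_neg iid_below_sets) auto
    then show "{\<omega> \<in> space (iid_measure G). \<forall>y\<in>J - {c}. \<not> \<omega> y < q} \<in> sets (iid_measure G)"
      by (intro sets_countable_ball) (use assms in \<open>auto intro: countable_finite\<close>)
  qed
  then show ?thesis unfolding lone_def using finite_subset[OF assms(3,2)]
    by (intro sets_countable_bex) (auto intro: countable_finite)
qed

text \<open>The events for different positions of the lone vertex are disjoint, and each has
  probability at least q (1 - |J| q) \<ge> q / 2 by Bernoulli's inequality.\<close>

lemma lone_prob:
  assumes J: "J \<subseteq> verts G" "finite J" "b \<subseteq> J" and q: "0 \<le> q" "q \<le> 1" "real (card J) * q \<le> 1 / 2"
  shows "measure (iid_measure G) {\<omega> \<in> space (iid_measure G). lone b J q \<omega>} \<ge> real (card b) * q / 2"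
proof -
  interpret I: prob_space "iid_measure G" by (rule iid_prob)
  have fb: "finite b" using J finite_subset by blast
  define X where "X c y = (if y = c then {x \<in> {0..1}. x < q} else {x \<in> {0..1::real}. \<not> x < q})" for c y :: 'v
  define F where "F c = {\<omega> \<in> space (iid_measure G). \<forall>y\<in>J. \<omega> y \<in> X c y}" for c
  have Xs: "X c y \<in> sets unit_measure" for c y
    using unit_sets[of "\<lambda>x. x < q"] unit_sets[of "\<lambda>x. \<not> x < q"] unfolding X_def by (cases "y = c") (auto simp: not_less)
  have Feq: "F c = {\<omega> \<in> space (iid_measure G). \<omega> c < q \<and> (\<forall>y\<in>J - {c}. \<not> \<omega> y < q)}" if "c \<in> J" for c
    using that J(1) by (auto simp: F_def X_def iid_space)
  have un: "{\<omega> \<in> space (iid_measure G). lone b J q \<omega>} = (\<Union>c\<in>b. F c)"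
    using Feq J(3) by (auto simp: lone_def)
  have Fs: "F c \<in> sets (iid_measure G)" if "c \<in> b" for c
    using lone_sets[of J "{c}" q] J that Feq[of c] by (auto simp: lone_def)
  have mX: "measure unit_measure (X c y) = (if y = c then q else 1 - q)" for c y
    using unit_below[OF q(1,2)] unit_above[OF q(1,2)] q by (simp add: X_def measure_def)
  have FP: "I.prob (F c) \<ge> q / 2" if c: "c \<in> b" for c
  proof -
    have cJ: "c \<in> J" using c J by blast
    have "I.prob (F c) = (\<Prod>y\<in>J. if y = c then q else 1 - q)"
      unfolding F_def by (subst iid_box[OF J(1,2) Xs]) (simp add: mX)
    also have "\<dots> = q * (\<Prod>y\<in>J - {c}. if y = c then q else 1 - q)" using J(2) cJ by (subst prod.remove[of J c]) auto
    also have "(\<Prod>y\<in>J - {c}. if y = c then q else 1 - q) = (\<Prod>y\<in>J - {c}. 1 - q)" by (rule prod.cong) auto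
    also have "\<dots> = (1 - q) ^ card (J - {c})" by simp
    finally have eq: "I.prob (F c) = q * (1 - q) ^ card (J - {c})" .
    have "card (J - {c}) \<le> card J" using J by (intro card_mono) auto
    then have "real (card (J - {c})) * q \<le> 1 / 2" using q mult_right_mono[of "real (card (J - {c}))" "real (card J)" q] by simp
    moreover have "1 + real (card (J - {c})) * (- q) \<le> (1 + (- q)) ^ card (J - {c})"
      by (rule Bernoulli_inequality) (use q in simp)
    ultimately have "1 / 2 \<le> (1 - q) ^ card (J - {c})" by simp
    then show ?thesis unfolding eq using mult_left_mono[of "1 / 2" "(1 - q) ^ card (J - {c})" q] q by simp
  qed
  have dis: "disjoint_family_on F b"
    unfolding disjoint_family_on_def
  proof (intro ballI impI)
    fix c c' assume cc: "c \<in> b" "c' \<in> b" "c \<noteq> c'"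
    then have "c \<in> J" "c' \<in> J" using J by auto
    then show "F c \<inter> F c' = {}" unfolding Feq[OF \<open>c \<in> J\<close>] Feq[OF \<open>c' \<in> J\<close>] using cc by auto
  qed
  have "I.prob (\<Union>c\<in>b. F c) = (\<Sum>c\<in>b. I.prob (F c))"
    by (rule I.finite_measure_finite_Union) (use fb Fs dis in auto)
  also have "\<dots> \<ge> (\<Sum>c\<in>b. q / 2)" by (rule sum_mono) (rule FP)
  finally show ?thesis unfolding un by simp
qed

end

text \<open>Lets an event that depends on the labels in J be studied in the product over J
  alone.\<close>

lemma iid_finite_verts: "iid_measure \<lparr>verts = J, edges = {}\<rparr> = (\<Pi>\<^sub>M v\<in>J. unit_measure)"
  by (simp add: iid_measure_def)

text \<open>The n-th event depends on the labels in J n only.\<close>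

lemma lone_indep:
  fixes G :: "'v ugraph"
  assumes J: "\<And>n. J n \<subseteq> verts G" "\<And>n. finite (J n)" "\<And>n. b n \<subseteq> J n" "disjoint_family J"
    and N: "finite N" "N \<noteq> {}" "verts G \<noteq> {}"
  shows "measure (iid_measure G) (\<Inter>n\<in>N. {\<omega> \<in> space (iid_measure G). \<not> lone (b n) (J n) (q n) \<omega>}) =
    (\<Prod>n\<in>N. measure (iid_measure G) {\<omega> \<in> space (iid_measure G). \<not> lone (b n) (J n) (q n) \<omega>})"
proof -
  interpret I: prob_space "iid_measure G" by (rule iid_prob)
  have ind: "I.indep_vars (\<lambda>j. PiM (J j) (\<lambda>_. unit_measure)) (\<lambda>j \<omega>. restrict (\<lambda>i. \<omega> i) (J j)) N"
    by (rule I.indep_vars_restrict[OF iid_indep[OF N(3)]])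
      (use J in \<open>auto simp: disjoint_family_on_def\<close>)
  define A where "A n = {\<omega> \<in> space (PiM (J n) (\<lambda>_. unit_measure)). \<not> lone (b n) (J n) (q n) \<omega>}" for n
  have As: "A n \<in> sets (PiM (J n) (\<lambda>_. unit_measure))" for n
    unfolding A_def using lone_sets[of "J n" "\<lparr>verts = J n, edges = {}\<rparr>" "b n" "q n"] J
    by (intro sets.sets_Collect_neg) (simp add: iid_finite_verts)
  have lr: "lone (b n) (J n) (q n) (restrict \<omega> (J n)) = lone (b n) (J n) (q n) \<omega>" for n \<omega>
    unfolding lone_def using J(3)[of n] by (intro bex_cong) (auto simp: subset_iff)
  have sp: "restrict \<omega> (J n) \<in> space (PiM (J n) (\<lambda>_. unit_measure))" if "\<omega> \<in> space (iid_measure G)" for n \<omega>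
    using that J(1)[of n] by (auto simp: iid_space space_PiM space_restrict_space)
  have eq: "(\<lambda>\<omega>. restrict (\<lambda>i. \<omega> i) (J n)) -` A n \<inter> space (iid_measure G) = {\<omega> \<in> space (iid_measure G). \<not> lone (b n) (J n) (q n) \<omega>}" for n
    using sp by (auto simp: A_def lr)
  have "I.prob (\<Inter>n\<in>N. (\<lambda>\<omega>. restrict (\<lambda>i. \<omega> i) (J n)) -` A n \<inter> space (iid_measure G)) =
     (\<Prod>n\<in>N. I.prob ((\<lambda>\<omega>. restrict (\<lambda>i. \<omega> i) (J n)) -` A n \<inter> space (iid_measure G)))"
    by (rule I.indep_varsD[OF ind N(2,1) order_refl]) (rule As)
  then show ?thesis unfolding eq .
qed

context phased_graph
begin

section \<open>Every vertex is reached\<close>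

text \<open>A lone vertex near x is a centre, provided that no vertex of S competes with it. The
  set S, later the ball of the previous scale, is what makes the events of different scales
  depend on disjoint sets of labels.\<close>

lemma alone_reg:
  assumes x: "x \<in> V" and lone: "lone (B x (r m) - S) (B x (9 * r m) - S) (p m) \<omega>"
    and S: "\<forall>y\<in>S. \<not> \<omega> y < p m"
  shows "x \<in> region (Suc m) \<omega>"
proof -
  obtain c where c: "c \<in> B x (r m)" "\<omega> c < p m" "\<forall>y\<in>B x (9 * r m) - S - {c}. \<not> \<omega> y < p m"
    using lone by (auto simp: lone_def)
  have "c' = c" if c': "\<omega> c' < p m" "c' \<in> B c (8 * r m)" for c'
  proof -
    have "c' \<in> B x (9 * r m)" using ball_trans_le[OF c(1) c'(2)] by simp
    then show ?thesis using c(3) S c' by blast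
  qed
  then have "c \<in> centres m \<omega>" using c ball_verts[OF x] by (auto simp: centres_def)
  then have "x \<in> zone m \<omega> (region m \<omega>)" using ball_sym[OF c(1)] unfolding zone_def by blast
  then have "x \<in> fresh m \<omega> (region m \<omega>)" using zone_fresh by blast
  then show ?thesis using fresh_in_grow by simp
qed

lemma r_mono: "m \<le> n \<Longrightarrow> r m \<le> r n"
proof (induction n rule: dec_induct)
  case (step n) then show ?case using r_Suc[of n] by linarith
qed simp

text \<open>If x is missed at scale n + 1, then, apart from the ball of scale n, there is no
  lone candidate for a centre near x, or this ball contains a candidate itself. The annuli of
  different scales are disjoint, so the first kind of failure is independent over the scales and
  has probability at most 1 - \<delta> each; the second kind is summable. Failure at N + 1
  consecutive scales from N + 1 on thus has a probability that tends to 0.\<close>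

lemma AE_reached:
  assumes x: "x \<in> V" and \<delta>: "0 < \<delta>" "\<delta> \<le> 1" and p: "\<And>n. 0 \<le> p n" "\<And>n. p n \<le> 1"
    and small: "\<And>n. real (card (B x (9 * r n))) * p n \<le> 1 / 2"
    and rare: "\<And>n. real (card (B x (9 * r n))) * p (Suc n) \<le> (1 / 2) ^ n"
    and dense: "\<And>n. real (card (B x (r (Suc n)) - B x (9 * r n))) * p (Suc n) / 2 \<ge> \<delta>"
  shows "AE \<omega> in iid_measure G. \<exists>n. x \<in> region n \<omega>"
proof -
  let ?I = "iid_measure G"
  interpret I: prob_space ?I by (rule iid_prob)
  define b where "b n = B x (r (Suc n)) - B x (9 * r n)" for n
  define J where "J n = B x (9 * r (Suc n)) - B x (9 * r n)" for n
  define q where "q n = p (Suc n)" for n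
  define L where "L n = {\<omega> \<in> space ?I. \<not> lone (b n) (J n) (q n) \<omega>}" for n
  define Dv where "Dv n = {\<omega> \<in> space ?I. \<exists>y\<in>B x (9 * r n). \<omega> y < q n}" for n
  have J: "J n \<subseteq> V" "finite (J n)" "b n \<subseteq> J n" for n
  proof -
    show "J n \<subseteq> V" using ball_verts[OF x] by (auto simp: J_def)
    show "finite (J n)" using finite_ball[OF x] by (simp add: J_def)
    show "b n \<subseteq> J n" using ball_mono[of "r (Suc n)" "9 * r (Suc n)" x] by (auto simp: b_def J_def)
  qed
  have disj: "disjoint_family J"
  proof -
    have "J m \<inter> J n = {}" if "m < n" for m n
    proof -
      have "B x (9 * r (Suc m)) \<subseteq> B x (9 * r n)" using r_mono[of "Suc m" n] that by (intro ball_mono) simp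
      then show ?thesis by (auto simp: J_def)
    qed
    then show ?thesis unfolding disjoint_family_on_def by (metis Int_commute linorder_neqE_nat)
  qed
  have lone_s: "{\<omega> \<in> space ?I. lone (b n) (J n) (q n) \<omega>} \<in> sets ?I" for n by (rule lone_sets[OF J])
  have L_s: "L n \<in> sets ?I" for n unfolding L_def using lone_s by (rule sets.sets_Collect_neg)
  have Dv_s: "Dv n \<in> sets ?I" for n
    unfolding Dv_def using finite_ball[OF x] ball_verts[OF x]
    by (intro sets_countable_bex iid_below_sets) (auto intro: countable_finite)
  have L_p: "I.prob (L n) \<le> 1 - \<delta>" for n
  proof -
    have "card (J n) \<le> card (B x (9 * r (Suc n)))" unfolding J_def by (rule card_mono) (use finite_ball[OF x] in auto)
    then have "real (card (J n)) * q n \<le> real (card (B x (9 * r (Suc n)))) * q n"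
      by (intro mult_right_mono) (use p in \<open>auto simp: q_def\<close>)
    then have "real (card (J n)) * q n \<le> 1 / 2" using small[of "Suc n"] by (simp add: q_def)
    then have "I.prob {\<omega> \<in> space ?I. lone (b n) (J n) (q n) \<omega>} \<ge> real (card (b n)) * q n / 2"
      by (intro lone_prob J) (use p in \<open>auto simp: q_def\<close>)
    then have "I.prob {\<omega> \<in> space ?I. lone (b n) (J n) (q n) \<omega>} \<ge> \<delta>" using dense[of n] by (simp add: b_def q_def)
    moreover have "L n = space ?I - {\<omega> \<in> space ?I. lone (b n) (J n) (q n) \<omega>}" by (auto simp: L_def)
    ultimately show ?thesis using I.prob_compl[OF lone_s[of n]] by simp
  qed
  have Dv_p: "I.prob (Dv n) \<le> (1 / 2) ^ n" for n
  proof -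
    have single: "I.prob {\<omega> \<in> space ?I. \<omega> y < q n} = q n" if "y \<in> V" for y
    proof -
      have "{\<omega> \<in> space ?I. \<omega> y < q n} = {\<omega> \<in> space ?I. \<forall>i\<in>{y}. \<omega> i \<in> {z \<in> {0..1}. z < q n}}"
        using that by (auto simp: iid_space)
      also have "I.prob \<dots> = measure unit_measure {z \<in> {0..1}. z < q n}"
        using iid_box[of "{y}" G "\<lambda>_. {z \<in> {0..1}. z < q n}"] that unit_sets[of "\<lambda>z. z < q n"] by simp
      also have "\<dots> = q n" using unit_below[of "q n"] p by (simp add: measure_def q_def)
      finally show ?thesis .
    qed
    have "Dv n = (\<Union>y\<in>B x (9 * r n). {\<omega> \<in> space ?I. \<omega> y < q n})" by (auto simp: Dv_def)
    also have "I.prob \<dots> \<le> (\<Sum>y\<in>B x (9 * r n). I.prob {\<omega> \<in> space ?I. \<omega> y < q n})"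
      using finite_ball[OF x] iid_below_sets[OF ball_verts[OF x]]
      by (intro I.finite_measure_subadditive_finite) blast+
    also have "\<dots> = real (card (B x (9 * r n))) * q n" using single ball_verts[OF x] by simp
    finally show ?thesis using rare[of n] by (simp add: q_def)
  qed
  define Bad where "Bad = (\<Inter>n. L n \<union> Dv n)"
  have Bad_s: "Bad \<in> sets ?I" unfolding Bad_def using L_s Dv_s by (intro sets.countable_INT) auto
  have bound: "I.prob Bad \<le> (1 - \<delta>) ^ Suc N + real (Suc N) * (1 / 2) ^ Suc N" for N
  proof -
    let ?S = "{Suc N..<Suc N + Suc N}"
    have fs: "(\<Inter>n\<in>?S. L n) \<in> sets ?I" "(\<Union>n\<in>?S. Dv n) \<in> sets ?I"
      using L_s Dv_s by (auto intro!: sets.finite_INT)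
    have "Bad \<subseteq> (\<Inter>n\<in>?S. L n) \<union> (\<Union>n\<in>?S. Dv n)" by (auto simp: Bad_def)
    then have "I.prob Bad \<le> I.prob ((\<Inter>n\<in>?S. L n) \<union> (\<Union>n\<in>?S. Dv n))"
      by (rule I.finite_measure_mono) (use fs in auto)
    also have "\<dots> \<le> I.prob (\<Inter>n\<in>?S. L n) + I.prob (\<Union>n\<in>?S. Dv n)" by (rule measure_Un_le[OF fs])
    also have "I.prob (\<Inter>n\<in>?S. L n) = (\<Prod>n\<in>?S. I.prob (L n))"
      unfolding L_def by (rule lone_indep[OF J disj]) (use x in auto)
    also have "\<dots> \<le> (\<Prod>n\<in>?S. 1 - \<delta>)" by (rule prod_mono) (use L_p in auto)
    also have "\<dots> = (1 - \<delta>) ^ Suc N" by simp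
    also have "I.prob (\<Union>n\<in>?S. Dv n) \<le> (\<Sum>n\<in>?S. I.prob (Dv n))"
      by (rule I.finite_measure_subadditive_finite) (use Dv_s in auto)
    also have "\<dots> \<le> (\<Sum>n\<in>?S. (1 / 2) ^ Suc N)"
    proof (rule sum_mono)
      fix n assume "n \<in> ?S"
      then have "(1 / 2 :: real) ^ n \<le> (1 / 2) ^ Suc N" by (intro power_decreasing) auto
      then show "I.prob (Dv n) \<le> (1 / 2) ^ Suc N" using Dv_p[of n] by linarith
    qed
    also have "\<dots> = real (Suc N) * (1 / 2) ^ Suc N" by simp
    finally show ?thesis by simp
  qed
  have "(\<lambda>n. (1 - \<delta>) ^ n + real n * (1 / 2) ^ n) \<longlonglongrightarrow> 0 + 0"
    by (intro tendsto_add LIMSEQ_power_zero powser_times_n_limit_0) (use \<delta> in auto)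
  then have "(\<lambda>N. (1 - \<delta>) ^ Suc N + real (Suc N) * (1 / 2) ^ Suc N) \<longlonglongrightarrow> 0 + 0" by (rule LIMSEQ_Suc)
  then have "I.prob Bad \<le> 0 + 0" by (rule LIMSEQ_le_const) (use bound in auto)
  then have "I.prob Bad = 0" using measure_nonneg[of ?I Bad] by linarith
  then have "AE \<omega> in ?I. \<omega> \<notin> Bad"
    using Bad_s I.emeasure_eq_measure[of Bad] by (intro AE_not_in) (auto simp: null_sets_def)
  then show ?thesis using AE_space
  proof eventually_elim
    case (elim \<omega>)
    then obtain n where "\<omega> \<notin> L n" "\<omega> \<notin> Dv n" by (auto simp: Bad_def)
    then have "lone (b n) (J n) (q n) \<omega>" "\<forall>y\<in>B x (9 * r n). \<not> \<omega> y < p (Suc n)"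
      using elim by (auto simp: L_def Dv_def q_def)
    then show ?case using alone_reg[OF x, of "Suc n"] unfolding b_def J_def q_def by blast
  qed
qed

section \<open>Measurability\<close>

text \<open>A function that is determined by finitely many comparisons of labels in a ball is
  measurable: countably many patterns of such comparisons exist, and each is a measurable
  condition.\<close>

lemma local_measurable:
  assumes A: "A \<in> sets (iid_measure G)" and x: "x \<in> V"
    and loc: "\<And>\<omega>. \<omega> \<in> A \<Longrightarrow> \<exists>R. \<forall>\<omega>'\<in>A. alike (\<lambda>x. x) (B x R) R \<omega> \<omega>' \<longrightarrow> F \<omega>' = F \<omega>"
  shows "{\<omega> \<in> A. F \<omega> = y} \<in> sets (iid_measure G)"
proof -
  define pat where "pat R \<omega> = ({(v, w) \<in> B x R \<times> B x R. \<omega> v < \<omega> w}, {(v, m) \<in> B x R \<times> {..R}. \<omega> v < p m})"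
    for R :: nat and \<omega> :: "'v \<Rightarrow> real"
  define PP where "PP R = Pow (B x R \<times> B x R) \<times> Pow (B x R \<times> {..R})" for R :: nat
  define good where "good R = {P \<in> PP R. \<forall>\<omega>\<in>A. pat R \<omega> = P \<longrightarrow> F \<omega> = y}" for R
  have finP: "finite (PP R)" for R unfolding PP_def using finite_ball[OF x] by simp
  have cell: "{\<omega> \<in> A. pat R \<omega> = P} \<in> sets (iid_measure G)" for R P
  proof -
    obtain P1 P2 where P: "P = (P1, P2)" by force
    have Asp: "A \<subseteq> space (iid_measure G)" using A sets.sets_into_space by blast
    have s1: "{\<omega> \<in> space (iid_measure G). (\<omega> (fst z) < \<omega> (snd z)) = (z \<in> P1)} \<in> sets (iid_measure G)"
      if "z \<in> B x R \<times> B x R" for z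
    proof (cases "z \<in> P1")
      case True
      then show ?thesis using iid_less_sets[of "fst z" G "snd z"] that ball_verts[OF x] by auto
    next
      case False
      then show ?thesis using sets.sets_Collect_neg[OF iid_less_sets[of "fst z" G "snd z"]] that ball_verts[OF x] by auto
    qed
    have s2: "{\<omega> \<in> space (iid_measure G). (\<omega> (fst z) < p (snd z)) = (z \<in> P2)} \<in> sets (iid_measure G)"
      if "z \<in> B x R \<times> {..R}" for z
    proof (cases "z \<in> P2")
      case True
      then show ?thesis using iid_below_sets[of "fst z" G "p (snd z)"] that ball_verts[OF x] by auto
    next
      case False
      then show ?thesis using sets.sets_Collect_neg[OF iid_below_sets[of "fst z" G "p (snd z)"]] that ball_verts[OF x] by auto
    qed
    show ?thesis
    proof (cases "P \<in> PP R")
      case True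
      then have "{\<omega> \<in> A. pat R \<omega> = P} = A \<inter> {\<omega> \<in> space (iid_measure G). \<forall>z\<in>B x R \<times> B x R. (\<omega> (fst z) < \<omega> (snd z)) = (z \<in> P1)}
          \<inter> {\<omega> \<in> space (iid_measure G). \<forall>z\<in>B x R \<times> {..R}. (\<omega> (fst z) < p (snd z)) = (z \<in> P2)}"
        using Asp unfolding P pat_def PP_def by (auto; blast)
      moreover have "\<dots> \<in> sets (iid_measure G)"
        using finite_ball[OF x] s1 s2 A by (intro sets.Int sets_countable_ball) (auto intro: countable_finite)
      ultimately show ?thesis by simp
    next
      case False
      have "pat R \<omega> \<in> PP R" for \<omega> by (auto simp: pat_def PP_def)
      then have "{\<omega> \<in> A. pat R \<omega> = P} = {}" using False by blast
      then show ?thesis by (simp only: sets.empty_sets)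
    qed
  qed
  have alike_pat: "alike (\<lambda>x. x) (B x R) R \<omega> \<omega>'" if "pat R \<omega> = pat R \<omega>'" for R \<omega> \<omega>'
  proof -
    have 1: "{(v, w) \<in> B x R \<times> B x R. \<omega> v < \<omega> w} = {(v, w) \<in> B x R \<times> B x R. \<omega>' v < \<omega>' w}"
      and 2: "{(v, m) \<in> B x R \<times> {..R}. \<omega> v < p m} = {(v, m) \<in> B x R \<times> {..R}. \<omega>' v < p m}"
      using that by (auto simp: pat_def)
    have "\<omega> v < \<omega> w \<longleftrightarrow> \<omega>' v < \<omega>' w" if "v \<in> B x R" "w \<in> B x R" for v w
      using that arg_cong[OF 1, of "\<lambda>S. (v, w) \<in> S"] by simp
    moreover have "\<omega> v < p m \<longleftrightarrow> \<omega>' v < p m" if "v \<in> B x R" "m \<le> R" for v m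
      using that arg_cong[OF 2, of "\<lambda>S. (v, m) \<in> S"] by simp
    ultimately show ?thesis by (simp add: alike_def)
  qed
  have "{\<omega> \<in> A. F \<omega> = y} = (\<Union>R. \<Union>P\<in>good R. {\<omega> \<in> A. pat R \<omega> = P})"
  proof (intro equalityI subsetI)
    fix \<omega> assume w: "\<omega> \<in> {\<omega> \<in> A. F \<omega> = y}"
    then obtain R where R: "\<forall>\<omega>'\<in>A. alike (\<lambda>x. x) (B x R) R \<omega> \<omega>' \<longrightarrow> F \<omega>' = F \<omega>" using loc by blast
    have "pat R \<omega> \<in> good R" unfolding good_def
    proof (intro CollectI conjI ballI impI)
      show "pat R \<omega> \<in> PP R" by (auto simp: pat_def PP_def)
      fix \<omega>' assume "\<omega>' \<in> A" "pat R \<omega>' = pat R \<omega>"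
      then show "F \<omega>' = y" using R alike_pat[of R \<omega> \<omega>'] w by auto
    qed
    then show "\<omega> \<in> (\<Union>R. \<Union>P\<in>good R. {\<omega> \<in> A. pat R \<omega> = P})" using w by blast
  qed (auto simp: good_def)
  moreover have "(\<Union>P\<in>good R. {\<omega> \<in> A. pat R \<omega> = P}) \<in> sets (iid_measure G)" for R
    using cell finP finite_subset[of "good R" "PP R"] by (intro sets.finite_UN) (auto simp: good_def)
  ultimately show ?thesis by auto
qed

text \<open>The factor is defined on the settled labels; all its properties were shown for each
  of them.\<close>

lemma factor:
  assumes count: "countable V" and reached: "\<And>x. x \<in> V \<Longrightarrow> AE \<omega> in iid_measure G. \<exists>n. x \<in> region n \<omega>"
  shows "\<exists>A \<Phi>. aut_factor G d A \<Phi> \<and> finitary G A \<Phi> \<and>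
    (AE \<omega> in iid_measure G. schreier_decoration G d (\<Phi> \<omega>)) \<and>
    (AE \<omega> in iid_measure G. \<not> (\<exists>x. infinite_monochromatic_path G (\<Phi> \<omega>) x))"
proof -
  let ?I = "iid_measure G"
  define A where "A = {\<omega> \<in> space ?I. settled \<omega>}"
  define A0 where "A0 = {\<omega> \<in> space ?I. inj_on \<omega> V}"
  have A0: "A0 \<in> sets ?I" unfolding A0_def by (rule iid_inj(2)[OF count])
  have "{\<omega> \<in> A0. x \<in> region n \<omega>} \<in> sets ?I" if x: "x \<in> V" for x n
  proof -
    have "{\<omega> \<in> A0. (x \<in> region n \<omega>) = True} \<in> sets ?I"
    proof (rule local_measurable[OF A0 x])
      fix \<omega> assume "\<omega> \<in> A0"
      show "\<exists>R. \<forall>\<omega>'\<in>A0. alike (\<lambda>x. x) (B x R) R \<omega> \<omega>' \<longrightarrow> (x \<in> region n \<omega>') = (x \<in> region n \<omega>)"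
      proof (intro exI[of _ "reach n + n"] ballI impI)
        fix \<omega>' assume w: "\<omega>' \<in> A0" "alike (\<lambda>x. x) (B x (reach n + n)) (reach n + n) \<omega> \<omega>'"
        have "nb (reach n) {x} \<subseteq> B x (reach n + n)" using ball_mono[of "reach n" "reach n + n" x] by (auto simp: nb_def)
        then have "alike (\<lambda>x. x) (nb (reach n) {x}) n \<omega> \<omega>'" by (rule alike_mono[OF w(2)]) simp
        from reg_col_alike[OF id_aut _ _ this] show "(x \<in> region n \<omega>') = (x \<in> region n \<omega>)"
          using w x by (auto simp: A0_def)
      qed
    qed
    then show ?thesis by simp
  qed
  then have "(\<Union>n. {\<omega> \<in> A0. x \<in> region n \<omega>}) \<in> sets ?I" if "x \<in> V" for x using that by auto
  moreover have "(\<Union>n. {\<omega> \<in> A0. x \<in> region n \<omega>}) = {\<omega> \<in> space ?I. inj_on \<omega> V \<and> (\<exists>n. x \<in> region n \<omega>)}" for x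
    by (auto simp: A0_def)
  ultimately have "{\<omega> \<in> space ?I. inj_on \<omega> V \<and> (\<exists>n. x \<in> region n \<omega>)} \<in> sets ?I" if "x \<in> V" for x
    using that by simp
  then have "{\<omega> \<in> space ?I. \<forall>x\<in>V. inj_on \<omega> V \<and> (\<exists>n. x \<in> region n \<omega>)} \<in> sets ?I"
    by (intro sets_countable_ball[OF count])
  moreover have "A = A0 \<inter> {\<omega> \<in> space ?I. \<forall>x\<in>V. inj_on \<omega> V \<and> (\<exists>n. x \<in> region n \<omega>)}"
    by (auto simp: A_def A0_def settled_def)
  ultimately have A: "A \<in> sets ?I" using A0 by simp
  have "AE \<omega> in ?I. \<forall>x\<in>V. \<exists>n. x \<in> region n \<omega>" using reached by (simp add: AE_ball_countable[OF count])
  then have AE: "AE \<omega> in ?I. settled \<omega>"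
    using iid_inj(1)[OF count] by eventually_elim (simp add: settled_def)
  have Asp: "A \<subseteq> space ?I" by (auto simp: A_def)
  have null: "space ?I - A \<in> null_sets ?I"
  proof -
    have "AE \<omega> in ?I. \<omega> \<notin> space ?I - A" using AE AE_space by eventually_elim (simp add: A_def)
    then show ?thesis using A AE_iff_null_sets[of "space ?I - A" ?I] by auto
  qed
  have meas: "decor \<in> measurable (restrict_space ?I A) (decoration_space G d)"
  proof -
    have sp: "space (restrict_space ?I A) = A" using Asp by (auto simp: space_restrict_space)
    have D: "decor \<omega> \<in> space (decoration_space G d)" if "\<omega> \<in> A" for \<omega>
      using that decor_schreier by (auto simp: A_def schreier_decoration_def)
    have "(\<lambda>\<omega> e. decor \<omega> e) \<in> measurable (restrict_space ?I A) (\<Pi>\<^sub>M e\<in>E. count_space ({..<d} \<times> e))"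
    proof (rule measurable_PiM_single')
      fix e assume e: "e \<in> E"
      obtain x where x: "x \<in> e" "x \<in> V" using edge_nonempty e edge_sub by blast
      have fin: "finite ({..<d} \<times> e)" using edge_pair[OF e] by auto
      show "(\<lambda>\<omega>. decor \<omega> e) \<in> measurable (restrict_space ?I A) (count_space ({..<d} \<times> e))"
        unfolding measurable_count_space_eq2[OF fin]
      proof (intro conjI ballI)
        show "(\<lambda>\<omega>. decor \<omega> e) \<in> space (restrict_space ?I A) \<rightarrow> {..<d} \<times> e"
        proof
          fix \<omega> assume "\<omega> \<in> space (restrict_space ?I A)"
          then have "decor \<omega> \<in> (\<Pi>\<^sub>E e\<in>E. {..<d} \<times> e)" using D unfolding sp by (simp add: decoration_space_def space_PiM)
          then show "decor \<omega> e \<in> {..<d} \<times> e" using e by (rule PiE_mem)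
        qed
        fix y
        have "{\<omega> \<in> A. decor \<omega> e = y} \<in> sets ?I"
        proof (rule local_measurable[OF A x(2)])
          fix \<omega> assume "\<omega> \<in> A"
          then obtain R where "\<forall>\<omega>'. settled \<omega>' \<longrightarrow> alike (\<lambda>x. x) (B x R) R \<omega> \<omega>' \<longrightarrow> (\<forall>e\<in>E. x \<in> e \<longrightarrow> decor \<omega>' e = decor \<omega> e)"
            using decor_local[OF _ x(2), of \<omega>] by (auto simp: A_def)
          then show "\<exists>R. \<forall>\<omega>'\<in>A. alike (\<lambda>x. x) (B x R) R \<omega> \<omega>' \<longrightarrow> decor \<omega>' e = decor \<omega> e"
            using e x by (auto simp: A_def)
        qed
        moreover have "(\<lambda>\<omega>. decor \<omega> e) -` {y} \<inter> space (restrict_space ?I A) = {\<omega> \<in> A. decor \<omega> e = y}" unfolding sp by auto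
        ultimately show "(\<lambda>\<omega>. decor \<omega> e) -` {y} \<inter> space (restrict_space ?I A) \<in> sets (restrict_space ?I A)"
          using A by (subst sets_restrict_space_iff) auto
      qed
    next
      show "(\<lambda>\<omega> e. decor \<omega> e) \<in> space (restrict_space ?I A) \<rightarrow> (\<Pi>\<^sub>E e\<in>E. space (count_space ({..<d} \<times> e)))"
        using D unfolding sp by (auto simp: decoration_space_def space_PiM)
    qed
    then show ?thesis by (simp add: decoration_space_def)
  qed
  have "aut_factor G d A decor"
    unfolding aut_factor_def
  proof (intro conjI ballI)
    fix \<gamma> \<omega> assume g: "\<gamma> \<in> Aut" and w: "\<omega> \<in> A"
    have "act_label G \<gamma> \<omega> \<in> space ?I"
      using w ainv_V[OF g] by (auto simp: act_label_def A_def iid_space)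
    then show "act_label G \<gamma> \<omega> \<in> A" using settled_aut[OF g] w by (simp add: A_def)
    show "act_decoration G \<gamma> (decor \<omega>) = decor (act_label G \<gamma> \<omega>)" using decor_aut[OF g] w by (simp add: A_def)
  qed (use Asp null meas in auto)
  moreover have "finitary G A decor"
    unfolding finitary_def
  proof
    fix x assume x: "x \<in> V"
    show "AE \<omega> in ?I. \<exists>R. \<forall>\<omega>'\<in>A. (\<forall>y\<in>B x R. \<omega>' y = \<omega> y) \<longrightarrow> (\<forall>e\<in>E. x \<in> e \<longrightarrow> decor \<omega>' e = decor \<omega> e)"
      using AE
    proof eventually_elim
      case (elim \<omega>)
      then obtain R where R: "\<forall>\<omega>'. settled \<omega>' \<longrightarrow> alike (\<lambda>x. x) (B x R) R \<omega> \<omega>' \<longrightarrow> (\<forall>e\<in>E. x \<in> e \<longrightarrow> decor \<omega>' e = decor \<omega> e)"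
        using decor_local[OF _ x] by blast
      have "alike (\<lambda>x. x) (B x R) R \<omega> \<omega>'" if "\<forall>y\<in>B x R. \<omega>' y = \<omega> y" for \<omega>'
        using that by (simp add: alike_def)
      then show ?case using R by (intro exI[of _ R]) (simp add: A_def)
    qed
  qed
  moreover have "AE \<omega> in ?I. schreier_decoration G d (decor \<omega>)"
    by (rule eventually_mono[OF AE]) (rule decor_schreier)
  moreover have "AE \<omega> in ?I. \<not> (\<exists>x. infinite_monochromatic_path G (decor \<omega>) x)"
    by (rule eventually_mono[OF AE]) (use decor_no_path in blast)
  ultimately show ?thesis by blast
qed

end

context phases
begin

text \<open>The density p n is of order 1 / (r n)^2, the reciprocal of the size of a ball of
  radius r n, so that such a ball has a bounded chance to contain a centre, while r (n + 1) is
  chosen 2^n times larger than r n up to a constant, which makes the interference of smaller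
  balls summable. The constants 81 and 162 come from balls of radius 9 r n.\<close>

theorem factor_exists:
  "\<exists>A \<Phi>. aut_factor G d A \<Phi> \<and> finitary G A \<Phi> \<and>
    (AE \<omega> in iid_measure G. schreier_decoration G d (\<Phi> \<omega>)) \<and>
    (AE \<omega> in iid_measure G. \<not> (\<exists>x. infinite_monochromatic_path G (\<Phi> \<omega>) x))"
proof -
  obtain c1 c where c1: "0 < c1" and c0: "\<And>x n. x \<in> V \<Longrightarrow> 1 \<le> n \<Longrightarrow> c1 * (real n)\<^sup>2 \<le> real (card (B x n))"
      "\<And>x n. x \<in> V \<Longrightarrow> 1 \<le> n \<Longrightarrow> real (card (B x n)) \<le> c * (real n)\<^sup>2"
    using growth by blast
  define c2 where "c2 = max c 1"
  have c2: "c2 \<ge> 1" "\<And>x n. x \<in> V \<Longrightarrow> 1 \<le> n \<Longrightarrow> real (card (B x n)) \<le> c2 * (real n)\<^sup>2"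
  proof -
    fix x and n :: nat assume *: "x \<in> V" "1 \<le> n"
    have "c * (real n)\<^sup>2 \<le> c2 * (real n)\<^sup>2" by (rule mult_right_mono) (auto simp: c2_def)
    then show "real (card (B x n)) \<le> c2 * (real n)\<^sup>2" using c0(2)[OF *] by linarith
  qed (simp add: c2_def)
  \<comment> \<open>The summand 7 is what the growth condition on the radii demands. The other
    summand makes the ball of radius 9 r n at most half as large as the ball of radius r (n + 1).\<close>
  define C where "C = 7 + nat \<lceil>162 * c2 / c1\<rceil>"
  have C: "C \<ge> 7" "162 * c2 / c1 \<le> real C" unfolding C_def by (simp, linarith)
  have C': "162 * c2 \<le> c1 * real C" using C(2) c1 by (simp add: pos_divide_le_eq mult.commute)
  define r where "r = rec_nat (4 * (2 * D + k\<^sub>0 + 3)) (\<lambda>n x. C * 2 ^ n * x)"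
  have r_S: "r (Suc n) = C * 2 ^ n * r n" for n by (simp add: r_def)
  define p where "p n = 1 / (162 * c2 * (real (r n))\<^sup>2)" for n
  have "7 * r n \<le> r (Suc n)" for n
  proof -
    have "7 * 1 \<le> C * 2 ^ n" by (rule mult_le_mono[OF C(1)]) simp
    then show ?thesis unfolding r_S by (intro mult_le_mono1) simp
  qed
  then interpret phased_graph G d Ph D k\<^sub>0 r p
    by unfold_locales (auto simp: r_def)
  have r1: "r n \<ge> 1" for n
    using r_ge[of n] by (simp add: t_def k_def)
  have r_pos: "0 < (real (r n))\<^sup>2" for n using r1[of n] by simp
  have rS: "(real (r (Suc n)))\<^sup>2 = (real C)\<^sup>2 * 4 ^ n * (real (r n))\<^sup>2" for n
  proof -
    have "(2 ^ n)\<^sup>2 = (4 :: real) ^ n" by (simp add: power2_eq_square flip: power_mult_distrib)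
    then show ?thesis by (simp add: r_S power_mult_distrib)
  qed
  have ball9: "real (card (B x (9 * r n))) \<le> 81 * c2 * (real (r n))\<^sup>2" if "x \<in> V" for x n
    using c2(2)[OF that, of "9 * r n"] r1[of n] by (simp add: power_mult_distrib)
  have reached: "AE \<omega> in iid_measure G. \<exists>n. x \<in> region n \<omega>" if x: "x \<in> V" for x
  proof (rule AE_reached[OF x])
    have "c1 \<le> c2" using c0(1)[OF x, of 1] c2(2)[OF x, of 1] by simp
    then show "c1 / (648 * c2) \<le> 1" "0 < c1 / (648 * c2)" using c1 c2(1) by (auto simp: field_simps)
    show "0 \<le> p n" for n using c2(1) by (simp add: p_def)
    show "p n \<le> 1" for n
    proof -
      have "1 * 1 \<le> 162 * c2 * (real (r n))\<^sup>2" by (rule mult_mono) (use c2(1) r1[of n] in \<open>auto simp: one_le_power\<close>)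
      then show ?thesis by (simp add: p_def)
    qed
    show "real (card (B x (9 * r n))) * p n \<le> 1 / 2" for n
    proof -
      have "real (card (B x (9 * r n))) * p n \<le> 81 * c2 * (real (r n))\<^sup>2 * p n"
        by (rule mult_right_mono[OF ball9[OF x]]) (use c2(1) in \<open>simp add: p_def\<close>)
      also have "\<dots> = 1 / 2" using c2(1) r_pos[of n] by (simp add: p_def field_simps)
      finally show ?thesis .
    qed
    show "real (card (B x (9 * r n))) * p (Suc n) \<le> (1 / 2) ^ n" for n
    proof -
      have "1 * 1 \<le> real C * real C" by (rule mult_mono) (use C(1) in auto)
      then have "1 \<le> 2 * (real C)\<^sup>2" by (simp add: power2_eq_square)
      then have C1: "1 * (2::real) ^ n \<le> (2 * (real C)\<^sup>2) * 4 ^ n"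
        by (rule mult_mono) (use C(1) in \<open>auto intro!: power_mono simp: power2_eq_square\<close>)
      have "real (card (B x (9 * r n))) * p (Suc n) \<le> 81 * c2 * (real (r n))\<^sup>2 * p (Suc n)"
        by (rule mult_right_mono[OF ball9[OF x]]) (use c2(1) in \<open>simp add: p_def\<close>)
      also have "\<dots> = 1 / (2 * (real C)\<^sup>2 * 4 ^ n)"
        unfolding p_def rS using c2(1) r_pos[of n] C(1) by (simp add: field_simps)
      also have "\<dots> \<le> 1 / 2 ^ n" by (rule divide_left_mono) (use C1 C(1) in auto)
      finally show ?thesis by (simp add: power_one_over)
    qed
    show "c1 / (648 * c2) \<le> real (card (B x (r (Suc n)) - B x (9 * r n))) * p (Suc n) / 2" for n
    proof -
      let ?R = "(real (r (Suc n)))\<^sup>2"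
      have "real C * (real (r n))\<^sup>2 \<le> ?R"
      proof -
        have "real C * 1 \<le> (real C * real C) * 4 ^ n" by (rule mult_mono) (use C(1) in auto)
        then show ?thesis unfolding rS power2_eq_square[of "real C"] by (intro mult_right_mono) auto
      qed
      then have "c1 * (real C * (real (r n))\<^sup>2) \<le> c1 * ?R" using c1 by (intro mult_left_mono) auto
      then have "162 * c2 * (real (r n))\<^sup>2 \<le> c1 * ?R"
        using mult_right_mono[OF C', of "(real (r n))\<^sup>2"]
        by (simp add: mult.assoc del: of_nat_mult)
      moreover have "real (card (B x (r (Suc n)))) \<ge> c1 * ?R" using c0(1)[OF x] r1 by blast
      moreover have "real (card (B x (r (Suc n)) - B x (9 * r n))) \<ge> real (card (B x (r (Suc n)))) - real (card (B x (9 * r n)))"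
        using diff_card_le_card_Diff[OF finite_ball[OF x], of "B x (r (Suc n))" "9 * r n"] by linarith
      ultimately have "real (card (B x (r (Suc n)) - B x (9 * r n))) \<ge> c1 * ?R / 2" using ball9[OF x, of n] by linarith
      then have "c1 * ?R / 2 * p (Suc n) \<le> real (card (B x (r (Suc n)) - B x (9 * r n))) * p (Suc n)"
        by (rule mult_right_mono) (use c2(1) in \<open>simp add: p_def\<close>)
      moreover have "c1 * ?R / 2 * p (Suc n) = c1 / (324 * c2)"
        unfolding p_def using c2(1) r_pos[of "Suc n"] by (simp add: field_simps)
      ultimately show ?thesis by (simp add: field_simps)
    qed
  qed
  show ?thesis by (rule factor[OF countable_V reached])
qed

end

section \<open>Lattices spread over the plane\<close>

text \<open>The graph is spread over the integer plane by a map pos with fibres of at most f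
  vertices and of diameter at most h, such that adjacent vertices lie over adjacent or equal
  cells (diagonals included), and horizontally and vertically neighbouring cells are joined by
  an edge. Graph distance is then comparable to distance in the plane, which yields quadratic
  growth.\<close>

locale planar_graph =
  fixes G :: "'v ugraph" and pos :: "'v \<Rightarrow> int \<times> int" and f h :: nat
  assumes edge_doubleton: "e \<in> edges G \<Longrightarrow> \<exists>u v. u \<in> verts G \<and> v \<in> verts G \<and> u \<noteq> v \<and> e = {u, v}"
    and pos_adj: "(u, v) \<in> adj G \<Longrightarrow>
      \<bar>fst (pos u) - fst (pos v)\<bar> \<le> 1 \<and> \<bar>snd (pos u) - snd (pos v)\<bar> \<le> 1"
    and fibre: "finite {v \<in> verts G. pos v = z}" "card {v \<in> verts G. pos v = z} \<le> f"
    and same_fibre: "u \<in> verts G \<Longrightarrow> v \<in> verts G \<Longrightarrow> pos u = pos v \<Longrightarrow> v \<in> graph_ball G u h"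
    and step_right: "\<exists>u v. (u, v) \<in> adj G \<and> pos u = z \<and> pos v = z + (1, 0)"
    and step_up: "\<exists>u v. (u, v) \<in> adj G \<and> pos u = z \<and> pos v = z + (0, 1)"
begin

definition box :: "int \<times> int \<Rightarrow> int \<Rightarrow> (int \<times> int) set" where
  "box z m = {fst z - m..fst z + m} \<times> {snd z - m..snd z + m}"

lemma card_box: "0 \<le> m \<Longrightarrow> card (box z m) = nat (2 * m + 1) ^ 2"
  by (simp add: box_def card_cartesian_product power2_eq_square)

lemma finite_box: "finite (box z m)"
  by (simp add: box_def)

lemma pos_ball: "y \<in> graph_ball G x n \<Longrightarrow> pos y \<in> box (pos x) (int n)"
proof -
  have "(x, y) \<in> adj G ^^ m \<Longrightarrow> pos y \<in> box (pos x) (int m)" for m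
  proof (induction m arbitrary: y)
    case (Suc m)
    then obtain z where z: "(x, z) \<in> adj G ^^ m" "(z, y) \<in> adj G" by auto
    then show ?case using Suc.IH[OF z(1)] pos_adj[OF z(2)] by (auto simp: box_def mem_Times_iff)
  qed (simp add: box_def mem_Times_iff)
  moreover assume "y \<in> graph_ball G x n"
  then obtain m where "m \<le> n" "(x, y) \<in> adj G ^^ m" by (auto simp: graph_ball_def)
  ultimately have "pos y \<in> box (pos x) (int m)" by blast
  then show ?thesis using \<open>m \<le> n\<close> by (auto simp: box_def mem_Times_iff)
qed

lemma preimage_box:
  shows finite_preimage: "finite X \<Longrightarrow> finite {v \<in> verts G. pos v \<in> X}"
    and card_preimage: "finite X \<Longrightarrow> card {v \<in> verts G. pos v \<in> X} \<le> f * card X"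
proof -
  assume X: "finite X"
  have eq: "{v \<in> verts G. pos v \<in> X} = (\<Union>z\<in>X. {v \<in> verts G. pos v = z})" by auto
  show "finite {v \<in> verts G. pos v \<in> X}" unfolding eq using X fibre by blast
  have "card (\<Union>z\<in>X. {v \<in> verts G. pos v = z}) \<le> (\<Sum>z\<in>X. card {v \<in> verts G. pos v = z})"
    by (rule card_UN_le[OF X])
  also have "\<dots> \<le> (\<Sum>z\<in>X. f)" by (rule sum_mono) (rule fibre)
  finally show "card {v \<in> verts G. pos v \<in> X} \<le> f * card X" unfolding eq by (simp add: mult.commute)
qed

lemma ball_preimage: "x \<in> verts G \<Longrightarrow> graph_ball G x n \<subseteq> {v \<in> verts G. pos v \<in> box (pos x) (int n)}"
proof
  fix y assume x: "x \<in> verts G" and y: "y \<in> graph_ball G x n"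
  obtain m where "(x, y) \<in> adj G ^^ m" using y by (auto simp: graph_ball_def)
  then have "y \<in> verts G"
  proof (cases m)
    case (Suc k)
    then obtain z where "(z, y) \<in> adj G" using \<open>(x, y) \<in> adj G ^^ m\<close> by auto
    then have "{z, y} \<in> edges G" by (simp add: adj_def)
    then show ?thesis using edge_doubleton[of "{z, y}"] by (auto simp: doubleton_eq_iff)
  qed (use x in auto)
  then show "y \<in> {v \<in> verts G. pos v \<in> box (pos x) (int n)}" using pos_ball[OF y] by simp
qed

sublocale graph G
proof
  show "e \<in> edges G \<Longrightarrow> \<exists>u v. u \<in> verts G \<and> v \<in> verts G \<and> u \<noteq> v \<and> e = {u, v}" for e by (rule edge_doubleton)
  show "finite (graph_ball G x r)" if "x \<in> verts G" for x r
    using ball_preimage[OF that] finite_preimage[OF finite_box] finite_subset by blast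
qed

lemma fibre_ex: "\<exists>v\<in>V. pos v = z"
  using step_right[of z] adjD by blast

lemma countable_verts: "countable V"
proof -
  have "V = (\<Union>z\<in>UNIV. {v \<in> V. pos v = z})" by auto
  moreover have "countable (\<Union>z\<in>UNIV. {v \<in> V. pos v = z})"
    by (intro countable_UN countableI_type) (use fibre countable_finite in blast)
  ultimately show ?thesis by simp
qed

lemma one_step:
  assumes u: "u \<in> V" "v \<in> V" and d: "pos v - pos u \<in> {(1, 0), (-1, 0), (0, 1), (0, -1)}"
  shows "v \<in> B u (2 * h + 1)"
proof -
  have "\<exists>u' v'. (u', v') \<in> adj G \<and> pos u' = pos u \<and> pos v' = pos v"
  proof -
    have "pos v = pos u + (1, 0) \<or> pos u = pos v + (1, 0) \<or> pos v = pos u + (0, 1) \<or> pos u = pos v + (0, 1)"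
      using d by (cases "pos u"; cases "pos v") auto
    then show ?thesis using step_right[of "pos u"] step_right[of "pos v"] step_up[of "pos u"] step_up[of "pos v"] adj_sym
      by metis
  qed
  then obtain u' v' where uv: "(u', v') \<in> adj G" "pos u' = pos u" "pos v' = pos v" by blast
  have "u' \<in> B u h" using same_fibre u uv adjD by metis
  moreover have "v' \<in> B u' 1" using uv ball_edge edge_adj by blast
  moreover have "v \<in> B v' h" using same_fibre u uv adjD by metis
  ultimately have "v \<in> B u (h + 1 + h)" using ball_trans by blast
  then show ?thesis by (simp add: mult_2)
qed

lemma near_ball:
  assumes "u \<in> V" "v \<in> V" "nat \<bar>fst (pos v) - fst (pos u)\<bar> + nat \<bar>snd (pos v) - snd (pos u)\<bar> \<le> n"
  shows "v \<in> B u (h + n * (2 * h + 1))"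
  using assms
proof (induction n arbitrary: v)
  case 0
  then have "pos u = pos v" by (simp add: prod_eq_iff)
  then show ?case using same_fibre 0 by simp
next
  case (Suc n)
  obtain a b where ab: "pos v = (a, b)" by force
  obtain x y where xy: "pos u = (x, y)" by force
  have "\<exists>z. nat \<bar>fst z - x\<bar> + nat \<bar>snd z - y\<bar> \<le> n \<and> ((a, b) - z \<in> {(1, 0), (-1, 0), (0, 1), (0, -1)} \<or> z = (a, b))"
  proof -
    consider "a > x" | "a < x" | "a = x" "b > y" | "a = x" "b < y" | "a = x" "b = y" by linarith
    then show ?thesis
    proof cases
      case 1 then show ?thesis using Suc.prems(3) ab xy by (intro exI[of _ "(a - 1, b)"]) auto
    next
      case 2 then show ?thesis using Suc.prems(3) ab xy by (intro exI[of _ "(a + 1, b)"]) auto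
    next
      case 3 then show ?thesis using Suc.prems(3) ab xy by (intro exI[of _ "(a, b - 1)"]) auto
    next
      case 4 then show ?thesis using Suc.prems(3) ab xy by (intro exI[of _ "(a, b + 1)"]) auto
    next
      case 5 then show ?thesis by (intro exI[of _ "(a, b)"]) auto
    qed
  qed
  then obtain z where z: "nat \<bar>fst z - x\<bar> + nat \<bar>snd z - y\<bar> \<le> n"
      "(a, b) - z \<in> {(1, 0), (-1, 0), (0, 1), (0, -1)} \<or> z = (a, b)" by blast
  obtain w where w: "w \<in> V" "pos w = z" using fibre_ex by blast
  have "w \<in> B u (h + n * (2 * h + 1))" using Suc.IH[OF Suc.prems(1) w(1)] z w xy by simp
  moreover have "v \<in> B w (2 * h + 1)"
    using z(2)
  proof
    assume "z = (a, b)"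
    then have "v \<in> B w h" using same_fibre w ab Suc.prems by simp
    then show ?thesis by (rule ball_monoD) simp
  qed (use one_step w ab Suc.prems in auto)
  ultimately have "v \<in> B u (h + n * (2 * h + 1) + (2 * h + 1))" using ball_trans by blast
  then show ?case by (simp add: algebra_simps)
qed

lemma near_ball_box:
  assumes "u \<in> V" "v \<in> V" "pos v \<in> box (pos u) (int m)"
  shows "v \<in> B u (h + 2 * m * (2 * h + 1))"
  by (rule near_ball) (use assms in \<open>auto simp: box_def mem_Times_iff\<close>)

lemma connected: "u \<in> V \<Longrightarrow> v \<in> V \<Longrightarrow> \<exists>n. v \<in> B u n"
  using near_ball by blast

lemma planar_growth: "\<exists>c>0. \<exists>c'. \<forall>x\<in>V. \<forall>n\<ge>1. c * (real n)\<^sup>2 \<le> real (card (B x n)) \<and>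
      real (card (B x n)) \<le> c' * (real n)\<^sup>2"
proof -
  define H where "H = 5 * h + 2"
  have H: "H > 0" by (simp add: H_def)
  have up: "real (card (B x n)) \<le> 9 * real f * (real n)\<^sup>2" if x: "x \<in> V" and n: "1 \<le> n" for x n
  proof -
    have "card (B x n) \<le> card {v \<in> V. pos v \<in> box (pos x) (int n)}"
      by (rule card_mono[OF finite_preimage[OF finite_box] ball_preimage[OF x]])
    also have "\<dots> \<le> f * card (box (pos x) (int n))" by (rule card_preimage[OF finite_box])
    also have "\<dots> = f * (2 * n + 1)\<^sup>2" by (simp add: card_box nat_add_distrib nat_mult_distrib)
    also have "\<dots> \<le> f * (3 * n)\<^sup>2" using n by (intro mult_le_mono2 power_mono) auto
    finally have "real (card (B x n)) \<le> real (f * (3 * n)\<^sup>2)" by (rule of_nat_mono)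
    then show ?thesis by (simp add: power_mult_distrib)
  qed
  have down: "1 / (real (2 * H))\<^sup>2 * (real n)\<^sup>2 \<le> real (card (B x n))" if x: "x \<in> V" and n: "1 \<le> n" for x n
  proof (cases "n < H")
    case True
    have "card {x} \<le> card (B x n)" by (rule card_mono) (use finite_ball[OF x] in auto)
    then have 1: "1 \<le> real (card (B x n))" by simp
    have "(real n)\<^sup>2 \<le> (real (2 * H))\<^sup>2" by (rule power_mono) (use True in auto)
    then have "1 / (real (2 * H))\<^sup>2 * (real n)\<^sup>2 \<le> 1" using H by (simp add: divide_le_eq)
    then show ?thesis using 1 by linarith
  next
    case False
    define m where "m = n div H"
    have m: "1 \<le> m" using False H div_le_mono[of H n H] by (simp add: m_def)
    have nm: "n \<le> 2 * H * m"
    proof -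
      have "n = m * H + n mod H" by (simp add: m_def)
      moreover have "n mod H \<le> H * m" using mod_less_divisor[OF H, of n] m by (metis le_trans less_imp_le_nat mult_le_mono2 mult.right_neutral)
      ultimately show ?thesis by (simp add: algebra_simps)
    qed
    have mH: "m * H \<le> n" by (simp add: m_def)
    have sub: "box (pos x) (int (m - 1)) \<subseteq> pos ` B x n"
    proof
      fix z assume z: "z \<in> box (pos x) (int (m - 1))"
      obtain v where v: "v \<in> V" "pos v = z" using fibre_ex by blast
      have "v \<in> B x (h + 2 * (m - 1) * (2 * h + 1))" using near_ball_box[OF x v(1)] v z by simp
      moreover have "h + 2 * (m - 1) * (2 * h + 1) \<le> m * H"
      proof -
        obtain j where j: "m = Suc j" using m by (cases m) auto
        show ?thesis unfolding H_def j by (simp add: algebra_simps)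
      qed
      ultimately have "v \<in> B x n" using mH by (metis ball_monoD le_trans)
      then show "z \<in> pos ` B x n" using v by blast
    qed
    have "card (box (pos x) (int (m - 1))) \<le> card (pos ` B x n)"
      by (rule card_mono[OF finite_imageI[OF finite_ball[OF x]] sub])
    also have "\<dots> \<le> card (B x n)" by (rule card_image_le[OF finite_ball[OF x]])
    finally have "nat (2 * int (m - 1) + 1) ^ 2 \<le> card (B x n)" by (simp add: card_box)
    moreover have "m \<le> nat (2 * int (m - 1) + 1)" using m by linarith
    then have "m\<^sup>2 \<le> nat (2 * int (m - 1) + 1) ^ 2" by (rule power_mono) simp
    ultimately have "m\<^sup>2 \<le> card (B x n)" by linarith
    then have "(real m)\<^sup>2 \<le> real (card (B x n))" by (metis of_nat_le_iff of_nat_power)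
    moreover have "(real n)\<^sup>2 \<le> (real (2 * H))\<^sup>2 * (real m)\<^sup>2"
    proof -
      have "real n \<le> real (2 * H) * real m" using nm by (metis of_nat_le_iff of_nat_mult)
      then have "(real n)\<^sup>2 \<le> (real (2 * H) * real m)\<^sup>2" by (rule power_mono) simp
      then show ?thesis by (simp only: power_mult_distrib)
    qed
    then have "1 / (real (2 * H))\<^sup>2 * (real n)\<^sup>2 \<le> (real m)\<^sup>2" using H by (simp add: divide_le_eq mult.commute)
    ultimately show ?thesis by linarith
  qed
  have "1 / (real (2 * H))\<^sup>2 > 0" using H by simp
  then show ?thesis using up down by blast
qed

end

lemma (in graph) card_incident:
  assumes ws: "distinct ws" "set ws = {w. (v, w) \<in> adj G}"
  shows "card {e \<in> E. v \<in> e \<and> Q e} = length (filter (\<lambda>w. Q {v, w}) ws)"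
proof -
  have "{e \<in> E. v \<in> e \<and> Q e} = (\<lambda>w. {v, w}) ` set (filter (\<lambda>w. Q {v, w}) ws)"
  proof (intro equalityI subsetI)
    fix e assume e: "e \<in> {e \<in> E. v \<in> e \<and> Q e}"
    then obtain w where "e = {v, w}" using edge_pair[of e] by auto
    then show "e \<in> (\<lambda>w. {v, w}) ` set (filter (\<lambda>w. Q {v, w}) ws)" using e ws by (auto simp: adj_def)
  qed (use ws in \<open>auto simp: adj_def\<close>)
  moreover have "inj_on (\<lambda>w. {v, w}) (set (filter (\<lambda>w. Q {v, w}) ws))"
    by (intro inj_onI) (auto simp: doubleton_eq_iff)
  ultimately show ?thesis
    by (simp only: card_image distinct_card[OF distinct_filter[OF ws(1)]])
qed

lemma (in coloured_graph) valid_neighbours: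
  assumes "\<And>v. v \<in> V \<Longrightarrow> distinct (ws v) \<and> set (ws v) = {w. (v, w) \<in> adj G}"
    and "\<And>v i. v \<in> V \<Longrightarrow> i < d \<Longrightarrow> length (filter (\<lambda>w. q {v, w} = i) (ws v)) = 2"
    and "\<And>e. e \<in> E \<Longrightarrow> q e < d"
  shows "valid q"
  using assms card_incident[of "ws v" v "\<lambda>e. q e = i" for v i] by (auto simp: valid_def)

context planar_graph
begin

text \<open>Local rigidity is global: a local coincidence of two colourings that spreads from a
  vertex to its neighbours holds everywhere.\<close>

lemma rigid:
  assumes x: "x \<in> V" "\<forall>e\<in>E. x \<in> e \<longrightarrow> q e = p e"
    and step: "\<And>v w. (v, w) \<in> adj G \<Longrightarrow> \<forall>e\<in>E. v \<in> e \<longrightarrow> q e = p e \<Longrightarrow> \<forall>e\<in>E. w \<in> e \<longrightarrow> q e = p e"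
  shows "\<forall>e\<in>E. q e = p e"
proof
  fix e assume e: "e \<in> E"
  then obtain y where y: "y \<in> e" "y \<in> V" using edge_pair by blast
  then obtain n where "y \<in> B x n" using connected x by blast
  then obtain m where m: "(x, y) \<in> adj G ^^ m" by (auto simp: graph_ball_def)
  have "(x, z) \<in> adj G ^^ m \<Longrightarrow> \<forall>e\<in>E. z \<in> e \<longrightarrow> q e = p e" for z m
  proof (induction m arbitrary: z)
    case (Suc m)
    then obtain w where w: "(x, w) \<in> adj G ^^ m" "(w, z) \<in> adj G" by auto
    show ?case by (rule step[OF w(2) Suc.IH[OF w(1)]])
  qed (use x in auto)
  then show "q e = p e" using m e y by blast
qed

text \<open>The monochromatic paths of a phase stay inside bounded cells; cell names the cell of
  a vertex for a fixed colour.\<close>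

lemma short_by_cells:
  assumes inv: "\<And>u v. (u, v) \<in> coloured_graph.mono_step G q i \<Longrightarrow> cell u = cell v"
    and close: "\<And>u v. u \<in> V \<Longrightarrow> v \<in> V \<Longrightarrow> cell u = cell v \<Longrightarrow> pos v \<in> box (pos u) (int m)"
    and u: "u \<in> V" and uv: "(u, v) \<in> (coloured_graph.mono_step G q i)\<^sup>*"
  shows "v \<in> B u (h + 2 * m * (2 * h + 1))"
proof -
  interpret coloured_graph G undefined by unfold_locales
  have "cell u = cell v \<and> v \<in> V" using uv
  proof (induction rule: rtrancl_induct)
    case (step y z)
    then have "z \<in> V" using edge_sub by (auto simp: mono_step_def)
    then show ?case using inv[OF step(2)] step by simp
  qed (use u in simp)
  then show ?thesis using near_ball_box close u by blast
qed

end

section \<open>The (3,4,6,4) lattice\<close>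

definition nbrs_3464 :: "(int \<times> int) \<times> nat \<Rightarrow> ((int \<times> int) \<times> nat) list" where
  "nbrs_3464 = (\<lambda>(x, k). [(x, (k + 1) mod 6), (x, (k + 5) mod 6),
     (x + hex_dir k, (k + 4) mod 6), (x + hex_dir (k + 5), (k + 2) mod 6)])"

lemma less_6: "k < 6 \<Longrightarrow> k = 0 \<or> k = 1 \<or> k = 2 \<or> k = 3 \<or> k = 4 \<or> k = (5 :: nat)"
  by linarith

lemma hex_dir_simps: "hex_dir 0 = (1, 0)" "hex_dir (Suc 0) = (0, 1)" "hex_dir 1 = (0, 1)" "hex_dir 2 = (-1, 1)" "hex_dir 3 = (-1, 0)"
  "hex_dir 4 = (0, -1)" "hex_dir 5 = (1, -1)" "hex_dir 6 = (1, 0)" "hex_dir 7 = (0, 1)" "hex_dir 8 = (-1, 1)" "hex_dir 9 = (-1, 0)"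
  "hex_dir 10 = (0, -1)" "hex_dir (Suc (Suc 0)) = (-1, 1)"
  by (simp_all add: hex_dir_def)

lemma hex_dir_opposite:
  assumes "k < 6"
  shows "y + hex_dir k + hex_dir ((k + 4) mod 6 + 5) = y"
    and "y + hex_dir (k + 5) + hex_dir ((k + 2) mod 6) = y"
proof -
  have "hex_dir k + hex_dir ((k + 4) mod 6 + 5) = 0" "hex_dir (k + 5) + hex_dir ((k + 2) mod 6) = 0"
    using less_6[OF assms] by (auto simp: hex_dir_simps zero_prod_def)
  then show "y + hex_dir k + hex_dir ((k + 4) mod 6 + 5) = y" "y + hex_dir (k + 5) + hex_dir ((k + 2) mod 6) = y"
    by (simp_all only: add.assoc add_0_right)
qed

lemma mod_6:
  assumes "k < (6 :: nat)"
  shows "((k + 1) mod 6 + 5) mod 6 = k" "((k + 5) mod 6 + 1) mod 6 = k"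
    "((k + 2) mod 6 + 4) mod 6 = k" "((k + 4) mod 6 + 2) mod 6 = k"
  using less_6[OF assms] by auto

lemma rot_3464:
  assumes "k < (6 :: nat)"
  shows "hex_dir k + hex_dir ((k + 4) mod 6) = hex_dir (k + 5)" "((k + 4) mod 6 + 4) mod 6 = (k + 2) mod 6"
  using less_6[OF assms] by (auto simp: hex_dir_simps)

lemma E_3464: "edges lattice_3464 = {{(x, k), (x, (k + 1) mod 6)} | x k. k < 6} \<union>
     {{(x, k), (x + hex_dir k, (k + 4) mod 6)} | x k. k < 6}"
  by (simp add: lattice_3464_def)

lemma edge_3464E:
  assumes "e \<in> edges lattice_3464"
  obtains x k where "k < 6" "e = {(x, k), (x, (k + 1) mod 6)}"
    | x k where "k < 6" "e = {(x, k), (x + hex_dir k, (k + 4) mod 6)}"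
proof -
  from assms consider (1) x k where "e = {(x, k), (x, (k + 1) mod 6)}" "k < 6"
    | (2) x k where "e = {(x, k), (x + hex_dir k, (k + 4) mod 6)}" "k < 6"
    unfolding E_3464 Un_iff mem_Collect_eq by (elim disjE exE conjE)
  then show thesis
  proof cases
    case 1 show thesis by (rule that(1)[OF 1(2,1)])
  next
    case 2 show thesis by (rule that(2)[OF 2(2,1)])
  qed
qed

lemma adj_3464: "((x, k), w) \<in> adj lattice_3464 \<longleftrightarrow> k < 6 \<and> w \<in> set (nbrs_3464 (x, k))"
proof
  obtain y l where w: "w = (y, l)" by (cases w)
  assume "((x, k), w) \<in> adj lattice_3464"
  then have "{(x, k), (y, l)} \<in> edges lattice_3464" by (simp add: w adj_def)
  then show "k < 6 \<and> w \<in> set (nbrs_3464 (x, k))"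
  proof (cases rule: edge_3464E)
    case (1 z m)
    then have "(x, k) = (z, m) \<and> (y, l) = (z, (m + 1) mod 6) \<or> (x, k) = (z, (m + 1) mod 6) \<and> (y, l) = (z, m)"
      by (simp only: doubleton_eq_iff)
    then show ?thesis using mod_6(1)[OF 1(1)] 1(1) unfolding w nbrs_3464_def by (elim disjE conjE) simp_all
  next
    case (2 z m)
    then have "(x, k) = (z, m) \<and> (y, l) = (z + hex_dir m, (m + 4) mod 6) \<or>
        (x, k) = (z + hex_dir m, (m + 4) mod 6) \<and> (y, l) = (z, m)"
      by (simp only: doubleton_eq_iff)
    then show ?thesis using mod_6(4)[OF 2(1)] hex_dir_opposite(1)[OF 2(1), of z] 2(1)
      unfolding w nbrs_3464_def by (elim disjE conjE) simp_all
  qed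
next
  assume a: "k < 6 \<and> w \<in> set (nbrs_3464 (x, k))"
  have 1: "((z, m), (z, (m + 1) mod 6)) \<in> adj lattice_3464" "((z, (m + 1) mod 6), (z, m)) \<in> adj lattice_3464"
    "((z, m), (z + hex_dir m, (m + 4) mod 6)) \<in> adj lattice_3464"
    "((z + hex_dir m, (m + 4) mod 6), (z, m)) \<in> adj lattice_3464" if "m < 6" for z m
  proof -
    have "{(z, m), (z, (m + 1) mod 6)} \<in> edges lattice_3464"
      "{(z, m), (z + hex_dir m, (m + 4) mod 6)} \<in> edges lattice_3464"
      unfolding E_3464 using that by blast+
    then show "((z, m), (z, (m + 1) mod 6)) \<in> adj lattice_3464" "((z, (m + 1) mod 6), (z, m)) \<in> adj lattice_3464"
      "((z, m), (z + hex_dir m, (m + 4) mod 6)) \<in> adj lattice_3464"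
      "((z + hex_dir m, (m + 4) mod 6), (z, m)) \<in> adj lattice_3464"
      unfolding adj_def mem_Collect_eq prod.case by (simp_all only: insert_commute)
  qed
  have k: "k < 6" using a by simp
  have "(k + 5) mod 6 < 6" "(k + 2) mod 6 < 6" by simp_all
  then have "((x, k), (x, (k + 5) mod 6)) \<in> adj lattice_3464"
    "((x, k), (x + hex_dir (k + 5), (k + 2) mod 6)) \<in> adj lattice_3464"
    using 1(2)[of "(k + 5) mod 6" x] 1(4)[of "(k + 2) mod 6" "x + hex_dir (k + 5)"]
    unfolding mod_6[OF k] hex_dir_opposite(2)[OF k] by blast+
  moreover have "((x, k), (x, (k + 1) mod 6)) \<in> adj lattice_3464"
    "((x, k), (x + hex_dir k, (k + 4) mod 6)) \<in> adj lattice_3464" using 1(1,3)[OF k] by blast+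
  ultimately show "((x, k), w) \<in> adj lattice_3464"
    using a unfolding nbrs_3464_def prod.case list.set insert_iff empty_iff by blast
qed

lemma distinct_nbrs_3464: "k < 6 \<Longrightarrow> distinct (nbrs_3464 (x, k))"
  using less_6[of k] by (cases x) (auto simp: nbrs_3464_def hex_dir_simps)

lemma V_3464: "verts lattice_3464 = UNIV \<times> {..<6}"
  by (simp add: lattice_3464_def)

interpretation L: planar_graph lattice_3464 fst 6 6
proof
  let ?G = lattice_3464
  have "\<exists>u v. u \<in> verts ?G \<and> v \<in> verts ?G \<and> u \<noteq> v \<and> e = {u, v}" if e: "e \<in> edges ?G" for e
  proof -
    have ne: "(x, k) \<noteq> (z, (k + 1) mod 6)" "(x, k) \<noteq> (z, (k + 4) mod 6)" if "k < 6" for x z and k :: nat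
      using less_6[OF that] by auto
    show ?thesis using e
    proof (cases rule: edge_3464E)
      case (1 x k)
      show ?thesis
        by (rule exI[of _ "(x, k)"], rule exI[of _ "(x, (k + 1) mod 6)"]) (use 1 ne(1)[of k x x] in \<open>simp add: V_3464\<close>)
    next
      case (2 x k)
      show ?thesis
        by (rule exI[of _ "(x, k)"], rule exI[of _ "(x + hex_dir k, (k + 4) mod 6)"])
          (use 2 ne(2)[of k x "x + hex_dir k"] in \<open>simp add: V_3464\<close>)
    qed
  qed
  then show "e \<in> edges ?G \<Longrightarrow> \<exists>u v. u \<in> verts ?G \<and> v \<in> verts ?G \<and> u \<noteq> v \<and> e = {u, v}" for e .
  show "\<bar>fst (fst u) - fst (fst v)\<bar> \<le> 1 \<and> \<bar>snd (fst u) - snd (fst v)\<bar> \<le> 1" if "(u, v) \<in> adj ?G" for u v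
  proof -
    obtain a b k where u: "u = ((a, b), k)" by (metis prod.exhaust)
    show ?thesis using that less_6[of k] unfolding u adj_3464 by (auto simp: nbrs_3464_def hex_dir_simps)
  qed
  have fib: "{v \<in> verts ?G. fst v = z} = Pair z ` {..<6}" for z by (auto simp: V_3464)
  show "finite {v \<in> verts ?G. fst v = z}" "card {v \<in> verts ?G. fst v = z} \<le> 6" for z
    unfolding fib using card_image_le[of "{..<6 :: nat}" "Pair z"] by auto
  show "v \<in> graph_ball ?G u 6" if uv: "u \<in> verts ?G" "v \<in> verts ?G" "fst u = fst v" for u v
  proof -
    obtain x k l where uv: "u = (x, k)" "v = (x, l)" "k < 6" "l < 6"
      using uv by (cases u; cases v) (auto simp: V_3464)
    have "((x, k), (x, (k + n) mod 6)) \<in> adj ?G ^^ n" for n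
    proof (induction n)
      case (Suc n)
      have "((x, (k + n) mod 6), (x, ((k + n) mod 6 + 1) mod 6)) \<in> adj ?G" by (simp add: adj_3464 nbrs_3464_def)
      then have "((x, (k + n) mod 6), (x, (k + Suc n) mod 6)) \<in> adj ?G" by (simp add: mod_Suc_eq)
      then show ?case using Suc by auto
    qed (use uv in simp)
    from this[of "(l + 6 - k) mod 6"]
    have "(u, v) \<in> adj ?G ^^ ((l + 6 - k) mod 6)" using uv by (simp add: mod_add_right_eq)
    moreover have "(l + 6 - k) mod 6 \<le> 6" by (rule less_imp_le) simp
    ultimately show ?thesis unfolding graph_ball_def by blast
  qed
  show "\<exists>u v. (u, v) \<in> adj ?G \<and> fst u = z \<and> fst v = z + (1, 0)" for z
    by (rule exI[of _ "(z, 0)"], rule exI[of _ "(z + (1, 0), 4)"])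
      (simp add: adj_3464 nbrs_3464_def hex_dir_simps)
  show "\<exists>u v. (u, v) \<in> adj ?G \<and> fst u = z \<and> fst v = z + (0, 1)" for z
    by (rule exI[of _ "(z, 1)"], rule exI[of _ "(z + (0, 1), 5)"])
      (simp add: adj_3464 nbrs_3464_def hex_dir_simps)
qed

interpretation L: coloured_graph lattice_3464 2
  by unfold_locales

text \<open>A single phase suffices for this lattice: the edges of the triangles have one colour
  and the edges of the hexagons the other one. Lying in a triangle is a property of the abstract
  graph, so this phase is invariant under all automorphisms and nothing has to be glued.\<close>

definition in_triangle :: "'v ugraph \<Rightarrow> 'v set \<Rightarrow> nat" where
  "in_triangle G e = (if \<exists>w. \<forall>u\<in>e. (u, w) \<in> adj G then 1 else 0)"

lemma in_triangle_3464:
  assumes "k < 6"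
  shows "in_triangle lattice_3464 {(x, k), (x, (k + 1) mod 6)} = 0"
    "in_triangle lattice_3464 {(x, k), (x, (k + 5) mod 6)} = 0"
    "in_triangle lattice_3464 {(x, k), (x + hex_dir k, (k + 4) mod 6)} = 1"
    "in_triangle lattice_3464 {(x, k), (x + hex_dir (k + 5), (k + 2) mod 6)} = 1"
proof -
  obtain a b where x: "x = (a, b)" by force
  have 0: "in_triangle lattice_3464 {(x, k), (x, (k + 1) mod 6)} = 0" if "k < 6" for k
  proof -
    have "\<not> (w \<in> set (nbrs_3464 (x, k)) \<and> w \<in> set (nbrs_3464 (x, (k + 1) mod 6)))" for w
      using less_6[OF that] x by (auto simp: nbrs_3464_def hex_dir_simps)
    then show ?thesis by (simp add: in_triangle_def adj_3464)
  qed
  have 1: "in_triangle lattice_3464 {(y, k), (y + hex_dir k, (k + 4) mod 6)} = 1" if "k < 6" for k y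
  proof -
    obtain a b where y: "y = (a, b)" by force
    have "(y + hex_dir (k + 5), (k + 2) mod 6) \<in> set (nbrs_3464 (y, k))" by (simp add: nbrs_3464_def)
    moreover have "(y + hex_dir (k + 5), (k + 2) mod 6) \<in> set (nbrs_3464 (y + hex_dir k, (k + 4) mod 6))"
      using less_6[OF that] y by (auto simp: nbrs_3464_def hex_dir_simps)
    ultimately have "\<exists>w. w \<in> set (nbrs_3464 (y, k)) \<and> w \<in> set (nbrs_3464 (y + hex_dir k, (k + 4) mod 6))" by blast
    then show ?thesis using that by (simp add: in_triangle_def adj_3464)
  qed
  show "in_triangle lattice_3464 {(x, k), (x, (k + 1) mod 6)} = 0"
    "in_triangle lattice_3464 {(x, k), (x + hex_dir k, (k + 4) mod 6)} = 1" using 0 1 assms by auto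
  show "in_triangle lattice_3464 {(x, k), (x, (k + 5) mod 6)} = 0"
    using 0[of "(k + 5) mod 6"] unfolding mod_6[OF assms] by (simp add: insert_commute)
  show "in_triangle lattice_3464 {(x, k), (x + hex_dir (k + 5), (k + 2) mod 6)} = 1"
    using 1[of "(k + 2) mod 6" "x + hex_dir (k + 5)"]
    unfolding mod_6[OF assms] hex_dir_opposite(2)[OF assms] by (simp add: insert_commute)
qed

interpretation L: phases lattice_3464 2 "{in_triangle lattice_3464}" "6 + 2 * 2 * 13" 0
proof
  let ?q = "in_triangle lattice_3464"
  show val: "q \<in> {?q} \<Longrightarrow> L.valid q" for q
  proof -
    have "L.valid ?q"
    proof (rule L.valid_neighbours[where ws = nbrs_3464])
      fix v :: "(int \<times> int) \<times> nat" and i :: nat assume v: "v \<in> L.V"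
      obtain x k where xk: "v = (x, k)" "k < 6" using v by (auto simp: V_3464)
      show "distinct (nbrs_3464 v) \<and> set (nbrs_3464 v) = {w. (v, w) \<in> adj lattice_3464}"
        using xk distinct_nbrs_3464 adj_3464 by auto
      assume "i < 2"
      then have "i = 0 \<or> i = 1" by linarith
      then show "length (filter (\<lambda>w. ?q {v, w} = i) (nbrs_3464 v)) = 2"
        using in_triangle_3464[OF xk(2), of x] unfolding xk nbrs_3464_def by auto
    qed (simp add: in_triangle_def)
    then show "q \<in> {?q} \<Longrightarrow> L.valid q" by simp
  qed
  show "\<exists>q'\<in>{?q}. \<forall>e\<in>L.E. q' (\<gamma> ` e) = q e" if "q \<in> {?q}" "\<gamma> \<in> L.Aut" for q \<gamma>
  proof -
    have "(\<exists>w. \<forall>u\<in>\<gamma> ` e. (u, w) \<in> adj lattice_3464) \<longleftrightarrow> (\<exists>w. \<forall>u\<in>e. (u, w) \<in> adj lattice_3464)" if e: "e \<in> L.E" for e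
    proof
      assume "\<exists>w. \<forall>u\<in>\<gamma> ` e. (u, w) \<in> adj lattice_3464"
      then obtain w where w: "\<forall>u\<in>e. (\<gamma> u, w) \<in> adj lattice_3464" by auto
      obtain y where y: "y \<in> e" using L.edge_pair[OF e] by blast
      then have wV: "w \<in> L.V" using w L.adjD by blast
      have "(u, L.ainv \<gamma> w) \<in> adj lattice_3464" if u: "u \<in> e" for u
        using L.aut_adj[OF \<open>\<gamma> \<in> L.Aut\<close>, of u "L.ainv \<gamma> w"] w u L.edge_sub[OF e] L.ainv_V[OF \<open>\<gamma> \<in> L.Aut\<close> wV] L.ainv_right[OF \<open>\<gamma> \<in> L.Aut\<close> wV] by auto
      then show "\<exists>w. \<forall>u\<in>e. (u, w) \<in> adj lattice_3464" by blast
    next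
      assume "\<exists>w. \<forall>u\<in>e. (u, w) \<in> adj lattice_3464"
      then obtain w where w: "\<forall>u\<in>e. (u, w) \<in> adj lattice_3464" by blast
      then have "\<forall>u\<in>e. (\<gamma> u, \<gamma> w) \<in> adj lattice_3464"
        using L.aut_adj[OF \<open>\<gamma> \<in> L.Aut\<close>] L.adjD by blast
      then show "\<exists>w. \<forall>u\<in>\<gamma> ` e. (u, w) \<in> adj lattice_3464" by blast
    qed
    then show ?thesis using \<open>q \<in> {?q}\<close> by (simp add: in_triangle_def)
  qed
  show "L.glue 0 q q'" if "q \<in> {?q}" "q' \<in> {?q}" for q q'
    using that val L.glue_refl by auto
  define rot where "rot = (\<lambda>(x :: int \<times> int, k). (x + hex_dir k, (k + 4) mod 6))"
  show "v \<in> L.B u (6 + 2 * 2 * 13)" if "q \<in> {?q}" "u \<in> L.V" "(u, v) \<in> (L.mono_step q i)\<^sup>*" for q u v i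
  proof -
    define cell :: "(int \<times> int) \<times> nat \<Rightarrow> ((int \<times> int) \<times> nat) set" where
      "cell w = (if i = 1 then {w, rot w, rot (rot w)} else {(fst w, 0)})" for w
    have "v \<in> L.B u (6 + 2 * 2 * (2 * 6 + 1))"
    proof (rule L.short_by_cells[where q = q and i = i and cell = cell])
      show "(u, v) \<in> (L.mono_step q i)\<^sup>*" "u \<in> L.V" using that by auto
      fix u v assume "(u, v) \<in> L.mono_step q i"
      moreover have "q = ?q" using that by simp
      ultimately have uv: "(u, v) \<in> adj lattice_3464" "?q {u, v} = i" by (simp_all add: L.mono_step_def adj_def)
      obtain x k where xk: "u = (x, k)" by (cases u)
      have k: "k < 6" "v \<in> set (nbrs_3464 (x, k))" using uv unfolding xk adj_3464 by auto
      obtain a b where x: "x = (a, b)" by force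
      have "i = 0 \<and> fst v = x \<or> i = 1 \<and> (v = rot u \<or> v = rot (rot u))"
      proof -
        have rr: "rot (rot u) = (x + hex_dir (k + 5), (k + 2) mod 6)"
          by (simp only: xk rot_def prod.case add.assoc rot_3464[OF k(1)])
        note t = in_triangle_3464[OF k(1), of x]
        from k(2) consider "v = (x, (k + 1) mod 6)" | "v = (x, (k + 5) mod 6)"
          | "v = (x + hex_dir k, (k + 4) mod 6)" | "v = (x + hex_dir (k + 5), (k + 2) mod 6)"
          by (auto simp: nbrs_3464_def)
        then show ?thesis
        proof cases
          case 1 then show ?thesis using uv(2) t(1) unfolding xk by simp
        next
          case 2 then show ?thesis using uv(2) t(2) unfolding xk by simp
        next
          case 3 then show ?thesis using uv(2) t(3) unfolding xk by (simp add: rot_def)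
        next
          case 4 then show ?thesis using uv(2) t(4) rr unfolding xk by simp
        qed
      qed
      moreover have rrr: "rot (rot (rot u)) = u"
        using hex_dir_opposite(2)[OF k(1), of x] mod_6(3)[OF k(1)]
        by (simp only: xk rot_def prod.case rot_3464[OF k(1)] add.assoc)
      ultimately show "cell u = cell v" using xk by (elim disjE conjE) (auto simp: cell_def rrr)
    next
      fix u v assume u: "u \<in> L.V" "v \<in> L.V" "cell u = cell v"
      obtain a b k where k: "u = ((a, b), k)" "k < 6" using u by (auto simp: V_3464)
      show "fst v \<in> L.box (fst u) (int 2)"
      proof (cases "i = 1")
        case True
        then have "v = u \<or> v = rot u \<or> v = rot (rot u)" using u(3) by (auto simp: cell_def)
        then show ?thesis using less_6[OF k(2)] by (auto simp: k rot_def hex_dir_simps L.box_def)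
      next
        case False
        then have "fst u = fst v" using u(3) by (auto simp: cell_def)
        then show ?thesis by (simp add: L.box_def mem_Times_iff)
      qed
    qed
    then show ?thesis by simp
  qed
  show "countable L.V" by (rule L.countable_verts)
  show "\<exists>c>0. \<exists>c'. \<forall>x\<in>L.V. \<forall>n\<ge>1. c * (real n)\<^sup>2 \<le> real (card (L.B x n)) \<and>
      real (card (L.B x n)) \<le> c' * (real n)\<^sup>2" by (rule L.planar_growth)
qed simp

theorem factor_3464: "\<exists>A \<Phi>. aut_factor lattice_3464 2 A \<Phi> \<and> finitary lattice_3464 A \<Phi> \<and>
       (AE \<omega> in iid_measure lattice_3464. schreier_decoration lattice_3464 2 (\<Phi> \<omega>)) \<and>
       (AE \<omega> in iid_measure lattice_3464. \<not> (\<exists>p. infinite_monochromatic_path lattice_3464 (\<Phi> \<omega>) p))"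
  by (rule L.factor_exists)

lemma (in graph) edge_other: "e \<in> E \<Longrightarrow> v \<in> e \<Longrightarrow> \<exists>w. e = {v, w} \<and> (v, w) \<in> adj G"
proof -
  assume e: "e \<in> E" "v \<in> e"
  obtain x y where xy: "e = {x, y}" using edge_pair[OF e(1)] by blast
  then have "v = x \<or> v = y" using e(2) by simp
  then have "e = {v, y} \<or> e = {v, x}" using xy by (elim disjE) (simp_all add: insert_commute)
  then show ?thesis using e(1) unfolding adj_def by (elim disjE) blast+
qed

section \<open>The Kagome lattice\<close>

text \<open>A vertex of the Kagome lattice is an edge of the hexagonal lattice, written
  \<open>hex_edge x i\<close>: it joins the upper vertex of the cell x to the lower vertex of
  the cell \<open>x + hex_shift i\<close>. Its neighbours are the two other edges at each of
  these two ends.\<close>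

definition hex_shift :: "nat \<Rightarrow> int \<times> int" where
  "hex_shift i = (if i = 0 then (0, 0) else if i = 1 then (1, 0) else (0, 1))"

definition hex_edge :: "int \<times> int \<Rightarrow> nat \<Rightarrow> ((int \<times> int) \<times> bool) set" where
  "hex_edge x i = {(x, True), (x + hex_shift i, False)}"

definition other_two :: "nat \<Rightarrow> nat list" where
  "other_two i = (if i = 0 then [1, 2] else if i = 1 then [0, 2] else [0, 1])"

definition address :: "((int \<times> int) \<times> bool) set \<Rightarrow> (int \<times> int) \<times> nat" where
  "address v = (THE xi. snd xi < 3 \<and> v = hex_edge (fst xi) (snd xi))"

definition kagome_nbrs :: "int \<times> int \<Rightarrow> nat \<Rightarrow> ((int \<times> int) \<times> bool) set list" where
  "kagome_nbrs x i = map (\<lambda>j. hex_edge x j) (other_two i) @ map (\<lambda>j. hex_edge (x + hex_shift i - hex_shift j) j) (other_two i)"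

lemma less_3: "i < 3 \<Longrightarrow> i = 0 \<or> i = 1 \<or> i = (2 :: nat)"
  by linarith

lemma hex_shift_inj: "i < 3 \<Longrightarrow> j < 3 \<Longrightarrow> hex_shift i = hex_shift j \<longleftrightarrow> i = j"
  using less_3[of i] less_3[of j] by (auto simp: hex_shift_def)

lemma hex_shift_add: "i < 3 \<Longrightarrow> j < 3 \<Longrightarrow> x + hex_shift i = x + hex_shift j \<longleftrightarrow> i = j"
  using hex_shift_inj by simp

lemma other_two: "i < 3 \<Longrightarrow> j \<in> set (other_two i) \<longleftrightarrow> j < 3 \<and> j \<noteq> i"
  using less_3[of i] less_3[of j] by (auto simp: other_two_def)

lemma hex_edge_eq: "i < 3 \<Longrightarrow> j < 3 \<Longrightarrow> hex_edge x i = hex_edge y j \<longleftrightarrow> x = y \<and> i = j"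
  using hex_shift_add[of i j x] by (auto simp: hex_edge_def doubleton_eq_iff)

lemma hex_edge_meet: "hex_edge x i \<inter> hex_edge y j \<noteq> {} \<longleftrightarrow> x = y \<or> x + hex_shift i = y + hex_shift j"
  by (auto simp: hex_edge_def)

lemma address_hex_edge[simp]: "i < 3 \<Longrightarrow> address (hex_edge x i) = (x, i)"
  unfolding address_def by (intro the_equality) (auto simp: hex_edge_eq)

lemma V_kagome: "verts kagome_lattice = {hex_edge x i | x i. i < 3}"
proof -
  have "verts kagome_lattice = {{(x, True), (x + s, False)} | (x :: int \<times> int) s. s \<in> {(0, 0), (1, 0), (0, 1)}}"
    by (simp add: kagome_lattice_def line_graph_def hexagonal_lattice_def)
  also have "\<dots> = {hex_edge x i | x i. i < 3}"
  proof (intro equalityI subsetI)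
    fix e assume "e \<in> {{(x, True), (x + s, False)} | (x :: int \<times> int) s. s \<in> {(0, 0), (1, 0), (0, 1)}}"
    then obtain x s where e: "e = {(x, True), (x + s, False)}" "s \<in> {(0, 0), (1, 0), (0, 1)}" by blast
    have "s = hex_shift 0 \<or> s = hex_shift 1 \<or> s = hex_shift 2" using e(2) by (simp add: hex_shift_def)
    then have "\<exists>i<3. s = hex_shift i" by (elim disjE) (auto intro: exI[of _ 0] exI[of _ 1] exI[of _ 2])
    then show "e \<in> {hex_edge x i | x i. i < 3}" using e(1) unfolding hex_edge_def by blast
  next
    fix e assume "e \<in> {hex_edge x i | x i. i < 3}"
    then obtain x i where "e = hex_edge x i" by blast
    moreover have "hex_shift i \<in> {(0, 0), (1, 0), (0, 1)}" by (simp add: hex_shift_def)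
    ultimately show "e \<in> {{(x, True), (x + s, False)} | (x :: int \<times> int) s. s \<in> {(0, 0), (1, 0), (0, 1)}}"
      unfolding hex_edge_def by blast
  qed
  finally show ?thesis .
qed

lemma hex_edge_disj: "hex_edge x i \<inter> hex_edge y j = {} \<longleftrightarrow> x \<noteq> y \<and> x + hex_shift i \<noteq> y + hex_shift j"
  using hex_edge_meet[of x i y j] by blast

lemma hex_edge_V: "i < 3 \<Longrightarrow> hex_edge x i \<in> verts kagome_lattice"
  unfolding V_kagome by blast

lemma kagome_adj: "(u, v) \<in> adj kagome_lattice \<longleftrightarrow>
    u \<in> verts kagome_lattice \<and> v \<in> verts kagome_lattice \<and> u \<noteq> v \<and> u \<inter> v \<noteq> {}"
proof -
  have E: "edges kagome_lattice = {{e, f} | e f. e \<in> verts kagome_lattice \<and> f \<in> verts kagome_lattice \<and> e \<noteq> f \<and> e \<inter> f \<noteq> {}}"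
    by (simp add: kagome_lattice_def line_graph_def)
  show ?thesis unfolding adj_def E mem_Collect_eq prod.case doubleton_eq_iff by blast
qed

lemma kagome_nbrs:
  assumes i: "i < 3"
  shows "set (kagome_nbrs x i) = {w. (hex_edge x i, w) \<in> adj kagome_lattice}"
proof (intro equalityI subsetI)
  fix w assume "w \<in> set (kagome_nbrs x i)"
  then obtain j where j: "j < 3" "j \<noteq> i" "w = hex_edge x j \<or> w = hex_edge (x + hex_shift i - hex_shift j) j"
    unfolding kagome_nbrs_def using other_two[OF i] by auto
  then have "w \<in> verts kagome_lattice" "hex_edge x i \<noteq> w"
    using hex_edge_V[OF j(1), of x] hex_edge_V[OF j(1), of "x + hex_shift i - hex_shift j"] hex_edge_eq[OF i j(1), of x x]
      hex_edge_eq[OF i j(1), of x "x + hex_shift i - hex_shift j"] by auto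
  moreover have "hex_edge x i \<inter> w \<noteq> {}" using j(3) by (auto simp: hex_edge_disj)
  ultimately show "w \<in> {w. (hex_edge x i, w) \<in> adj kagome_lattice}" using hex_edge_V[OF i] by (simp add: kagome_adj)
next
  fix w assume "w \<in> {w. (hex_edge x i, w) \<in> adj kagome_lattice}"
  then have w: "w \<in> verts kagome_lattice" "hex_edge x i \<noteq> w" "hex_edge x i \<inter> w \<noteq> {}" by (auto simp: kagome_adj)
  then obtain y j where yj: "w = hex_edge y j" "j < 3" unfolding V_kagome by blast
  then have "x = y \<or> x + hex_shift i = y + hex_shift j" using w(3) by (simp add: hex_edge_meet)
  moreover have "y = x + hex_shift i - hex_shift j" if "x + hex_shift i = y + hex_shift j" using that by (simp add: eq_diff_eq)
  moreover have "i \<noteq> j" using w(2) calculation yj by auto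
  then have jo: "j \<in> set (other_two i)" using other_two[OF i] yj(2) by simp
  ultimately have "w = hex_edge x j \<or> w = hex_edge (x + hex_shift i - hex_shift j) j" using yj(1) by auto
  then show "w \<in> set (kagome_nbrs x i)" unfolding kagome_nbrs_def using jo by auto
qed

lemma kagome_nbrs_distinct: "i < 3 \<Longrightarrow> distinct (kagome_nbrs x i)"
proof -
  assume i: "i < 3"
  have d: "distinct (other_two i)" by (simp add: other_two_def)
  have ne: "hex_edge x j \<noteq> hex_edge (x + hex_shift i - hex_shift l) l" if "j \<in> set (other_two i)" "l \<in> set (other_two i)" for j l
    using that other_two[OF i] hex_edge_eq[of j l x "x + hex_shift i - hex_shift l"] hex_shift_inj[OF i, of l] by (auto simp: algebra_simps)
  have "inj_on (\<lambda>j. hex_edge x j) (set (other_two i))" "inj_on (\<lambda>j. hex_edge (x + hex_shift i - hex_shift j) j) (set (other_two i))"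
    by (auto intro!: inj_onI simp: other_two[OF i] hex_edge_eq)
  then show ?thesis unfolding kagome_nbrs_def using d ne by (auto simp: distinct_map)
qed

text \<open>The three edges of the hexagonal lattice at an upper vertex form a triangle of the
  Kagome lattice, and so do the three edges at a lower vertex. Every Kagome edge lies in exactly
  one triangle, and this is its kind. Automorphisms may exchange the two kinds, so there are two
  phases: colour 0 for one kind and colour 1 for the other.\<close>

definition side :: "((int \<times> int) \<times> bool) set set \<Rightarrow> nat" where
  "side e = (if \<exists>x. \<forall>v\<in>e. (x, True) \<in> v then 0 else 1)"

lemma side_hex_edge: "side {hex_edge x i, hex_edge y j} = (if x = y then 0 else 1)"
  by (auto simp: side_def hex_edge_def)

interpretation K: planar_graph kagome_lattice "\<lambda>v. fst (address v)" 3 1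
proof
  let ?G = kagome_lattice
  show "\<exists>u v. u \<in> verts ?G \<and> v \<in> verts ?G \<and> u \<noteq> v \<and> e = {u, v}" if "e \<in> edges ?G" for e
  proof -
    have "e \<in> {{e, f} | e f. e \<in> verts ?G \<and> f \<in> verts ?G \<and> e \<noteq> f \<and> e \<inter> f \<noteq> {}}"
      using that by (simp add: kagome_lattice_def line_graph_def)
    then show ?thesis by blast
  qed
  show "\<bar>fst (fst (address u)) - fst (fst (address v))\<bar> \<le> 1 \<and> \<bar>snd (fst (address u)) - snd (fst (address v))\<bar> \<le> 1"
    if a: "(u, v) \<in> adj ?G" for u v
  proof -
    obtain x i where u: "u = hex_edge x i" "i < 3" using a unfolding kagome_adj V_kagome by blast
    obtain y j where v: "v = hex_edge y j" "j < 3" using a unfolding kagome_adj V_kagome by blast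
    have "x = y \<or> x + hex_shift i = y + hex_shift j" using a u v by (simp add: kagome_adj hex_edge_meet)
    then show ?thesis
    proof
      assume "x + hex_shift i = y + hex_shift j"
      then have "fst x + fst (hex_shift i) = fst y + fst (hex_shift j)" "snd x + snd (hex_shift i) = snd y + snd (hex_shift j)"
        by (metis fst_add, metis snd_add)
      moreover have "fst (hex_shift i) \<in> {0, 1}" "fst (hex_shift j) \<in> {0, 1}" "snd (hex_shift i) \<in> {0, 1}" "snd (hex_shift j) \<in> {0, 1}"
        by (auto simp: hex_shift_def)
      ultimately show ?thesis using u v by auto
    qed (use u v in simp)
  qed
  have fib: "{v \<in> verts ?G. fst (address v) = z} = hex_edge z ` {..<3}" for z
    unfolding V_kagome by (auto simp del: split_paired_Ex)
  show "finite {v \<in> verts ?G. fst (address v) = z}" "card {v \<in> verts ?G. fst (address v) = z} \<le> 3" for z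
    unfolding fib using card_image_le[of "{..<3 :: nat}" "hex_edge z"] by auto
  show "v \<in> graph_ball ?G u 1" if uv: "u \<in> verts ?G" "v \<in> verts ?G" "fst (address u) = fst (address v)" for u v
  proof (cases "u = v")
    case True then show ?thesis by (auto simp: graph_ball_def intro: exI[of _ 0])
  next
    case False
    have "u \<inter> v \<noteq> {}" using uv unfolding V_kagome by (auto simp: hex_edge_disj)
    then have "(u, v) \<in> adj ?G" using False uv by (simp add: kagome_adj)
    then show ?thesis unfolding graph_ball_def by (auto intro: exI[of _ 1])
  qed
  show "\<exists>u v. (u, v) \<in> adj ?G \<and> fst (address u) = z \<and> fst (address v) = z + (1, 0)" for z
    by (rule exI[of _ "hex_edge z 1"], rule exI[of _ "hex_edge (z + (1, 0)) 0"])
      (simp add: kagome_adj hex_edge_V hex_edge_eq hex_edge_meet, simp add: hex_shift_def zero_prod_def[symmetric])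
  show "\<exists>u v. (u, v) \<in> adj ?G \<and> fst (address u) = z \<and> fst (address v) = z + (0, 1)" for z
    by (rule exI[of _ "hex_edge z 2"], rule exI[of _ "hex_edge (z + (0, 1)) 0"])
      (simp add: kagome_adj hex_edge_V hex_edge_eq hex_edge_meet, simp add: hex_shift_def zero_prod_def[symmetric])
qed

interpretation K: coloured_graph kagome_lattice 2
  by unfold_locales

text \<open>At a vertex, the relation of having the same kind is expressed by adjacency alone.
  Hence automorphisms preserve it, and it determines the kinds up to exchange.\<close>

lemma side_transitive:
  assumes "(v, w) \<in> adj kagome_lattice" "(v, w') \<in> adj kagome_lattice"
  shows "side {v, w} = side {v, w'} \<longleftrightarrow> w = w' \<or> (w, w') \<in> adj kagome_lattice"
proof -
  obtain x i where v: "v = hex_edge x i" "i < 3" using assms unfolding kagome_adj V_kagome by blast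
  obtain y j where w: "w = hex_edge y j" "j < 3" using assms unfolding kagome_adj V_kagome by blast
  obtain z l where w': "w' = hex_edge z l" "l < 3" using assms unfolding kagome_adj V_kagome by blast
  have 1: "x = y \<and> i \<noteq> j \<or> x \<noteq> y \<and> i \<noteq> j \<and> x + hex_shift i = y + hex_shift j"
    using assms(1) v w hex_shift_add by (auto simp: kagome_adj hex_edge_meet hex_edge_eq)
  have 2: "x = z \<and> i \<noteq> l \<or> x \<noteq> z \<and> i \<noteq> l \<and> x + hex_shift i = z + hex_shift l"
    using assms(2) v w' hex_shift_add by (auto simp: kagome_adj hex_edge_meet hex_edge_eq)
  have "side {v, w} = side {v, w'} \<longleftrightarrow> (x = y \<longleftrightarrow> x = z)" by (auto simp: v w w' side_hex_edge)
  moreover have "w = w' \<or> (w, w') \<in> adj kagome_lattice \<longleftrightarrow> y = z \<or> y + hex_shift j = z + hex_shift l"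
    using hex_edge_V w w' by (auto simp: kagome_adj hex_edge_meet hex_edge_eq)
  moreover have "(x = y \<longleftrightarrow> x = z) \<longleftrightarrow> y = z \<or> y + hex_shift j = z + hex_shift l"
    using 1 2 hex_shift_add[OF v(2) w(2), of x] hex_shift_add[OF v(2) w'(2), of x] by metis
  ultimately show ?thesis by simp
qed

definition upper :: "nat \<Rightarrow> ((int \<times> int) \<times> bool) set set \<Rightarrow> nat" where
  "upper c e = (if c = 0 then side e else 1 - side e)"

lemma side_01: "side e = 0 \<or> side e = 1"
  by (simp add: side_def)

lemma upper_01: "upper c e = 0 \<or> upper c e = 1"
  using side_01[of e] by (auto simp: upper_def)

lemma upper_eq: "upper c e = upper c e' \<longleftrightarrow> side e = side e'"
  using side_01[of e] side_01[of e'] by (auto simp: upper_def)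

lemma kagome_valid: "K.valid (upper c)"
proof (rule K.valid_neighbours[where ws = "\<lambda>v. kagome_nbrs (fst (address v)) (snd (address v))"])
  fix v i assume v: "v \<in> K.V"
  obtain x j where xj: "v = hex_edge x j" "j < 3" using v unfolding V_kagome by blast
  show "distinct (kagome_nbrs (fst (address v)) (snd (address v))) \<and> set (kagome_nbrs (fst (address v)) (snd (address v))) = {w. (v, w) \<in> adj kagome_lattice}"
    using kagome_nbrs[OF xj(2)] kagome_nbrs_distinct[OF xj(2)] xj by simp
  assume "i < (2 :: nat)"
  then have i: "i = 0 \<or> i = 1" by linarith
  have u0: "side {hex_edge x j, hex_edge x l} = 0" for l by (simp add: side_hex_edge)
  have u1: "side {hex_edge x j, hex_edge (x + hex_shift j - hex_shift l) l} = 1" if "l \<in> set (other_two j)" for l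
  proof -
    have "hex_shift j \<noteq> hex_shift l" using that other_two[OF xj(2)] hex_shift_inj[OF xj(2), of l] by auto
    then have "x \<noteq> x + hex_shift j - hex_shift l" by (simp add: algebra_simps)
    then show ?thesis by (simp add: side_hex_edge)
  qed
  have "\<exists>l m. other_two j = [l, m]" by (simp add: other_two_def)
  then obtain l m where lm: "other_two j = [l, m]" by blast
  have "side {hex_edge x j, hex_edge (x + hex_shift j - hex_shift l) l} = 1" "side {hex_edge x j, hex_edge (x + hex_shift j - hex_shift m) m} = 1"
    using u1 lm by simp_all
  then show "length (filter (\<lambda>w. upper c {v, w} = i) (kagome_nbrs (fst (address v)) (snd (address v)))) = 2"
    using i xj(2) unfolding xj(1) kagome_nbrs_def by (auto simp: lm upper_def u0)
qed (use upper_01 in \<open>metis One_nat_def lessI pos2 numeral_2_eq_2\<close>)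

text \<open>Every edge lies on exactly one hexagonal face, and around a hexagon the edges
  alternate between the two kinds. So at each of its vertices a hexagon has one edge of each
  kind, and exchanging the colours around a hexagon preserves all colour degrees. The value is a
  label for the hexagon, proportional to its position.\<close>

definition hexagon_of :: "((int \<times> int) \<times> bool) set set \<Rightarrow> int \<times> int" where
  "hexagon_of e = (if side e = 0 then (\<Sum>v\<in>e. fst (address v) + hex_shift (snd (address v)) + hex_shift (snd (address v))) - (2, 2)
     else (\<Sum>v\<in>e. fst (address v) - hex_shift (snd (address v))))"

lemma hexagon_of_up: "i < 3 \<Longrightarrow> j < 3 \<Longrightarrow> i \<noteq> j \<Longrightarrow>
    hexagon_of {hex_edge x i, hex_edge x j} = x + x + hex_shift i + hex_shift i + hex_shift j + hex_shift j - (2, 2)"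
  using hex_edge_eq[of i j x x] by (simp add: hexagon_of_def side_hex_edge)

lemma hexagon_of_down: "i < 3 \<Longrightarrow> j < 3 \<Longrightarrow> i \<noteq> j \<Longrightarrow>
    hexagon_of {hex_edge x i, hex_edge (x + hex_shift i - hex_shift j) j} = x + x - hex_shift j - hex_shift j"
proof -
  assume ij: "i < 3" "j < 3" "i \<noteq> j"
  then have "x \<noteq> x + hex_shift i - hex_shift j" using hex_shift_inj[of i j] by (auto simp: algebra_simps)
  then show ?thesis using ij hex_edge_eq[of i j x "x + hex_shift i - hex_shift j"] by (simp add: hexagon_of_def side_hex_edge)
qed

lemma kagome_glue: "K.glue (1 + 2 * 2 * (2 * 1 + 1)) (upper 0) (upper 1)"
proof (rule K.glue_pieces[where piece = hexagon_of])
  show "K.valid (upper 0)" "K.valid (upper 1)" by (rule kagome_valid)+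
next
  fix v c z assume v: "v \<in> K.V" "c < (2 :: nat)"
  obtain x i where xi: "v = hex_edge x i" "i < 3" using v unfolding V_kagome by blast
  note card = K.card_incident[OF kagome_nbrs_distinct[OF xi(2)] kagome_nbrs[OF xi(2)], where Q = "\<lambda>e. hexagon_of e = z \<and> q e = c" for q]
  have ne: "hex_shift i \<noteq> hex_shift j" if "j \<noteq> i" "j < 3" for j using hex_shift_inj[OF xi(2) that(2)] that by auto
  have d: "x \<noteq> x + hex_shift i - hex_shift j" if "j \<noteq> i" "j < 3" for j using ne[OF that] by (auto simp: algebra_simps)
  have "length (filter (\<lambda>w. hexagon_of {v, w} = z \<and> upper 0 {v, w} = c) (kagome_nbrs x i)) =
     length (filter (\<lambda>w. hexagon_of {v, w} = z \<and> upper 1 {v, w} = c) (kagome_nbrs x i))"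
  proof -
    obtain j l where jl: "other_two i = [j, l]" "j < 3" "l < 3" "j \<noteq> i" "l \<noteq> i"
      "hex_shift i + hex_shift j + hex_shift l = (1, 1)"
      using less_3[OF xi(2)] by (auto simp: other_two_def hex_shift_def)
    have s: "hexagon_of {v, hex_edge x j} = hexagon_of {v, hex_edge (x + hex_shift i - hex_shift l) l}"
        "hexagon_of {v, hex_edge x l} = hexagon_of {v, hex_edge (x + hex_shift i - hex_shift j) j}"
    proof -
      have e1: "hex_shift i + hex_shift j = (1, 1) - hex_shift l" using jl(6) by (simp add: eq_diff_eq)
      have e2: "hex_shift i + hex_shift l = (1, 1) - hex_shift j" using jl(6) by (simp add: eq_diff_eq ac_simps)
      have "hexagon_of {v, hex_edge x j} = x + x + (hex_shift i + hex_shift j) + (hex_shift i + hex_shift j) - ((1, 1) + (1, 1))"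
        unfolding xi(1) hexagon_of_up[OF xi(2) jl(2) jl(4)[symmetric]] by simp
      also have "\<dots> = hexagon_of {v, hex_edge (x + hex_shift i - hex_shift l) l}"
        unfolding e1 xi(1) hexagon_of_down[OF xi(2) jl(3) jl(5)[symmetric]] by (simp add: algebra_simps)
      finally show "hexagon_of {v, hex_edge x j} = hexagon_of {v, hex_edge (x + hex_shift i - hex_shift l) l}" .
      have "hexagon_of {v, hex_edge x l} = x + x + (hex_shift i + hex_shift l) + (hex_shift i + hex_shift l) - ((1, 1) + (1, 1))"
        unfolding xi(1) hexagon_of_up[OF xi(2) jl(3) jl(5)[symmetric]] by simp
      also have "\<dots> = hexagon_of {v, hex_edge (x + hex_shift i - hex_shift j) j}"
        unfolding e2 xi(1) hexagon_of_down[OF xi(2) jl(2) jl(4)[symmetric]] by (simp add: algebra_simps)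
      finally show "hexagon_of {v, hex_edge x l} = hexagon_of {v, hex_edge (x + hex_shift i - hex_shift j) j}" .
    qed
    have u: "side {v, hex_edge x j} = 0" "side {v, hex_edge x l} = 0" "side {v, hex_edge (x + hex_shift i - hex_shift j) j} = 1" "side {v, hex_edge (x + hex_shift i - hex_shift l) l} = 1"
      using d jl xi(1) by (auto simp: side_hex_edge)
    show ?thesis using v(2) unfolding kagome_nbrs_def jl(1) by (simp add: s upper_def u)
  qed
  then show "card {e \<in> K.E. v \<in> e \<and> hexagon_of e = z \<and> upper 0 e = c} = card {e \<in> K.E. v \<in> e \<and> hexagon_of e = z \<and> upper 1 e = c}"
    unfolding xi(1) card .
next
  fix e e' u assume e: "e \<in> K.E" "e' \<in> K.E" "hexagon_of e = hexagon_of e'" "u \<in> e"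
  have near: "\<bar>fst (hexagon_of e) - 2 * fst (fst (address u))\<bar> \<le> 2 \<and> \<bar>snd (hexagon_of e) - 2 * snd (fst (address u))\<bar> \<le> 2"
    if e: "e \<in> K.E" "u \<in> e" for e u
  proof -
    obtain w where w: "e = {u, w}" and a: "(u, w) \<in> adj kagome_lattice" using K.edge_other[OF e] by blast
    then obtain x i where u: "u = hex_edge x i" "i < 3" unfolding kagome_adj V_kagome by blast
    have "w \<in> set (kagome_nbrs x i)" using a kagome_nbrs[OF u(2)] u by simp
    then obtain j where j: "j < 3" "i \<noteq> j" "w = hex_edge x j \<or> w = hex_edge (x + hex_shift i - hex_shift j) j"
      unfolding kagome_nbrs_def using other_two[OF u(2)] by auto
    have p: "hexagon_of e = x + x + hex_shift i + hex_shift i + hex_shift j + hex_shift j - (2, 2) \<or> hexagon_of e = x + x - hex_shift j - hex_shift j"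
      using j(3) hexagon_of_up[OF u(2) j(1,2), of x] hexagon_of_down[OF u(2) j(1,2), of x] unfolding w u(1) by (elim disjE) simp_all
    have "fst (address u) = x" using u by simp
    then show ?thesis using p less_3[OF u(2)] less_3[OF j(1)] j(2) by (cases x) (auto simp: hex_shift_def)
  qed
  show "e' \<subseteq> K.B u (1 + 2 * 2 * (2 * 1 + 1))"
  proof
    fix w assume w: "w \<in> e'"
    have "fst (address w) \<in> K.box (fst (address u)) (int 2)"
      using near[OF e(1,4)] near[OF e(2) w] e(3) by (auto simp: K.box_def mem_Times_iff)
    then show "w \<in> K.B u (1 + 2 * 2 * (2 * 1 + 1))" by (rule K.near_ball_box[rotated 2]) (use K.edge_sub e w in auto)
  qed
qed

lemma kagome_rigid:
  assumes q: "\<And>e. e \<in> K.E \<Longrightarrow> q e = 0 \<or> q e = (1 :: nat)"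
    and tr: "\<And>v w w'. (v, w) \<in> adj kagome_lattice \<Longrightarrow> (v, w') \<in> adj kagome_lattice \<Longrightarrow>
      q {v, w} = q {v, w'} \<longleftrightarrow> w = w' \<or> (w, w') \<in> adj kagome_lattice"
  shows "\<exists>c\<in>{0, 1}. \<forall>e\<in>K.E. q e = upper c e"
proof -
  have spread: "\<forall>e\<in>K.E. v \<in> e \<longrightarrow> q e = upper c e"
    if a: "(v, w) \<in> adj kagome_lattice" "q {v, w} = upper c {v, w}" for v w c
  proof (intro ballI impI)
    fix e assume e: "e \<in> K.E" "v \<in> e"
    then obtain w' where w': "e = {v, w'}" and a': "(v, w') \<in> adj kagome_lattice" using K.edge_other by blast
    have "q {v, w} = q e \<longleftrightarrow> upper c {v, w} = upper c e"
      using tr[OF a(1) a'] side_transitive[OF a(1) a'] unfolding upper_eq w' by simp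
    then show "q e = upper c e" using a(2) q[OF e(1)] upper_01[of c "{v, w}"] upper_01[of c e] by auto
  qed
  have a0: "(hex_edge 0 0, hex_edge 0 1) \<in> adj kagome_lattice" by (simp add: kagome_adj hex_edge_V hex_edge_eq hex_edge_meet)
  then have e0: "{hex_edge 0 0, hex_edge 0 1} \<in> K.E" by (simp add: adj_def)
  have "q {hex_edge 0 0, hex_edge 0 1} = upper 0 {hex_edge 0 0, hex_edge 0 1} \<or> q {hex_edge 0 0, hex_edge 0 1} = upper 1 {hex_edge 0 0, hex_edge 0 1}"
    using q[OF e0] side_01[of "{hex_edge 0 0, hex_edge 0 1}"] by (auto simp: upper_def)
  then obtain c where c: "c = 0 \<or> c = 1" "q {hex_edge 0 0, hex_edge 0 1} = upper c {hex_edge 0 0, hex_edge 0 1}" by blast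
  have "\<forall>e\<in>K.E. q e = upper c e"
  proof (rule K.rigid[of "hex_edge 0 0"])
    show "hex_edge 0 0 \<in> K.V" by (simp add: hex_edge_V)
    show "\<forall>e\<in>K.E. hex_edge 0 0 \<in> e \<longrightarrow> q e = upper c e" by (rule spread[OF a0 c(2)])
    fix v w assume a: "(v, w) \<in> adj kagome_lattice" "\<forall>e\<in>K.E. v \<in> e \<longrightarrow> q e = upper c e"
    then have "q {w, v} = upper c {w, v}" by (auto simp: adj_def insert_commute)
    then show "\<forall>e\<in>K.E. w \<in> e \<longrightarrow> q e = upper c e" using spread[OF K.adj_sym[OF a(1)]] by blast
  qed
  then show ?thesis using c(1) by auto
qed

interpretation K: phases kagome_lattice 2 "{upper 0, upper 1}" 7 13
proof
  show "K.valid q" if "q \<in> {upper 0, upper 1}" for q using that kagome_valid by auto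
  show "\<exists>q'\<in>{upper 0, upper 1}. \<forall>e\<in>K.E. q' (\<gamma> ` e) = q e" if q: "q \<in> {upper 0, upper 1}" and g: "\<gamma> \<in> K.Aut" for q \<gamma>
  proof -
    obtain c where c: "q = upper c" using q by blast
    have img: "K.push \<gamma> q {v, w} = q {K.ainv \<gamma> v, K.ainv \<gamma> w}" for v w by (simp add: K.push_def)
    have ia: "(K.ainv \<gamma> v, K.ainv \<gamma> w) \<in> adj kagome_lattice \<longleftrightarrow> (v, w) \<in> adj kagome_lattice" if "v \<in> K.V" "w \<in> K.V" for v w
      using K.aut_adj[OF K.ainv_aut[OF g] that] .
    have "\<exists>c'\<in>{0, 1}. \<forall>e\<in>K.E. K.push \<gamma> q e = upper c' e"
    proof (rule kagome_rigid)
      show "K.push \<gamma> q e = 0 \<or> K.push \<gamma> q e = 1" for e using upper_01 by (simp add: K.push_def c)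
      fix v w w' assume a: "(v, w) \<in> adj kagome_lattice" "(v, w') \<in> adj kagome_lattice"
      then have V: "v \<in> K.V" "w \<in> K.V" "w' \<in> K.V" using K.adjD by auto
      have a': "(K.ainv \<gamma> v, K.ainv \<gamma> w) \<in> adj kagome_lattice" "(K.ainv \<gamma> v, K.ainv \<gamma> w') \<in> adj kagome_lattice"
        using ia[OF V(1,2)] ia[OF V(1,3)] a by simp_all
      have "K.push \<gamma> q {v, w} = K.push \<gamma> q {v, w'} \<longleftrightarrow> K.ainv \<gamma> w = K.ainv \<gamma> w' \<or> (K.ainv \<gamma> w, K.ainv \<gamma> w') \<in> adj kagome_lattice"
        unfolding img unfolding c upper_eq by (rule side_transitive[OF a'])
      then show "K.push \<gamma> q {v, w} = K.push \<gamma> q {v, w'} \<longleftrightarrow> w = w' \<or> (w, w') \<in> adj kagome_lattice"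
        using ia V K.aut_inj[OF K.ainv_aut[OF g]] by simp
    qed
    then obtain c' where c': "c' \<in> {0, 1}" "\<forall>e\<in>K.E. K.push \<gamma> q e = upper c' e" by blast
    have "upper c' (\<gamma> ` e) = q e" if "e \<in> K.E" for e
      using c'(2) K.aut_edge[OF g that] K.push_image[OF g K.edge_sub[OF that], of q] by auto
    then show ?thesis using c'(1) by blast
  qed
  show "K.glue 13 q q'" if "q \<in> {upper 0, upper 1}" "q' \<in> {upper 0, upper 1}" for q q'
  proof -
    have "K.glue 13 (upper 0) (upper 1)" using kagome_glue by simp
    then show ?thesis using that K.glue_sym K.glue_refl[OF kagome_valid] by blast
  qed
  show "v \<in> K.B u 7" if q: "q \<in> {upper 0, upper 1}" and u: "u \<in> K.V" and uv: "(u, v) \<in> (K.mono_step q i)\<^sup>*" for q u v i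
  proof -
    obtain c where c: "q = upper c" using q by blast
    define cell where "cell v = (if upper c {} = i then fst (address v) else fst (address v) + hex_shift (snd (address v)))" for v
    have "v \<in> K.B u (1 + 2 * 1 * (2 * 1 + 1))"
    proof (rule K.short_by_cells[OF _ _ u uv, where cell = cell])
      fix u v assume a: "(u, v) \<in> K.mono_step q i"
      then have ad: "(u, v) \<in> adj kagome_lattice" "upper c {u, v} = i" by (auto simp: K.mono_step_def adj_def c)
      obtain x j where x: "u = hex_edge x j" "j < 3" using ad unfolding kagome_adj V_kagome by blast
      obtain y l where y: "v = hex_edge y l" "l < 3" using ad unfolding kagome_adj V_kagome by blast
      have m: "x = y \<or> x + hex_shift j = y + hex_shift l" using ad(1) x y by (simp add: kagome_adj hex_edge_meet)
      have "side {} = 0" by (simp add: side_def)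
      then have "upper c {} = i \<longleftrightarrow> x = y"
        using ad(2) unfolding x(1) y(1) by (cases "x = y"; cases "c = 0") (simp_all add: upper_def side_hex_edge)
      then show "cell u = cell v" using m x y by (auto simp: cell_def)
    next
      fix u v assume a: "u \<in> K.V" "v \<in> K.V" "cell u = cell v"
      obtain x j where x: "u = hex_edge x j" "j < 3" using a unfolding V_kagome by blast
      obtain y l where y: "v = hex_edge y l" "l < 3" using a unfolding V_kagome by blast
      have "x = y \<or> x + hex_shift j = y + hex_shift l" using a(3) x y by (auto simp: cell_def split: if_splits)
      then show "fst (address v) \<in> K.box (fst (address u)) (int 1)"
        using x y less_3[OF x(2)] less_3[OF y(2)] by (cases x; cases y) (auto simp: hex_shift_def K.box_def)
    qed
    then show ?thesis by simp
  qed
  show "countable K.V" by (rule K.countable_verts)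
  show "\<exists>c>0. \<exists>c'. \<forall>x\<in>K.V. \<forall>n\<ge>1. c * (real n)\<^sup>2 \<le> real (card (K.B x n)) \<and>
      real (card (K.B x n)) \<le> c' * (real n)\<^sup>2" by (rule K.planar_growth)
qed simp

theorem factor_kagome: "\<exists>A \<Phi>. aut_factor kagome_lattice 2 A \<Phi> \<and> finitary kagome_lattice A \<Phi> \<and>
       (AE \<omega> in iid_measure kagome_lattice. schreier_decoration kagome_lattice 2 (\<Phi> \<omega>)) \<and>
       (AE \<omega> in iid_measure kagome_lattice. \<not> (\<exists>p. infinite_monochromatic_path kagome_lattice (\<Phi> \<omega>) p))"
  by (rule K.factor_exists)

section \<open>Cayley graphs of the plane and periodic colourings\<close>

text \<open>The edges at v in a Cayley graph with generators ds: the pair \<open>(x, i)\<close>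
  is the edge from x to \<open>x + ds ! i\<close>.\<close>

definition star :: "(int \<times> int) list \<Rightarrow> int \<times> int \<Rightarrow> ((int \<times> int) \<times> nat) list" where
  "star ds v = map (\<lambda>i. (v, i)) [0..<length ds] @ map (\<lambda>i. (v - ds ! i, i)) [0..<length ds]"

text \<open>The multiset of the values of F at the edges around v. Equality of multisets turns
  the balance conditions of gluing into finite computations for periodic colourings.\<close>

definition around :: "(int \<times> int) list \<Rightarrow> (int \<times> int \<Rightarrow> nat \<Rightarrow> 'a) \<Rightarrow> int \<times> int \<Rightarrow> 'a multiset" where
  "around ds F v = mset (map (\<lambda>(x, i). F x i) (star ds v))"

locale cayley =
  fixes G :: "(int \<times> int) ugraph" and d :: nat and ds :: "(int \<times> int) list"
  assumes G_eq: "G = cayley_graph (set ds)" and d_eq: "d = length ds"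
    and distinct_ds: "distinct ds"
    and no_opposite: "s \<in> set ds \<Longrightarrow> t \<in> set ds \<Longrightarrow> s + t \<noteq> 0"
    and small: "s \<in> set ds \<Longrightarrow> \<bar>fst s\<bar> \<le> 1 \<and> \<bar>snd s\<bar> \<le> 1"
    and units: "(1, 0) \<in> set ds" "(0, 1) \<in> set ds"
begin

lemma verts_UNIV[simp]: "verts G = UNIV"
  by (simp add: G_eq cayley_graph_def)

lemma edges_ds: "edges G = {{x, x + s} | x s. s \<in> set ds}"
  by (simp add: G_eq cayley_graph_def)

lemma edge_iff: "e \<in> edges G \<longleftrightarrow> (\<exists>x i. i < d \<and> e = {x, x + ds ! i})"
proof
  assume "e \<in> edges G"
  then obtain x s where "e = {x, x + s}" "s \<in> set ds" unfolding edges_ds by blast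
  then show "\<exists>x i. i < d \<and> e = {x, x + ds ! i}" by (metis in_set_conv_nth d_eq)
next
  assume "\<exists>x i. i < d \<and> e = {x, x + ds ! i}"
  then show "e \<in> edges G" unfolding edges_ds d_eq using nth_mem by blast
qed

lemma adj_iff: "(u, v) \<in> adj G \<longleftrightarrow> v - u \<in> set ds \<or> u - v \<in> set ds"
proof -
  have "(u, v) \<in> adj G \<longleftrightarrow> (\<exists>s\<in>set ds. v = u + s \<or> u = v + s)"
    unfolding adj_def edges_ds mem_Collect_eq prod.case doubleton_eq_iff by blast
  also have "\<dots> \<longleftrightarrow> v - u \<in> set ds \<or> u - v \<in> set ds"
    by (metis add_diff_cancel_left' add.commute diff_add_cancel)
  finally show ?thesis .
qed

lemma nonzero: "s \<in> set ds \<Longrightarrow> s \<noteq> 0"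
  using no_opposite[of s s] by auto

sublocale planar_graph G "\<lambda>x. x" 1 0
proof
  show "\<exists>u v. u \<in> verts G \<and> v \<in> verts G \<and> u \<noteq> v \<and> e = {u, v}" if e: "e \<in> edges G" for e
  proof -
    obtain x s where xs: "e = {x, x + s}" "s \<in> set ds" using e unfolding edges_ds by blast
    show ?thesis by (rule exI[of _ x], rule exI[of _ "x + s"]) (use xs nonzero[of s] in simp)
  qed
  show "\<bar>fst u - fst v\<bar> \<le> 1 \<and> \<bar>snd u - snd v\<bar> \<le> 1" if "(u, v) \<in> adj G" for u v
    using that small[of "v - u"] small[of "u - v"] unfolding adj_iff fst_diff snd_diff by linarith
  show "finite {v \<in> verts G. v = z}" "card {v \<in> verts G. v = z} \<le> 1" for z by simp_all
  show "v \<in> graph_ball G u 0" if "u = v" for u v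
    using that unfolding graph_ball_def by (auto intro: exI[of _ 0])
  show "\<exists>u v. (u, v) \<in> adj G \<and> u = z \<and> v = z + (1, 0)" "\<exists>u v. (u, v) \<in> adj G \<and> u = z \<and> v = z + (0, 1)" for z
    unfolding adj_iff using units add_diff_cancel_left' by metis+
qed

sublocale coloured_graph G d
  by unfold_locales

definition lab :: "(int \<times> int \<Rightarrow> nat \<Rightarrow> 'a) \<Rightarrow> (int \<times> int) set \<Rightarrow> 'a" where
  "lab F e = (THE c. \<exists>x i. i < d \<and> e = {x, x + ds ! i} \<and> c = F x i)"

lemma edge_unique:
  assumes "i < d" "j < d" "{x, x + ds ! i} = {y, y + ds ! j}"
  shows "x = y \<and> i = j"
proof -
  have "x = y \<and> ds ! i = ds ! j \<or> x = y + ds ! j \<and> x + ds ! i = y" using assms(3) by (auto simp: doubleton_eq_iff)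
  then show ?thesis
  proof
    assume "x = y + ds ! j \<and> x + ds ! i = y"
    then have "ds ! j + ds ! i = 0" by (metis add.assoc add_cancel_right_right)
    then show ?thesis using no_opposite[of "ds ! j" "ds ! i"] assms by (simp add: d_eq)
  qed (use assms distinct_ds in \<open>auto simp: d_eq nth_eq_iff_index_eq\<close>)
qed

lemma lab_edge:
  assumes "i < d" shows "lab F {x, x + ds ! i} = F x i" "lab F {x + ds ! i, x} = F x i" "lab F {x, x - ds ! i} = F (x - ds ! i) i"
proof -
  show 1: "lab F {x, x + ds ! i} = F x i" for x
    unfolding lab_def
  proof (rule the_equality)
    show "\<exists>y j. j < d \<and> {x, x + ds ! i} = {y, y + ds ! j} \<and> F x i = F y j" using assms by blast
    fix c assume "\<exists>y j. j < d \<and> {x, x + ds ! i} = {y, y + ds ! j} \<and> c = F y j"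
    then obtain y j where "j < d" "{x, x + ds ! i} = {y, y + ds ! j}" "c = F y j" by blast
    then show "c = F x i" using edge_unique[OF assms \<open>j < d\<close>, of x y] by simp
  qed
  show "lab F {x + ds ! i, x} = F x i" using 1 by (simp add: insert_commute)
  show "lab F {x, x - ds ! i} = F (x - ds ! i) i" using 1[of "x - ds ! i"] by (simp add: insert_commute)
qed

lemma card_around:
  fixes P :: "int \<times> int \<Rightarrow> nat \<Rightarrow> 'a" and F :: "int \<times> int \<Rightarrow> nat \<Rightarrow> 'b"
  shows "card {e \<in> E. v \<in> e \<and> Q (lab P e) (lab F e)} =
    size (filter_mset (\<lambda>(p, c). Q p c) (around ds (\<lambda>x i. (P x i, F x i)) v))"
proof -
  define ws where "ws = map (\<lambda>i. v + ds ! i) [0..<d] @ map (\<lambda>i. v - ds ! i) [0..<d]"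
  have "set (map (\<lambda>i. v + ds ! i) [0..<d]) = (+) v ` set ds" "set (map (\<lambda>i. v - ds ! i) [0..<d]) = (-) v ` set ds"
    by (force simp: d_eq in_set_conv_nth)+
  then have s: "set ws = (+) v ` set ds \<union> (-) v ` set ds" by (simp add: ws_def)
  have "set ws = {w. (v, w) \<in> adj G}"
    unfolding s adj_iff
  proof (intro equalityI subsetI)
    fix w assume "w \<in> {w. w - v \<in> set ds \<or> v - w \<in> set ds}"
    then have "w - v \<in> set ds \<or> v - w \<in> set ds" by simp
    then show "w \<in> (+) v ` set ds \<union> (-) v ` set ds"
    proof
      assume "w - v \<in> set ds" then show ?thesis by (intro UnI1 image_eqI[of _ _ "w - v"]) simp_all
    next
      assume "v - w \<in> set ds" then show ?thesis by (intro UnI2 image_eqI[of _ _ "v - w"]) simp_all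
    qed
  qed auto
  moreover have "distinct ws"
  proof -
    have ne: "v + ds ! i \<noteq> v - ds ! j" if "i < d" "j < d" for i j
    proof
      assume "v + ds ! i = v - ds ! j"
      then have "ds ! i + ds ! j = 0" by (simp add: algebra_simps)
      then show False using no_opposite[of "ds ! i" "ds ! j"] that by (simp add: d_eq)
    qed
    have "set (map (\<lambda>i. v + ds ! i) [0..<d]) \<inter> set (map (\<lambda>i. v - ds ! i) [0..<d]) = {}"
    proof (rule equals0I)
      fix w assume "w \<in> set (map (\<lambda>i. v + ds ! i) [0..<d]) \<inter> set (map (\<lambda>i. v - ds ! i) [0..<d])"
      then obtain i j where "i < d" "w = v + ds ! i" "j < d" "w = v - ds ! j" by auto
      then show False using ne by metis
    qed
    moreover have "distinct (map (\<lambda>i. v + ds ! i) [0..<d])" "distinct (map (\<lambda>i. v - ds ! i) [0..<d])"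
      using distinct_ds by (simp_all add: distinct_map inj_on_def d_eq nth_eq_iff_index_eq)
    ultimately show ?thesis unfolding ws_def by simp
  qed
  ultimately have "card {e \<in> E. v \<in> e \<and> Q (lab P e) (lab F e)} = length (filter (\<lambda>w. Q (lab P {v, w}) (lab F {v, w})) ws)"
    by (rule card_incident[rotated])
  also have "\<dots> = length (filter (\<lambda>(p, c). Q p c) (map (\<lambda>(x, i). (P x i, F x i)) (star ds v)))"
  proof -
    have 1: "filter (\<lambda>i. Q (lab P {v, v + ds ! i}) (lab F {v, v + ds ! i})) [0..<d] = filter (\<lambda>i. Q (P v i) (F v i)) [0..<d]"
      "filter (\<lambda>i. Q (lab P {v, v - ds ! i}) (lab F {v, v - ds ! i})) [0..<d] = filter (\<lambda>i. Q (P (v - ds ! i) i) (F (v - ds ! i) i)) [0..<d]"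
      by (auto intro!: filter_cong simp: lab_edge)
    show ?thesis unfolding ws_def star_def d_eq[symmetric] by (simp add: filter_map o_def 1)
  qed
  finally show ?thesis unfolding around_def by (simp only: size_mset flip: mset_filter)
qed

definition periodic :: "nat \<Rightarrow> (int \<times> int \<Rightarrow> nat \<Rightarrow> 'a) \<Rightarrow> bool" where
  "periodic n F \<longleftrightarrow> (\<forall>x z i. F (x + (int n * fst z, int n * snd z)) i = F x i)"

lemma window:
  assumes "n > 0" obtains y z :: "int \<times> int" where "x = y + (int n * fst z, int n * snd z)" "y \<in> {0..<int n} \<times> {0..<int n}"
proof
  show "x = (fst x mod int n, snd x mod int n) + (int n * fst (fst x div int n, snd x div int n), int n * snd (fst x div int n, snd x div int n))"
    by (simp add: prod_eq_iff)
  show "(fst x mod int n, snd x mod int n) \<in> {0..<int n} \<times> {0..<int n}" using assms by simp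
qed

lemma around_shift: "around ds F (v + w) = around ds (\<lambda>x i. F (x + w) i) v"
  unfolding around_def star_def by (simp add: o_def add_diff_eq diff_add_eq)

lemma valid_lab:
  assumes "\<And>v i. i < d \<Longrightarrow> count (around ds F v) i = 2" and "\<And>v i. i < d \<Longrightarrow> F v i < d"
  shows "valid (lab F)"
  unfolding valid_def
proof (intro conjI ballI allI impI)
  fix e assume "e \<in> E"
  then show "lab F e < d" using assms(2) by (auto simp: edge_iff lab_edge)
next
  fix v i assume "i < d"
  have "card {e \<in> E. v \<in> e \<and> lab F e = i} = size (filter_mset (\<lambda>(p, c). c = i) (around ds (\<lambda>x i. (F x i, F x i)) v))"
    using card_around[of v "\<lambda>p c. c = i" F F] .
  also have "\<dots> = count (around ds F v) i"
    unfolding around_def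
    by (simp only: count_mset count_list_eq_length_filter filter_map o_def split_def eq_commute length_map
        size_mset fst_conv snd_conv flip: mset_filter)
  finally show "card {e \<in> E. v \<in> e \<and> lab F e = i} = 2" using assms \<open>i < d\<close> by simp
qed

text \<open>The function P assigns edges to pieces, which are named by the cells of a sublattice
  of index n in each direction; by P (x + n z) = P x + z all pieces are translates of one.
  Balance and boundedness then have to be verified at the vertices of one period only, and
  validity is inherited because the colours around each vertex are only permuted.\<close>

lemma periodic_glue:
  assumes n: "n > 0" and F: "periodic n F" "valid (lab F)" and F': "periodic n F'"
    and P: "\<And>x z i. P (x + (int n * fst z, int n * snd z)) i = P x i + z"
    and bal: "\<And>v. v \<in> {0..<int n} \<times> {0..<int n} \<Longrightarrow> around ds (\<lambda>x i. (P x i, F x i)) v = around ds (\<lambda>x i. (P x i, F' x i)) v"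
    and bnd: "\<And>v i. v \<in> {0..<int n} \<times> {0..<int n} \<Longrightarrow> i < d \<Longrightarrow> P v i \<in> {- int m..int m} \<times> {- int m..int m}"
  shows "valid (lab F')" "glue (4 * (n * m + n)) (lab F) (lab F')"
proof -
  have bal': "around ds (\<lambda>x i. (P x i, F x i)) v = around ds (\<lambda>x i. (P x i, F' x i)) v" for v
  proof -
    obtain y z where v: "v = y + (int n * fst z, int n * snd z)" and y: "y \<in> {0..<int n} \<times> {0..<int n}" using window[OF n] .
    have s: "around ds (\<lambda>x i. (P x i, H x i)) v = image_mset (\<lambda>(p, c). (p + z, c)) (around ds (\<lambda>x i. (P x i, H x i)) y)"
      if "periodic n H" for H :: "int \<times> int \<Rightarrow> nat \<Rightarrow> nat"
    proof -
      have "around ds (\<lambda>x i. (P x i, H x i)) v = around ds (\<lambda>x i. (P x i + z, H x i)) y"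
        using that unfolding v around_shift P periodic_def by (simp only:)
      then show ?thesis unfolding around_def by (simp add: image_mset.compositionality o_def split_def)
    qed
    show ?thesis unfolding s[OF F(1)] s[OF F'] bal[OF y] ..
  qed
  have card: "card {e \<in> E. v \<in> e \<and> Q (lab P e) (lab F e)} = card {e \<in> E. v \<in> e \<and> Q (lab P e) (lab F' e)}" for v Q
    unfolding card_around bal' ..
  show V': "valid (lab F')"
    unfolding valid_def
  proof (intro conjI ballI allI impI)
    fix e assume e: "e \<in> E"
    then obtain v where v: "v \<in> e" using edge_pair by blast
    have 0: "{e \<in> E. v \<in> e \<and> \<not> lab F e < d} = {}" using F(2) by (auto simp: valid_def)
    have "card {e \<in> E. v \<in> e \<and> \<not> lab F' e < d} = 0" using card[of v "\<lambda>p c. \<not> c < d"] unfolding 0 by simp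
    moreover have "finite {e \<in> E. v \<in> e \<and> \<not> lab F' e < d}"
      by (rule finite_subset[OF _ finite_incident[of v]]) auto
    ultimately have "{e \<in> E. v \<in> e \<and> \<not> lab F' e < d} = {}" by simp
    then show "lab F' e < d" using e v by blast
  next
    fix v i assume "i < d"
    then show "card {e \<in> E. v \<in> e \<and> lab F' e = i} = 2"
      using F(2)[unfolded valid_def, THEN conjunct2, rule_format, of v i] card[of v "\<lambda>p c. c = i"] by simp
  qed
  show "glue (4 * (n * m + n)) (lab F) (lab F')"
  proof (rule glue_pieces[where piece = "lab P", OF F(2) V'])
    show "card {e \<in> E. v \<in> e \<and> lab P e = j \<and> lab F e = i} = card {e \<in> E. v \<in> e \<and> lab P e = j \<and> lab F' e = i}" for v i j
      by (rule card)
    fix e e' u assume e: "e \<in> E" "e' \<in> E" "lab P e = lab P e'" "u \<in> e"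
    have near: "\<bar>int n * fst (lab P e) - fst u\<bar> \<le> int (n * m + n) \<and> \<bar>int n * snd (lab P e) - snd u\<bar> \<le> int (n * m + n)"
      if e: "e \<in> E" "u \<in> e" for e u
    proof -
      obtain x i where xi: "i < d" "e = {x, x + ds ! i}" using e edge_iff by blast
      obtain y z where v: "x = y + (int n * fst z, int n * snd z)" and y: "y \<in> {0..<int n} \<times> {0..<int n}" using window[OF n] .
      have l: "lab P e = P y i + z" by (simp add: xi lab_edge v P)
      obtain g where g: "u = x + g" "\<bar>fst g\<bar> \<le> 1" "\<bar>snd g\<bar> \<le> 1"
        using e(2) xi small[of "ds ! i"] by (auto simp: d_eq intro: that[of 0] that[of "ds ! i"])
      have b: "\<bar>fst (P y i)\<bar> \<le> int m" "\<bar>snd (P y i)\<bar> \<le> int m" using bnd[OF y xi(1)] by (auto simp: mem_Times_iff)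
      have c: "\<bar>int n * t - (s + g')\<bar> \<le> int (n * m + n)" if "\<bar>t\<bar> \<le> int m" "0 \<le> s" "s < int n" "\<bar>g'\<bar> \<le> 1" for t s g'
      proof -
        have "\<bar>int n * t\<bar> \<le> int n * int m" using that(1) by (simp add: abs_mult mult_left_mono)
        then show ?thesis using that by simp
      qed
      show ?thesis
        using c[OF b(1), of "fst y" "fst g"] c[OF b(2), of "snd y" "snd g"] y g(2,3)
        unfolding l g(1) v by (simp add: mem_Times_iff algebra_simps)
    qed
    show "e' \<subseteq> B u (4 * (n * m + n))"
    proof
      fix w assume w: "w \<in> e'"
      have "w \<in> box u (int (2 * (n * m + n)))"
        using near[OF e(1,4)] near[OF e(2) w] e(3) by (auto simp: box_def mem_Times_iff)
      from near_ball_box[OF _ _ this] show "w \<in> B u (4 * (n * m + n))" by simp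
    qed
  qed
qed

lemma short_lab:
  assumes F: "\<And>x i. i < d \<Longrightarrow> F x i = c \<Longrightarrow> cell x = cell (x + ds ! i)"
    and close: "\<And>u v. cell u = cell v \<Longrightarrow> v \<in> box u (int m)"
    and uv: "(u, v) \<in> (mono_step (lab F) c)\<^sup>*"
  shows "v \<in> B u (2 * m)"
proof -
  have "v \<in> B u (0 + 2 * m * (2 * 0 + 1))"
  proof (rule short_by_cells[OF _ _ _ uv, where cell = cell])
    fix u v assume "(u, v) \<in> mono_step (lab F) c"
    then have a: "{u, v} \<in> E" "lab F {u, v} = c" by (simp_all add: mono_step_def)
    obtain x i where xi: "i < d" "{u, v} = {x, x + ds ! i}" using a(1) edge_iff by blast
    moreover have "F x i = c" using a(2) xi(2) lab_edge(1)[OF xi(1), of F x] by simp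
    ultimately have "cell x = cell (x + ds ! i)" using F[OF xi(1)] by simp
    then show "cell u = cell v" using xi(2) by (auto simp: doubleton_eq_iff)
  qed (use close in auto)
  then show ?thesis by simp
qed

end

lemma int_const:
  fixes f :: "int \<Rightarrow> 'a"
  assumes "\<And>x. f (x + 1) = f x" shows "f x = f 0"
proof (induction x rule: int_induct[where k = 0])
  case (step2 i) then show ?case using assms[of "i - 1"] by simp
qed (use assms in auto)

lemma (in coloured_graph) push_short:
  assumes g: "\<gamma> \<in> Aut" and q: "\<And>u v. u \<in> V \<Longrightarrow> (u, v) \<in> (mono_step q i)\<^sup>* \<Longrightarrow> v \<in> B u D"
    and u: "u \<in> V" "(u, v) \<in> (mono_step (push \<gamma> q) i)\<^sup>*"
  shows "v \<in> B u D"
proof -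
  have "v \<in> V \<and> (ainv \<gamma> u, ainv \<gamma> v) \<in> (mono_step q i)\<^sup>*" using u(2)
  proof (induction rule: rtrancl_induct)
    case (step y z)
    then have e: "{y, z} \<in> E" "q {ainv \<gamma> y, ainv \<gamma> z} = i" by (auto simp: mono_step_def push_def)
    then have "z \<in> V" "(ainv \<gamma> y, ainv \<gamma> z) \<in> mono_step q i"
      using edge_sub aut_edge[OF ainv_aut[OF g] e(1)] by (auto simp: mono_step_def)
    then show ?case using step by (auto intro: rtrancl_into_rtrancl)
  qed (use u in simp)
  then have "v \<in> V" "ainv \<gamma> v \<in> B (ainv \<gamma> u) D" using q[of "ainv \<gamma> u" "ainv \<gamma> v"] ainv_V[OF g u(1)] by auto
  then show ?thesis using aut_ball_iff[OF ainv_aut[OF g] u(1)] by simp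
qed

lemma (in coloured_graph) glue_cong:
  assumes "\<forall>e\<in>E. p e = p' e" "\<forall>e\<in>E. q e = q' e"
  shows "glue k p q \<longleftrightarrow> glue k p' q'"
  unfolding glue_def using assms by simp

text \<open>Transport of structure; it allows the gluing of the mirror images of phases to be
  deduced from that of the phases.\<close>

lemma (in coloured_graph) glue_push:
  assumes g: "\<gamma> \<in> Aut" and pq: "glue k p q"
  shows "glue k (push \<gamma> p) (push \<gamma> q)"
  unfolding glue_def
proof (intro allI impI)
  fix K assume K: "K \<subseteq> V"
  let ?K = "ainv \<gamma> ` K"
  have K': "?K \<subseteq> V" using K ainv_V[OF g] by blast
  obtain \<sigma> where s: "valid \<sigma>" "\<forall>e\<in>E. e \<inter> ?K \<noteq> {} \<longrightarrow> \<sigma> e = p e" "\<forall>e\<in>E. \<not> e \<subseteq> nb k ?K \<longrightarrow> \<sigma> e = q e"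
    using pq[unfolded glue_def, rule_format, OF K'] by blast
  have n: "nb k ?K = ainv \<gamma> ` nb k K" using aut_nb_image[OF ainv_aut[OF g] K] by simp
  have 1: "push \<gamma> \<sigma> e = push \<gamma> p e" if "e \<in> E" "e \<inter> K \<noteq> {}" for e
  proof -
    have "ainv \<gamma> ` e \<inter> ?K \<noteq> {}" using that(2) by auto
    then show ?thesis using s(2)[rule_format, OF aut_edge[OF ainv_aut[OF g] that(1)]] by (simp add: push_def)
  qed
  have 2: "push \<gamma> \<sigma> e = push \<gamma> q e" if e: "e \<in> E" "\<not> e \<subseteq> nb k K" for e
  proof -
    obtain x where x: "x \<in> e" "x \<notin> nb k K" using e(2) by blast
    have xV: "x \<in> V" using x(1) edge_sub[OF e(1)] by blast
    have "ainv \<gamma> x \<notin> ainv \<gamma> ` nb k K"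
    proof
      assume "ainv \<gamma> x \<in> ainv \<gamma> ` nb k K"
      then obtain y where "y \<in> nb k K" "ainv \<gamma> x = ainv \<gamma> y" by blast
      then show False using x xV nb_verts[OF K] aut_inj[OF ainv_aut[OF g], of x y] by blast
    qed
    then have "\<not> ainv \<gamma> ` e \<subseteq> nb k ?K" unfolding n using x by blast
    then show ?thesis using s(3)[rule_format, OF aut_edge[OF ainv_aut[OF g] e(1)]] by (simp add: push_def)
  qed
  show "\<exists>\<sigma>. valid \<sigma> \<and> (\<forall>e\<in>E. e \<inter> K \<noteq> {} \<longrightarrow> \<sigma> e = push \<gamma> p e) \<and> (\<forall>e\<in>E. \<not> e \<subseteq> nb k K \<longrightarrow> \<sigma> e = push \<gamma> q e)"
    using valid_push[OF g s(1)] 1 2 by (intro exI[of _ "push \<gamma> \<sigma>"]) simp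
qed

section \<open>The square lattice\<close>

text \<open>In the phases of the square lattice each colour class is a disjoint union of unit
  squares. The parameters i and j say which of the four translates is meant. All of them are
  glued to the colouring of rows and columns, which is not a phase itself as its monochromatic
  paths are infinite.\<close>

definition squares :: "int \<Rightarrow> int \<Rightarrow> int \<times> int \<Rightarrow> nat \<Rightarrow> nat" where
  "squares i j x k = nat ((if k = 0 then fst x + i else snd x + j) mod 2)"

definition straight :: "int \<times> int \<Rightarrow> nat \<Rightarrow> nat" where
  "straight x k = k"

text \<open>A phase differs from the colouring of rows and columns along disjoint unit squares,
  where the two colours alternate in both colourings. Each piece contains one of these squares.\<close>

definition square_piece :: "int \<Rightarrow> int \<Rightarrow> int \<times> int \<Rightarrow> nat \<Rightarrow> int \<times> int" where
  "square_piece i j x k = ((fst x + i + 1) div 2, (snd x + j) div 2)"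

interpretation S: cayley square_lattice 2 "[(1, 0), (0, 1)]"
proof
  show "square_lattice = cayley_graph (set [(1, 0), (0, 1)])" by (simp add: square_lattice_def)
  show "s + t \<noteq> 0" if "s \<in> set [(1, 0), (0, 1 :: int)]" "t \<in> set [(1, 0), (0, 1)]" for s t :: "int \<times> int"
    using that by (auto simp: zero_prod_def)
  show "\<bar>fst s\<bar> \<le> 1 \<and> \<bar>snd s\<bar> \<le> 1" if "s \<in> set [(1, 0), (0, 1)]" for s :: "int \<times> int"
    using that by auto
qed simp_all

lemma two_by_two: "v \<in> {0..<int 2} \<times> {0..<int 2} \<Longrightarrow> v \<in> {(0, 0), (0, 1), (1, 0), (1, 1)}"
  by (cases v) auto

lemma square_glue:
  assumes "i = 0 \<or> i = 1" "j = 0 \<or> j = 1"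
  shows "S.valid (S.lab (squares i j))" "S.glue 16 (S.lab straight) (S.lab (squares i j))"
proof -
  let ?ds = "[(1, 0), (0, 1)] :: (int \<times> int) list"
  have "S.valid (S.lab straight)"
    by (rule S.valid_lab) (auto simp: around_def star_def straight_def upt_rec less_2_cases_iff)
  note * = S.periodic_glue[where n = 2 and F = straight and F' = "squares i j" and P = "square_piece i j" and m = 1, OF _ _ this]
  have 0: "S.periodic 2 straight" by (simp add: S.periodic_def straight_def)
  have 1: "S.periodic 2 (squares i j)"
  proof -
    have "(x + 2 * z + k) mod 2 = (x + k) mod 2" for x z k :: int by presburger
    then show ?thesis by (simp add: S.periodic_def squares_def)
  qed
  have 2: "square_piece i j (x + (int 2 * fst z, int 2 * snd z)) k = square_piece i j x k + z" for x z k
    by (cases x; cases z) (simp add: square_piece_def, presburger)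
  have 3: "around ?ds (\<lambda>x k. (square_piece i j x k, straight x k)) v = around ?ds (\<lambda>x k. (square_piece i j x k, squares i j x k)) v"
    if v: "v \<in> {0..<int 2} \<times> {0..<int 2}" for v
    using assms two_by_two[OF v]
    by (auto simp: around_def star_def squares_def straight_def square_piece_def upt_rec)
  have 4: "square_piece i j v k \<in> {- int 1..int 1} \<times> {- int 1..int 1}" if v: "v \<in> {0..<int 2} \<times> {0..<int 2}" for v k
    using assms two_by_two[OF v] by (auto simp: square_piece_def)
  show "S.valid (S.lab (squares i j))" "S.glue 16 (S.lab straight) (S.lab (squares i j))"
    using *[OF _ 0 1 2 3 4] by simp_all
qed

lemma square_adj: "(u, v) \<in> adj square_lattice \<longleftrightarrow>
    v = u + (1, 0) \<or> v = u + (0, 1) \<or> v = u + (-1, 0) \<or> v = u + (0, -1)"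
  unfolding S.adj_iff by (cases u; cases v) auto

lemma square_edge: "k < 2 \<Longrightarrow> k = 0 \<or> k = (1 :: nat)"
  by linarith

text \<open>Monochromatic paths of length 2 close to squares. This property is invariant under
  automorphisms, and it characterises the phases of the square lattice.\<close>

definition closes :: "(int \<times> int) ugraph \<Rightarrow> ((int \<times> int) set \<Rightarrow> nat) \<Rightarrow> bool" where
  "closes G q \<longleftrightarrow> (\<forall>v w w'. (v, w) \<in> adj G \<and> (v, w') \<in> adj G \<and> w \<noteq> w' \<and> q {v, w} = q {v, w'} \<longrightarrow>
     (\<exists>u. u \<noteq> v \<and> (w, u) \<in> adj G \<and> (w', u) \<in> adj G \<and> q {w, u} = q {v, w} \<and> q {w', u} = q {v, w}))"

lemma squares_lab:
  "S.lab (squares i j) {(a, b), (a + 1, b)} = nat ((a + i) mod 2)"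
  "S.lab (squares i j) {(a, b), (a, b + 1)} = nat ((b + j) mod 2)"
  using S.lab_edge(1)[of 0 "squares i j" "(a, b)"] S.lab_edge(1)[of 1 "squares i j" "(a, b)"]
  by (simp_all add: squares_def)

lemma closes_squares: "closes square_lattice (S.lab (squares i j))"
  unfolding closes_def
proof (intro allI impI, elim conjE)
  let ?q = "S.lab (squares i j)"
  fix v w w'
  assume a: "(v, w) \<in> adj square_lattice" "(v, w') \<in> adj square_lattice" "w \<noteq> w'" "?q {v, w} = ?q {v, w'}"
  obtain a b where v: "v = (a, b)" by force
  define R T where "R = nat ((a + i) mod 2)" and "T = nat ((b + j) mod 2)"
  have par: "nat ((x - 1 + k) mod 2) = 1 - nat ((x + k) mod 2)" "nat ((x + k) mod 2) \<le> 1" for x k :: int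
  proof -
    have "(x + k) mod 2 = 0 \<and> (x - 1 + k) mod 2 = 1 \<or> (x + k) mod 2 = 1 \<and> (x - 1 + k) mod 2 = 0" by presburger
    then show "nat ((x - 1 + k) mod 2) = 1 - nat ((x + k) mod 2)" "nat ((x + k) mod 2) \<le> 1" by auto
  qed
  have "?q {(a - 1, y), (a, y)} = 1 - R" "?q {(x, b - 1), (x, b)} = 1 - T" for x y
    using squares_lab(1)[of i j "a - 1" y] squares_lab(2)[of i j x "b - 1"] by (simp_all add: par R_def T_def)
  moreover have "?q {(a, y), (a + 1, y)} = R" "?q {(x, b), (x, b + 1)} = T" for x y
    by (simp_all add: squares_lab R_def T_def)
  ultimately have l: "?q {(a, y), (a - 1, y)} = 1 - R" "?q {(a - 1, y), (a, y)} = 1 - R"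
    "?q {(a, y), (a + 1, y)} = R" "?q {(a + 1, y), (a, y)} = R"
    "?q {(x, b), (x, b - 1)} = 1 - T" "?q {(x, b - 1), (x, b)} = 1 - T"
    "?q {(x, b), (x, b + 1)} = T" "?q {(x, b + 1), (x, b)} = T" for x y
    by (simp_all add: insert_commute)
  have RT: "R = 0 \<or> R = 1" "T = 0 \<or> T = 1" using par(2)[of a i] par(2)[of b j] unfolding R_def T_def by linarith+
  have w: "w = (a + 1, b) \<or> w = (a, b + 1) \<or> w = (a - 1, b) \<or> w = (a, b - 1)"
    "w' = (a + 1, b) \<or> w' = (a, b + 1) \<or> w' = (a - 1, b) \<or> w' = (a, b - 1)"
    using a(1,2)[unfolded square_adj v] by simp_all
  define u where "u = w + w' - v"
  have "u \<noteq> v \<and> (w, u) \<in> adj square_lattice \<and> (w', u) \<in> adj square_lattice \<and>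
     ?q {w, u} = ?q {v, w} \<and> ?q {w', u} = ?q {v, w}"
    using w(1)
  proof (elim disjE)
    assume "w = (a + 1, b)"
    then show ?thesis using w(2) a(3,4) RT unfolding u_def v by (elim disjE) (simp_all add: square_adj l)
  next
    assume "w = (a, b + 1)"
    then show ?thesis using w(2) a(3,4) RT unfolding u_def v by (elim disjE) (simp_all add: square_adj l)
  next
    assume "w = (a - 1, b)"
    then show ?thesis using w(2) a(3,4) RT unfolding u_def v by (elim disjE) (simp_all add: square_adj l)
  next
    assume "w = (a, b - 1)"
    then show ?thesis using w(2) a(3,4) RT unfolding u_def v by (elim disjE) (simp_all add: square_adj l)
  qed
  then show "\<exists>u. u \<noteq> v \<and> (w, u) \<in> adj square_lattice \<and> (w', u) \<in> adj square_lattice \<and> ?q {w, u} = ?q {v, w} \<and> ?q {w', u} = ?q {v, w}"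
    by blast
qed

lemma closes_push:
  assumes g: "\<gamma> \<in> S.Aut" and q: "closes square_lattice q"
  shows "closes square_lattice (S.push \<gamma> q)"
  unfolding closes_def
proof (intro allI impI, elim conjE)
  fix v w w'
  assume a: "(v, w) \<in> adj square_lattice" "(v, w') \<in> adj square_lattice" "w \<noteq> w'" "S.push \<gamma> q {v, w} = S.push \<gamma> q {v, w'}"
  let ?i = "S.ainv \<gamma>"
  have ad: "(?i x, ?i y) \<in> adj square_lattice \<longleftrightarrow> (x, y) \<in> adj square_lattice" for x y
    using S.aut_adj[OF S.ainv_aut[OF g]] by simp
  have p: "S.push \<gamma> q {x, y} = q {?i x, ?i y}" for x y by (simp add: S.push_def)
  have "?i w \<noteq> ?i w'" using a(3) S.aut_inj[OF S.ainv_aut[OF g]] by simp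
  then obtain u where u: "u \<noteq> ?i v" "(?i w, u) \<in> adj square_lattice" "(?i w', u) \<in> adj square_lattice"
      "q {?i w, u} = q {?i v, ?i w}" "q {?i w', u} = q {?i v, ?i w}"
    using q[unfolded closes_def, rule_format, of "?i v" "?i w" "?i w'"] a ad unfolding p by blast
  have g': "?i (\<gamma> u) = u" using S.ainv_left[OF g, of u] by simp
  show "\<exists>u. u \<noteq> v \<and> (w, u) \<in> adj square_lattice \<and> (w', u) \<in> adj square_lattice \<and>
      S.push \<gamma> q {w, u} = S.push \<gamma> q {v, w} \<and> S.push \<gamma> q {w', u} = S.push \<gamma> q {v, w}"
    using u g' ad[of w "\<gamma> u"] ad[of w' "\<gamma> u"] by (intro exI[of _ "\<gamma> u"]) (auto simp: p)
qed

text \<open>Opposite edges at v have different colours, because their other ends have no common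
  neighbour except v. So the colours alternate along rows and along columns. Closing squares
  then forces all rows to agree with each other, and all columns.\<close>

lemma closes_imp_squares:
  assumes q: "closes square_lattice q" and 2: "\<And>e. e \<in> S.E \<Longrightarrow> q e < 2"
  shows "\<exists>i\<in>{0, 1}. \<exists>j\<in>{0, 1}. \<forall>e\<in>S.E. q e = S.lab (squares i j) e"
proof -
  define hor ver where "hor a b = q {(a, b), (a + 1, b)}" and "ver a b = q {(a, b), (a, b + 1)}" for a b
  have l2: "hor a b < 2" "ver a b < 2" for a b
    using 2[of "{(a, b), (a + 1, b)}"] 2[of "{(a, b), (a, b + 1)}"]
    unfolding hor_def ver_def S.edge_adj by (simp_all add: square_adj)
  have cl: "\<exists>u. u \<noteq> v \<and> (w, u) \<in> adj square_lattice \<and> (w', u) \<in> adj square_lattice \<and> q {w, u} = q {v, w} \<and> q {w', u} = q {v, w}"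
    if "(v, w) \<in> adj square_lattice" "(v, w') \<in> adj square_lattice" "w \<noteq> w'" "q {v, w} = q {v, w'}" for v w w'
    using q that unfolding closes_def by blast
  have h: "hor a b \<noteq> hor (a - 1) b" for a b
    using cl[of "(a, b)" "(a + 1, b)" "(a - 1, b)"] unfolding hor_def by (auto simp: square_adj insert_commute)
  have v: "ver a b \<noteq> ver a (b - 1)" for a b
    using cl[of "(a, b)" "(a, b + 1)" "(a, b - 1)"] unfolding ver_def by (auto simp: square_adj insert_commute)
  have 1: "ver a b = hor a b \<Longrightarrow> ver (a + 1) b = hor a b \<and> hor a (b + 1) = hor a b" for a b
    using cl[of "(a, b)" "(a + 1, b)" "(a, b + 1)"] unfolding hor_def ver_def by (auto simp: square_adj insert_commute)
  have 2: "ver a (b - 1) = hor a b \<Longrightarrow> ver (a + 1) (b - 1) = hor a b" for a b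
    using cl[of "(a, b)" "(a + 1, b)" "(a, b - 1)"] unfolding hor_def ver_def by (auto simp: square_adj insert_commute)
  have 3: "ver a b = hor (a - 1) b \<Longrightarrow> hor (a - 1) (b + 1) = hor (a - 1) b" for a b
    using cl[of "(a, b)" "(a - 1, b)" "(a, b + 1)"] unfolding hor_def ver_def by (auto simp: square_adj insert_commute)
  have ver: "ver (a + 1) b = ver a b" for a b
    using 1[of a b] 2[of a b] v[of a b] v[of "a + 1" b] l2(1)[of a b] l2(2)[of a b] l2(2)[of a "b - 1"]
      l2(2)[of "a + 1" b] l2(2)[of "a + 1" "b - 1"] by linarith
  have hor: "hor a (b + 1) = hor a b" for a b
    using 1[of a b] 3[of a b] h[of a b] h[of a "b + 1"] l2(1)[of a b] l2(2)[of a b] l2(1)[of a "b + 1"]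
      l2(1)[of "a - 1" b] l2(1)[of "a - 1" "b + 1"] by linarith
  have hor0: "hor a b = hor a 0" for a b using int_const[of "hor a" b] hor by simp
  have ver0: "ver a b = ver 0 b" for a b using int_const[of "\<lambda>a. ver a b" a] ver by simp
  have alt: "int (f x) = (x + int (f 0)) mod 2" if f: "\<And>x. f x \<noteq> f (x - 1)" "\<And>x. f x < 2" for f :: "int \<Rightarrow> nat" and x
  proof -
    have "(int (f (x + 1)) + (x + 1)) mod 2 = (int (f x) + x) mod 2" for x
      using f(1)[of "x + 1"] f(2)[of x] f(2)[of "x + 1"] by simp presburger
    from int_const[of "\<lambda>x. (int (f x) + x) mod 2" x, OF this] show ?thesis
      using f(2)[of x] f(2)[of 0] by simp presburger
  qed
  define i j where "i = int (hor 0 0)" and "j = int (ver 0 0)"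
  have hor_eq: "hor a b = nat ((a + i) mod 2)" for a b
    using alt[of "\<lambda>a. hor a b" a] h l2(1) hor0[of 0 b] unfolding i_def by (metis nat_int)
  have ver_eq: "ver a b = nat ((b + j) mod 2)" for a b
    using alt[of "\<lambda>b. ver a b" b] v l2(2) ver0[of a 0] unfolding j_def by (metis nat_int)
  have "q e = S.lab (squares i j) e" if e: "e \<in> S.E" for e
  proof -
    obtain x k where xk: "k < 2" "e = {x, x + [(1, 0), (0, 1)] ! k}" using S.edge_iff e by blast
    obtain a b where x: "x = (a, b)" by force
    show ?thesis using square_edge[OF xk(1)] hor_eq[of a b] ver_eq[of a b]
      squares_lab[of i j a b] unfolding hor_def ver_def xk(2) x by (elim disjE) simp_all
  qed
  moreover have "i \<in> {0, 1}" "j \<in> {0, 1}" using l2[of 0 0] unfolding i_def j_def by auto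
  ultimately show ?thesis by blast
qed

lemma square_short:
  assumes "(u, v) \<in> (S.mono_step (S.lab (squares i j)) c)\<^sup>*"
  shows "v \<in> S.B u 2"
proof -
  define cell where "cell x = (if c = 0 then ((fst x + i) div 2, (snd x + j) div 2) else ((fst x + i + 1) div 2, (snd x + j + 1) div 2))"
    for x :: "int \<times> int"
  have "v \<in> S.B u (2 * 1)"
  proof (rule S.short_lab[OF _ _ assms, where cell = cell])
    fix x k assume k: "k < (2 :: nat)" "squares i j x k = c"
    then have "c < 2" by (auto simp: squares_def)
    then show "cell x = cell (x + [(1, 0), (0, 1)] ! k)"
    proof -
      have c: "c = 0 \<or> c = 1" using \<open>c < 2\<close> by linarith
      have 0: "(t + 1) div 2 = t div 2" if "nat (t mod 2) = 0" for t :: int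
      proof -
        have "t mod 2 = 0" using that pos_mod_sign[of 2 t] by linarith
        then show ?thesis by presburger
      qed
      have 1: "(t + 1 + 1) div 2 = (t + 1) div 2" if "nat (t mod 2) = 1" for t :: int
      proof -
        have "t mod 2 = 1" using that by linarith
        then show ?thesis by presburger
      qed
      have e: "fst x + 1 + i = fst x + i + 1" "snd x + 1 + j = snd x + j + 1" by simp_all
      show ?thesis using c
      proof
        assume c: "c = 0"
        show ?thesis using square_edge[OF k(1)]
        proof
          assume "k = 0" then show ?thesis using k(2) 0[of "fst x + i"] c by (simp add: cell_def squares_def e)
        next
          assume "k = 1" then show ?thesis using k(2) 0[of "snd x + j"] c by (simp add: cell_def squares_def e)
        qed
      next
        assume c: "c = 1"
        show ?thesis using square_edge[OF k(1)]
        proof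
          assume "k = 0" then show ?thesis using k(2) 1[of "fst x + i"] c by (simp only: cell_def squares_def e) (simp add: e)
        next
          assume "k = 1" then show ?thesis using k(2) 1[of "snd x + j"] c by (simp only: cell_def squares_def e) (simp add: e)
        qed
      qed
    qed
  next
    fix u v assume c: "cell u = cell v"
    have "\<bar>x - y\<bar> \<le> 1" if "(x + t) div 2 = (y + t) div 2" for x y t :: int using that by presburger
    then show "v \<in> S.box u (int 1)" using c unfolding cell_def S.box_def
      by (auto simp: mem_Times_iff add.assoc split: if_splits)
  qed
  then show ?thesis by simp
qed

text \<open>Two phases are glued by way of the colouring of rows and columns; each of the two
  transitions has width 16 = 4 (2 * 1 + 2).\<close>

interpretation S: phases square_lattice 2 "{S.lab (squares i j) | i j. i \<in> {0, 1} \<and> j \<in> {0, 1}}" 2 32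
proof
  let ?Ph = "{S.lab (squares i j) | i j. i \<in> {0, 1} \<and> j \<in> {0, 1}}"
  have Ph: "\<exists>i j. (i = 0 \<or> i = 1) \<and> (j = 0 \<or> j = 1) \<and> q = S.lab (squares i j)" if "q \<in> ?Ph" for q using that by blast
  show "?Ph \<noteq> {}" by blast
  show val: "S.valid q" if "q \<in> ?Ph" for q using Ph[OF that] square_glue(1) by blast
  show "\<exists>q'\<in>?Ph. \<forall>e\<in>S.E. q' (\<gamma> ` e) = q e" if q: "q \<in> ?Ph" and g: "\<gamma> \<in> S.Aut" for q \<gamma>
  proof -
    have "closes square_lattice q" using Ph[OF q] closes_squares by blast
    moreover have "S.push \<gamma> q e < 2" if "e \<in> S.E" for e
      using S.valid_push[OF g val[OF q]] that by (simp add: S.valid_def)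
    ultimately obtain i j where ij: "i \<in> {0, 1}" "j \<in> {0, 1}" "\<forall>e\<in>S.E. S.push \<gamma> q e = S.lab (squares i j) e"
      using closes_imp_squares[OF closes_push[OF g]] by blast
    have "S.lab (squares i j) (\<gamma> ` e) = q e" if "e \<in> S.E" for e
      using ij(3) S.aut_edge[OF g that] S.push_image[OF g S.edge_sub[OF that], of q] by auto
    then show ?thesis using ij(1,2) by blast
  qed
  show "S.glue 32 q q'" if "q \<in> ?Ph" "q' \<in> ?Ph" for q q'
  proof -
    have "S.glue 16 (S.lab straight) q" "S.glue 16 (S.lab straight) q'"
      using Ph[OF that(1)] Ph[OF that(2)] square_glue(2) by blast+
    then show ?thesis using S.glue_trans[OF S.glue_sym, of 16 "S.lab straight" q 16 q'] by simp
  qed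
  show "v \<in> S.B u 2" if "q \<in> ?Ph" "(u, v) \<in> (S.mono_step q c)\<^sup>*" for q u v c
    using Ph[OF that(1)] that(2) square_short by blast
  show "countable S.V" by (rule S.countable_verts)
  show "\<exists>c>0. \<exists>c'. \<forall>x\<in>S.V. \<forall>n\<ge>1. c * (real n)\<^sup>2 \<le> real (card (S.B x n)) \<and>
      real (card (S.B x n)) \<le> c' * (real n)\<^sup>2" by (rule S.planar_growth)
qed

theorem factor_square: "\<exists>A \<Phi>. aut_factor square_lattice 2 A \<Phi> \<and> finitary square_lattice A \<Phi> \<and>
       (AE \<omega> in iid_measure square_lattice. schreier_decoration square_lattice 2 (\<Phi> \<omega>)) \<and>
       (AE \<omega> in iid_measure square_lattice. \<not> (\<exists>p. infinite_monochromatic_path square_lattice (\<Phi> \<omega>) p))"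
  by (rule S.factor_exists)

section \<open>The triangular lattice\<close>

abbreviation tri_ds :: "(int \<times> int) list" where
  "tri_ds \<equiv> [(1, 0), (0, 1), (-1, 1)]"

definition table :: "'a list \<Rightarrow> int \<times> int \<Rightarrow> nat \<Rightarrow> 'a" where
  "table T x i = T ! nat (9 * (fst x mod 3) + 3 * (snd x mod 3) + int i)"

definition tri_piece :: "(int \<times> int) list \<Rightarrow> int \<times> int \<Rightarrow> nat \<Rightarrow> int \<times> int" where
  "tri_piece T x i = (fst x div 3, snd x div 3) + table T x i"

text \<open>In the phases of the triangular lattice the colour classes are disjoint unions of
  triangles. Either all upward triangles are monochromatic, the one based at (a, b) having the
  colour number a - b modulo 3 in the list ts, or all downward triangles are. An edge in the
  direction (-1, 1) belongs to the upward triangle based at the left neighbour of its base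
  point, whence the shift by 1.\<close>

definition up_tri :: "nat list \<Rightarrow> int \<times> int \<Rightarrow> nat \<Rightarrow> nat" where
  "up_tri ts x i = ts ! nat ((fst x - snd x - (if i = 2 then 1 else 0)) mod 3)"

definition down_tri :: "nat list \<Rightarrow> int \<times> int \<Rightarrow> nat \<Rightarrow> nat" where
  "down_tri ts x i = up_tri ts (- x - tri_ds ! i) i"

text \<open>An intermediate colouring through which upward triangles are turned into downward
  triangles.\<close>

definition mixed :: "int \<times> int \<Rightarrow> nat \<Rightarrow> nat" where
  "mixed = table [0,0,1,0,2,1,1,1,0,2,1,1,2,0,2,2,0,2,2,0,1,2,0,1,0,1,2]"

abbreviation window3 :: "(int \<times> int) list" where
  "window3 \<equiv> [(0,0),(0,1),(0,2),(1,0),(1,1),(1,2),(2,0),(2,1),(2,2)]"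

text \<open>The finite test that T, read as the table of the shifts of pieces relative to the
  cells of size 3 by 3, balances the colourings F and F'.\<close>

definition matches :: "(int \<times> int) list \<Rightarrow> (int \<times> int \<Rightarrow> nat \<Rightarrow> nat) \<Rightarrow> (int \<times> int \<Rightarrow> nat \<Rightarrow> nat) \<Rightarrow> bool" where
  "matches T F F' \<longleftrightarrow> list_all (\<lambda>v. around tri_ds (\<lambda>x i. (tri_piece T x i, F x i)) v = around tri_ds (\<lambda>x i. (tri_piece T x i, F' x i)) v) window3
   \<and> length T = 27 \<and> list_all (\<lambda>(a, b). \<bar>a\<bar> \<le> 2 \<and> \<bar>b\<bar> \<le> 2) T"

text \<open>The tables record how the edges in one period that differ in the two colourings are
  grouped into balanced pieces; edges on which the colourings agree have no influence on the
  balance and are left in their own cell.\<close>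

lemma matches_mixed:
  "matches [(0, 0), (0, 0), (0, 0), (0, 0), (0, 0), (0, 0), (0, 0), (0, 0), (0, 0), (0, 0), (0, 0), (0, 0), (0, 0), (0, 0), (0, 0), (0, 0), (0, 1), (0, 1), (0, 0), (0, 0), (0, 0), (1, 0), (0, 1), (0, 1), (0, 0), (0, 1), (0, 0)]
     (up_tri [0, 1, 2]) mixed"
  "matches [(0, 0), (0, 0), (0, 0), (-1, 1), (0, 0), (0, 0), (0, 1), (0, 0), (-1, 1), (0, 0), (0, 0), (0, 0), (0, 0), (0, 0), (-1, 1), (0, 0), (0, 1), (0, 0), (0, 0), (1, 0), (0, 0), (0, 1), (0, 1), (0, 0), (1, 1), (1, 1), (0, 1)]
     mixed (down_tri [2, 0, 1])"
  by code_simp+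

text \<open>The same table serves three pairs, since renaming the colours carries each of them
  to the others.\<close>

lemma matches_up:
  defines "T \<equiv> [(0, 0), (0, 0), (1, 0), (0, 0), (1, 0), (0, 0), (1, 0), (1, 1), (0, 0), (0, 1), (0, 0), (0, 0), (0, 0), (0, 0), (1, 1), (1, 0), (0, 2), (0, 2), (1, 1), (0, 1), (1, 1), (2, 0), (0, 1), (0, 0), (0, 0), (0, 0), (0, 1)]"
  shows "matches T (up_tri [0, 1, 2]) (up_tri [0, 2, 1])" "matches T (up_tri [1, 0, 2]) (up_tri [1, 2, 0])"
    "matches T (up_tri [2, 1, 0]) (up_tri [2, 0, 1])"
  unfolding T_def by code_simp+

lemma matches_up':
  "matches [(-1, 1), (0, 1), (0, 0), (0, 0), (0, 0), (0, 1), (-1, 1), (-1, 2), (-1, 1), (0, 0), (-1, 1), (0, 0), (1, 0), (-1, 1), (0, 0), (0, 0), (0, 0), (0, 2), (0, 0), (0, 0), (1, 0), (1, 0), (0, 2), (0, 2), (0, 2), (1, 1), (0, 0)]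
     (up_tri [0, 1, 2]) (up_tri [1, 0, 2])"
  "matches [(0, 1), (0, 0), (0, 1), (0, 0), (-1, 1), (0, 0), (0, 0), (0, 0), (-1, 1), (0, 0), (0, 0), (-1, 1), (0, 0), (-1, 2), (-1, 2), (1, 1), (-1, 2), (0, 0), (1, 0), (0, 0), (0, 0), (0, 0), (0, 0), (1, 1), (0, 2), (1, 1), (0, 2)]
     (up_tri [0, 1, 2]) (up_tri [2, 1, 0])"
  by code_simp+

definition perms3 :: "nat list set" where
  "perms3 = {[0, 1, 2], [0, 2, 1], [1, 0, 2], [1, 2, 0], [2, 0, 1], [2, 1, 0]}"

interpretation T: cayley triangular_lattice 3 tri_ds
proof
  show "triangular_lattice = cayley_graph (set tri_ds)" by (simp add: triangular_lattice_def)
  show "s + t \<noteq> 0" if "s \<in> set tri_ds" "t \<in> set tri_ds" for s t :: "int \<times> int"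
    using that by (auto simp: zero_prod_def)
  show "\<bar>fst s\<bar> \<le> 1 \<and> \<bar>snd s\<bar> \<le> 1" if "s \<in> set tri_ds" for s :: "int \<times> int"
    using that by auto
qed simp_all

lemma window3: "v \<in> {0..<int 3} \<times> {0..<int 3} \<Longrightarrow> v \<in> set window3"
proof -
  assume "v \<in> {0..<int 3} \<times> {0..<int 3}"
  then have "fst v = 0 \<or> fst v = 1 \<or> fst v = 2" "snd v = 0 \<or> snd v = 1 \<or> snd v = 2" by (auto simp: mem_Times_iff)
  then show ?thesis by (cases v) auto
qed

lemma mod3_shift: "(x + 3 * z) mod 3 = x mod 3" "(x - 3 * z) mod 3 = x mod 3" for x z :: int
  by presburger+

lemma periodic_table: "T.periodic 3 (table T)"
  by (simp add: T.periodic_def table_def mod3_shift)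

lemma periodic_up: "T.periodic 3 (up_tri ts)"
proof -
  have "(a + 3 * y - (b + 3 * z) - k) mod 3 = (a - b - k) mod 3" for a b y z k :: int by presburger
  from this[where k = 0] this[where k = 1] show ?thesis by (simp add: T.periodic_def up_tri_def)
qed

lemma periodic_down: "T.periodic 3 (down_tri ts)"
  unfolding T.periodic_def
proof (intro allI)
  fix x z :: "int \<times> int" and i
  have "- (x + (int 3 * fst z, int 3 * snd z)) - tri_ds ! i = (- x - tri_ds ! i) + (int 3 * fst (- z), int 3 * snd (- z))"
    by (simp add: prod_eq_iff)
  then show "down_tri ts (x + (int 3 * fst z, int 3 * snd z)) i = down_tri ts x i"
    using periodic_up[of ts, unfolded T.periodic_def, rule_format, of "- x - tri_ds ! i" "- z" i] unfolding down_tri_def by (simp only:)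
qed

lemma matches_glue:
  assumes m: "matches T F F'" and per: "T.periodic 3 F" "T.periodic 3 F'" and v: "T.valid (T.lab F)"
  shows "T.valid (T.lab F') \<and> T.glue 36 (T.lab F) (T.lab F')"
proof -
  note * = T.periodic_glue[where n = 3 and P = "tri_piece T" and m = 2, OF _ per(1) v per(2)]
  have 1: "tri_piece T (x + (int 3 * fst z, int 3 * snd z)) i = tri_piece T x i + z" for x z i
    using periodic_table[of T, unfolded T.periodic_def, rule_format, of x z i]
    by (simp add: tri_piece_def prod_eq_iff)
  have 2: "around tri_ds (\<lambda>x i. (tri_piece T x i, F x i)) v = around tri_ds (\<lambda>x i. (tri_piece T x i, F' x i)) v"
    if "v \<in> {0..<int 3} \<times> {0..<int 3}" for v
    using m window3[OF that] unfolding matches_def list_all_iff by blast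
  have 3: "tri_piece T v i \<in> {- int 2..int 2} \<times> {- int 2..int 2}" if v: "v \<in> {0..<int 3} \<times> {0..<int 3}" and i: "i < 3" for v i
  proof -
    have b: "0 \<le> fst v" "fst v < 3" "0 \<le> snd v" "snd v < 3" using v by (auto simp: mem_Times_iff)
    then have "tri_piece T v i = table T v i" by (simp add: tri_piece_def zero_prod_def[symmetric])
    moreover have "table T v i \<in> set T"
      unfolding table_def by (rule nth_mem) (use m b i in \<open>simp add: matches_def nat_less_iff\<close>)
    ultimately show ?thesis using m unfolding matches_def list_all_iff by (force simp: mem_Times_iff abs_le_iff)
  qed
  show ?thesis using *[OF _ 1 2 3] by simp
qed

lemma up_valid_012: "T.valid (T.lab (up_tri [0, 1, 2]))"
proof (rule T.valid_lab)
  have c: "list_all (\<lambda>v. list_all (\<lambda>i. count (around tri_ds (up_tri [0, 1, 2]) v) i = 2 \<and> up_tri [0, 1, 2] v i < 3) [0, 1, 2]) window3"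
    by code_simp
  fix v and i :: nat assume "i < 3"
  then have i: "i \<in> set [0, 1, 2]" by auto
  have p0: "0 < (3 :: nat)" by simp
  obtain y z :: "int \<times> int" where v: "v = y + (int 3 * fst z, int 3 * snd z)" and y: "y \<in> {0..<int 3} \<times> {0..<int 3}"
    using T.window[OF p0] .
  have p: "up_tri [0, 1, 2] (x + (int 3 * fst z, int 3 * snd z)) k = up_tri [0, 1, 2] x k" for x k
    using periodic_up unfolding T.periodic_def by blast
  have "around tri_ds (up_tri [0, 1, 2]) v = around tri_ds (up_tri [0, 1, 2]) y"
    unfolding v T.around_shift p ..
  then show "count (around tri_ds (up_tri [0, 1, 2]) v) i = 2" "up_tri [0, 1, 2] v i < 3"
    using c[unfolded list_all_iff, rule_format, OF window3[OF y] i] unfolding v p by auto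
qed

text \<open>The transitions form a tree on the six permutations rooted at the identity, with at
  most two transitions from the root to any vertex.\<close>

lemma up_glue:
  assumes "ts \<in> perms3"
  shows "T.valid (T.lab (up_tri ts)) \<and> T.glue 72 (T.lab (up_tri [0, 1, 2])) (T.lab (up_tri ts))"
proof -
  note g = matches_glue[OF _ periodic_up periodic_up]
  note v0 = up_valid_012
  note a = g[OF matches_up(1) v0] g[OF matches_up'(1) v0] g[OF matches_up'(2) v0]
  note b = g[OF matches_up(2) a(2)[THEN conjunct1]] g[OF matches_up(3) a(3)[THEN conjunct1]]
  have t: "T.glue 72 p r" if "T.glue 36 p q" "T.glue 36 q r" for p q r
    using T.glue_trans[OF that] by simp
  have m: "T.glue 72 p r" if "T.glue 36 p r" for p r
    using T.glue_mono[OF that] by simp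
  show ?thesis using assms v0 a b t m T.glue_refl[OF v0] unfolding perms3_def by blast
qed

lemma tri_adj: "(u, v) \<in> adj triangular_lattice \<longleftrightarrow> v = u + (1, 0) \<or> v = u + (0, 1) \<or> v = u + (-1, 1) \<or>
    v = u + (-1, 0) \<or> v = u + (0, -1) \<or> v = u + (1, -1)"
proof -
  have 1: "v - u = s \<longleftrightarrow> v = u + s" "u - v = s \<longleftrightarrow> v = u - s" for s by (auto simp: algebra_simps)
  have 2: "u - (1, 0) = u + (-1, 0)" "u - (0, 1) = u + (0, -1)" "u - (-1, 1) = u + (1, -1)"
    by (simp_all add: prod_eq_iff)
  show ?thesis unfolding T.adj_iff list.set insert_iff empty_iff 1 2 by simp
qed

abbreviation neg :: "int \<times> int \<Rightarrow> int \<times> int" where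
  "neg \<equiv> uminus"

lemma neg_aut: "neg \<in> T.Aut"
proof -
  have "bij_betw neg UNIV UNIV" by (simp add: bij_uminus)
  moreover have "{u, v} \<in> T.E \<longleftrightarrow> {- u, - v} \<in> T.E" for u v
  proof -
    have "- v - - u = u - v" "- u - - v = v - u" by simp_all
    then show ?thesis unfolding T.edge_adj T.adj_iff by (simp only: disj_commute)
  qed
  ultimately show ?thesis unfolding graph_aut_def T.verts_UNIV by blast
qed

lemma push_neg: "T.push neg q e = q (neg ` e)"
proof -
  have "inv neg = neg" by (rule inv_equality) simp_all
  then show ?thesis by (simp add: T.push_def)
qed

lemma down_push: "\<forall>e\<in>T.E. T.push neg (T.lab (up_tri ts)) e = T.lab (down_tri ts) e"
proof
  fix e assume "e \<in> T.E"
  then obtain x i where xi: "i < 3" "e = {x, x + tri_ds ! i}" using T.edge_iff by blast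
  have "neg ` e = {- x - tri_ds ! i, (- x - tri_ds ! i) + tri_ds ! i}" unfolding xi(2) by auto
  then show "T.push neg (T.lab (up_tri ts)) e = T.lab (down_tri ts) e"
    unfolding push_neg unfolding xi(2) T.lab_edge(1)[OF xi(1)] by (simp only: T.lab_edge(1)[OF xi(1)] down_tri_def)
qed

text \<open>The reflection at the origin carries upward triangles to downward ones, so the
  phases of the second kind are the images of those of the first kind under an automorphism.\<close>

lemma up_down_glue: "T.glue 72 (T.lab (up_tri [0, 1, 2])) (T.push neg (T.lab (up_tri [2, 0, 1])))"
proof -
  have m: "T.periodic 3 mixed" unfolding mixed_def by (rule periodic_table)
  note a = matches_glue[OF matches_mixed(1) periodic_up m up_valid_012]
  note b = matches_glue[OF matches_mixed(2) m periodic_down a[THEN conjunct1]]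
  have "T.glue 72 (T.lab (up_tri [0, 1, 2])) (T.lab (down_tri [2, 0, 1]))"
    using T.glue_trans[OF a[THEN conjunct2] b[THEN conjunct2]] by simp
  then show ?thesis using T.glue_cong[OF _ down_push] by blast
qed

definition tri_phases :: "((int \<times> int) set \<Rightarrow> nat) set" where
  "tri_phases = (\<lambda>ts. T.lab (up_tri ts)) ` perms3 \<union> (\<lambda>ts. T.push neg (T.lab (up_tri ts))) ` perms3"

lemma tri_phases_glue:
  assumes "q \<in> tri_phases"
  shows "T.valid q \<and> T.glue 216 (T.lab (up_tri [0, 1, 2])) q"
proof -
  let ?u = "\<lambda>ts. T.lab (up_tri ts)"
  obtain ts where ts: "ts \<in> perms3" "q = ?u ts \<or> q = T.push neg (?u ts)" using assms unfolding tri_phases_def by blast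
  note u = up_glue[OF ts(1)]
  have p: "[2, 0, 1] \<in> perms3" by (simp add: perms3_def)
  have "T.glue (72 + (72 + 72)) (?u [0, 1, 2]) (T.push neg (?u ts))"
    by (rule T.glue_trans[OF up_down_glue T.glue_trans[OF T.glue_push[OF neg_aut T.glue_sym[OF up_glue[OF p, THEN conjunct2]]]
      T.glue_push[OF neg_aut u[THEN conjunct2]]]])
  moreover have "T.glue 216 (?u [0, 1, 2]) (?u ts)" by (rule T.glue_mono[OF u[THEN conjunct2]]) simp
  moreover have "T.valid (?u ts)" "T.valid (T.push neg (?u ts))" using u T.valid_push[OF neg_aut] by blast+
  ultimately show ?thesis using ts(2) by auto
qed

lemma up_short:
  assumes "ts \<in> perms3" "(u, v) \<in> (T.mono_step (T.lab (up_tri ts)) c)\<^sup>*"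
  shows "v \<in> T.B u 2"
proof -
  have "\<exists>m. \<forall>k. 0 \<le> k \<and> k < 3 \<and> ts ! nat k = c \<longrightarrow> k = (m :: int)"
  proof -
    have "\<exists>m :: int. \<forall>k\<in>{0, 1, 2}. ts ! nat k = c \<longrightarrow> k = m"
    proof -
      have "ts ! nat 0 \<noteq> ts ! nat 1" "ts ! nat 0 \<noteq> ts ! nat 2" "ts ! nat 1 \<noteq> ts ! nat 2"
        using assms(1) unfolding perms3_def by auto
      then show ?thesis by (metis empty_iff insert_iff)
    qed
    then obtain m :: int where m: "\<forall>k\<in>{0, 1, 2}. ts ! nat k = c \<longrightarrow> k = m" by blast
    have "k \<in> {0, 1, 2}" if "0 \<le> k" "k < 3" for k :: int using that by auto
    then show ?thesis using m by blast
  qed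
  then obtain m :: int where m: "\<And>k. 0 \<le> k \<Longrightarrow> k < 3 \<Longrightarrow> ts ! nat k = c \<Longrightarrow> k = m" by blast
  define cell where "cell x = (if (fst x - snd x - m) mod 3 = 0 then x
    else if (fst x - snd x - m) mod 3 = 1 then x - (1, 0) else x - (0, 1))" for x :: "int \<times> int"
  have "v \<in> T.B u (2 * 1)"
  proof (rule T.short_lab[OF _ _ assms(2), where cell = cell])
    fix x i assume i: "i < (3 :: nat)" "up_tri ts x i = c"
    obtain a b where x: "x = (a, b)" by force
    have r: "(a - b - (if i = 2 then 1 else 0)) mod 3 = m"
      by (rule m) (use i(2) x in \<open>simp_all add: up_tri_def\<close>)
    have i3: "i = 0 \<or> i = 1 \<or> i = 2" using i(1) by linarith
    have 0: "(t - m) mod 3 = 0" "(t + 1 - m) mod 3 = 1" "(t - 1 - m) mod 3 = 2" if "t mod 3 = m" for t using that by presburger+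
    show "cell x = cell (x + tri_ds ! i)"
      using i3
    proof (elim disjE)
      assume "i = 0"
      then show ?thesis using r 0[of "a - b"] unfolding x cell_def by (simp add: algebra_simps)
    next
      assume "i = 1"
      then show ?thesis using r 0[of "a - b"] unfolding x cell_def by (simp add: algebra_simps)
    next
      assume "i = 2"
      then show ?thesis using r 0[of "a - b - 1"] unfolding x cell_def by (simp add: algebra_simps)
    qed
  next
    fix u v assume c: "cell u = cell v"
    have "\<exists>s\<in>{(0, 0), (1, 0), (0, 1)}. w = cell w + s" for w
    proof -
      have "w = cell w + (0, 0) \<or> w = cell w + (1, 0) \<or> w = cell w + (0, 1)" by (simp add: cell_def zero_prod_def[symmetric])
      then show ?thesis by blast
    qed
    from this[of u] this[of v] obtain s t where "u = cell u + s" "v = cell u + t"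
      "s \<in> {(0, 0), (1, 0), (0, 1)}" "t \<in> {(0, 0), (1, 0), (0, 1)}" unfolding c by metis
    then have "v = u - s + t" by (metis add_diff_cancel_right')
    then show "v \<in> T.box u (int 1)" using \<open>s \<in> _\<close> \<open>t \<in> _\<close> by (cases u) (auto simp: T.box_def)
  qed
  then show ?thesis by simp
qed

text \<open>Monochromatic paths of length 2 close to triangles. This property is invariant under
  automorphisms, and it characterises the phases of the triangular lattice.\<close>

definition triads :: "('v set \<Rightarrow> nat) \<Rightarrow> 'v ugraph \<Rightarrow> bool" where
  "triads q G \<longleftrightarrow> (\<forall>v w w'. (v, w) \<in> adj G \<and> (v, w') \<in> adj G \<and> w \<noteq> w' \<and> q {v, w} = q {v, w'} \<longrightarrow>
     (w, w') \<in> adj G \<and> q {w, w'} = q {v, w})"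

lemma triads_push:
  assumes g: "\<gamma> \<in> T.Aut" and q: "triads q triangular_lattice"
  shows "triads (T.push \<gamma> q) triangular_lattice"
  unfolding triads_def
proof (intro allI impI, elim conjE)
  fix v w w'
  assume a: "(v, w) \<in> adj triangular_lattice" "(v, w') \<in> adj triangular_lattice" "w \<noteq> w'" "T.push \<gamma> q {v, w} = T.push \<gamma> q {v, w'}"
  let ?i = "T.ainv \<gamma>"
  have ad: "(?i x, ?i y) \<in> adj triangular_lattice \<longleftrightarrow> (x, y) \<in> adj triangular_lattice" for x y
    using T.aut_adj[OF T.ainv_aut[OF g]] by simp
  have p: "T.push \<gamma> q {x, y} = q {?i x, ?i y}" for x y by (simp add: T.push_def)
  have "?i w \<noteq> ?i w'" using a(3) T.aut_inj[OF T.ainv_aut[OF g]] by simp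
  then show "(w, w') \<in> adj triangular_lattice \<and> T.push \<gamma> q {w, w'} = T.push \<gamma> q {v, w}"
    using q[unfolded triads_def, rule_format, of "?i v" "?i w" "?i w'"] a ad unfolding p by blast
qed

lemma up_lab:
  "T.lab (up_tri ts) {(a, b), (a + 1, b)} = ts ! nat ((a - b) mod 3)"
  "T.lab (up_tri ts) {(a, b), (a, b + 1)} = ts ! nat ((a - b) mod 3)"
  "T.lab (up_tri ts) {(a, b), (a - 1, b + 1)} = ts ! nat ((a - b - 1) mod 3)"
  using T.lab_edge(1)[of 0 "up_tri ts" "(a, b)"] T.lab_edge(1)[of 1 "up_tri ts" "(a, b)"] T.lab_edge(1)[of 2 "up_tri ts" "(a, b)"]
  by (simp_all add: up_tri_def)

lemma triads_up:
  assumes "ts \<in> perms3" shows "triads (T.lab (up_tri ts)) triangular_lattice"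
  unfolding triads_def
proof (intro allI impI, elim conjE)
  let ?q = "T.lab (up_tri ts)"
  fix v w w'
  assume a: "(v, w) \<in> adj triangular_lattice" "(v, w') \<in> adj triangular_lattice" "w \<noteq> w'" "?q {v, w} = ?q {v, w'}"
  obtain a b where v: "v = (a, b)" by force
  define A B C where "A = ts ! nat ((a - b) mod 3)" and "B = ts ! nat ((a - b - 1) mod 3)" and "C = ts ! nat ((a - b + 1) mod 3)"
  have d: "A \<noteq> B" "A \<noteq> C" "B \<noteq> C"
  proof -
    have "(t mod 3, (t - 1) mod 3, (t + 1) mod 3) \<in> {(0, 2, 1), (1, 0, 2), (2, 1, 0)}" for t :: int
    proof -
      have "t mod 3 = 0 \<and> (t - 1) mod 3 = 2 \<and> (t + 1) mod 3 = 1 \<or> t mod 3 = 1 \<and> (t - 1) mod 3 = 0 \<and> (t + 1) mod 3 = 2 \<or>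
        t mod 3 = 2 \<and> (t - 1) mod 3 = 1 \<and> (t + 1) mod 3 = 0" by presburger
      then show ?thesis by auto
    qed
    from this[of "a - b"] show "A \<noteq> B" "A \<noteq> C" "B \<noteq> C"
      using assms unfolding A_def B_def C_def perms3_def by auto
  qed
  have l: "?q {(a, b), (a + 1, b)} = A" "?q {(a, b), (a, b + 1)} = A" "?q {(a + 1, b), (a, b + 1)} = A"
    "?q {(a, b), (a - 1, b + 1)} = B" "?q {(a - 1, b), (a, b)} = B" "?q {(a - 1, b), (a - 1, b + 1)} = B"
    "?q {(a, b - 1), (a, b)} = C" "?q {(a + 1, b - 1), (a, b)} = C" "?q {(a, b - 1), (a + 1, b - 1)} = C"
  proof -
    have e: "a + 1 - b - 1 = a - b" "a - 1 - b = a - b - 1" "a - (b - 1) = a - b + 1" "a + 1 - (b - 1) - 1 = a - b + 1"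
      "a + 1 - 1 = a" "a - 1 + 1 = a" "b - 1 + 1 = b"
      by simp_all
    show "?q {(a, b), (a + 1, b)} = A" "?q {(a, b), (a, b + 1)} = A" "?q {(a, b), (a - 1, b + 1)} = B"
      by (simp_all only: up_lab A_def B_def)
    show "?q {(a + 1, b), (a, b + 1)} = A" using up_lab(3)[of ts "a + 1" b] by (simp only: e A_def)
    show "?q {(a - 1, b), (a, b)} = B" using up_lab(1)[of ts "a - 1" b] by (simp only: e B_def)
    show "?q {(a - 1, b), (a - 1, b + 1)} = B" using up_lab(2)[of ts "a - 1" b] by (simp only: e B_def)
    show "?q {(a, b - 1), (a, b)} = C" using up_lab(2)[of ts a "b - 1"] by (simp only: e C_def)
    show "?q {(a + 1, b - 1), (a, b)} = C" using up_lab(3)[of ts "a + 1" "b - 1"] by (simp only: e C_def)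
    show "?q {(a, b - 1), (a + 1, b - 1)} = C" using up_lab(1)[of ts a "b - 1"] by (simp only: e C_def)
  qed
  have com: "?q {x, y} = ?q {y, x}" for x y by (simp add: insert_commute)
  note l' = l l[THEN trans[OF com]]
  have w': "w' = (a + 1, b) \<or> w' = (a, b + 1) \<or> w' = (a - 1, b + 1) \<or> w' = (a - 1, b) \<or> w' = (a, b - 1) \<or> w' = (a + 1, b - 1)"
    using a(2) unfolding tri_adj v by simp
  have "w = (a + 1, b) \<or> w = (a, b + 1) \<or> w = (a - 1, b + 1) \<or> w = (a - 1, b) \<or> w = (a, b - 1) \<or> w = (a + 1, b - 1)"
    using a(1) unfolding tri_adj v by simp
  then show "(w, w') \<in> adj triangular_lattice \<and> ?q {w, w'} = ?q {v, w}"
  proof (elim disjE)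
    assume w: "w = (a + 1, b)"
    show ?thesis using w' a(3,4) d unfolding v w by (elim disjE) (simp_all add: tri_adj l')
  next
    assume w: "w = (a, b + 1)"
    show ?thesis using w' a(3,4) d unfolding v w by (elim disjE) (simp_all add: tri_adj l')
  next
    assume w: "w = (a - 1, b + 1)"
    show ?thesis using w' a(3,4) d unfolding v w by (elim disjE) (simp_all add: tri_adj l')
  next
    assume w: "w = (a - 1, b)"
    show ?thesis using w' a(3,4) d unfolding v w by (elim disjE) (simp_all add: tri_adj l')
  next
    assume w: "w = (a, b - 1)"
    show ?thesis using w' a(3,4) d unfolding v w by (elim disjE) (simp_all add: tri_adj l')
  next
    assume w: "w = (a + 1, b - 1)"
    show ?thesis using w' a(3,4) d unfolding v w by (elim disjE) (simp_all add: tri_adj l')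
  qed
qed

text \<open>The six edges at a vertex, in cyclic order, are \<open>p1 a b\<close>, \<open>p2 a
  b\<close>, \<open>p3 a b\<close>, \<open>p1 (a - 1) b\<close>, \<open>p2 a (b - 1)\<close>,
  \<open>p3 (a + 1) (b - 1)\<close>. Only consecutive edges may have the same colour. With three
  colours this leaves two patterns: the monochromatic pairs span upward triangles or downward
  triangles.\<close>

lemma triads_at:
  assumes q: "triads q triangular_lattice" and 3: "\<And>e. e \<in> T.E \<Longrightarrow> q e < 3"
  defines "p1 \<equiv> \<lambda>a b. q {(a, b), (a + 1, b)}" and "p2 \<equiv> \<lambda>a b. q {(a, b), (a, b + 1)}" and "p3 \<equiv> \<lambda>a b. q {(a, b), (a - 1, b + 1)}"
  shows "p1 a b < 3 \<and> p2 a b < 3 \<and> p3 a b < 3"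
    "p1 a b \<noteq> p3 a b \<and> p1 a b \<noteq> p1 (a - 1) b \<and> p1 a b \<noteq> p2 a (b - 1) \<and> p2 a b \<noteq> p1 (a - 1) b \<and>
     p2 a b \<noteq> p2 a (b - 1) \<and> p2 a b \<noteq> p3 (a + 1) (b - 1) \<and> p3 a b \<noteq> p2 a (b - 1) \<and>
     p3 a b \<noteq> p3 (a + 1) (b - 1) \<and> p1 (a - 1) b \<noteq> p3 (a + 1) (b - 1)"
    "p1 a b = p2 a b \<Longrightarrow> p3 (a + 1) b = p1 a b"
    "p3 a b = p1 (a - 1) b \<Longrightarrow> p2 (a - 1) b = p3 a b"
    "p2 a (b - 1) = p3 (a + 1) (b - 1) \<Longrightarrow> p1 a (b - 1) = p2 a (b - 1)"
    "p1 a b = p2 a b \<and> p3 a b = p1 (a - 1) b \<and> p2 a (b - 1) = p3 (a + 1) (b - 1) \<or>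
     p2 a b = p3 a b \<and> p1 (a - 1) b = p2 a (b - 1) \<and> p3 (a + 1) (b - 1) = p1 a b"
proof -
  have tr: "(w, w') \<in> adj triangular_lattice \<and> q {w, w'} = q {v, w}"
    if "(v, w) \<in> adj triangular_lattice" "(v, w') \<in> adj triangular_lattice" "w \<noteq> w'" "q {v, w} = q {v, w'}" for v w w'
    using q that unfolding triads_def by blast
  show lt: "p1 a b < 3 \<and> p2 a b < 3 \<and> p3 a b < 3" for a b
    using 3[of "{(a, b), (a + 1, b)}"] 3[of "{(a, b), (a, b + 1)}"] 3[of "{(a, b), (a - 1, b + 1)}"]
    unfolding p1_def p2_def p3_def T.edge_adj by (simp add: tri_adj)
  have c: "p1 (a - 1) b = q {(a, b), (a - 1, b)}" "p2 a (b - 1) = q {(a, b), (a, b - 1)}" "p3 (a + 1) (b - 1) = q {(a, b), (a + 1, b - 1)}" for a b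
    by (simp_all add: p1_def p2_def p3_def insert_commute)
  show ne: "p1 a b \<noteq> p3 a b \<and> p1 a b \<noteq> p1 (a - 1) b \<and> p1 a b \<noteq> p2 a (b - 1) \<and> p2 a b \<noteq> p1 (a - 1) b \<and>
     p2 a b \<noteq> p2 a (b - 1) \<and> p2 a b \<noteq> p3 (a + 1) (b - 1) \<and> p3 a b \<noteq> p2 a (b - 1) \<and>
     p3 a b \<noteq> p3 (a + 1) (b - 1) \<and> p1 (a - 1) b \<noteq> p3 (a + 1) (b - 1)" for a b
    unfolding c unfolding p1_def p2_def p3_def
    by (intro conjI notI; drule tr[rotated 3]; simp add: tri_adj)
  show "p1 a b = p2 a b \<Longrightarrow> p3 (a + 1) b = p1 a b"
    using tr[of "(a, b)" "(a + 1, b)" "(a, b + 1)"] unfolding p1_def p2_def p3_def by (simp add: tri_adj)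
  show "p3 a b = p1 (a - 1) b \<Longrightarrow> p2 (a - 1) b = p3 a b"
    using tr[of "(a, b)" "(a - 1, b + 1)" "(a - 1, b)"] unfolding c unfolding p2_def p3_def by (simp add: tri_adj insert_commute)
  show "p2 a (b - 1) = p3 (a + 1) (b - 1) \<Longrightarrow> p1 a (b - 1) = p2 a (b - 1)"
    using tr[of "(a, b)" "(a, b - 1)" "(a + 1, b - 1)"] unfolding c unfolding p1_def by (simp add: tri_adj insert_commute)
  show "p1 a b = p2 a b \<and> p3 a b = p1 (a - 1) b \<and> p2 a (b - 1) = p3 (a + 1) (b - 1) \<or>
     p2 a b = p3 a b \<and> p1 (a - 1) b = p2 a (b - 1) \<and> p3 (a + 1) (b - 1) = p1 a b"
  proof -
    have six: "c0 = c1 \<and> c2 = c3 \<and> c4 = c5 \<or> c1 = c2 \<and> c3 = c4 \<and> c5 = c0"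
      if l: "c0 < 3" "c1 < 3" "c2 < 3" "c3 < 3" "c4 < 3" "c5 < 3"
        and n: "c0 \<noteq> c2" "c0 \<noteq> c3" "c0 \<noteq> c4" "c1 \<noteq> c3" "c1 \<noteq> c4" "c1 \<noteq> c5" "c2 \<noteq> c4" "c2 \<noteq> c5" "c3 \<noteq> c5"
      for c0 c1 c2 c3 c4 c5 :: nat
    proof -
      have "c1 = c0 \<or> c1 = c2" using l(1,2,3,5) n(1,3,5,7) by linarith
      moreover have "c3 = c2 \<or> c3 = c4" using l(1,3,4,5) n(1,2,3,7) by linarith
      moreover have "c5 = c4 \<or> c5 = c0" using l(1,3,5,6) n(1,3,7,8) by linarith
      ultimately show ?thesis using n by metis
    qed
    show ?thesis by (rule six) (use lt[of a b] lt[of "a - 1" b] lt[of a "b - 1"] lt[of "a + 1" "b - 1"] ne[of a b] in simp_all)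
  qed
qed

text \<open>The pattern of upward triangles spreads to all neighbouring vertices. The colours of
  the upward triangles at (a, b), (a - 1, b) and (a, b - 1), which meet at the vertex (a, b),
  are distinct, so the colour depends on a - b only, with period 3.\<close>

lemma triads_imp_up:
  assumes q: "triads q triangular_lattice" and 3: "\<And>e. e \<in> T.E \<Longrightarrow> q e < 3"
    and start: "q {(0, 0), (1, 0)} = q {(0, 0), (0, 1)}"
  shows "\<exists>ts\<in>perms3. \<forall>e\<in>T.E. q e = T.lab (up_tri ts) e"
proof -
  define t p2 p3 where "t a b = q {(a, b), (a + 1, b)}" and "p2 a b = q {(a, b), (a, b + 1)}"
    and "p3 a b = q {(a, b), (a - 1, b + 1)}" for a b
  note at = triads_at[OF q 3, folded t_def p2_def p3_def]
  have 1: "t (a + 1) b = p2 (a + 1) b \<longleftrightarrow> t a b = p2 a b" for a b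
  proof -
    have e: "a + 1 - 1 = a" by simp
    note at(2)[of "a + 1" b, unfolded e] at(3)[of a b] at(4)[of "a + 1" b, unfolded e] at(6)[of "a + 1" b, unfolded e]
    then show ?thesis by metis
  qed
  have 2: "t a (b + 1) = p2 a (b + 1) \<longleftrightarrow> t a b = p2 a b" for a b
  proof -
    have e: "b + 1 - 1 = b" by simp
    note at(2)[of a "b + 1", unfolded e] at(3)[of a b] at(5)[of a "b + 1", unfolded e] at(6)[of a "b + 1", unfolded e]
    then show ?thesis by metis
  qed
  have U: "p2 a b = t a b" for a b
  proof -
    have "(t a b = p2 a b) = (t 0 b = p2 0 b)" by (rule int_const[of "\<lambda>a. t a b = p2 a b"]) (rule 1)
    also have "\<dots> = (t 0 0 = p2 0 0)" by (rule int_const[of "\<lambda>b. t 0 b = p2 0 b"]) (rule 2)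
    finally show ?thesis using start by (simp add: t_def p2_def)
  qed
  have p3: "p3 a b = t (a - 1) b" for a b using at(3)[of "a - 1" b] U by simp
  have lt: "t a b < 3" for a b using at(1) by blast
  have ne: "t a b \<noteq> t (a - 1) b" "t a b \<noteq> t a (b - 1)" "t (a - 1) b \<noteq> t a (b - 1)" for a b
    using at(2)[of a b] U p3 by auto
  have diag: "t (a + 1) (b + 1) = t a b" for a b
    using ne[of "a + 1" "b + 1"] ne(1)[of "a + 1" b] ne(2)[of a "b + 1"] lt[of a b] lt[of "a + 1" b] lt[of a "b + 1"] lt[of "a + 1" "b + 1"]
    by simp
  define s where "s k = t k 0" for k
  have ts: "t a b = s (a - b)" for a b
    using int_const[of "\<lambda>k. t (a - b + k) k" b] diag[of "a - b + k" k for k] by (simp add: s_def ac_simps)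
  have slt: "s k < 3" for k using lt by (simp add: s_def)
  have sne: "s k \<noteq> s (k + 1)" "s (k + 2) \<noteq> s (k + 1)" "s k \<noteq> s (k + 2)" for k
  proof -
    have n: "s x \<noteq> s (x - 1)" "s x \<noteq> s (x + 1)" "s (x - 1) \<noteq> s (x + 1)" for x
      using ne[of x 0] unfolding ts by simp_all
    have e: "k + 1 - 1 = k" "k + 1 + 1 = k + 2" by simp_all
    show "s k \<noteq> s (k + 1)" "s (k + 2) \<noteq> s (k + 1)" "s k \<noteq> s (k + 2)"
      using n[of "k + 1", unfolded e] by metis+
  qed
  have s3: "s (k + 3) = s k" for k
    using sne[of k] sne[of "k + 1"] slt[of k] slt[of "k + 1"] slt[of "k + 2"] slt[of "k + 3"] by (simp add: ac_simps)
  have per: "s (k mod 3 + 3 * j) = s (k mod 3)" for k j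
  proof -
    have "s (k mod 3 + 3 * (x + 1)) = s (k mod 3 + 3 * x)" for x
      using s3[of "k mod 3 + 3 * x"] by (simp add: distrib_left add.assoc)
    from int_const[of "\<lambda>j. s (k mod 3 + 3 * j)" j, OF this] show ?thesis by simp
  qed
  have smod: "s k = [s 0, s 1, s 2] ! nat (k mod 3)" for k
  proof -
    have "s k = s (k mod 3)" using per[of k "k div 3"] by (simp add: ac_simps)
    moreover have "k mod 3 = 0 \<or> k mod 3 = 1 \<or> k mod 3 = 2" by presburger
    ultimately show ?thesis by auto
  qed
  have "[s 0, s 1, s 2] \<in> perms3"
  proof -
    have perm: "[x, y, z] \<in> perms3" if "x < 3" "y < 3" "z < 3" "x \<noteq> y" "z \<noteq> y" "x \<noteq> z" for x y z
    proof -
      have "x = 0 \<or> x = 1 \<or> x = 2" "y = 0 \<or> y = 1 \<or> y = 2" "z = 0 \<or> z = 1 \<or> z = 2" using that(1-3) by linarith+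
      then show ?thesis using that(4-6) by (elim disjE) (simp_all add: perms3_def)
    qed
    show ?thesis by (rule perm) (use slt sne[of 0] in simp_all)
  qed
  moreover have "q e = T.lab (up_tri [s 0, s 1, s 2]) e" if e: "e \<in> T.E" for e
  proof -
    obtain x i where xi: "i < 3" "e = {x, x + tri_ds ! i}" using T.edge_iff e by blast
    obtain a b where x: "x = (a, b)" by force
    have "i = 0 \<or> i = 1 \<or> i = 2" using xi(1) by linarith
    moreover have "q {(a, b), (a + 1, b)} = s (a - b)" "q {(a, b), (a, b + 1)} = s (a - b)" "q {(a, b), (a - 1, b + 1)} = s (a - b - 1)"
    proof -
      have e: "a - 1 - b = a - b - 1" by simp
      show "q {(a, b), (a + 1, b)} = s (a - b)" "q {(a, b), (a, b + 1)} = s (a - b)" "q {(a, b), (a - 1, b + 1)} = s (a - b - 1)"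
        using ts[of a b] U[of a b] p3[of a b] ts[of "a - 1" b, unfolded e] unfolding t_def p2_def p3_def by metis+
    qed
    ultimately show ?thesis unfolding xi(2) x
      by (elim disjE) (simp_all add: up_lab flip: smod)
  qed
  ultimately show ?thesis by blast
qed

lemma triads_imp_phase:
  assumes q: "triads q triangular_lattice" and 3: "\<And>e. e \<in> T.E \<Longrightarrow> q e < 3"
  shows "\<exists>q'\<in>tri_phases. \<forall>e\<in>T.E. q e = q' e"
proof (cases "q {(0, 0), (1, 0)} = q {(0, 0), (0, 1)}")
  case True
  then show ?thesis using triads_imp_up[OF q 3] unfolding tri_phases_def by blast
next
  case False
  let ?q = "T.push neg q"
  have "q {(-1, 0), (0, 0)} = q {(0, -1), (0, 0)}" using False triads_at(6)[OF q 3, of 0 0] by simp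
  then have "?q {(0, 0), (1, 0)} = ?q {(0, 0), (0, 1)}" by (simp add: push_neg insert_commute)
  moreover have "?q e < 3" if "e \<in> T.E" for e using 3 T.aut_edge[OF neg_aut that] by (simp add: push_neg)
  ultimately obtain ts where ts: "ts \<in> perms3" "\<forall>e\<in>T.E. ?q e = T.lab (up_tri ts) e"
    using triads_imp_up[OF triads_push[OF neg_aut q]] by blast
  have "q e = T.push neg (T.lab (up_tri ts)) e" if e: "e \<in> T.E" for e
  proof -
    have "?q (neg ` e) = T.lab (up_tri ts) (neg ` e)" using ts(2) T.aut_edge[OF neg_aut e] by blast
    moreover have "neg ` neg ` e = e" by (simp add: image_image)
    ultimately show ?thesis by (simp add: push_neg)
  qed
  then show ?thesis using ts(1) unfolding tri_phases_def by blast
qed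

text \<open>Two phases are glued by way of the phase \<open>up_tri [0, 1, 2]\<close>. From there
  each phase is reached by at most six elementary transitions of width 36 = 4 (3 * 2 + 3).\<close>

interpretation T: phases triangular_lattice 3 tri_phases 2 432
proof
  have tr: "triads q triangular_lattice" if q: "q \<in> tri_phases" for q
    using q triads_up triads_push[OF neg_aut] unfolding tri_phases_def by blast
  show "tri_phases \<noteq> {}" by (simp add: tri_phases_def perms3_def)
  show val: "T.valid q" if "q \<in> tri_phases" for q using tri_phases_glue[OF that] by blast
  show "\<exists>q'\<in>tri_phases. \<forall>e\<in>T.E. q' (\<gamma> ` e) = q e" if q: "q \<in> tri_phases" and g: "\<gamma> \<in> T.Aut" for q \<gamma>
  proof -
    have "T.push \<gamma> q e < 3" if "e \<in> T.E" for e
      using T.valid_push[OF g val[OF q]] that by (simp add: T.valid_def)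
    then obtain q' where q': "q' \<in> tri_phases" "\<forall>e\<in>T.E. T.push \<gamma> q e = q' e"
      using triads_imp_phase[OF triads_push[OF g tr[OF q]]] by blast
    have "q' (\<gamma> ` e) = q e" if "e \<in> T.E" for e
      using q'(2) T.aut_edge[OF g that] T.push_image[OF g T.edge_sub[OF that], of q] by auto
    then show ?thesis using q'(1) by blast
  qed
  show "T.glue 432 q q'" if "q \<in> tri_phases" "q' \<in> tri_phases" for q q'
    using T.glue_trans[OF T.glue_sym[OF tri_phases_glue[OF that(1), THEN conjunct2]] tri_phases_glue[OF that(2), THEN conjunct2]]
    by simp
  show "v \<in> T.B u 2" if q: "q \<in> tri_phases" and u: "u \<in> T.V" and uv: "(u, v) \<in> (T.mono_step q c)\<^sup>*" for q u v c
  proof -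
    obtain ts where ts: "ts \<in> perms3" "q = T.lab (up_tri ts) \<or> q = T.push neg (T.lab (up_tri ts))"
      using q unfolding tri_phases_def by blast
    note s = up_short[OF ts(1)]
    show ?thesis using ts(2)
    proof
      assume "q = T.push neg (T.lab (up_tri ts))"
      then show ?thesis using T.push_short[OF neg_aut _ u, where q = "T.lab (up_tri ts)" and i = c and D = 2] s uv by blast
    qed (use s uv in blast)
  qed
  show "countable T.V" by (rule T.countable_verts)
  show "\<exists>c>0. \<exists>c'. \<forall>x\<in>T.V. \<forall>n\<ge>1. c * (real n)\<^sup>2 \<le> real (card (T.B x n)) \<and>
      real (card (T.B x n)) \<le> c' * (real n)\<^sup>2" by (rule T.planar_growth)
qed

theorem factor_triangular: "\<exists>A \<Phi>. aut_factor triangular_lattice 3 A \<Phi> \<and> finitary triangular_lattice A \<Phi> \<and>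
       (AE \<omega> in iid_measure triangular_lattice. schreier_decoration triangular_lattice 3 (\<Phi> \<omega>)) \<and>
       (AE \<omega> in iid_measure triangular_lattice. \<not> (\<exists>p. infinite_monochromatic_path triangular_lattice (\<Phi> \<omega>) p))"
  by (rule T.factor_exists)

theorem theorem1p1:
  shows "(\<exists>A \<Phi>. aut_factor square_lattice 2 A \<Phi> \<and> finitary square_lattice A \<Phi> \<and>
       (AE \<omega> in iid_measure square_lattice. schreier_decoration square_lattice 2 (\<Phi> \<omega>)) \<and>
       (AE \<omega> in iid_measure square_lattice. \<not> (\<exists>p. infinite_monochromatic_path square_lattice (\<Phi> \<omega>) p))) \<and>
    (\<exists>A \<Phi>. aut_factor triangular_lattice 3 A \<Phi> \<and> finitary triangular_lattice A \<Phi> \<and>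
       (AE \<omega> in iid_measure triangular_lattice. schreier_decoration triangular_lattice 3 (\<Phi> \<omega>)) \<and>
       (AE \<omega> in iid_measure triangular_lattice. \<not> (\<exists>p. infinite_monochromatic_path triangular_lattice (\<Phi> \<omega>) p))) \<and>
    (\<exists>A \<Phi>. aut_factor kagome_lattice 2 A \<Phi> \<and> finitary kagome_lattice A \<Phi> \<and>
       (AE \<omega> in iid_measure kagome_lattice. schreier_decoration kagome_lattice 2 (\<Phi> \<omega>)) \<and>
       (AE \<omega> in iid_measure kagome_lattice. \<not> (\<exists>p. infinite_monochromatic_path kagome_lattice (\<Phi> \<omega>) p))) \<and>
    (\<exists>A \<Phi>. aut_factor lattice_3464 2 A \<Phi> \<and> finitary lattice_3464 A \<Phi> \<and>
       (AE \<omega> in iid_measure lattice_3464. schreier_decoration lattice_3464 2 (\<Phi> \<omega>)) \<and>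
       (AE \<omega> in iid_measure lattice_3464. \<not> (\<exists>p. infinite_monochromatic_path lattice_3464 (\<Phi> \<omega>) p)))"
  using factor_square factor_triangular factor_kagome factor_3464 by (intro conjI)

end
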